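(* The problem C-$\langle \mathcal{C}_r \rightarrow \mathcal{T}_s \rangle$ is in $\mathsf{P}$: when the virtual graph is a cycle and the substrate graph is a tree, a minimum-cost feasible mapping (or the fact that none exists) can be computed in time $\mathcal{O}(n_r^2 n_s)$.
   Context: Uniform-demand Virtual Network Embedding (uniVNE). An instance consists of a virtual graph $\mathcal{G}_r=(V_r,E_r)$ (undirected, simple, connected, $n_r=|V_r|$ nodes) and a substrate graph $\mathcal{G}_s=(V_s,E_s)$ (undirected, simple, connected, $n_s=|V_s|$ nodes) with capacities $c(u)\in\mathbb{N}^+$ for $u\in V_s$ and $c(e)\in\mathbb{N}^+$ for $e\in E_s$. A mapping is a pair $m=(m_V,m_E)$ where $m_V:V_r\to V_s$ and $m_E$ assigns to each virtual edge $(\bar u,\bar v)\in E_r$ a loop-free path of $\mathcal{G}_s$ connecting $m_V(\bar u)$ and $m_V(\bar v)$ (the empty path if these coincide). The mapping is feasible if every $u\in V_s$ satisfies $|m_V^{-1}(u)|\le c(u)$ and every $e\in E_s$ belongs to at most $c(e)$ of the paths $m_E(\bar e)$. In C-uniVNE one is additionally given nonnegative integer costs $w(u)$, $u\in V_s$, and $w(e)$, $e\in E_s$ (and a budget $\Gamma$); the cost of $m$ is $\sum_{\bar u\in V_r} w(m_V(\bar u))+\sum_{\bar e\in E_r}\sum_{e\in m_E(\bar e)} w(e)$, and the task is to decide whether a feasible mapping of cost at most $\Gamma$ exists, equivalently to find a minimum-cost feasible mapping. *)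

theory Defs
  imports "HOL-Computational_Algebra.Polynomial" "HOL-Library.Log_Nat"
begin

section \<open>Graphs\<close>

text \<open>
  An undirected simple graph is a vertex set together with a set of two-element vertex sets.
  A path is given by its vertex sequence; the one-vertex sequence is the empty path.
\<close>

definition simple_graph :: "'a set \<Rightarrow> 'a set set \<Rightarrow> bool" where
  "simple_graph V E \<longleftrightarrow> finite V \<and> V \<noteq> {} \<and> (\<forall>e\<in>E. e \<subseteq> V \<and> card e = 2)"

definition path_edges :: "'a list \<Rightarrow> 'a set set" where
  "path_edges p = {{p ! i, p ! Suc i} | i. Suc i < length p}"

definition is_path :: "'a set \<Rightarrow> 'a set set \<Rightarrow> 'a list \<Rightarrow> bool" where
  "is_path V E p \<longleftrightarrow> p \<noteq> [] \<and> distinct p \<and> set p \<subseteq> V \<and> path_edges p \<subseteq> E"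

definition connected_graph :: "'a set \<Rightarrow> 'a set set \<Rightarrow> bool" where
  "connected_graph V E \<longleftrightarrow> simple_graph V E \<and>
     (\<forall>u\<in>V. \<forall>v\<in>V. \<exists>p. is_path V E p \<and> hd p = u \<and> last p = v)"

definition cycle_edges :: "'a list \<Rightarrow> 'a set set" where
  "cycle_edges vs = {{vs ! i, vs ! (Suc i mod length vs)} | i. i < length vs}"

definition is_cycle :: "'a set \<Rightarrow> 'a set set \<Rightarrow> bool" where
  "is_cycle V E \<longleftrightarrow> (\<exists>vs. distinct vs \<and> 3 \<le> length vs \<and> V = set vs \<and> E = cycle_edges vs)"

definition acyclic_graph :: "'a set set \<Rightarrow> bool" where
  "acyclic_graph E \<longleftrightarrow> \<not> (\<exists>vs. distinct vs \<and> 3 \<le> length vs \<and> cycle_edges vs \<subseteq> E)"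

definition is_tree :: "'a set \<Rightarrow> 'a set set \<Rightarrow> bool" where
  "is_tree V E \<longleftrightarrow> connected_graph V E \<and> acyclic_graph E"


section \<open>Uniform-demand virtual network embedding\<close>

record ('a, 'b) univne =
  VR :: "'a set"
  ER :: "'a set set"
  VS :: "'b set"
  ES :: "'b set set"
  node_cap :: "'b \<Rightarrow> nat"
  edge_cap :: "'b set \<Rightarrow> nat"
  node_cost :: "'b \<Rightarrow> nat"
  edge_cost :: "'b set \<Rightarrow> nat"

definition univne_instance :: "('a, 'b) univne \<Rightarrow> bool" where
  "univne_instance I \<longleftrightarrow>
     connected_graph (VR I) (ER I) \<and> connected_graph (VS I) (ES I) \<and>
     (\<forall>u\<in>VS I. 0 < node_cap I u) \<and> (\<forall>e\<in>ES I. 0 < edge_cap I e)"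

type_synonym ('a, 'b) mapping = "('a \<Rightarrow> 'b) \<times> ('a set \<Rightarrow> 'b list)"

text \<open>
  The path of a virtual edge may be traversed in either direction.  When both end nodes are
  mapped to the same substrate node, distinctness of the vertex sequence forces the empty path.
\<close>

definition is_mapping :: "('a, 'b) univne \<Rightarrow> ('a, 'b) mapping \<Rightarrow> bool" where
  "is_mapping I m \<longleftrightarrow>
     (\<forall>x\<in>VR I. fst m x \<in> VS I) \<and>
     (\<forall>f\<in>ER I. is_path (VS I) (ES I) (snd m f) \<and>
                {hd (snd m f), last (snd m f)} = fst m ` f)"

definition feasible :: "('a, 'b) univne \<Rightarrow> ('a, 'b) mapping \<Rightarrow> bool" where
  "feasible I m \<longleftrightarrow> is_mapping I m \<and>
     (\<forall>u\<in>VS I. card {x \<in> VR I. fst m x = u} \<le> node_cap I u) \<and>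
     (\<forall>e\<in>ES I. card {f \<in> ER I. e \<in> path_edges (snd m f)} \<le> edge_cap I e)"

definition mapping_cost :: "('a, 'b) univne \<Rightarrow> ('a, 'b) mapping \<Rightarrow> nat" where
  "mapping_cost I m =
     (\<Sum>x\<in>VR I. node_cost I (fst m x)) +
     (\<Sum>f\<in>ER I. \<Sum>e\<in>path_edges (snd m f). edge_cost I e)"

definition min_cost_feasible :: "('a, 'b) univne \<Rightarrow> ('a, 'b) mapping \<Rightarrow> bool" where
  "min_cost_feasible I m \<longleftrightarrow> feasible I m \<and>
     (\<forall>m'. feasible I m' \<longrightarrow> mapping_cost I m \<le> mapping_cost I m')"


section \<open>Random access machines\<close>

text \<open>
  A program uses finitely many registers and an unbounded memory addressed through registers;
  all cells hold natural numbers.  Arithmetic is restricted to addition and truncated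
  subtraction, so that numbers grow by at most one bit per step and counting steps is a
  meaningful time measure.
\<close>

datatype instr =
    SetConst nat nat      \<comment> \<open>\<open>R[r] := k\<close>\<close>
  | Copy nat nat          \<comment> \<open>\<open>R[r] := R[s]\<close>\<close>
  | Add nat nat nat       \<comment> \<open>\<open>R[r] := R[s] + R[t]\<close>\<close>
  | Sub nat nat nat       \<comment> \<open>\<open>R[r] := R[s] - R[t]\<close>\<close>
  | Load nat nat          \<comment> \<open>\<open>R[r] := M[R[s]]\<close>\<close>
  | Store nat nat         \<comment> \<open>\<open>M[R[r]] := R[s]\<close>\<close>
  | Jump nat
  | JumpLess nat nat nat  \<comment> \<open>jump to the last argument if \<open>R[r] < R[s]\<close>\<close>

record config =
  pc :: nat
  reg :: "nat \<Rightarrow> nat"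
  mem :: "nat \<Rightarrow> nat"

fun exec_instr :: "instr \<Rightarrow> config \<Rightarrow> config" where
  "exec_instr (SetConst r k) c = c\<lparr>pc := Suc (pc c), reg := (reg c)(r := k)\<rparr>"
| "exec_instr (Copy r s) c = c\<lparr>pc := Suc (pc c), reg := (reg c)(r := reg c s)\<rparr>"
| "exec_instr (Add r s t) c = c\<lparr>pc := Suc (pc c), reg := (reg c)(r := reg c s + reg c t)\<rparr>"
| "exec_instr (Sub r s t) c = c\<lparr>pc := Suc (pc c), reg := (reg c)(r := reg c s - reg c t)\<rparr>"
| "exec_instr (Load r s) c = c\<lparr>pc := Suc (pc c), reg := (reg c)(r := mem c (reg c s))\<rparr>"
| "exec_instr (Store r s) c = c\<lparr>pc := Suc (pc c), mem := (mem c)(reg c r := reg c s)\<rparr>"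
| "exec_instr (Jump l) c = c\<lparr>pc := l\<rparr>"
| "exec_instr (JumpLess r s l) c = c\<lparr>pc := (if reg c r < reg c s then l else Suc (pc c))\<rparr>"

definition halted :: "instr list \<Rightarrow> config \<Rightarrow> bool" where
  "halted P c \<longleftrightarrow> length P \<le> pc c"

definition step :: "instr list \<Rightarrow> config \<Rightarrow> config" where
  "step P c = (if halted P c then c else exec_instr (P ! pc c) c)"

definition init_config :: "nat list \<Rightarrow> config" where
  "init_config xs = \<lparr>pc = 0, reg = (\<lambda>_. 0)(0 := length xs),
     mem = (\<lambda>i. if i < length xs then xs ! i else 0)\<rparr>"

definition result_of :: "config \<Rightarrow> nat list" where
  "result_of c = map (mem c) [0..<reg c 0]"

definition run :: "instr list \<Rightarrow> nat list \<Rightarrow> nat \<Rightarrow> config" where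
  "run P xs t = (step P ^^ t) (init_config xs)"

definition computes_within :: "instr list \<Rightarrow> nat list \<Rightarrow> nat list \<Rightarrow> nat \<Rightarrow> bool" where
  "computes_within P xs ys t \<longleftrightarrow> halted P (run P xs t) \<and> result_of (run P xs t) = ys"


section \<open>Polynomial time\<close>

text \<open>
  Polynomial time is measured by the logarithmic cost criterion for random access machines,
  for which polynomial time coincides with polynomial time on Turing machines: an instruction
  is charged for the binary lengths of the numbers and addresses it handles.  Decision problems
  are sets of sequences of natural numbers, the size of a sequence being the total length of its
  entries in binary.
\<close>

definition bits :: "nat \<Rightarrow> nat" where
  "bits n = max 1 (floorlog 2 n)"

definition input_size :: "nat list \<Rightarrow> nat" where
  "input_size xs = (\<Sum>x\<leftarrow>xs. bits x)"

fun instr_cost :: "instr \<Rightarrow> config \<Rightarrow> nat" where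
  "instr_cost (SetConst r k) c = 1 + bits k"
| "instr_cost (Copy r s) c = 1 + bits (reg c s)"
| "instr_cost (Add r s t) c = 1 + bits (reg c s) + bits (reg c t)"
| "instr_cost (Sub r s t) c = 1 + bits (reg c s) + bits (reg c t)"
| "instr_cost (Load r s) c = 1 + bits (reg c s) + bits (mem c (reg c s))"
| "instr_cost (Store r s) c = 1 + bits (reg c r) + bits (reg c s)"
| "instr_cost (Jump l) c = 1"
| "instr_cost (JumpLess r s l) c = 1 + bits (reg c r) + bits (reg c s)"

definition step_cost :: "instr list \<Rightarrow> config \<Rightarrow> nat" where
  "step_cost P c = (if halted P c then 0 else instr_cost (P ! pc c) c)"

definition log_time :: "instr list \<Rightarrow> nat list \<Rightarrow> nat \<Rightarrow> nat" where
  "log_time P xs t = (\<Sum>i<t. step_cost P (run P xs i))"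

definition class_P :: "nat list set set" where
  "class_P = {L. \<exists>(P :: instr list) (q :: nat poly). \<forall>xs. \<exists>t.
     computes_within P xs [if xs \<in> L then 1 else 0] t \<and>
     log_time P xs t \<le> poly q (input_size xs)}"


section \<open>Encoding of instances and mappings\<close>

text \<open>
  The nodes of either graph are numbered from 0, and its edges are listed in any order, with
  the end nodes of each edge in any order.
\<close>

definition edge_listing :: "'a set set \<Rightarrow> ('a \<times> 'a) list \<Rightarrow> bool" where
  "edge_listing E es \<longleftrightarrow>
     distinct (map (\<lambda>(u, v). {u, v}) es) \<and> set (map (\<lambda>(u, v). {u, v}) es) = E"

definition presented_instance ::
  "(nat, nat) univne \<Rightarrow> (nat \<times> nat) list \<Rightarrow> (nat \<times> nat) list \<Rightarrow> bool" where
  "presented_instance I er es \<longleftrightarrow> univne_instance I \<and>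
     VR I = {..<card (VR I)} \<and> VS I = {..<card (VS I)} \<and>
     edge_listing (ER I) er \<and> edge_listing (ES I) es"

definition encode ::
  "(nat, nat) univne \<Rightarrow> (nat \<times> nat) list \<Rightarrow> (nat \<times> nat) list \<Rightarrow> nat list" where
  "encode I er es =
     [card (VR I), length er] @ concat (map (\<lambda>(u, v). [u, v]) er) @
     [card (VS I), length es] @
     concat (map (\<lambda>u. [node_cap I u, node_cost I u]) [0..<card (VS I)]) @
     concat (map (\<lambda>(u, v). [u, v, edge_cap I {u, v}, edge_cost I {u, v}]) es)"

text \<open>
  A mapping is written as the list of the images of the virtual nodes, followed by the path of
  each virtual edge, preceded by its number of nodes, in the order of the edge list.
\<close>

definition encode_mapping ::
  "(nat, nat) univne \<Rightarrow> (nat \<times> nat) list \<Rightarrow> (nat, nat) mapping \<Rightarrow> nat list" where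
  "encode_mapping I er m =
     map (fst m) [0..<card (VR I)] @
     concat (map (\<lambda>(u, v). length (snd m {u, v}) # snd m {u, v}) er)"

type_synonym graph_class = "nat set \<Rightarrow> nat set set \<Rightarrow> bool"

definition C_uniVNE :: "graph_class \<Rightarrow> graph_class \<Rightarrow> nat list set" where
  "C_uniVNE R S = {encode I er es @ [\<Gamma>] | I er es \<Gamma>.
     presented_instance I er es \<and> R (VR I) (ER I) \<and> S (VS I) (ES I) \<and>
     (\<exists>m. feasible I m \<and> mapping_cost I m \<le> \<Gamma>)}"

definition optimal_output ::
  "(nat, nat) univne \<Rightarrow> (nat \<times> nat) list \<Rightarrow> nat list \<Rightarrow> bool" where
  "optimal_output I er ys \<longleftrightarrow>
     (if \<exists>m. feasible I m
      then \<exists>m. min_cost_feasible I m \<and> ys = 1 # encode_mapping I er m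
      else ys = [0])"

end

theory Submission
  imports Defs "HOL-Library.Extended_Nat"
begin

text \<open>
  Cutting the substrate tree at an edge splits the virtual cycle into arcs.  If both sides of the
  edge receive virtual nodes, at least two virtual edges cross it, and exactly two suffice when the
  nodes below it form one interval of the cycle.  Hence only the number \<open>a\<close> of nodes placed below an
  edge matters: it needs capacity 2 and costs twice its weight if \<open>0 < a < n\<^sub>r\<close>, and nothing
  otherwise.  Conversely, any admissible choice of the numbers of nodes placed on the substrate
  nodes is realised by numbering the cycle along a traversal of the tree.  What remains is a
  knapsack problem on the tree, solved by eliminating leaves: each of the \<open>n\<^sub>s - 1\<close> eliminations is
  a min-plus convolution of two tables of length \<open>n\<^sub>r + 1\<close>.

  To decide arbitrary inputs, the orders computed by the algorithm (the nodes along the cycle and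
  the leaf elimination with its parent function) are checked as certificates that the graphs
  encoded are a cycle and a tree.
\<close>

section \<open>A loop language and its compilation\<close>

text \<open>The time bound must be met by an explicit machine program that can only add and
  subtract, on edge lists in arbitrary order. Hence a loop language whose loop bounds are variables
  that stay fixed once loaded: a step bound can be read off the loop nest, and guarded loops of
  fixed length replace amortised arguments. No adjacency lists are built. On a cycle the next node
  is the sum of the neighbours of the current one minus its predecessor, and the neighbour sum of a
  leaf is its only neighbour, so a few accumulated numbers per node suffice for both traversals. The
  lower bound on crossings concerns arbitrary mappings; it holds because the ends of a tree path
  decide which cuts it crosses. That two crossings are attained at all tree edges at once rests on a
  single numbering that gives every subtree an interval. For membership in P, unit steps bound
  logarithmic cost because numbers at most double per step. Arrays are unbounded and subtraction is
  truncated, so the program also runs safely on lists that encode nothing, provided their sizes are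
  plausible; only the final answer has to be guarded.\<close>

datatype loc = Var nat | Cell nat nat

type_synonym state = "loc \<Rightarrow> nat"

datatype aexp = Num nat | Rd nat | Plus aexp aexp | Minus aexp aexp | At nat aexp

primrec ev :: "aexp \<Rightarrow> state \<Rightarrow> nat" where
  "ev (Num n) s = n"
| "ev (Rd x) s = s (Var x)"
| "ev (Plus a b) s = ev a s + ev b s"
| "ev (Minus a b) s = ev a s - ev b s"
| "ev (At k a) s = s (Cell k (ev a s))"

datatype com =
    Skip
  | Assign nat aexp (infix "::=" 61)
  | Put nat aexp aexp
  | Seq com com (infixr ";;" 60)
  | IfLess aexp aexp com com
  | For nat nat com

text \<open>The bound of a \<open>For\<close> is read once on entry and the counter is overwritten
  before each pass, so every command is total and its body cannot change the number of
  passes.\<close>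

primrec sem :: "com \<Rightarrow> state \<Rightarrow> state" where
  "sem Skip s = s"
| "sem (x ::= a) s = s(Var x := ev a s)"
| "sem (Put k a b) s = s(Cell k (ev a s) := ev b s)"
| "sem (c ;; d) s = sem d (sem c s)"
| "sem (IfLess a b c d) s = (if ev a s < ev b s then sem c s else sem d s)"
| "sem (For x y c) s = fold (\<lambda>i s. sem c (s(Var x := i))) [0..<s (Var y)] s"

text \<open>Over-approximates the locations written: a \<open>Put\<close> counts as touching its
  whole array, because indices are run-time values. Frame conditions can then be checked by the
  simplifier.\<close>

primrec may :: "com \<Rightarrow> loc \<Rightarrow> bool" where
  "may Skip l = False"
| "may (x ::= a) l = (l = Var x)"
| "may (Put k a b) l = (\<exists>i. l = Cell k i)"
| "may (c ;; d) l = (may c l \<or> may d l)"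
| "may (IfLess a b c d) l = (may c l \<or> may d l)"
| "may (For x y c) l = (l = Var x \<or> may c l)"

lemma fold_frame:
  "(\<And>i s. i \<in> set xs \<Longrightarrow> f i s l = s l) \<Longrightarrow> fold f xs s l = s l"
  by (induction xs arbitrary: s) auto

lemma sem_frame: "\<not> may c l \<Longrightarrow> sem c s l = s l"
proof (induction c arbitrary: s)
  case (For x y c)
  then show ?case by (auto intro!: fold_frame)
qed auto

text \<open>Besides the invariant, the step may use that all locations outside the write set still
  agree with the state before the loop. Invariants therefore mention only what the body
  changes.\<close>

lemma For_inv:
  assumes "I 0 s0"
    and step: "\<And>i s. i < s0 (Var y) \<Longrightarrow> I i s \<Longrightarrow> (\<And>l. \<not> may (For x y c) l \<Longrightarrow> s l = s0 l)
      \<Longrightarrow> I (Suc i) (sem c (s(Var x := i)))"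
  shows "I (s0 (Var y)) (sem (For x y c) s0)"
proof -
  let ?S = "\<lambda>i. fold (\<lambda>i s. sem c (s(Var x := i))) [0..<i] s0"
  have "i \<le> s0 (Var y) \<Longrightarrow> I i (?S i)" for i
  proof (induction i)
    case 0
    then show ?case using assms(1) by simp
  next
    case (Suc i)
    have "\<not> may (For x y c) l \<Longrightarrow> ?S i l = s0 l" for l
      by (intro fold_frame) (auto simp: sem_frame)
    then have "I (Suc i) (sem c ((?S i)(Var x := i)))"
      using step[OF _ Suc.IH[OF Suc_leD[OF Suc.prems]]] Suc.prems Suc_le_lessD by blast
    moreover have "?S (Suc i) = sem c ((?S i)(Var x := i))" by simp
    ultimately show ?case by (simp only:)
  qed
  from this[of "s0 (Var y)"] show ?thesis by simp
qed

section \<open>Exact step counts and static bounds on them\<close>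

primrec esz :: "aexp \<Rightarrow> nat" where
  "esz (Num n) = 1"
| "esz (Rd x) = 1"
| "esz (Plus a b) = esz a + esz b + 1"
| "esz (Minus a b) = esz a + esz b + 1"
| "esz (At k a) = esz a + 9"

text \<open>Exact number of machine steps of the compiled code. Expressions compile to straight-line
  code, so \<open>esz\<close> is both length and time; 9 is an address computation of eight
  instructions plus one access. A loop pays 4 for its set-up and the final failing test with the
  exit jump, and 5 per pass for the test, the counter update and the jump back.\<close>

primrec tm :: "com \<Rightarrow> state \<Rightarrow> nat" where
  "tm Skip s = 0"
| "tm (x ::= a) s = esz a + 1"
| "tm (Put k a b) s = esz a + esz b + 9"
| "tm (c ;; d) s = tm c s + tm d (sem c s)"
| "tm (IfLess a b c d) s = esz a + esz b + 1 + (if ev a s < ev b s then tm c s else tm d s + 1)"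
| "tm (For x y c) s = 4 + (\<Sum>i<s (Var y). 5 +
     tm c ((fold (\<lambda>i s. sem c (s(Var x := i))) [0..<i] s)(Var x := i)))"

primrec tb :: "com \<Rightarrow> (nat \<Rightarrow> nat) \<Rightarrow> nat" where
  "tb Skip B = 0"
| "tb (x ::= a) B = esz a + 1"
| "tb (Put k a b) B = esz a + esz b + 9"
| "tb (c ;; d) B = tb c B + tb d B"
| "tb (IfLess a b c d) B = esz a + esz b + 2 + tb c B + tb d B"
| "tb (For x y c) B = 4 + B y * (5 + tb c B)"

primrec bvs :: "com \<Rightarrow> nat set" where
  "bvs Skip = {}"
| "bvs (x ::= a) = {}"
| "bvs (Put k a b) = {}"
| "bvs (c ;; d) = bvs c \<union> bvs d"
| "bvs (IfLess a b c d) = bvs c \<union> bvs d"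
| "bvs (For x y c) = insert y (bvs c)"

text \<open>Since no loop-bound variable is ever assigned, its initial bound is still valid on entry
  to every nested loop, and bounds simply multiply along a nest.\<close>

lemma tm_le_tb:
  assumes "\<forall>y\<in>bvs c. \<not> may c (Var y) \<and> s (Var y) \<le> B y"
  shows "tm c s \<le> tb c B"
  using assms
proof (induction c arbitrary: s)
  case (Seq c d)
  have "tm c s \<le> tb c B" using Seq by auto
  moreover have "tm d (sem c s) \<le> tb d B"
    using Seq.prems by (intro Seq.IH(2)) (auto simp: sem_frame)
  ultimately show ?case by simp
next
  case (IfLess a b c d)
  have "tm c s \<le> tb c B" "tm d s \<le> tb d B" using IfLess by auto
  then show ?case by simp
next
  case (For x y c)
  let ?S = "\<lambda>i. fold (\<lambda>i s. sem c (s(Var x := i))) [0..<i] s"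
  have "tm c ((?S i)(Var x := i)) \<le> tb c B" for i
  proof (rule For.IH, rule ballI)
    fix z assume z: "z \<in> bvs c"
    then have nm: "\<not> may (For x y c) (Var z)" "s (Var z) \<le> B z" using For.prems by auto
    have "?S i (Var z) = s (Var z)"
      using nm(1) by (intro fold_frame) (auto simp: sem_frame)
    then show "\<not> may c (Var z) \<and> ((?S i)(Var x := i)) (Var z) \<le> B z" using nm by auto
  qed
  then have "(\<Sum>i<s (Var y). 5 + tm c ((?S i)(Var x := i))) \<le> (\<Sum>i<s (Var y). 5 + tb c B)"
    by (intro sum_mono) auto
  also have "\<dots> = s (Var y) * (5 + tb c B)" by simp
  also have "\<dots> \<le> B y * (5 + tb c B)" using For.prems by (intro mult_right_mono) auto
  finally show ?case by simp
qed auto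

section \<open>Code generation and its correctness\<close>

primrec wfe :: "aexp \<Rightarrow> bool" where
  "wfe (Num n) = True"
| "wfe (Rd x) = (x < 100)"
| "wfe (Plus a b) = (wfe a \<and> wfe b)"
| "wfe (Minus a b) = (wfe a \<and> wfe b)"
| "wfe (At k a) = (k < 32 \<and> wfe a)"

primrec wfc :: "com \<Rightarrow> bool" where
  "wfc Skip = True"
| "wfc (x ::= a) = (x < 100 \<and> wfe a)"
| "wfc (Put k a b) = (k < 32 \<and> wfe a \<and> wfe b)"
| "wfc (c ;; d) = (wfc c \<and> wfc d)"
| "wfc (IfLess a b c d) = (wfe a \<and> wfe b \<and> wfc c \<and> wfc d)"
| "wfc (For x y c) = (x < 100 \<and> y < 100 \<and> wfc c)"

text \<open>
  Variables are the registers below 100, register 100 holds the base address of the arrays, which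
  are interleaved with stride 32, and the registers from \<open>d\<close> on are free.
\<close>

definition addr :: "nat \<Rightarrow> nat \<Rightarrow> instr list" where
  "addr k d = [Add d d d, Add d d d, Add d d d, Add d d d, Add d d d, Add d d 100,
     SetConst (Suc d) k, Add d d (Suc d)]"

text \<open>The registers from \<open>d\<close> on serve as an evaluation stack: the result ends in
  \<open>d\<close>, and a second operand is evaluated one register higher so that the first
  survives.\<close>

primrec ecomp :: "aexp \<Rightarrow> nat \<Rightarrow> instr list" where
  "ecomp (Num n) d = [SetConst d n]"
| "ecomp (Rd x) d = [Copy d x]"
| "ecomp (Plus a b) d = ecomp a d @ ecomp b (Suc d) @ [Add d d (Suc d)]"
| "ecomp (Minus a b) d = ecomp a d @ ecomp b (Suc d) @ [Sub d d (Suc d)]"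
| "ecomp (At k a) d = ecomp a d @ addr k d @ [Load d d]"

lemma length_addr [simp]: "length (addr k d) = 8"
  by (simp add: addr_def)

lemma length_ecomp [simp]: "length (ecomp e d) = esz e"
  by (induction e arbitrary: d) auto

text \<open>\<open>off\<close> is the absolute position of the code, needed because jumps are
  absolute. A conditional puts the else-branch first, and a successful comparison jumps over it. A
  loop keeps its counter in \<open>d\<close> and its limit in \<open>Suc d\<close>; its body works
  from two registers higher.\<close>

primrec compile :: "com \<Rightarrow> nat \<Rightarrow> nat \<Rightarrow> instr list" where
  "compile Skip d off = []"
| "compile (x ::= a) d off = ecomp a d @ [Copy x d]"
| "compile (Put k a b) d off = ecomp a d @ addr k d @ ecomp b (Suc d) @ [Store d (Suc d)]"
| "compile (c1 ;; c2) d off =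
     compile c1 d off @ compile c2 d (off + length (compile c1 d off))"
| "compile (IfLess a b c1 c2) d off =
     (let off2 = off + esz a + esz b + 1; p2 = compile c2 d off2;
          off1 = off2 + length p2 + 1; p1 = compile c1 d off1
      in ecomp a d @ ecomp b (Suc d) @ [JumpLess d (Suc d) off1] @ p2 @
         [Jump (off1 + length p1)] @ p1)"
| "compile (For x y c) d off =
     (let p = compile c (Suc (Suc d)) (off + 7)
      in [SetConst d 0, Copy (Suc d) y, JumpLess d (Suc d) (off + 4), Jump (off + 8 + length p),
          Copy x d, SetConst (Suc (Suc d)) 1, Add d d (Suc (Suc d))] @ p @ [Jump (off + 2)])"

definition code_at :: "instr list \<Rightarrow> nat \<Rightarrow> instr list \<Rightarrow> bool" where
  "code_at P off xs \<longleftrightarrow> (\<forall>i<length xs. off + i < length P \<and> P ! (off + i) = xs ! i)"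

lemma code_at_Nil [simp]: "code_at P off []"
  by (simp add: code_at_def)

lemma code_at_Cons [simp]:
  "code_at P off (x # xs) \<longleftrightarrow> off < length P \<and> P ! off = x \<and> code_at P (Suc off) xs"
  unfolding code_at_def by (auto simp: less_Suc_eq_0_disj)

lemma code_at_append [simp]:
  "code_at P off (xs @ ys) \<longleftrightarrow> code_at P off xs \<and> code_at P (off + length xs) ys"
  by (induction xs arbitrary: off) auto

lemma code_at_mid: "code_at (xs @ ys @ zs) (length xs) ys"
  unfolding code_at_def by (auto simp: nth_append)

definition reach :: "instr list \<Rightarrow> config \<Rightarrow> nat \<Rightarrow> config \<Rightarrow> bool" where
  "reach P c t c' \<longleftrightarrow> (step P ^^ t) c = c'"

lemma reach_refl [simp]: "reach P c 0 c"
  by (simp add: reach_def)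

lemma reach_trans: "reach P c t c' \<Longrightarrow> reach P c' u c'' \<Longrightarrow> reach P c (t + u) c''"
  by (simp add: reach_def add.commute[of t] funpow_add)

primrec straight :: "instr \<Rightarrow> bool" where
  "straight (SetConst r k) = True"
| "straight (Copy r s) = True"
| "straight (Add r s t) = True"
| "straight (Sub r s t) = True"
| "straight (Load r s) = True"
| "straight (Store r s) = True"
| "straight (Jump l) = False"
| "straight (JumpLess r s l) = False"

lemma reach_step:
  "reach P (exec_instr (P ! pc c) c) t c' \<Longrightarrow> pc c < length P \<Longrightarrow> reach P c (Suc t) c'"
  by (simp add: reach_def step_def halted_def funpow_swap1)

lemma reach_one:
  "code_at P (pc c) [i] \<Longrightarrow> c' = exec_instr i c \<Longrightarrow> reach P c 1 c'"
  using reach_step[of P c 0 c'] by simp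

lemma reach_straight:
  assumes "code_at P (pc c) is" "list_all straight is" "n = length is"
    "c' = fold exec_instr is c"
  shows "reach P c n c'"
  using assms
proof (induction "is" arbitrary: c n)
  case (Cons i js)
  have "pc (exec_instr i c) = Suc (pc c)" using Cons.prems by (cases i) auto
  then have "reach P (exec_instr i c) (length js) c'"
    using Cons by auto
  then show ?case using Cons.prems by (auto intro: reach_step)
qed simp

text \<open>Memory below \<open>b\<close> and the registers above 100 are left unconstrained: the
  former still holds the raw input, the latter are temporaries.\<close>

definition rel :: "state \<Rightarrow> nat \<Rightarrow> (nat \<Rightarrow> nat) \<Rightarrow> (nat \<Rightarrow> nat) \<Rightarrow> bool" where
  "rel s b r m \<longleftrightarrow> (\<forall>x<100. r x = s (Var x)) \<and> r 100 = b \<and>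
     (\<forall>k<32. \<forall>i. m (b + 32 * i + k) = s (Cell k i))"

lemma rel_temps: "rel s b r m \<Longrightarrow> (\<And>x. x < d \<Longrightarrow> r' x = r x) \<Longrightarrow> 100 < d \<Longrightarrow> rel s b r' m"
  by (simp add: rel_def)

lemma rel_temp [simp]: "100 < d \<Longrightarrow> rel s b (r(d := v)) m = rel s b r m"
  by (simp add: rel_def)

lemma rel_Var: "rel s b r m \<Longrightarrow> x < 100 \<Longrightarrow> rel (s(Var x := v)) b (r(x := v)) m"
  by (simp add: rel_def)

text \<open>Quotient and remainder by 32 recover index and array, so distinct cells never
  alias.\<close>

lemma cell_addr_eq:
  assumes "k < 32" "k' < 32"
  shows "(b::nat) + 32 * i + k = b + 32 * i' + k' \<longleftrightarrow> i = i' \<and> k = k'"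
proof
  assume "b + 32 * i + k = b + 32 * i' + k'"
  then have "(32 * i + k) div 32 = (32 * i' + k') div 32" "(32 * i + k) mod 32 = (32 * i' + k') mod 32"
    by simp_all
  then show "i = i' \<and> k = k'" using assms by simp
qed simp

lemma rel_Cell: "rel s b r m \<Longrightarrow> k < 32 \<Longrightarrow> rel (s(Cell k i := v)) b r (m(b + 32 * i + k := v))"
  by (simp add: rel_def cell_addr_eq)

text \<open>Five doublings multiply the index by the stride 32, the machine having no
  multiplication.\<close>

lemma addr_correct:
  assumes "code_at P off (addr k d)" "100 < d"
  shows "\<exists>r'. reach P \<lparr>pc = off, reg = r, mem = m\<rparr> 8 \<lparr>pc = off + 8, reg = r', mem = m\<rparr> \<and>
    r' d = r 100 + 32 * r d + k \<and> (\<forall>x<d. r' x = r x)"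
proof (intro exI conjI)
  show "reach P \<lparr>pc = off, reg = r, mem = m\<rparr> 8
      \<lparr>pc = off + 8, reg = r(d := r 100 + 32 * r d + k, Suc d := k), mem = m\<rparr>"
    using assms by (intro reach_straight[of P _ "addr k d"])
      (auto simp: addr_def fun_eq_iff)
qed (use assms in auto)

lemma ecomp_correct:
  assumes "code_at P off (ecomp e d)" "100 < d" "wfe e" "rel s b r m"
  shows "\<exists>r'. reach P \<lparr>pc = off, reg = r, mem = m\<rparr> (esz e)
      \<lparr>pc = off + esz e, reg = r', mem = m\<rparr> \<and> r' d = ev e s \<and> (\<forall>x<d. r' x = r x)"
  using assms
proof (induction e arbitrary: d off r)
  case (Num n)
  then have "reach P \<lparr>pc = off, reg = r, mem = m\<rparr> 1 \<lparr>pc = off + 1, reg = r(d := n), mem = m\<rparr>"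
    by (intro reach_one) auto
  then show ?case by fastforce
next
  case (Rd x)
  then have "reach P \<lparr>pc = off, reg = r, mem = m\<rparr> 1 \<lparr>pc = off + 1, reg = r(d := r x), mem = m\<rparr>"
    by (intro reach_one) auto
  then show ?case using Rd by (fastforce simp: rel_def)
next
  case (Plus e1 e2)
  have at: "code_at P off (ecomp e1 d)" "code_at P (off + esz e1) (ecomp e2 (Suc d))"
      "code_at P (off + esz e1 + esz e2) [Add d d (Suc d)]"
    and d: "100 < d" "100 < Suc d" and wf: "wfe e1" "wfe e2"
    using Plus.prems by auto
  from Plus.IH(1)[OF at(1) d(1) wf(1) Plus.prems(4)] obtain r1 where
    r1: "reach P \<lparr>pc = off, reg = r, mem = m\<rparr> (esz e1) \<lparr>pc = off + esz e1, reg = r1, mem = m\<rparr>"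
      "r1 d = ev e1 s" "\<forall>x<d. r1 x = r x" by blast
  have "rel s b r1 m" using Plus.prems r1 by - (rule rel_temps[of s b r m d], auto)
  from Plus.IH(2)[OF at(2) d(2) wf(2) this] obtain r2 where
    r2: "reach P \<lparr>pc = off + esz e1, reg = r1, mem = m\<rparr> (esz e2)
        \<lparr>pc = off + esz e1 + esz e2, reg = r2, mem = m\<rparr>"
      "r2 (Suc d) = ev e2 s" "\<forall>x<Suc d. r2 x = r1 x" by blast
  have "reach P \<lparr>pc = off + esz e1 + esz e2, reg = r2, mem = m\<rparr> 1
    \<lparr>pc = off + esz e1 + esz e2 + 1, reg = r2(d := r2 d + r2 (Suc d)), mem = m\<rparr>"
    using at(3) by (intro reach_one) auto
  from reach_trans[OF reach_trans[OF r1(1) r2(1)] this]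
  have "reach P \<lparr>pc = off, reg = r, mem = m\<rparr> (esz (Plus e1 e2)) \<lparr>pc = off + esz (Plus e1 e2),
      reg = r2(d := r2 d + r2 (Suc d)), mem = m\<rparr>"
    by (simp add: add.assoc)
  moreover have "(r2(d := r2 d + r2 (Suc d))) d = ev (Plus e1 e2) s"
    "\<forall>x<d. (r2(d := r2 d + r2 (Suc d))) x = r x"
    using r1 r2 by auto
  ultimately show ?case by blast
next
  case (Minus e1 e2)
  have at: "code_at P off (ecomp e1 d)" "code_at P (off + esz e1) (ecomp e2 (Suc d))"
      "code_at P (off + esz e1 + esz e2) [Sub d d (Suc d)]"
    and d: "100 < d" "100 < Suc d" and wf: "wfe e1" "wfe e2"
    using Minus.prems by auto
  from Minus.IH(1)[OF at(1) d(1) wf(1) Minus.prems(4)] obtain r1 where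
    r1: "reach P \<lparr>pc = off, reg = r, mem = m\<rparr> (esz e1) \<lparr>pc = off + esz e1, reg = r1, mem = m\<rparr>"
      "r1 d = ev e1 s" "\<forall>x<d. r1 x = r x" by blast
  have "rel s b r1 m" using Minus.prems r1 by - (rule rel_temps[of s b r m d], auto)
  from Minus.IH(2)[OF at(2) d(2) wf(2) this] obtain r2 where
    r2: "reach P \<lparr>pc = off + esz e1, reg = r1, mem = m\<rparr> (esz e2)
        \<lparr>pc = off + esz e1 + esz e2, reg = r2, mem = m\<rparr>"
      "r2 (Suc d) = ev e2 s" "\<forall>x<Suc d. r2 x = r1 x" by blast
  have "reach P \<lparr>pc = off + esz e1 + esz e2, reg = r2, mem = m\<rparr> 1
    \<lparr>pc = off + esz e1 + esz e2 + 1, reg = r2(d := r2 d - r2 (Suc d)), mem = m\<rparr>"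
    using at(3) by (intro reach_one) auto
  from reach_trans[OF reach_trans[OF r1(1) r2(1)] this]
  have "reach P \<lparr>pc = off, reg = r, mem = m\<rparr> (esz (Minus e1 e2)) \<lparr>pc = off + esz (Minus e1 e2),
      reg = r2(d := r2 d - r2 (Suc d)), mem = m\<rparr>"
    by (simp add: add.assoc)
  moreover have "(r2(d := r2 d - r2 (Suc d))) d = ev (Minus e1 e2) s"
    "\<forall>x<d. (r2(d := r2 d - r2 (Suc d))) x = r x"
    using r1 r2 by auto
  ultimately show ?case by blast
next
  case (At k e)
  have at: "code_at P off (ecomp e d)" "code_at P (off + esz e) (addr k d)"
      "code_at P (off + esz e + 8) [Load d d]"
    and d: "100 < d" and wf: "wfe e" "k < 32"
    using At.prems by (auto simp: add.assoc)
  from At.IH[OF at(1) d wf(1) At.prems(4)] obtain r1 where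
    r1: "reach P \<lparr>pc = off, reg = r, mem = m\<rparr> (esz e) \<lparr>pc = off + esz e, reg = r1, mem = m\<rparr>"
      "r1 d = ev e s" "\<forall>x<d. r1 x = r x" by blast
  have rel1: "rel s b r1 m" using At.prems r1 by - (rule rel_temps[of s b r m d], auto)
  from addr_correct[OF at(2) d, of r1 m] obtain r2 where
    r2: "reach P \<lparr>pc = off + esz e, reg = r1, mem = m\<rparr> 8
        \<lparr>pc = off + esz e + 8, reg = r2, mem = m\<rparr>"
      "r2 d = r1 100 + 32 * r1 d + k" "\<forall>x<d. r2 x = r1 x" by blast
  have v: "m (r2 d) = s (Cell k (ev e s))"
    using r2 r1 rel1 At.prems by (auto simp: rel_def)
  have "reach P \<lparr>pc = off + esz e + 8, reg = r2, mem = m\<rparr> 1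
    \<lparr>pc = off + esz e + 8 + 1, reg = r2(d := m (r2 d)), mem = m\<rparr>"
    using at(3) by (intro reach_one) auto
  from reach_trans[OF reach_trans[OF r1(1) r2(1)] this]
  have "reach P \<lparr>pc = off, reg = r, mem = m\<rparr> (esz (At k e))
      \<lparr>pc = off + esz (At k e), reg = r2(d := m (r2 d)), mem = m\<rparr>"
    by (simp add: ac_simps)
  moreover have "(r2(d := m (r2 d))) d = ev (At k e) s" "\<forall>x<d. (r2(d := m (r2 d))) x = r x"
    using r1 r2 v by auto
  ultimately show ?case by blast
qed


text \<open>The preservation of the registers from 100 up to \<open>d\<close> is what makes the
  induction work: the counters and limits of enclosing loops live there while the body runs.\<close>

lemma compile_correct:
  assumes "code_at P off (compile c d off)" "100 < d" "wfc c" "rel s b r m"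
  shows "\<exists>r' m'. reach P \<lparr>pc = off, reg = r, mem = m\<rparr> (tm c s)
      \<lparr>pc = off + length (compile c d off), reg = r', mem = m'\<rparr> \<and> rel (sem c s) b r' m' \<and>
      (\<forall>x<d. 100 \<le> x \<longrightarrow> r' x = r x)"
  using assms
proof (induction c arbitrary: d off s r m)
  case Skip
  then show ?case by - (rule exI[of _ r], rule exI[of _ m], simp)
next
  case (Assign x a)
  have at: "code_at P off (ecomp a d)" "wfe a" using Assign.prems by auto
  from ecomp_correct[OF at(1) Assign.prems(2) at(2) Assign.prems(4)] obtain r1 where
    r1: "reach P \<lparr>pc = off, reg = r, mem = m\<rparr> (esz a) \<lparr>pc = off + esz a, reg = r1, mem = m\<rparr>"
      "r1 d = ev a s" "\<forall>x<d. r1 x = r x" by blast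
  have rel1: "rel s b r1 m" using Assign.prems r1 by - (rule rel_temps[of s b r m d], auto)
  have "reach P \<lparr>pc = off + esz a, reg = r1, mem = m\<rparr> 1
    \<lparr>pc = off + esz a + 1, reg = r1(x := ev a s), mem = m\<rparr>"
    using Assign.prems r1 by (intro reach_one) auto
  from reach_trans[OF r1(1) this] have
    "reach P \<lparr>pc = off, reg = r, mem = m\<rparr> (tm (x ::= a) s)
      \<lparr>pc = off + length (compile (x ::= a) d off), reg = r1(x := ev a s), mem = m\<rparr>"
    by (simp add: add.assoc)
  moreover have "rel (sem (x ::= a) s) b (r1(x := ev a s)) m"
    using rel_Var[OF rel1] Assign.prems by simp
  moreover have "\<forall>y<d. 100 \<le> y \<longrightarrow> (r1(x := ev a s)) y = r y"
    using r1 Assign.prems by auto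
  ultimately show ?case by blast
next
  case (Put k e1 e2)
  have at: "code_at P off (ecomp e1 d)" "code_at P (off + esz e1) (addr k d)"
      "code_at P (off + esz e1 + 8) (ecomp e2 (Suc d))"
      "code_at P (off + esz e1 + 8 + esz e2) [Store d (Suc d)]"
    and wf: "wfe e1" "wfe e2" "k < 32" and d: "100 < d" "100 < Suc d"
    using Put.prems by (auto simp: add.assoc)
  from ecomp_correct[OF at(1) d(1) wf(1) Put.prems(4)] obtain r1 where
    r1: "reach P \<lparr>pc = off, reg = r, mem = m\<rparr> (esz e1) \<lparr>pc = off + esz e1, reg = r1, mem = m\<rparr>"
      "r1 d = ev e1 s" "\<forall>x<d. r1 x = r x" by blast
  have rel1: "rel s b r1 m" using Put.prems r1 by - (rule rel_temps[of s b r m d], auto)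
  from addr_correct[OF at(2) d(1), of r1 m] obtain r2 where
    r2: "reach P \<lparr>pc = off + esz e1, reg = r1, mem = m\<rparr> 8
        \<lparr>pc = off + esz e1 + 8, reg = r2, mem = m\<rparr>"
      "r2 d = r1 100 + 32 * r1 d + k" "\<forall>x<d. r2 x = r1 x" by blast
  have rel2: "rel s b r2 m" using Put.prems r2 rel1 by - (rule rel_temps[of s b r1 m d], auto)
  from ecomp_correct[OF at(3) d(2) wf(2) rel2] obtain r3 where
    r3: "reach P \<lparr>pc = off + esz e1 + 8, reg = r2, mem = m\<rparr> (esz e2)
        \<lparr>pc = off + esz e1 + 8 + esz e2, reg = r3, mem = m\<rparr>"
      "r3 (Suc d) = ev e2 s" "\<forall>x<Suc d. r3 x = r2 x" by blast
  have rel3: "rel s b r3 m" using Put.prems r3 rel2 by - (rule rel_temps[of s b r2 m d], auto)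
  have a: "r3 d = b + 32 * ev e1 s + k"
    using r1 r2 r3 rel1 by (auto simp: rel_def)
  have "reach P \<lparr>pc = off + esz e1 + 8 + esz e2, reg = r3, mem = m\<rparr> 1
    \<lparr>pc = off + esz e1 + 8 + esz e2 + 1, reg = r3, mem = m(b + 32 * ev e1 s + k := ev e2 s)\<rparr>"
    using at(4) r3 a by (intro reach_one) auto
  from reach_trans[OF reach_trans[OF reach_trans[OF r1(1) r2(1)] r3(1)] this] have
    "reach P \<lparr>pc = off, reg = r, mem = m\<rparr> (tm (Put k e1 e2) s)
      \<lparr>pc = off + length (compile (Put k e1 e2) d off), reg = r3,
       mem = m(b + 32 * ev e1 s + k := ev e2 s)\<rparr>"
    by (simp add: ac_simps)
  moreover have "rel (sem (Put k e1 e2) s) b r3 (m(b + 32 * ev e1 s + k := ev e2 s))"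
    using rel_Cell[OF rel3] Put.prems by simp
  moreover have "\<forall>y<d. 100 \<le> y \<longrightarrow> r3 y = r y"
    using r1 r2 r3 by auto
  ultimately show ?case by blast
next
  case (Seq c1 c2)
  have at: "code_at P off (compile c1 d off)" "wfc c1"
      "code_at P (off + length (compile c1 d off)) (compile c2 d (off + length (compile c1 d off)))" "wfc c2"
    using Seq.prems by auto
  from Seq.IH(1)[OF at(1) Seq.prems(2) at(2) Seq.prems(4)] obtain r1 m1 where
    1: "reach P \<lparr>pc = off, reg = r, mem = m\<rparr> (tm c1 s)
        \<lparr>pc = off + length (compile c1 d off), reg = r1, mem = m1\<rparr>"
      "rel (sem c1 s) b r1 m1" "\<forall>x<d. 100 \<le> x \<longrightarrow> r1 x = r x" by blast
  from Seq.IH(2)[OF at(3) Seq.prems(2) at(4) 1(2)] obtain r2 m2 where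
    2: "reach P \<lparr>pc = off + length (compile c1 d off), reg = r1, mem = m1\<rparr> (tm c2 (sem c1 s))
        \<lparr>pc = off + length (compile (c1 ;; c2) d off), reg = r2, mem = m2\<rparr>"
      "rel (sem c2 (sem c1 s)) b r2 m2" "\<forall>x<d. 100 \<le> x \<longrightarrow> r2 x = r1 x"
    by (auto simp only: compile.simps length_append add.assoc)
  from reach_trans[OF 1(1) 2(1)] 1 2 show ?case
    by - (rule exI[of _ r2], rule exI[of _ m2], simp)
next
  case (IfLess e1 e2 c1 c2)
  define p2 where "p2 = compile c2 d (off + esz e1 + esz e2 + 1)"
  define off1 where "off1 = off + esz e1 + esz e2 + 1 + length p2 + 1"
  define p1 where "p1 = compile c1 d off1"
  have code: "compile (IfLess e1 e2 c1 c2) d off = ecomp e1 d @ ecomp e2 (Suc d) @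
      [JumpLess d (Suc d) off1] @ p2 @ [Jump (off1 + length p1)] @ p1"
    by (simp add: p2_def p1_def off1_def Let_def)
  have at: "code_at P off (ecomp e1 d)" "code_at P (off + esz e1) (ecomp e2 (Suc d))"
    "code_at P (off + esz e1 + esz e2) [JumpLess d (Suc d) off1]"
    "code_at P (off + esz e1 + esz e2 + 1) p2"
    "code_at P (off + esz e1 + esz e2 + 1 + length p2) [Jump (off1 + length p1)]"
    "code_at P off1 p1"
    using IfLess.prems(1) unfolding code by (auto simp: off1_def)
  have wf: "wfe e1" "wfe e2" "wfc c1" "wfc c2" and d: "100 < d" "100 < Suc d"
    using IfLess.prems by auto
  from ecomp_correct[OF at(1) d(1) wf(1) IfLess.prems(4)] obtain r1 where
    r1: "reach P \<lparr>pc = off, reg = r, mem = m\<rparr> (esz e1) \<lparr>pc = off + esz e1, reg = r1, mem = m\<rparr>"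
      "r1 d = ev e1 s" "\<forall>x<d. r1 x = r x" by blast
  have rel1: "rel s b r1 m" using IfLess.prems r1 by - (rule rel_temps[of s b r m d], auto)
  from ecomp_correct[OF at(2) d(2) wf(2) rel1] obtain r2 where
    r2: "reach P \<lparr>pc = off + esz e1, reg = r1, mem = m\<rparr> (esz e2)
        \<lparr>pc = off + esz e1 + esz e2, reg = r2, mem = m\<rparr>"
      "r2 (Suc d) = ev e2 s" "\<forall>x<Suc d. r2 x = r1 x" by blast
  have rel2: "rel s b r2 m" using IfLess.prems r2 rel1 by - (rule rel_temps[of s b r1 m d], auto)
  have r12: "\<forall>x<d. r2 x = r x" using r1 r2 by auto
  note 12 = reach_trans[OF r1(1) r2(1)]
  have len: "length (compile (IfLess e1 e2 c1 c2) d off) =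
      esz e1 + esz e2 + 1 + length p2 + 1 + length p1"
    unfolding code by simp
  show ?case
  proof (cases "ev e1 s < ev e2 s")
    case True
    have "reach P \<lparr>pc = off + esz e1 + esz e2, reg = r2, mem = m\<rparr> 1
        \<lparr>pc = off1, reg = r2, mem = m\<rparr>"
      using at(3) True r1 r2 by (intro reach_one) auto
    note 3 = reach_trans[OF 12 this]
    from IfLess.IH(1)[OF at(6)[unfolded p1_def] d(1) wf(3) rel2] obtain r3 m3 where
      4: "reach P \<lparr>pc = off1, reg = r2, mem = m\<rparr> (tm c1 s)
          \<lparr>pc = off1 + length p1, reg = r3, mem = m3\<rparr>"
        "rel (sem c1 s) b r3 m3" "\<forall>x<d. 100 \<le> x \<longrightarrow> r3 x = r2 x"
      unfolding p1_def by blast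
    from reach_trans[OF 3 4(1)] 4 r12 True show ?thesis
      unfolding len by - (rule exI[of _ r3], rule exI[of _ m3], simp add: off1_def add.assoc)
  next
    case False
    have "reach P \<lparr>pc = off + esz e1 + esz e2, reg = r2, mem = m\<rparr> 1
        \<lparr>pc = off + esz e1 + esz e2 + 1, reg = r2, mem = m\<rparr>"
      using at(3) False r1 r2 by (intro reach_one) auto
    note 3 = reach_trans[OF 12 this]
    from IfLess.IH(2)[OF at(4)[unfolded p2_def] d(1) wf(4) rel2]
    obtain r3 m3 where
      4: "reach P \<lparr>pc = off + esz e1 + esz e2 + 1, reg = r2, mem = m\<rparr> (tm c2 s)
          \<lparr>pc = off + esz e1 + esz e2 + 1 + length p2, reg = r3, mem = m3\<rparr>"
        "rel (sem c2 s) b r3 m3" "\<forall>x<d. 100 \<le> x \<longrightarrow> r3 x = r2 x"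
      unfolding p2_def by blast
    have 5: "reach P \<lparr>pc = off + esz e1 + esz e2 + 1 + length p2, reg = r3, mem = m3\<rparr> 1
        \<lparr>pc = off1 + length p1, reg = r3, mem = m3\<rparr>"
      using at(5) by (intro reach_one) auto
    from reach_trans[OF reach_trans[OF 3 4(1)] 5] 4 r12 False show ?thesis
      unfolding len by - (rule exI[of _ r3], rule exI[of _ m3], simp add: off1_def add.assoc)
  qed
next
  case (For x y c)
  define p where "p = compile c (Suc (Suc d)) (off + 7)"
  let ?c = "For x y c" and ?n = "s (Var y)"
  let ?S = "\<lambda>i. fold (\<lambda>i s. sem c (s(Var x := i))) [0..<i] s"
  let ?T = "\<lambda>i. 2 + (\<Sum>j<i. 5 + tm c ((?S j)(Var x := j)))"
  have code: "compile ?c d off = [SetConst d 0, Copy (Suc d) y] @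
      [JumpLess d (Suc d) (off + 4)] @ [Jump (off + 8 + length p)] @
      [Copy x d, SetConst (Suc (Suc d)) 1, Add d d (Suc (Suc d))] @ p @ [Jump (off + 2)]"
    by (simp add: p_def Let_def)
  have at: "code_at P off [SetConst d 0, Copy (Suc d) y]"
    "code_at P (off + 2) [JumpLess d (Suc d) (off + 4)]"
    "code_at P (off + 3) [Jump (off + 8 + length p)]"
    "code_at P (off + 4) [Copy x d, SetConst (Suc (Suc d)) 1, Add d d (Suc (Suc d))]"
    "code_at P (off + 7) p" "code_at P (off + 7 + length p) [Jump (off + 2)]"
    using For.prems(1) unfolding code code_at_append
    by (simp_all add: eval_nat_numeral)
  have d: "100 < d" "x < 100" "y < 100" "wfc c" using For.prems by auto
  \<comment> \<open>Configuration at the loop test after \<open>i\<close> passes; the time so far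
    excludes the final failing test and the exit jump.\<close>
  have loop: "i \<le> ?n \<Longrightarrow> \<exists>r' m'. reach P \<lparr>pc = off, reg = r, mem = m\<rparr> (?T i)
      \<lparr>pc = off + 2, reg = r', mem = m'\<rparr> \<and> rel (?S i) b r' m' \<and>
      (\<forall>x<d. 100 \<le> x \<longrightarrow> r' x = r x) \<and> r' d = i \<and> r' (Suc d) = ?n" for i
  proof (induction i)
    case 0
    have "reach P \<lparr>pc = off, reg = r, mem = m\<rparr> 2
        \<lparr>pc = off + 2, reg = r(d := 0, Suc d := r y), mem = m\<rparr>"
      using at(1) d by (intro reach_straight[of P _ "[SetConst d 0, Copy (Suc d) y]"]) auto
    moreover have "r y = ?n" using For.prems d by (auto simp: rel_def)
    moreover have "rel s b (r(d := 0, Suc d := r y)) m" using For.prems d by simp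
    moreover have "\<forall>x<d. 100 \<le> x \<longrightarrow> (r(d := 0, Suc d := r y)) x = r x" by simp
    moreover have "(r(d := 0, Suc d := r y)) d = 0" "(r(d := 0, Suc d := r y)) (Suc d) = r y" by auto
    ultimately show ?case
      unfolding fold.simps lessThan_0 sum.empty upt_0 add_0_right id_apply by metis
  next
    case (Suc i)
    from Suc.IH[OF Suc_leD[OF Suc.prems]] obtain r1 m1 where
      1: "reach P \<lparr>pc = off, reg = r, mem = m\<rparr> (?T i) \<lparr>pc = off + 2, reg = r1, mem = m1\<rparr>"
        "rel (?S i) b r1 m1" "\<forall>x<d. 100 \<le> x \<longrightarrow> r1 x = r x" "r1 d = i" "r1 (Suc d) = ?n"
      by blast
    have 2: "reach P \<lparr>pc = off + 2, reg = r1, mem = m1\<rparr> 1 \<lparr>pc = off + 4, reg = r1, mem = m1\<rparr>"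
      using at(2) 1 Suc.prems by (intro reach_one) auto
    let ?r = "r1(x := i, Suc (Suc d) := 1, d := Suc i)"
    have 3: "reach P \<lparr>pc = off + 4, reg = r1, mem = m1\<rparr> 3 \<lparr>pc = off + 7, reg = ?r, mem = m1\<rparr>"
      using at(4) 1 d by (intro reach_straight[of P _ "[Copy x d, SetConst (Suc (Suc d)) 1, Add d d (Suc (Suc d))]"]) auto
    have "rel ((?S i)(Var x := i)) b ?r m1"
      using rel_Var[OF 1(2) d(2)] d by simp
    from For.IH[OF at(5)[unfolded p_def] less_SucI[OF less_SucI[OF d(1)]] d(4) this]
    obtain r2 m2 where
      4: "reach P \<lparr>pc = off + 7, reg = ?r, mem = m1\<rparr> (tm c ((?S i)(Var x := i)))
          \<lparr>pc = off + 7 + length p, reg = r2, mem = m2\<rparr>"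
        "rel (sem c ((?S i)(Var x := i))) b r2 m2"
        "\<forall>x<Suc (Suc d). 100 \<le> x \<longrightarrow> r2 x = ?r x"
      unfolding p_def by blast
    have 5: "reach P \<lparr>pc = off + 7 + length p, reg = r2, mem = m2\<rparr> 1
        \<lparr>pc = off + 2, reg = r2, mem = m2\<rparr>"
      using at(6) by (intro reach_one) auto
    have t: "?T (Suc i) = ?T i + 1 + 3 + tm c ((?S i)(Var x := i)) + 1" by simp
    have "reach P \<lparr>pc = off, reg = r, mem = m\<rparr> (?T (Suc i)) \<lparr>pc = off + 2, reg = r2, mem = m2\<rparr>"
      unfolding t
      by (rule reach_trans[OF reach_trans[OF reach_trans[OF reach_trans[OF 1(1) 2] 3] 4(1)] 5])
    moreover have "rel (?S (Suc i)) b r2 m2" using 4(2) by simp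
    moreover have "\<forall>x<d. 100 \<le> x \<longrightarrow> r2 x = r x" "r2 d = Suc i" "r2 (Suc d) = ?n"
      using 1 4(3) d by auto
    ultimately show ?case by blast
  qed
  from loop[of ?n] obtain r1 m1 where
    1: "reach P \<lparr>pc = off, reg = r, mem = m\<rparr> (?T ?n) \<lparr>pc = off + 2, reg = r1, mem = m1\<rparr>"
      "rel (?S ?n) b r1 m1" "\<forall>x<d. 100 \<le> x \<longrightarrow> r1 x = r x" "r1 d = ?n" "r1 (Suc d) = ?n"
    by blast
  have 2: "reach P \<lparr>pc = off + 2, reg = r1, mem = m1\<rparr> 1 \<lparr>pc = off + 3, reg = r1, mem = m1\<rparr>"
    using at(2) 1 by (intro reach_one) auto
  have 3: "reach P \<lparr>pc = off + 3, reg = r1, mem = m1\<rparr> 1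
      \<lparr>pc = off + 8 + length p, reg = r1, mem = m1\<rparr>"
    using at(3) 1 by (intro reach_one) auto
  have t: "tm ?c s = ?T ?n + 1 + 1" by simp
  have "off + length (compile ?c d off) = off + 8 + length p" unfolding code by simp
  then have "reach P \<lparr>pc = off, reg = r, mem = m\<rparr> (tm ?c s)
      \<lparr>pc = off + length (compile ?c d off), reg = r1, mem = m1\<rparr>"
    using reach_trans[OF reach_trans[OF 1(1) 2] 3] unfolding t by (simp only:)
  then show ?case using 1 by - (rule exI[of _ r1], rule exI[of _ m1], simp)
qed

section \<open>Moving the input into the arrays and the output out of them\<close>

definition prolog :: "instr list" where
  "prolog = [Copy 100 0, SetConst 101 0, JumpLess 101 100 4, Jump 16, Load 102 101, Copy 103 101,
     Add 103 103 103, Add 103 103 103, Add 103 103 103, Add 103 103 103, Add 103 103 103,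
     Add 103 103 100, Store 103 102, SetConst 104 1, Add 101 101 104, Jump 2]"

definition epilog :: "nat \<Rightarrow> instr list" where
  "epilog e = [SetConst 101 0, JumpLess 101 0 (e + 3), Jump (e + 16), Copy 103 101,
     Add 103 103 103, Add 103 103 103, Add 103 103 103, Add 103 103 103, Add 103 103 103,
     Add 103 103 100, SetConst 104 1, Add 103 103 104, Load 102 103, Store 101 102,
     Add 101 101 104, Jump (e + 1)]"

text \<open>The input is copied to array 0; the output is array 1 up to the value of variable 0.\<close>

definition prog :: "com \<Rightarrow> instr list" where
  "prog c = prolog @ compile c 101 16 @ epilog (16 + length (compile c 101 16))"

definition init_state :: "nat list \<Rightarrow> state" where
  "init_state xs l = (case l of Var x \<Rightarrow> if x = 0 then length xs else 0
     | Cell k i \<Rightarrow> if k = 0 \<and> i < length xs then xs ! i else 0)"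

lemma init_state_simps [simp]:
  "init_state xs (Var x) = (if x = 0 then length xs else 0)"
  "init_state xs (Cell k i) = (if k = 0 \<and> i < length xs then xs ! i else 0)"
  by (simp_all add: init_state_def)

text \<open>The base address is the input length, so the arrays start right behind the input, and
  copying entry \<open>i\<close> to \<open>?n + 32 * i\<close> never destroys an entry still to be
  read.\<close>

lemma prolog_correct:
  fixes xs :: "nat list"
  assumes at: "code_at P 0 prolog"
  shows "\<exists>r m. reach P (init_config xs) (13 * length xs + 4) \<lparr>pc = 16, reg = r, mem = m\<rparr> \<and>
    rel (init_state xs) (length xs) r m"
proof -
  let ?n = "length xs"
  have at1: "code_at P 0 [Copy 100 0, SetConst 101 0]"
    "code_at P 2 [JumpLess 101 100 4]" "code_at P 3 [Jump 16]"
    "code_at P 4 [Load 102 101, Copy 103 101,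
     Add 103 103 103, Add 103 103 103, Add 103 103 103, Add 103 103 103, Add 103 103 103,
     Add 103 103 100, Store 103 102, SetConst 104 1, Add 101 101 104]"
    "code_at P 15 [Jump 2]"
    using at unfolding prolog_def by (simp_all add: eval_nat_numeral)
  let ?I = "\<lambda>i r m. (\<forall>x<100. r x = init_state xs (Var x)) \<and> r 100 = ?n \<and> r 101 = i \<and>
    (\<forall>a<?n. m a = xs ! a) \<and>
    (\<forall>k<32. \<forall>j. m (?n + 32 * j + k) = (if k = 0 \<and> j < i then xs ! j else 0))"
  have loop: "i \<le> ?n \<Longrightarrow> \<exists>r m. reach P (init_config xs) (2 + 13 * i) \<lparr>pc = 2, reg = r, mem = m\<rparr> \<and> ?I i r m" for i
  proof (induction i)
    case 0
    let ?m = "\<lambda>i. if i < ?n then xs ! i else 0"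
    let ?r = "(\<lambda>_. 0)(0 := ?n, 100 := ?n, 101 := 0)"
    have "reach P (init_config xs) (2 + 13 * 0) \<lparr>pc = 2, reg = ?r, mem = ?m\<rparr>"
      using at1(1)
      by (intro reach_straight[of P _ "[Copy 100 0, SetConst 101 0]"])
         (simp_all add: init_config_def)
    moreover have "?I 0 ?r ?m" by simp
    ultimately show ?case by blast
  next
    case (Suc i)
    from Suc.IH[OF Suc_leD[OF Suc.prems]] obtain r m where
      1: "reach P (init_config xs) (2 + 13 * i) \<lparr>pc = 2, reg = r, mem = m\<rparr>" and I: "?I i r m"
      by blast
    have 2: "reach P \<lparr>pc = 2, reg = r, mem = m\<rparr> 1 \<lparr>pc = 4, reg = r, mem = m\<rparr>"
      using at1(2) I Suc.prems by (intro reach_one) auto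
    let ?m = "m(?n + 32 * i + 0 := xs ! i)"
    let ?r = "r(102 := xs ! i, 103 := ?n + 32 * i, 104 := 1, 101 := Suc i)"
    have 3: "reach P \<lparr>pc = 4, reg = r, mem = m\<rparr> 11 \<lparr>pc = 15, reg = ?r, mem = ?m\<rparr>"
      using I Suc.prems by (intro reach_straight[of P _ "[Load 102 101, Copy 103 101,
        Add 103 103 103, Add 103 103 103, Add 103 103 103, Add 103 103 103, Add 103 103 103,
        Add 103 103 100, Store 103 102, SetConst 104 1, Add 101 101 104]"])
         (simp_all only: at1 config.simps, auto simp: fun_eq_iff)
    have 4: "reach P \<lparr>pc = 15, reg = ?r, mem = ?m\<rparr> 1 \<lparr>pc = 2, reg = ?r, mem = ?m\<rparr>"
      using at1(5) by (intro reach_one) auto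
    have t: "2 + 13 * Suc i = 2 + 13 * i + 1 + 11 + 1" by simp
    have 5: "reach P (init_config xs) (2 + 13 * Suc i) \<lparr>pc = 2, reg = ?r, mem = ?m\<rparr>"
      unfolding t by (rule reach_trans[OF reach_trans[OF reach_trans[OF 1 2] 3] 4])
    have "?m (?n + 32 * j + k) = (if k = 0 \<and> j < Suc i then xs ! j else 0)"
      if "k < 32" for k j
      using I that cell_addr_eq[OF that, of 0 ?n j i] by auto
    then have "?I (Suc i) ?r ?m" using I by simp
    with 5 show ?case by blast
  qed
  from loop[of ?n] obtain r m where
    1: "reach P (init_config xs) (2 + 13 * ?n) \<lparr>pc = 2, reg = r, mem = m\<rparr>" and I: "?I ?n r m"
    by blast
  have 2: "reach P \<lparr>pc = 2, reg = r, mem = m\<rparr> 1 \<lparr>pc = 3, reg = r, mem = m\<rparr>"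
    using at1(2) I by (intro reach_one) auto
  have 3: "reach P \<lparr>pc = 3, reg = r, mem = m\<rparr> 1 \<lparr>pc = 16, reg = r, mem = m\<rparr>"
    using at1(3) by (intro reach_one) auto
  have t: "13 * length xs + 4 = 2 + 13 * ?n + 1 + 1" by simp
  have "reach P (init_config xs) (13 * length xs + 4) \<lparr>pc = 16, reg = r, mem = m\<rparr>"
    unfolding t by (rule reach_trans[OF reach_trans[OF 1 2] 3])
  moreover have "rel (init_state xs) ?n r m" using I by (simp add: rel_def)
  ultimately show ?thesis by blast
qed

text \<open>The output may overwrite the array area itself. This is harmless: address
  \<open>i\<close> lies below \<open>b + 32 * j + 1\<close> for all \<open>j > i\<close>, so the
  cells still to be read are intact.\<close>

lemma epilog_correct:
  assumes at: "code_at P e (epilog e)" and rel: "rel s b r0 m0"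
  defines "n \<equiv> s (Var 0)"
  shows "\<exists>r m. reach P \<lparr>pc = e, reg = r0, mem = m0\<rparr> (14 * n + 3) \<lparr>pc = e + 16, reg = r, mem = m\<rparr> \<and>
    r 0 = n \<and> (\<forall>i<n. m i = s (Cell 1 i))"
proof -
  have at1: "code_at P e [SetConst 101 0]"
    "code_at P (e + 1) [JumpLess 101 0 (e + 3)]" "code_at P (e + 2) [Jump (e + 16)]"
    "code_at P (e + 3) [Copy 103 101,
     Add 103 103 103, Add 103 103 103, Add 103 103 103, Add 103 103 103, Add 103 103 103,
     Add 103 103 100, SetConst 104 1, Add 103 103 104, Load 102 103, Store 101 102,
     Add 101 101 104]"
    "code_at P (e + 15) [Jump (e + 1)]"
    using at unfolding epilog_def by (simp_all add: eval_nat_numeral)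
  let ?I = "\<lambda>i r m. r 0 = n \<and> r 100 = b \<and> r 101 = i \<and> (\<forall>j<i. m j = s (Cell 1 j)) \<and>
    (\<forall>j\<ge>i. m (b + 32 * j + 1) = s (Cell 1 j))"
  have loop: "i \<le> n \<Longrightarrow> \<exists>r m. reach P \<lparr>pc = e, reg = r0, mem = m0\<rparr> (1 + 14 * i)
      \<lparr>pc = e + 1, reg = r, mem = m\<rparr> \<and> ?I i r m" for i
  proof (induction i)
    case 0
    let ?r = "r0(101 := 0)"
    have 1: "reach P \<lparr>pc = e, reg = r0, mem = m0\<rparr> (1 + 14 * 0) \<lparr>pc = e + 1, reg = ?r, mem = m0\<rparr>"
      using at1(1) by (intro reach_straight[of P _ "[SetConst 101 0]"]) simp_all
    have "m0 (b + 32 * j + 1) = s (Cell 1 j)" for j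
      using rel[unfolded rel_def, THEN conjunct2, THEN conjunct2, rule_format, of 1 j] by simp
    then have I: "?I 0 ?r m0" using rel by (simp add: rel_def n_def)
    show ?case by (rule exI[of _ ?r], rule exI[of _ m0], rule conjI[OF 1 I])
  next
    case (Suc i)
    from Suc.IH[OF Suc_leD[OF Suc.prems]] obtain r m where
      1: "reach P \<lparr>pc = e, reg = r0, mem = m0\<rparr> (1 + 14 * i) \<lparr>pc = e + 1, reg = r, mem = m\<rparr>"
      and I: "?I i r m"
      by blast
    have 2: "reach P \<lparr>pc = e + 1, reg = r, mem = m\<rparr> 1 \<lparr>pc = e + 3, reg = r, mem = m\<rparr>"
      using at1(2) I Suc.prems by (intro reach_one) auto
    let ?v = "s (Cell 1 i)"
    have v: "?v = m x" if "x = b + 32 * i + 1" for x using I that by auto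
    let ?m = "m(i := ?v)"
    let ?r = "r(103 := b + 32 * i + 1, 104 := 1, 102 := ?v, 101 := Suc i)"
    have 3: "reach P \<lparr>pc = e + 3, reg = r, mem = m\<rparr> 12 \<lparr>pc = e + 15, reg = ?r, mem = ?m\<rparr>"
      using I Suc.prems by (intro reach_straight[of P _ "[Copy 103 101,
        Add 103 103 103, Add 103 103 103, Add 103 103 103, Add 103 103 103, Add 103 103 103,
        Add 103 103 100, SetConst 104 1, Add 103 103 104, Load 102 103, Store 101 102,
        Add 101 101 104]"])
         (simp_all only: at1 config.simps, auto simp: fun_eq_iff intro!: v[unfolded One_nat_def])
    have 4: "reach P \<lparr>pc = e + 15, reg = ?r, mem = ?m\<rparr> 1 \<lparr>pc = e + 1, reg = ?r, mem = ?m\<rparr>"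
      using at1(5) by (intro reach_one) auto
    have t: "1 + 14 * Suc i = 1 + 14 * i + 1 + 12 + 1" by simp
    have 5: "reach P \<lparr>pc = e, reg = r0, mem = m0\<rparr> (1 + 14 * Suc i) \<lparr>pc = e + 1, reg = ?r, mem = ?m\<rparr>"
      unfolding t by (rule reach_trans[OF reach_trans[OF reach_trans[OF 1 2] 3] 4])
    have I': "?I (Suc i) ?r ?m" using I by (auto simp: less_Suc_eq)
    show ?case by (rule exI[of _ ?r], rule exI[of _ ?m], rule conjI[OF 5 I'])
  qed
  from loop[of n] obtain r m where
    1: "reach P \<lparr>pc = e, reg = r0, mem = m0\<rparr> (1 + 14 * n) \<lparr>pc = e + 1, reg = r, mem = m\<rparr>"
    and I: "?I n r m"
    by blast
  have 2: "reach P \<lparr>pc = e + 1, reg = r, mem = m\<rparr> 1 \<lparr>pc = e + 2, reg = r, mem = m\<rparr>"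
    using at1(2) I by (intro reach_one) auto
  have 3: "reach P \<lparr>pc = e + 2, reg = r, mem = m\<rparr> 1 \<lparr>pc = e + 16, reg = r, mem = m\<rparr>"
    using at1(3) by (intro reach_one) auto
  have t: "14 * n + 3 = 1 + 14 * n + 1 + 1" by simp
  have "reach P \<lparr>pc = e, reg = r0, mem = m0\<rparr> (14 * n + 3) \<lparr>pc = e + 16, reg = r, mem = m\<rparr>"
    unfolding t by (rule reach_trans[OF reach_trans[OF 1 2] 3])
  then show ?thesis using I by blast
qed

lemma prog_computes:
  fixes c :: com and xs :: "nat list"
  assumes "wfc c"
  defines "s \<equiv> sem c (init_state xs)"
  shows "computes_within (prog c) xs (map (\<lambda>i. s (Cell 1 i)) [0..<s (Var 0)])
    (tm c (init_state xs) + 13 * length xs + 14 * s (Var 0) + 7)"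
proof -
  let ?P = "prog c" and ?e = "16 + length (compile c 101 16)"
  have l: "length prolog = 16" by (simp add: prolog_def)
  have at: "code_at ?P 0 prolog" "code_at ?P 16 (compile c 101 16)" "code_at ?P ?e (epilog ?e)"
    using code_at_mid[of "[]" prolog] code_at_mid[of prolog "compile c 101 16"]
      code_at_mid[of "prolog @ compile c 101 16" "epilog ?e" "[]"]
    by (simp_all add: prog_def l)
  from prolog_correct[OF at(1), of xs] obtain r m where
    1: "reach ?P (init_config xs) (13 * length xs + 4) \<lparr>pc = 16, reg = r, mem = m\<rparr>"
    "rel (init_state xs) (length xs) r m" by blast
  from compile_correct[OF at(2) _ assms(1) 1(2)] obtain r1 m1 where
    2: "reach ?P \<lparr>pc = 16, reg = r, mem = m\<rparr> (tm c (init_state xs)) \<lparr>pc = ?e, reg = r1, mem = m1\<rparr>"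
    "rel s (length xs) r1 m1" unfolding s_def by auto
  from epilog_correct[OF at(3) 2(2)] obtain r2 m2 where
    3: "reach ?P \<lparr>pc = ?e, reg = r1, mem = m1\<rparr> (14 * s (Var 0) + 3) \<lparr>pc = ?e + 16, reg = r2, mem = m2\<rparr>"
    "r2 0 = s (Var 0)" "\<forall>i<s (Var 0). m2 i = s (Cell 1 i)" by blast
  have "length ?P = ?e + 16" by (simp add: prog_def l epilog_def)
  moreover have "run ?P xs (tm c (init_state xs) + 13 * length xs + 14 * s (Var 0) + 7) =
      \<lparr>pc = ?e + 16, reg = r2, mem = m2\<rparr>"
    using reach_trans[OF reach_trans[OF 1(1) 2(1)] 3(1)]
    unfolding reach_def run_def by (simp add: ac_simps)
  ultimately show ?thesis using 3
    by (auto simp: computes_within_def halted_def result_of_def)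
qed

subsection \<open>Logarithmic cost\<close>

fun cst :: "instr \<Rightarrow> nat" where
  "cst (SetConst r k) = k"
| "cst _ = 0"

definition bounded :: "nat \<Rightarrow> config \<Rightarrow> bool" where
  "bounded B c \<longleftrightarrow> (\<forall>r. reg c r \<le> B) \<and> (\<forall>a. mem c a \<le> B)"

text \<open>With program constants inside the bound, addition is the only instruction that can
  exceed it, and then by a factor of at most two.\<close>

lemma bounded_exec:
  assumes "bounded B c" "cst i \<le> B"
  shows "bounded (2 * B) (exec_instr i c)"
proof -
  have r: "reg c r \<le> B" "mem c r \<le> B" for r using assms(1) by (auto simp: bounded_def)
  have r': "reg c r \<le> 2 * B" "mem c r \<le> 2 * B" for r using r[of r] by auto
  have "reg c x + reg c y \<le> 2 * B" "reg c x - reg c y \<le> 2 * B" for x y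
    using r[of x] r[of y] by auto
  then show ?thesis using assms(2) r' by (cases i) (auto simp: bounded_def)
qed

lemma bits_le: "n \<le> 2 ^ m \<Longrightarrow> bits n \<le> Suc m"
proof -
  assume "n \<le> 2 ^ m"
  then have "n < 2 ^ Suc m" by (rule le_less_trans) simp
  then show ?thesis unfolding bits_def by (auto intro!: floorlog_leI)
qed

lemma less_bits: "n < 2 ^ bits n"
proof (cases "n = 0")
  case False
  then have "n < 2 ^ floorlog 2 n" using floorlog_bounds[of n 2] by simp
  also have "\<dots> \<le> 2 ^ bits n" by (intro power_increasing) (auto simp: bits_def)
  finally show ?thesis .
qed simp

lemma instr_cost_le:
  assumes "bounded (2 ^ m) c" "cst i \<le> 2 ^ m"
  shows "instr_cost i c \<le> 2 * m + 3"
proof -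
  have b: "bits (reg c r) \<le> Suc m" "bits (mem c a) \<le> Suc m" for r a
    using assms(1) by (auto simp: bounded_def intro!: bits_le)
  have "bits (reg c r) + bits (reg c r') \<le> 2 * m + 2"
    "bits (reg c r) + bits (mem c a) \<le> 2 * m + 2" for r r' a
    using add_mono[OF b(1)[of r] b(1)[of r']] add_mono[OF b(1)[of r] b(2)[of a]] by auto
  moreover have "bits (cst i) \<le> Suc m" using assms(2) by (rule bits_le)
  moreover have "bits (reg c r) \<le> 2 * m + 2" for r
    using b(1)[of r] by simp
  ultimately show ?thesis using assms(2)
    by (cases i) (simp_all add: eval_nat_numeral le_SucI)
qed

lemma length_le_input_size: "length xs \<le> input_size xs"
  by (induction xs) (auto simp: input_size_def bits_def)

lemma mem_le_input_size: "x \<in> set xs \<Longrightarrow> x \<le> 2 ^ input_size xs"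
proof -
  assume "x \<in> set xs"
  then have "bits x \<le> input_size xs" unfolding input_size_def by (intro member_le_sum_list) auto
  then show ?thesis using less_bits[of x] by (meson less_imp_le_nat order_trans power_increasing one_le_numeral)
qed

text \<open>After \<open>i\<close> steps all numbers are at most
  \<open>2 ^ (K + input_size xs + i)\<close>, so each of the \<open>t\<close> steps handles numbers
  of length linear in \<open>K + input_size xs + t\<close>. Here \<open>K\<close> absorbs the
  constants of the program.\<close>

lemma log_time_le:
  fixes P :: "instr list"
  defines "K \<equiv> sum_list (map cst P)"
  shows "log_time P xs t \<le> t * (2 * (K + input_size xs + t) + 3)"
proof -
  let ?m = "\<lambda>i. K + input_size xs + i"
  have cst: "cst i \<le> 2 ^ (K + j)" if "i \<in> set P" for i j
  proof -
    have "cst i \<le> K" unfolding K_def using that by (intro member_le_sum_list) auto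
    also have "\<dots> \<le> K + j" by simp
    also have "\<dots> \<le> 2 ^ (K + j)" by (rule less_imp_le) (rule less_exp)
    finally show ?thesis .
  qed
  have b: "bounded (2 ^ ?m i) (run P xs i)" for i
  proof (induction i)
    case 0
    have 1: "length xs \<le> 2 ^ ?m 0"
      using length_le_input_size[of xs] less_exp[of "?m 0"] by linarith
    have "xs ! i \<le> 2 ^ ?m 0" if "i < length xs" for i
      using mem_le_input_size[OF nth_mem[OF that]]
      by (rule order_trans) (simp add: power_increasing)
    then show ?case using 1 by (auto simp: run_def init_config_def bounded_def)
  next
    case (Suc i)
    have r: "run P xs (Suc i) = step P (run P xs i)" by (simp add: run_def)
    show ?case
    proof (cases "halted P (run P xs i)")
      case True
      then show ?thesis using Suc unfolding r
        by (auto simp: step_def bounded_def intro: order_trans)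
    next
      case False
      have "bounded (2 * 2 ^ ?m i) (exec_instr (P ! pc (run P xs i)) (run P xs i))"
        using Suc cst[of _ "input_size xs + i"] False
        by (intro bounded_exec) (auto simp: halted_def add.assoc)
      then show ?thesis using False unfolding r by (simp add: step_def)
    qed
  qed
  have "step_cost P (run P xs i) \<le> 2 * ?m t + 3" if "i < t" for i
  proof (cases "halted P (run P xs i)")
    case False
    have "instr_cost (P ! pc (run P xs i)) (run P xs i) \<le> 2 * ?m i + 3"
      using b[of i] cst[of _ "input_size xs + i"] False
      by (intro instr_cost_le) (auto simp: halted_def add.assoc)
    then show ?thesis using that False by (simp add: step_cost_def)
  qed (simp add: step_cost_def)
  then have "log_time P xs t \<le> (\<Sum>i<t. 2 * ?m t + 3)"
    unfolding log_time_def by (intro sum_mono) auto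
  then show ?thesis by simp
qed

text \<open>Polynomially many unit-cost steps suffice for the logarithmic measure; a square of the
  step bound \<open>Q\<close> pays for the growth of the numbers.\<close>

lemma class_PI:
  assumes "\<And>xs. \<exists>t. t \<le> C * (length xs + 1) ^ d \<and>
    computes_within P xs [if xs \<in> L then 1 else 0] t"
  shows "L \<in> class_P"
proof -
  define K where "K = sum_list (map cst P)"
  define Q :: "nat poly" where "Q = [:C:] * [:1, 1:] ^ d"
  define q where "q = Q * ([:2 * K + 3:] + [:0, 2:] + [:2:] * Q)"
  have "\<exists>t. computes_within P xs [if xs \<in> L then 1 else 0] t \<and> log_time P xs t \<le> poly q (input_size xs)" for xs
  proof -
    obtain t where t: "t \<le> C * (length xs + 1) ^ d"
      "computes_within P xs [if xs \<in> L then 1 else 0] t" using assms by blast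
    have "C * (length xs + 1) ^ d \<le> C * (input_size xs + 1) ^ d"
      using length_le_input_size[of xs] by (intro mult_left_mono power_mono) auto
    also have "\<dots> = poly Q (input_size xs)" by (simp add: Q_def poly_power add.commute)
    finally have tQ: "t \<le> poly Q (input_size xs)" using t by linarith
    have "log_time P xs t \<le> t * (2 * (K + input_size xs + t) + 3)"
      unfolding K_def by (rule log_time_le)
    also have "\<dots> \<le> poly Q (input_size xs) * (2 * (K + input_size xs + poly Q (input_size xs)) + 3)"
      using tQ by (intro mult_mono) auto
    also have "\<dots> = poly q (input_size xs)" by (simp add: q_def algebra_simps)
    finally show ?thesis using t by blast
  qed
  then show ?thesis unfolding class_P_def by blast
qed

section \<open>Paths and trees\<close>

lemma path_edges_simps [simp]:
  "path_edges [] = {}" "path_edges [a] = {}"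
  "path_edges (a # b # r) = insert {a, b} (path_edges (b # r))"
proof -
  show "path_edges (a # b # r) = insert {a, b} (path_edges (b # r))"
  proof (intro set_eqI iffI)
    fix e assume "e \<in> path_edges (a # b # r)"
    then obtain i where i: "Suc i < length (a # b # r)" "e = {(a # b # r) ! i, (a # b # r) ! Suc i}"
      by (auto simp: path_edges_def)
    then show "e \<in> insert {a, b} (path_edges (b # r))"
      by (cases i) (auto simp: path_edges_def)
  next
    fix e assume e: "e \<in> insert {a, b} (path_edges (b # r))"
    show "e \<in> path_edges (a # b # r)"
    proof (cases "e = {a, b}")
      case True
      then show ?thesis unfolding path_edges_def by (intro CollectI exI[of _ 0]) auto
    next
      case False
      then obtain i where "Suc i < length (b # r)" "e = {(b # r) ! i, (b # r) ! Suc i}"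
        using e by (auto simp: path_edges_def)
      then show ?thesis unfolding path_edges_def by (intro CollectI exI[of _ "Suc i"]) auto
    qed
  qed
qed (auto simp: path_edges_def)

lemma path_edges_append:
  "path_edges (xs @ a # ys) = path_edges (xs @ [a]) \<union> path_edges (a # ys)"
proof (induction xs)
  case (Cons b xs)
  then show ?case by (cases xs) auto
qed simp

lemma path_edges_rev: "path_edges (rev xs) = path_edges xs"
proof (induction xs)
  case (Cons a xs)
  then show ?case
  proof (cases xs)
    case (Cons b r)
    have "path_edges (rev (a # xs)) = path_edges (rev xs) \<union> path_edges [b, a]"
      using path_edges_append[of "rev r" b "[a]"] by (simp add: Cons)
    then show ?thesis using Cons.IH Cons by auto
  qed simp
qed simp

lemma path_edges_subset: "e \<in> path_edges p \<Longrightarrow> e \<subseteq> set p"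
  by (auto simp: path_edges_def)

lemma finite_path_edges [simp]: "finite (path_edges p)"
  by (rule finite_subset[of _ "Pow (set p)"]) (auto dest: path_edges_subset)

lemma is_path_Cons:
  "is_path V E (a # b # r) \<longleftrightarrow> a \<in> V \<and> a \<notin> set (b # r) \<and> {a, b} \<in> E \<and> is_path V E (b # r)"
  by (auto simp: is_path_def)

lemma is_path_singleton [simp]: "is_path V E [a] \<longleftrightarrow> a \<in> V"
  by (auto simp: is_path_def)

lemma is_path_rev: "is_path V E (rev p) \<longleftrightarrow> is_path V E p"
  by (simp add: is_path_def path_edges_rev)

lemma path_crosses:
  assumes "is_path V E p" "hd p \<in> S" "last p \<notin> S"
  shows "\<exists>a b. {a, b} \<in> E \<and> a \<in> S \<and> b \<notin> S \<and> a \<in> V \<and> b \<in> V"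
  using assms
proof (induction p rule: induct_list012)
  case (3 a b r)
  then show ?case
    by (cases "b \<in> S") (auto simp: is_path_Cons, auto simp: is_path_def)
qed (auto simp: is_path_def)

text \<open>A rooted tree presented by an elimination order: \<open>od\<close> lists the nodes,
  \<open>rk\<close> is its inverse, and every node but the last has a parent \<open>pa\<close> of
  larger rank. Ranks make any walk towards the root well-founded without mentioning paths.\<close>

locale ptree =
  fixes n :: nat and od pa rk :: "nat \<Rightarrow> nat"
  assumes npos: "0 < n"
    and od: "\<And>i. i < n \<Longrightarrow> od i < n \<and> rk (od i) = i"
    and rk: "\<And>v. v < n \<Longrightarrow> rk v < n \<and> od (rk v) = v"
    and pa: "\<And>v. v < n \<Longrightarrow> v \<noteq> od (n - 1) \<Longrightarrow> pa v < n \<and> rk v < rk (pa v)"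
begin

definition root where "root = od (n - 1)"

definition E where "E = {{v, pa v} | v. v < n \<and> v \<noteq> root}"

text \<open>The subtree hanging at \<open>x\<close>, that is, one side of the cut made by the edge
  from \<open>x\<close> to its parent.\<close>

inductive_set D for x where
  self: "x \<in> D x"
| child: "v < n \<Longrightarrow> v \<noteq> root \<Longrightarrow> pa v \<in> D x \<Longrightarrow> v \<in> D x"

lemma pa': "v < n \<Longrightarrow> v \<noteq> root \<Longrightarrow> pa v < n" "v < n \<Longrightarrow> v \<noteq> root \<Longrightarrow> rk v < rk (pa v)"
  using pa by (auto simp: root_def)

lemma root: "root < n" "rk root = n - 1"
  using od[of "n - 1"] npos by (auto simp: root_def)

lemma rk_eq: "v < n \<Longrightarrow> w < n \<Longrightarrow> rk v = rk w \<longleftrightarrow> v = w"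
  using rk by metis

lemma od_eq: "i < n \<Longrightarrow> j < n \<Longrightarrow> od i = od j \<longleftrightarrow> i = j"
  using od by metis

lemma D_pa: "v < n \<Longrightarrow> v \<noteq> root \<Longrightarrow> v \<noteq> x \<Longrightarrow> v \<in> D x \<longleftrightarrow> pa v \<in> D x"
  by (metis D.simps)

lemma D_rk: "v \<in> D x \<Longrightarrow> x < n \<Longrightarrow> rk v \<le> rk x \<and> v < n"
  by (induction rule: D.induct) (use pa' in force)+

lemma pa_notin_D: "x < n \<Longrightarrow> x \<noteq> root \<Longrightarrow> pa x \<notin> D x"
  using D_rk pa' by (meson leD)

text \<open>The end of smaller rank is the child, so an edge determines the node it hangs
  from.\<close>

lemma edge_inj: "v < n \<Longrightarrow> v \<noteq> root \<Longrightarrow> w < n \<Longrightarrow> w \<noteq> root \<Longrightarrow> {v, pa v} = {w, pa w} \<Longrightarrow> v = w"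
  using pa'(2) by (metis doubleton_eq_iff order_less_asym)

lemma edge_up: "{a, b} \<in> E \<Longrightarrow> rk a < rk b \<Longrightarrow> b = pa a"
  unfolding E_def using pa'(2) by (auto simp: doubleton_eq_iff dest: order_less_asym)

text \<open>Only the edge from \<open>x\<close> to its parent changes membership in
  \<open>D x\<close>, and a path with distinct nodes passes it at most once. So whether it is used
  depends on the ends of the path alone.\<close>

lemma path_edge_iff:
  assumes "is_path {..<n} E p" "x < n" "x \<noteq> root"
  shows "{x, pa x} \<in> path_edges p \<longleftrightarrow> (hd p \<in> D x) \<noteq> (last p \<in> D x)"
  using assms(1)
proof (induction p rule: induct_list012)
  case 1
  then show ?case by (simp add: is_path_def)
next
  case (3 a b r)
  have ab: "{a, b} \<in> E" "a \<notin> set (b # r)" "is_path {..<n} E (b # r)"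
    using 3 by (auto simp: is_path_Cons)
  then have IH: "{x, pa x} \<in> path_edges (b # r) \<longleftrightarrow> (b \<in> D x) \<noteq> (last (b # r) \<in> D x)"
    using 3 by auto
  from ab obtain u where u: "u < n" "u \<noteq> root" "{a, b} = {u, pa u}" by (auto simp: E_def)
  show ?case
  proof (cases "u = x")
    case True
    have "a \<in> {x, pa x}" using u True by auto
    then have "{x, pa x} \<notin> path_edges (b # r)" using ab(2) path_edges_subset by blast
    moreover have "(a \<in> D x) \<noteq> (b \<in> D x)"
      using u True pa_notin_D[OF assms(2,3)] D.self[of x] by (auto simp: doubleton_eq_iff)
    ultimately show ?thesis using IH u True by auto
  next
    case False
    have "{a, b} \<noteq> {x, pa x}" using u edge_inj[OF u(1,2) assms(2,3)] False by auto
    moreover have "(a \<in> D x) = (b \<in> D x)"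
      using u D_pa[OF u(1,2) False] by (auto simp: doubleton_eq_iff)
    ultimately show ?thesis using IH by auto
  qed
qed simp

text \<open>
  The tree path between two nodes: the end node of smaller rank moves to its parent until both
  meet, so that the ranks of the nodes passed increase.
\<close>

definition climb :: "nat \<Rightarrow> nat \<Rightarrow> nat \<Rightarrow> nat \<Rightarrow> nat list \<Rightarrow> nat list \<Rightarrow> bool" where
  "climb a0 b0 a b L R \<longleftrightarrow> a < n \<and> b < n \<and> hd (L @ [a]) = a0 \<and> hd (R @ [b]) = b0 \<and>
     path_edges (L @ [a]) \<subseteq> E \<and> path_edges (R @ [b]) \<subseteq> E \<and> distinct (L @ R) \<and>
     (\<forall>x\<in>set L \<union> set R. x < n \<and> rk x < rk a \<and> rk x < rk b)"

lemma climb_init: "a < n \<Longrightarrow> b < n \<Longrightarrow> climb a b a b [] []"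
  by (simp add: climb_def)

lemma climb_sym: "climb a0 b0 a b L R \<Longrightarrow> climb b0 a0 b a R L"
  by (auto simp: climb_def)

text \<open>Every node passed has smaller rank than both current ends, so the node appended is new
  and the two halves stay disjoint.\<close>

lemma climb_left:
  assumes "climb a0 b0 a b L R" "rk a < rk b"
  shows "climb a0 b0 (pa a) b (L @ [a]) R"
proof -
  have a: "a < n" "b < n" using assms by (auto simp: climb_def)
  have "a \<noteq> root" using assms(2) a rk[of b] root(2) by auto
  note pa = pa'[OF a(1) this]
  have "path_edges ((L @ [a]) @ [pa a]) = path_edges (L @ [a]) \<union> {{a, pa a}}"
    using path_edges_append[of L a "[pa a]"] by simp
  then have "path_edges ((L @ [a]) @ [pa a]) \<subseteq> E"
    using assms a \<open>a \<noteq> root\<close> by (auto simp: climb_def E_def)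
  moreover have "a \<notin> set L \<union> set R" using assms(1) by (auto simp: climb_def)
  moreover have "hd ((L @ [a]) @ [pa a]) = a0" using assms by (cases L) (auto simp: climb_def)
  moreover have "rk x < rk (pa a)" if "x \<in> set L \<union> set R" for x
    using assms(1) that pa by (auto simp: climb_def intro: less_trans)
  ultimately show ?thesis using assms a pa unfolding climb_def by auto
qed

lemma climb_right:
  assumes "climb a0 b0 a b L R" "rk b < rk a"
  shows "climb a0 b0 a (pa b) L (R @ [b])"
  using climb_sym[OF climb_left[OF climb_sym[OF assms(1)] assms(2)]] .

text \<open>The nodes passed have distinct ranks below that of \<open>a\<close>, so fewer than
  \<open>n\<close> moves are possible. This also bounds the loop that computes tree paths.\<close>

lemma climb_length:
  assumes "climb a0 b0 a b L R"
  shows "length L + length R < n"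
proof -
  have "inj_on rk (set (L @ R))" using assms rk_eq by (auto simp: climb_def inj_on_def)
  then have "card (rk ` set (L @ R)) = length (L @ R)"
    using assms by (simp only: card_image distinct_card climb_def)
  moreover have "rk ` set (L @ R) \<subseteq> {..<rk a}" using assms by (auto simp: climb_def)
  ultimately have "length (L @ R) \<le> rk a" by (metis card_lessThan card_mono finite_lessThan)
  then show ?thesis using rk[of a] assms by (auto simp: climb_def)
qed

lemma climb_path:
  assumes "climb a0 b0 a a L R"
  shows "is_path {..<n} E (L @ a # rev R)" "hd (L @ a # rev R) = a0" "last (L @ a # rev R) = b0"
proof -
  have "path_edges (L @ a # rev R) = path_edges (L @ [a]) \<union> path_edges (R @ [a])"
    using path_edges_append[of L a "rev R"] path_edges_rev[of "R @ [a]"] by simp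
  then show "is_path {..<n} E (L @ a # rev R)"
    using assms by (auto simp: is_path_def climb_def)
  show "hd (L @ a # rev R) = a0" using assms by (cases L) (auto simp: climb_def)
  show "last (L @ a # rev R) = b0" using assms by (cases R) (auto simp: climb_def)
qed

text \<open>The number \<open>k\<close> acts as fuel: with \<open>k = n\<close> the second
  alternative contradicts the length bound, so the ends have met.\<close>

lemma climb_ex: "a0 < n \<Longrightarrow> b0 < n \<Longrightarrow>
  \<exists>a b L R. climb a0 b0 a b L R \<and> (a = b \<or> length L + length R = k)"
proof (induction k)
  case 0
  then show ?case using climb_init by fastforce
next
  case (Suc k)
  then obtain a b L R where c: "climb a0 b0 a b L R" "a = b \<or> length L + length R = k" by blast
  consider "a = b" | "rk a < rk b" | "rk b < rk a"
    using c(1) rk_eq[of a b] by (auto simp: climb_def) (meson linorder_neqE_nat)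
  then show ?case
  proof cases
    case 2
    then show ?thesis using climb_left[OF c(1) 2] c(2)
      by (intro exI[of _ "pa a"] exI[of _ b] exI[of _ "L @ [a]"] exI[of _ R]) auto
  next
    case 3
    then show ?thesis using climb_right[OF c(1) 3] c(2)
      by (intro exI[of _ a] exI[of _ "pa b"] exI[of _ L] exI[of _ "R @ [b]"]) auto
  qed (use c in blast)
qed

lemma simple: "simple_graph {..<n} E"
  using npos pa' by (auto simp: simple_graph_def E_def card_2_iff doubleton_eq_iff) force+

lemma connected: "connected_graph {..<n} E"
  unfolding connected_graph_def
proof (intro conjI simple ballI)
  fix u v assume "u \<in> {..<n}" "v \<in> {..<n}"
  then obtain a b L R where "climb u v a b L R" "a = b \<or> length L + length R = n"
    using climb_ex[of u v n] by auto
  then have "climb u v a a L R" using climb_length by fastforce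
  from climb_path[OF this] show "\<exists>p. is_path {..<n} E p \<and> hd p = u \<and> last p = v" by blast
qed

text \<open>On a cycle, both neighbours of the node of least rank would have to be its
  parent.\<close>

lemma acyclic: "acyclic_graph E"
  unfolding acyclic_graph_def
proof
  assume "\<exists>vs. distinct vs \<and> 3 \<le> length vs \<and> cycle_edges vs \<subseteq> E"
  then obtain vs where vs: "distinct vs" "3 \<le> length vs" "cycle_edges vs \<subseteq> E" by blast
  let ?l = "length vs"
  have "finite {..<?l}" "0 \<in> {..<?l}" using vs by auto
  then obtain i where i: "i < ?l" "\<And>j. j < ?l \<Longrightarrow> rk (vs ! i) \<le> rk (vs ! j)"
    using ex_min_if_finite[of "(\<lambda>i. rk (vs ! i)) ` {..<?l}"] by force
  have edge: "{vs ! j, vs ! (Suc j mod ?l)} \<in> E" if "j < ?l" for j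
    using vs(3) that by (auto simp: cycle_edges_def)
  \<comment> \<open>\<open>j\<close> and \<open>k\<close> are the cyclic neighbours of position
    \<open>i\<close>; a length of at least 3 keeps them apart.\<close>
  define j where "j = (if i = 0 then ?l - 1 else i - 1)"
  define k where "k = Suc i mod ?l"
  have j: "j < ?l" "Suc j mod ?l = i" "j \<noteq> i" and k: "k < ?l" "k \<noteq> i" "k \<noteq> j"
    using i(1) vs(2) by (auto simp: j_def k_def mod_Suc)
  have up: "vs ! m = pa (vs ! i)" if "m < ?l" "m \<noteq> i" "{vs ! i, vs ! m} \<in> E" for m
  proof -
    have "vs ! i < n" "vs ! m < n" using that(3) simple by (auto simp: simple_graph_def)
    then have "rk (vs ! i) \<noteq> rk (vs ! m)"
      using rk_eq vs(1) that i by (simp add: nth_eq_iff_index_eq)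
    then show ?thesis using i(2)[OF that(1)] edge_up[OF that(3)] by auto
  qed
  have "{vs ! i, vs ! j} \<in> E" using edge[OF j(1)] j(2) by (simp add: insert_commute)
  moreover have "{vs ! i, vs ! k} \<in> E" using edge[OF i(1)] by (simp add: k_def)
  ultimately have "vs ! j = vs ! k" using up j k by metis
  then show False using vs(1) j k by (simp add: nth_eq_iff_index_eq)
qed

lemma is_tree: "is_tree {..<n} E"
  by (simp add: is_tree_def connected acyclic)

lemma E_od: "E = (\<lambda>t. {od t, pa (od t)}) ` {..<n - 1}"
proof -
  have "v < n \<and> v \<noteq> root \<longleftrightarrow> v \<in> od ` {..<n - 1}" for v
  proof
    assume v: "v < n \<and> v \<noteq> root"
    then have "rk v < n" "rk v \<noteq> n - 1" using rk[of v] by (auto simp: root_def)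
    then have "rk v \<in> {..<n - 1}" by simp
    then show "v \<in> od ` {..<n - 1}" using rk[of v] v by (metis image_eqI)
  qed (auto simp: root_def od od_eq)
  then show ?thesis unfolding E_def by auto
qed

lemma od_notroot: "t < n - 1 \<Longrightarrow> od t < n \<and> od t \<noteq> root"
  using od od_eq[of t "n - 1"] by (auto simp: root_def)

lemma inj_edge: "inj_on (\<lambda>t. {od t, pa (od t)}) {..<n - 1}"
proof (rule inj_onI)
  fix t t' assume t: "t \<in> {..<n - 1}" "t' \<in> {..<n - 1}"
    and e: "{od t, pa (od t)} = {od t', pa (od t')}"
  then have "od t = od t'" using edge_inj[OF _ _ _ _ e] od_notroot by simp
  then show "t = t'" using t od_eq[of t t'] by simp
qed

lemma card_E: "card E = n - 1"
  unfolding E_od using card_image[OF inj_edge] by simp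

end

section \<open>Existence of leaves, with connectivity expressed by cuts\<close>

section \<open>Leaves\<close>

text \<open>Connectivity of the subgraph induced on \<open>A\<close>. In the form with cuts,
  removing a leaf preserves it without rerouting any path.\<close>

definition cut_connected :: "'a set set \<Rightarrow> 'a set \<Rightarrow> bool" where
  "cut_connected E A \<longleftrightarrow> (\<forall>S. S \<subseteq> A \<and> S \<noteq> {} \<and> S \<noteq> A \<longrightarrow> (\<exists>a\<in>S. \<exists>b\<in>A - S. {a, b} \<in> E))"

lemma connected_cut: "connected_graph V E \<Longrightarrow> cut_connected E V"
  unfolding cut_connected_def
proof (intro allI impI)
  fix S assume c: "connected_graph V E" and S: "S \<subseteq> V \<and> S \<noteq> {} \<and> S \<noteq> V"
  then obtain u v where "u \<in> S" "v \<in> V - S" by blast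
  moreover from this obtain p where "is_path V E p" "hd p = u" "last p = v"
    using c S unfolding connected_graph_def by (metis Diff_iff subsetD)
  ultimately show "\<exists>a\<in>S. \<exists>b\<in>V - S. {a, b} \<in> E"
    using path_crosses[of V E p S] by auto
qed

lemma cut_connected_nbr:
  assumes "cut_connected E A" "v \<in> A" "2 \<le> card A"
  shows "\<exists>u\<in>A. {v, u} \<in> E"
proof -
  have "{v} \<noteq> A" using assms(3) by auto
  then show ?thesis using assms unfolding cut_connected_def by blast
qed

text \<open>Put \<open>v\<close> on the side of its only neighbour \<open>p\<close>; the edge
  crossing the extended cut then cannot end in \<open>v\<close>.\<close>

lemma cut_connected_remove:
  assumes "cut_connected E A" "v \<in> A" "p \<in> A" "p \<noteq> v" "\<And>u. u \<in> A \<Longrightarrow> {v, u} \<in> E \<Longrightarrow> u = p"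
  shows "cut_connected E (A - {v})"
  unfolding cut_connected_def
proof (intro allI impI)
  fix S assume S: "S \<subseteq> A - {v} \<and> S \<noteq> {} \<and> S \<noteq> A - {v}"
  let ?S = "if p \<in> S then insert v S else S"
  have "?S \<subseteq> A" "?S \<noteq> {}" "?S \<noteq> A" using S assms by auto
  then have "\<exists>a\<in>?S. \<exists>b\<in>A - ?S. {a, b} \<in> E"
    using assms(1) unfolding cut_connected_def by blast
  then obtain a b where ab: "a \<in> ?S" "b \<in> A - ?S" "{a, b} \<in> E" by blast
  have "a \<noteq> v" using ab assms(5)[of b] S by (auto split: if_splits)
  moreover have "b \<noteq> v" using ab assms(5)[of a] S by (auto split: if_splits simp: insert_commute)
  ultimately show "\<exists>a\<in>S. \<exists>b\<in>A - {v} - S. {a, b} \<in> E"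
    using ab by (auto split: if_splits)
qed

text \<open>Longest-path argument: if no node were a leaf, the first node of a longest path would
  have a neighbour other than the second node; by maximality it lies on the path and closes a
  cycle.\<close>

lemma leaf_exists:
  assumes "cut_connected E A" "finite A" "2 \<le> card A" "acyclic_graph E" "\<forall>e\<in>E. card e = 2"
  shows "\<exists>v\<in>A. \<exists>p\<in>A. {v, p} \<in> E \<and> (\<forall>u\<in>A. {v, u} \<in> E \<longrightarrow> u = p)"
proof (rule ccontr)
  assume neg: "\<not> ?thesis"
  have other: "\<exists>u\<in>A. {v, u} \<in> E \<and> u \<noteq> w" if "v \<in> A" for v w
    using neg cut_connected_nbr[OF assms(1) that assms(3)] that by metis
  have irr: "{v, v} \<notin> E" for v using assms(5) by force
  let ?P = "\<lambda>p. is_path A E p"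
  obtain v0 where "v0 \<in> A" using assms(3) by fastforce
  then have "?P [v0]" by simp
  moreover have "length p < Suc (card A)" if "?P p" for p
    using that assms(2) by (auto simp: is_path_def less_Suc_eq_le distinct_card[symmetric] card_mono)
  ultimately obtain p where p: "?P p" and max: "\<And>q. ?P q \<Longrightarrow> length q \<le> length p"
    using ex_has_greatest_nat[of ?P "[v0]" length "Suc (card A)"] by blast
  obtain x r where xr: "p = x # r" using p by (cases p) (auto simp: is_path_def)
  have x: "x \<in> A" using p xr by (auto simp: is_path_def)
  define y where "y = (if r = [] then x else hd r)"
  obtain u where u: "u \<in> A" "{x, u} \<in> E" "u \<noteq> y" using other[OF x] by blast
  have "u \<in> set p"
  proof (rule ccontr)
    assume "u \<notin> set p"
    then have "?P (u # p)" using p u xr by (auto simp: is_path_Cons insert_commute)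
    from max[OF this] show False by simp
  qed
  then obtain k where k: "k < length p" "p ! k = u" by (auto simp: in_set_conv_nth)
  have "k \<noteq> 0"
  proof
    assume "k = 0"
    then have "u = x" using k xr by simp
    then show False using u irr by simp
  qed
  moreover have "k \<noteq> 1" using k u xr by (cases r) (auto simp: y_def)
  ultimately have k2: "2 \<le> k" by simp
  let ?vs = "take (Suc k) p"
  have len: "length ?vs = Suc k" using k by simp
  have "cycle_edges ?vs \<subseteq> E"
  proof
    fix e assume "e \<in> cycle_edges ?vs"
    then obtain i where i: "i < Suc k" "e = {?vs ! i, ?vs ! (Suc i mod Suc k)}"
      unfolding cycle_edges_def len by blast
    show "e \<in> E"
    proof (cases "i = k")
      case True
      have "?vs ! k = u" "?vs ! 0 = x" using k(2) xr by (simp_all only: nth_take lessI zero_less_Suc nth_Cons_0)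
      then show ?thesis using i(2) True u(2) by (simp add: insert_commute)
    next
      case False
      then have "e = {p ! i, p ! Suc i}" using i by simp
      then have "e \<in> path_edges p" using i k False by (auto simp: path_edges_def)
      then show ?thesis using p by (auto simp: is_path_def)
    qed
  qed
  moreover have "distinct ?vs" using p by (simp add: is_path_def)
  ultimately show False using assms(4) len k2 unfolding acyclic_graph_def by fastforce
qed

section \<open>Distributing N units over a tree by repeated min-plus convolution\<close>

section \<open>Eliminating leaves from a tree-structured minimisation\<close>

text \<open>\<open>ec x a\<close> is the cost of the edge above \<open>x\<close> when
  \<open>a\<close> units lie below it.\<close>

locale dp_tree = ptree +
  fixes ec :: "nat \<Rightarrow> nat \<Rightarrow> enat" and N :: nat
begin

definition alive where "alive i = od ` {i..<n}"

text \<open>The load of an eliminated node has already been added to its parent, so summing over the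
  nodes alive still gives the full load of the subtree.\<close>

definition below where "below i K x = (\<Sum>u\<in>alive i \<inter> D x. K u :: nat)"

text \<open>Cost of the distribution \<open>K\<close> at stage \<open>i\<close>: the tables of the
  nodes alive plus the edges not yet absorbed into a table.\<close>

definition total :: "nat \<Rightarrow> (nat \<Rightarrow> nat \<Rightarrow> enat) \<Rightarrow> (nat \<Rightarrow> nat) \<Rightarrow> enat" where
  "total i F K = (\<Sum>u\<in>alive i. F u (K u)) + (\<Sum>t\<in>{i..<n - 1}. ec (od t) (below i K (od t)))"

text \<open>The table of the parent becomes the min-plus convolution of its own with that of the
  leaf plus its edge. It is specified through a minimiser \<open>c\<close> rather than a minimum
  operator, so that any tie-breaking by a program fits.\<close>

definition merged where
  "merged i F F' c \<longleftrightarrow> (let v = od i; p = pa v in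
     (\<forall>u\<in>alive (Suc i) - {p}. F' u = F u) \<and>
     (\<forall>j\<le>N. c j \<le> j \<and> F' p j = F p (j - c j) + (F v (c j) + ec v (c j)) \<and>
        (\<forall>a\<le>j. F' p j \<le> F p (j - a) + (F v a + ec v a))))"

lemma finite_alive [simp]: "finite (alive i)"
  by (simp add: alive_def)

lemma alive_iff: "v \<in> alive i \<longleftrightarrow> v < n \<and> i \<le> rk v"
proof
  assume "v < n \<and> i \<le> rk v"
  then have "rk v \<in> {i..<n}" "v = od (rk v)" using rk[of v] by auto
  then show "v \<in> alive i" unfolding alive_def by (rule image_eqI[rotated])
qed (auto simp: alive_def od)

lemma alive_0: "alive 0 = {..<n}"
  by (auto simp: alive_iff)

lemma alive_last: "alive (n - Suc 0) = {root}"
proof (rule set_eqI)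
  fix v show "v \<in> alive (n - Suc 0) \<longleftrightarrow> v \<in> {root}"
    using rk[of v] npos root rk_eq[of v root] by (auto simp: alive_iff)
qed

lemma alive_Suc:
  assumes i: "i < n"
  shows "alive i = insert (od i) (alive (Suc i))" "od i \<notin> alive (Suc i)"
proof -
  show "od i \<notin> alive (Suc i)" using od[OF i] by (simp add: alive_iff)
  show "alive i = insert (od i) (alive (Suc i))"
  proof (rule set_eqI)
    fix v show "v \<in> alive i \<longleftrightarrow> v \<in> insert (od i) (alive (Suc i))"
      using od[OF i] rk_eq[of v "od i"] by (auto simp: alive_iff)
  qed
qed

lemma pa_alive: "i < n - 1 \<Longrightarrow> pa (od i) \<in> alive (Suc i)" "i < n - 1 \<Longrightarrow> pa (od i) \<noteq> od i"
  using pa'[of "od i"] od_notroot[of i] od[of i] by (auto simp: alive_iff)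

text \<open>All proper descendants of \<open>od i\<close> have smaller rank and are gone at stage
  \<open>i\<close>.\<close>

lemma below_self: "i < n \<Longrightarrow> below i K (od i) = K (od i)"
proof -
  assume i: "i < n"
  have "alive i \<inter> D (od i) = {od i}"
  proof (rule set_eqI)
    fix v show "v \<in> alive i \<inter> D (od i) \<longleftrightarrow> v \<in> {od i}"
      using D_rk[of v "od i"] od[OF i] rk_eq[of v "od i"] D.self[of "od i"] by (auto simp: alive_iff)
  qed
  then show ?thesis by (simp add: below_def)
qed

text \<open>Moving the load of the leaf to its parent is invisible from every other subtree root
  \<open>x\<close>, because \<open>D x\<close> contains both nodes or neither.\<close>

lemma below_step:
  assumes i: "i < n - 1" and x: "x < n" "x \<noteq> od i"
    and eq: "\<And>u. u \<in> alive (Suc i) \<Longrightarrow> u \<noteq> pa (od i) \<Longrightarrow> K' u = K u"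
    and p: "K' (pa (od i)) = K (pa (od i)) + K (od i)"
  shows "below (Suc i) K' x = below i K x"
proof -
  let ?v = "od i" and ?p = "pa (od i)"
  let ?A = "alive (Suc i) \<inter> D x"
  have v: "?v < n" "?v \<noteq> root" using od_notroot[OF i] by auto
  have iff: "?v \<in> D x \<longleftrightarrow> ?p \<in> D x" using D_pa[OF v] x by auto
  have notin: "?v \<notin> alive (Suc i)" "alive i = insert ?v (alive (Suc i))"
    using alive_Suc[of i] i by auto
  show ?thesis
  proof (cases "?p \<in> D x")
    case True
    then have pA: "?p \<in> ?A" using pa_alive[OF i] by auto
    have "below (Suc i) K' x = K' ?p + (\<Sum>u\<in>?A - {?p}. K' u)"
      unfolding below_def using pA by (simp add: sum.remove)
    also have "(\<Sum>u\<in>?A - {?p}. K' u) = (\<Sum>u\<in>?A - {?p}. K u)"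
      using eq by (intro sum.cong) auto
    also have "K' ?p + (\<Sum>u\<in>?A - {?p}. K u) = K ?v + (K ?p + (\<Sum>u\<in>?A - {?p}. K u))"
      using p by simp
    also have "K ?p + (\<Sum>u\<in>?A - {?p}. K u) = sum K ?A"
      using pA by (simp add: sum.remove)
    also have "K ?v + sum K ?A = sum K (insert ?v ?A)" using notin by simp
    also have "insert ?v ?A = alive i \<inter> D x" using notin iff True by auto
    finally show ?thesis by (simp add: below_def)
  next
    case False
    then have "alive i \<inter> D x = ?A" using notin iff by auto
    then show ?thesis unfolding below_def using eq False by (auto intro!: sum.cong)
  qed
qed

text \<open>The two totals are written over a common remainder \<open>R\<close> because infinity
  prevents cancellation in \<open>enat\<close>. Comparing the remaining terms gives the lower bound,
  equating them gives the backtracking.\<close>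

lemma total_step:
  assumes i: "i < n - 1"
    and eq: "\<And>u. u \<in> alive (Suc i) \<Longrightarrow> u \<noteq> pa (od i) \<Longrightarrow> K' u = K u"
    and p: "K' (pa (od i)) = K (pa (od i)) + K (od i)"
    and F: "\<And>u. u \<in> alive (Suc i) \<Longrightarrow> u \<noteq> pa (od i) \<Longrightarrow> F' u = F u"
  shows "\<exists>R. total (Suc i) F' K' = R + F' (pa (od i)) (K' (pa (od i))) \<and>
    total i F K = R + (F (pa (od i)) (K (pa (od i))) + (F (od i) (K (od i)) + ec (od i) (K (od i))))"
proof -
  let ?v = "od i" and ?p = "pa (od i)" and ?A = "alive (Suc i) - {pa (od i)}"
  define R1 where "R1 = (\<Sum>u\<in>?A. F u (K u))"
  define R2 where "R2 = (\<Sum>t\<in>{Suc i..<n - 1}. ec (od t) (below i K (od t)))"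
  have notin: "?v \<notin> alive (Suc i)" "alive i = insert ?v (alive (Suc i))"
    using alive_Suc[of i] i by auto
  have 1: "(\<Sum>u\<in>alive (Suc i). F' u (K' u)) = F' ?p (K' ?p) + R1"
    using pa_alive(1)[OF i] eq F unfolding R1_def by (subst sum.remove[of _ ?p]) auto
  have "(\<Sum>u\<in>alive (Suc i). F u (K u)) = F ?p (K ?p) + R1"
    using pa_alive(1)[OF i] unfolding R1_def by (intro sum.remove) auto
  then have 2: "(\<Sum>u\<in>alive i. F u (K u)) = F ?v (K ?v) + (F ?p (K ?p) + R1)"
    using notin by simp
  have "below (Suc i) K' (od t) = below i K (od t)" if "t \<in> {Suc i..<n - 1}" for t
  proof (rule below_step[OF i _ _ eq p])
    have t: "t < n" "i < n" "t \<noteq> i" using that i by auto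
    show "od t < n" "od t \<noteq> od i" using od_eq[OF t(1,2)] od[OF t(1)] t(3) by auto
  qed
  then have 3: "(\<Sum>t\<in>{Suc i..<n - 1}. ec (od t) (below (Suc i) K' (od t))) = R2"
    unfolding R2_def by (intro sum.cong) auto
  have "{i..<n - 1} = insert i {Suc i..<n - 1}" using i by auto
  then have 4: "(\<Sum>t\<in>{i..<n - 1}. ec (od t) (below i K (od t))) = ec ?v (K ?v) + R2"
    unfolding R2_def using below_self[of i K] i by simp
  show ?thesis unfolding total_def 1 2 3 4
    by (intro exI[of _ "R1 + R2"]) (simp add: ac_simps)
qed

lemma total_last: "total (n - Suc 0) F K = F root (K root)"
  by (simp add: total_def alive_last)

text \<open>
  Backtracking also places the cycle: a node set aside at step \<open>i\<close> receives the last positions of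
  the interval of its parent, so the positions in each subtree form an interval.
\<close>

definition placed :: "(nat \<Rightarrow> nat \<Rightarrow> nat \<Rightarrow> enat) \<Rightarrow> nat \<Rightarrow> (nat \<Rightarrow> nat) \<Rightarrow> (nat \<Rightarrow> nat) \<Rightarrow> (nat \<Rightarrow> nat) \<Rightarrow> bool" where
  "placed F i K st lc \<longleftrightarrow> (\<forall>q<N. lc q \<in> alive i) \<and>
     (\<forall>u\<in>alive i. \<forall>q. q < N \<and> lc q = u \<longleftrightarrow> st u \<le> q \<and> q < st u + K u) \<and>
     (\<forall>t. i \<le> t \<and> t < n - 1 \<longrightarrow> (\<exists>s a. \<forall>q<N. lc q \<in> D (od t) \<longleftrightarrow> s \<le> q \<and> q < s + a)) \<and>
     total i (F i) K = F (n - 1) root N"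

lemma placed_init:
  assumes "\<And>q. q < N \<Longrightarrow> lc q = root" "st root = 0" "K root = N"
  shows "placed F (n - 1) K st lc"
  using assms unfolding placed_def by (auto simp: alive_last total_last)

lemma placed_card:
  assumes "placed F i K st lc" "u \<in> alive i"
  shows "card {q. q < N \<and> lc q = u} = K u"
proof -
  have "{q. q < N \<and> lc q = u} = {st u..<st u + K u}" using assms by (auto simp: placed_def)
  then show ?thesis by simp
qed

lemma placed_le:
  assumes "placed F i K st lc" "u \<in> alive i"
  shows "K u \<le> N"
  using placed_card[OF assms] card_mono[of "{..<N}" "{q. q < N \<and> lc q = u}"] by auto

context
  fixes F :: "nat \<Rightarrow> nat \<Rightarrow> nat \<Rightarrow> enat" and c :: "nat \<Rightarrow> nat \<Rightarrow> nat"
  assumes merged: "\<And>i. i < n - 1 \<Longrightarrow> merged i (F i) (F (Suc i)) (c i)"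
begin

abbreviation "opt \<equiv> F (n - 1) root N"

lemma merged':
  assumes "i < n - 1"
  shows "u \<in> alive (Suc i) \<Longrightarrow> u \<noteq> pa (od i) \<Longrightarrow> F (Suc i) u = F i u"
    "j \<le> N \<Longrightarrow> c i j \<le> j"
    "j \<le> N \<Longrightarrow> F (Suc i) (pa (od i)) j =
       F i (pa (od i)) (j - c i j) + (F i (od i) (c i j) + ec (od i) (c i j))"
    "j \<le> N \<Longrightarrow> a \<le> j \<Longrightarrow> F (Suc i) (pa (od i)) j \<le>
       F i (pa (od i)) (j - a) + (F i (od i) a + ec (od i) a)"
  using merged[OF assms] unfolding merged_def Let_def by auto

text \<open>Merging a leaf into its parent never raises the total, and at the last stage the total
  is the root table at \<open>N\<close>.\<close>

lemma opt_le: "i \<le> n - 1 \<Longrightarrow> sum K (alive i) = N \<Longrightarrow> opt \<le> total i (F i) K"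
proof (induction i arbitrary: K rule: inc_induct)
  case base
  then show ?case by (simp add: total_last alive_last)
next
  case (step i)
  let ?v = "od i" and ?p = "pa (od i)"
  let ?K = "K(?p := K ?p + K ?v)"
  have i: "i < n - 1" "i < n" using step by auto
  have "sum K (alive i) = K ?v + (K ?p + sum K (alive (Suc i) - {?p}))"
    using alive_Suc[OF i(2)] sum.remove[OF finite_alive pa_alive(1)[OF i(1)], of K] by simp
  moreover have "sum ?K (alive (Suc i)) = ?K ?p + sum ?K (alive (Suc i) - {?p})"
    using pa_alive(1)[OF i(1)] by (simp add: sum.remove[of _ ?p])
  moreover have "sum ?K (alive (Suc i) - {?p}) = sum K (alive (Suc i) - {?p})"
    by (intro sum.cong) auto
  ultimately have sum: "sum ?K (alive (Suc i)) = N" "?K ?p \<le> N"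
    using step.prems by simp_all
  obtain R where R: "total (Suc i) (F (Suc i)) ?K = R + F (Suc i) ?p (?K ?p)"
    "total i (F i) K = R + (F i ?p (K ?p) + (F i ?v (K ?v) + ec ?v (K ?v)))"
    using total_step[OF i(1), of ?K K "F (Suc i)" "F i"] merged'(1)[OF i(1)] by auto
  have "F (Suc i) ?p (?K ?p) \<le> F i ?p (K ?p) + (F i ?v (K ?v) + ec ?v (K ?v))"
    using merged'(4)[OF i(1) sum(2), of "K ?v"] by simp
  then have "total (Suc i) (F (Suc i)) ?K \<le> total i (F i) K"
    unfolding R by (intro add_left_mono)
  with step.IH[OF sum(1)] show ?case by (rule order_trans)
qed

text \<open>The leaf \<open>v\<close> takes the last \<open>d\<close> positions of the interval of
  its parent \<open>p\<close>. No other node alive lies in the subtree of \<open>v\<close>, so its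
  positions are exactly these; the subtrees treated later contain both of \<open>v\<close> and
  \<open>p\<close> or neither, so their positions do not change.\<close>

lemma placed_step:
  assumes b: "placed F (Suc i) K st lc" and i: "i < n - 1"
  defines "v \<equiv> od i" and "p \<equiv> pa (od i)"
  defines "d \<equiv> c i (K p)"
  assumes K': "\<And>u. u \<in> alive (Suc i) \<Longrightarrow> u \<noteq> p \<Longrightarrow> K' u = K u" "K' v = d" "K' p = K p - d"
    and st': "\<And>u. u \<in> alive (Suc i) \<Longrightarrow> st' u = st u" "st' v = st p + (K p - d)"
    and lc': "\<And>q. lc' q = (if st' v \<le> q \<and> q < st' v + d then v else lc q)"
  shows "placed F i K' st' lc'"
proof -
  have pA: "p \<in> alive (Suc i)" "p \<noteq> v" using pa_alive[OF i] by (auto simp: p_def v_def)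
  have vA: "v \<notin> alive (Suc i)" "alive i = insert v (alive (Suc i))"
    using alive_Suc[of i] i by (auto simp: v_def)
  have KN: "K p \<le> N" using placed_le[OF b pA(1)] .
  have d: "d \<le> K p" using merged'(2)[OF i KN] by (simp add: d_def)
  have lcA: "\<And>q. q < N \<Longrightarrow> lc q \<in> alive (Suc i)"
    and ivl: "\<And>u q. u \<in> alive (Suc i) \<Longrightarrow> q < N \<and> lc q = u \<longleftrightarrow> st u \<le> q \<and> q < st u + K u"
    and D: "\<And>t. Suc i \<le> t \<Longrightarrow> t < n - 1 \<Longrightarrow> \<exists>s a. \<forall>q<N. lc q \<in> D (od t) \<longleftrightarrow> s \<le> q \<and> q < s + a"
    and tot: "total (Suc i) (F (Suc i)) K = opt"
    using b by (auto simp: placed_def)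
  have moved: "q < N \<and> lc q = p" if "st' v \<le> q" "q < st' v + d" for q
    using ivl[OF pA(1), of q] that st'(2) d by auto
  show ?thesis
    unfolding placed_def
  proof (intro conjI allI impI ballI)
    fix q assume "q < N"
    then show "lc' q \<in> alive i" using lcA vA lc' by auto
  next
    fix u q assume u: "u \<in> alive i"
    show "(q < N \<and> lc' q = u) = (st' u \<le> q \<and> q < st' u + K' u)"
    proof (cases "u = v")
      case True
      then show ?thesis using lc' moved[of q] lcA[of q] vA(1) K'(2) by auto
    next
      case False
      then have uA: "u \<in> alive (Suc i)" using u vA by auto
      show ?thesis
      proof (cases "u = p")
        case True
        then show ?thesis
          using lc'[of q] moved[of q] ivl[OF pA(1), of q] K'(3) st' d pA by auto
      next
        case False
        then show ?thesis
          using lc'[of q] moved[of q] ivl[OF uA, of q] K'(1)[OF uA] st'(1)[OF uA] \<open>u \<noteq> v\<close> by auto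
      qed
    qed
  next
    fix t assume t: "i \<le> t \<and> t < n - 1"
    show "\<exists>s a. \<forall>q<N. lc' q \<in> D (od t) \<longleftrightarrow> s \<le> q \<and> q < s + a"
    proof (cases "t = i")
      case True
      have "lc' q \<in> D v \<longleftrightarrow> st' v \<le> q \<and> q < st' v + d" if "q < N" for q
      proof -
        have "lc q \<notin> D v"
          using lcA[OF that] D_rk[of "lc q" v] od[of i] i by (auto simp: alive_iff v_def)
        then show ?thesis using lc' D.self by auto
      qed
      then show ?thesis using True unfolding v_def by blast
    next
      case False
      have "v \<in> D (od t) \<longleftrightarrow> p \<in> D (od t)"
        using D_pa[of v "od t"] od_notroot[OF i] od_eq[of i t] t False
        by (auto simp: v_def p_def)
      then have "lc' q \<in> D (od t) \<longleftrightarrow> lc q \<in> D (od t)" for q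
        using lc'[of q] moved[of q] by auto
      then show ?thesis using D[of t] t False by auto
    qed
  next
    have eq: "K u = K' u" if "u \<in> alive (Suc i)" "u \<noteq> pa (od i)" for u
      using K'(1)[of u] that by (simp add: p_def)
    have kp: "K (pa (od i)) = K' (pa (od i)) + K' (od i)"
      using K'(2,3) d by (simp add: p_def v_def)
    obtain R where R: "total (Suc i) (F (Suc i)) K = R + F (Suc i) p (K p)"
      "total i (F i) K' = R + (F i p (K' p) + (F i v (K' v) + ec v (K' v)))"
      using total_step[where F = "F i" and F' = "F (Suc i)", OF i eq kp merged'(1)[OF i]]
      unfolding p_def v_def by blast
    have "F (Suc i) p (K p) = F i p (K' p) + (F i v (K' v) + ec v (K' v))"
      using merged'(3)[OF i KN] K' by (simp add: d_def p_def v_def)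
    then show "total i (F i) K' = opt" using R tot by simp
  qed
qed

end

end

section \<open>Two-coloured cyclic sequences\<close>

section \<open>Cycles and cuts\<close>

text \<open>For the colouring of positions by membership in a subtree, this counts the virtual edges
  with ends on different sides.\<close>

definition changes :: "nat \<Rightarrow> (nat \<Rightarrow> bool) \<Rightarrow> nat" where
  "changes N B = card {i. i < N \<and> B i \<noteq> B (Suc i mod N)}"

text \<open>Going around the cycle there must be a switch from true to false and one back, at
  different positions.\<close>

lemma changes_ge_2:
  assumes "i < N" "B i" "j < N" "\<not> B j"
  shows "2 \<le> changes N B"
proof -
  have ex: "\<exists>k<N. P k \<and> \<not> P (Suc k mod N)" if "i < N" "P i" "j < N" "\<not> P j" for P :: "nat \<Rightarrow> bool" and i j
  proof (rule ccontr)
    assume "\<not> ?thesis"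
    then have step: "\<And>k. k < N \<Longrightarrow> P k \<Longrightarrow> P (Suc k mod N)" by blast
    have "P ((i + m) mod N)" for m
    proof (induction m)
      case (Suc m)
      have "P (Suc ((i + m) mod N) mod N)" using that Suc by (intro step) auto
      then show ?case by (simp add: mod_Suc_eq)
    qed (use that in simp)
    \<comment> \<open>\<open>i + (N - i + j)\<close> is \<open>j\<close> modulo
      \<open>N\<close>.\<close>
    from this[of "N - i + j"] have "P j" using that by simp
    then show False using that by simp
  qed
  obtain k where k: "k < N" "B k" "\<not> B (Suc k mod N)" using ex[of i B j] assms by blast
  obtain l where l: "l < N" "\<not> B l" "B (Suc l mod N)" using ex[of j "\<lambda>x. \<not> B x" i] assms by blast
  have "card {k, l} \<le> card {i. i < N \<and> B i \<noteq> B (Suc i mod N)}"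
    using k l by (intro card_mono) auto
  moreover have "k \<noteq> l" using k l by auto
  ultimately show ?thesis by (simp add: changes_def)
qed

lemma changes_0: "(\<And>i. i < N \<Longrightarrow> B i = b) \<Longrightarrow> changes N B = 0"
  unfolding changes_def by (auto simp: card_eq_0_iff)

text \<open>The colour can change only just before the interval and at its last position;
  \<open>N - 1\<close> stands for the wrap-around pair when the interval touches an end of the
  range.\<close>

lemma changes_interval:
  assumes "\<And>q. q < N \<Longrightarrow> B q \<longleftrightarrow> s \<le> q \<and> q < s + a"
  shows "changes N B \<le> 2"
proof -
  have "{i. i < N \<and> B i \<noteq> B (Suc i mod N)} \<subseteq> {if s = 0 then N - 1 else s - 1, if s + a < N then s + a - 1 else N - 1}"
  proof
    fix i assume "i \<in> {i. i < N \<and> B i \<noteq> B (Suc i mod N)}"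
    then have i: "i < N" "B i \<noteq> B (Suc i mod N)" by auto
    show "i \<in> {if s = 0 then N - 1 else s - 1, if s + a < N then s + a - 1 else N - 1}"
    proof (cases "Suc i = N")
      case True
      have "s = 0 \<or> \<not> s + a < N" 
      proof (rule ccontr)
        assume "\<not> (s = 0 \<or> \<not> s + a < N)"
        then have "\<not> B i" "\<not> B 0" using assms[of i] assms[of 0] i True by auto
        then show False using i True by simp
      qed
      then show ?thesis using True by auto
    next
      case False
      then have "Suc i < N" using i by simp
      then show ?thesis using i assms[of i] assms[of "Suc i"] by auto
    qed
  qed
  then have "changes N B \<le> card {if s = 0 then N - 1 else s - 1, if s + a < N then s + a - 1 else N - 1}"
    unfolding changes_def by (intro card_mono) auto
  also have "\<dots> \<le> 2" by (simp add: card_insert_if)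
  finally show ?thesis .
qed

text \<open>Two different indices could share an edge only if each were the successor of the other,
  which would force \<open>N = 2\<close>.\<close>

lemma cycle_edge_inj:
  assumes "inj_on X {..<N}" "3 \<le> N"
  shows "inj_on (\<lambda>i. {X i, X (Suc i mod N)}) {..<N}"
proof (rule inj_onI)
  fix i j assume i: "i \<in> {..<N}" and j: "j \<in> {..<N}"
    and e: "{X i, X (Suc i mod N)} = {X j, X (Suc j mod N)}"
  have X: "X a = X b \<longleftrightarrow> a = b" if "a < N" "b < N" for a b
    using assms that by (auto simp: inj_on_eq_iff)
  have "Suc i mod N < N" "Suc j mod N < N" using assms by auto
  then have "i = j \<or> (i = Suc j mod N \<and> Suc i mod N = j)"
    using e i j X by (auto simp: doubleton_eq_iff)
  then show "i = j" using i j assms(2) by (auto simp: mod_Suc split: if_splits)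
qed

section \<open>The embedding problem as a distribution problem on the tree\<close>

section \<open>Embedding a cycle into a tree\<close>

lemma nonconstant:
  assumes "\<not> (\<exists>b. \<forall>q<N. P q = b)"
  shows "\<exists>i j. i < (N::nat) \<and> P i \<and> j < N \<and> \<not> P j"
proof -
  have "\<not> (\<forall>q<N. P q = True)" "\<not> (\<forall>q<N. P q = False)"
    using assms by (metis (full_types))+
  then show ?thesis by auto
qed

lemma sum_enat: "(\<Sum>x\<in>A. enat (f x)) = enat (\<Sum>x\<in>A. f x)"
  by (induction A rule: infinite_finite_induct) (auto simp: zero_enat_def)

text \<open>\<open>X\<close> lists the virtual nodes around the cycle, so a placement becomes a
  function on the positions below \<open>N\<close>.\<close>

locale cycle_into_tree = ptree +
  fixes I :: "(nat, nat) univne" and N :: nat and X :: "nat \<Rightarrow> nat"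
  assumes N3: "3 \<le> N"
    and X: "inj_on X {..<N}" "X ` {..<N} = {..<N}"
    and VR: "VR I = {..<N}" and ER: "ER I = (\<lambda>i. {X i, X (Suc i mod N)}) ` {..<N}"
    and VS: "VS I = {..<n}" and ES: "ES I = E"
begin

definition ec :: "nat \<Rightarrow> nat \<Rightarrow> enat" where
  "ec x a = (if a = 0 \<or> N \<le> a then 0 else if edge_cap I {x, pa x} < 2 then \<infinity>
     else enat (2 * edge_cost I {x, pa x}))"

definition F0 :: "nat \<Rightarrow> nat \<Rightarrow> enat" where
  "F0 u j = (if j \<le> node_cap I u then enat (j * node_cost I u) else \<infinity>)"

sublocale dp_tree n od pa rk ec N ..

lemma X_less: "q < N \<Longrightarrow> X q < N"
  using X(2) by blast

lemma card_position: "card {x \<in> VR I. P x} = card {q. q < N \<and> P (X q)}"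
proof -
  have "{x \<in> VR I. P x} = X ` {q. q < N \<and> P (X q)}"
    using X(2) by (auto simp: VR)
  moreover have "inj_on X {q. q < N \<and> P (X q)}" using X(1) by (auto simp: inj_on_def)
  ultimately show ?thesis by (simp add: card_image)
qed

context
  fixes m :: "(nat, nat) mapping"
  assumes m: "is_mapping I m"
begin

abbreviation "img q \<equiv> fst m (X q)"
abbreviation "cnt u \<equiv> card {q. q < N \<and> img q = u}"
abbreviation "crossings x \<equiv> changes N (\<lambda>q. img q \<in> D x)"

lemma img_less: "q < N \<Longrightarrow> img q < n"
  using m X_less VR VS by (auto simp: is_mapping_def)

text \<open>Whether a virtual edge is routed through a tree edge is decided by the images of its
  ends. Hence neither feasibility nor cost depends on how the paths of a mapping are chosen.\<close>

lemma card_crossing: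
  assumes "x < n" "x \<noteq> root"
  shows "card {f \<in> ER I. {x, pa x} \<in> path_edges (snd m f)} = crossings x"
proof -
  let ?g = "\<lambda>i. {X i, X (Suc i mod N)}"
  let ?C = "{i. i < N \<and> (img i \<in> D x) \<noteq> (img (Suc i mod N) \<in> D x)}"
  have "{x, pa x} \<in> path_edges (snd m (?g i)) \<longleftrightarrow> (img i \<in> D x) \<noteq> (img (Suc i mod N) \<in> D x)"
    if "i < N" for i
  proof -
    have p: "is_path {..<n} E (snd m (?g i))"
      "{hd (snd m (?g i)), last (snd m (?g i))} = {img i, img (Suc i mod N)}"
      using m that by (auto simp: is_mapping_def ER VS ES)
    show ?thesis using path_edge_iff[OF p(1) assms] p(2) by (auto simp: doubleton_eq_iff)
  qed
  then have "{f \<in> ER I. {x, pa x} \<in> path_edges (snd m f)} = ?g ` ?C"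
    unfolding ER by blast
  moreover have "inj_on ?g ?C"
    using cycle_edge_inj[OF X(1) N3] by (rule inj_on_subset) auto
  ultimately show ?thesis by (simp add: card_image changes_def)
qed

lemma below_cnt: "below 0 cnt x = card {q. q < N \<and> img q \<in> D x}"
proof -
  have "below 0 cnt x = (\<Sum>u\<in>{..<n} \<inter> D x. \<Sum>q\<in>{q \<in> {q. q < N \<and> img q \<in> D x}. img q = u}. 1)"
    unfolding below_def alive_0
    by (intro sum.cong refl) (auto intro!: arg_cong[where f = card])
  also have "\<dots> = (\<Sum>q\<in>{q. q < N \<and> img q \<in> D x}. 1)"
    using img_less by (intro sum.group) auto
  finally show ?thesis by simp
qed

text \<open>Exchanging the two summations charges each tree edge for the virtual edges across it and
  each substrate node for its load.\<close>

lemma mapping_cost_eq: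
  "mapping_cost I m = (\<Sum>u<n. cnt u * node_cost I u) +
     (\<Sum>t<n - 1. crossings (od t) * edge_cost I {od t, pa (od t)})"
proof -
  have "(\<Sum>x\<in>VR I. node_cost I (fst m x)) = (\<Sum>q<N. node_cost I (img q))"
    using sum.reindex[OF X(1), of "\<lambda>x. node_cost I (fst m x)"] X(2) VR by simp
  also have "\<dots> = (\<Sum>u<n. \<Sum>q\<in>{q \<in> {..<N}. img q = u}. node_cost I (img q))"
    using img_less by (intro sum.group[symmetric]) auto
  also have "\<dots> = (\<Sum>u<n. cnt u * node_cost I u)" by simp
  finally have 1: "(\<Sum>x\<in>VR I. node_cost I (fst m x)) = (\<Sum>u<n. cnt u * node_cost I u)" .
  have fin: "finite (ER I)" "finite E" by (auto simp: ER E_od)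
  have "(\<Sum>f\<in>ER I. \<Sum>e\<in>path_edges (snd m f). edge_cost I e) =
      (\<Sum>f\<in>ER I. \<Sum>e\<in>E. if e \<in> path_edges (snd m f) then edge_cost I e else 0)"
  proof (rule sum.cong[OF refl])
    fix f assume "f \<in> ER I"
    then have "path_edges (snd m f) \<subseteq> E"
      using m by (auto simp: is_mapping_def is_path_def ES)
    then show "(\<Sum>e\<in>path_edges (snd m f). edge_cost I e) =
      (\<Sum>e\<in>E. if e \<in> path_edges (snd m f) then edge_cost I e else 0)"
      using fin by (simp add: sum.If_cases Int_absorb1)
  qed
  also have "\<dots> = (\<Sum>e\<in>E. \<Sum>f\<in>ER I. if e \<in> path_edges (snd m f) then edge_cost I e else 0)"
    by (rule sum.swap)
  also have "\<dots> = (\<Sum>e\<in>E. card {f \<in> ER I. e \<in> path_edges (snd m f)} * edge_cost I e)"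
    using fin by (intro sum.cong) (auto simp: sum.If_cases Int_def)
  also have "\<dots> = (\<Sum>t<n - 1. card {f \<in> ER I. {od t, pa (od t)} \<in> path_edges (snd m f)} *
      edge_cost I {od t, pa (od t)})"
    unfolding E_od by (subst sum.reindex[OF inj_edge]) simp
  also have "\<dots> = (\<Sum>t<n - 1. crossings (od t) * edge_cost I {od t, pa (od t)})"
    using od_notroot by (intro sum.cong refl) (simp add: card_crossing)
  finally show ?thesis using 1 by (simp add: mapping_cost_def)
qed

lemma feasible_iff:
  "feasible I m \<longleftrightarrow> (\<forall>u<n. cnt u \<le> node_cap I u) \<and>
     (\<forall>t<n - 1. crossings (od t) \<le> edge_cap I {od t, pa (od t)})"
proof -
  have "(\<forall>e\<in>ES I. card {f \<in> ER I. e \<in> path_edges (snd m f)} \<le> edge_cap I e) \<longleftrightarrow>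
      (\<forall>t<n - 1. crossings (od t) \<le> edge_cap I {od t, pa (od t)})"
    unfolding ES E_od using od_notroot by (auto simp: card_crossing)
  then show ?thesis using m by (auto simp: feasible_def VS card_position)
qed

lemma total_0: "total 0 F0 K = (\<Sum>u<n. F0 u (K u)) + (\<Sum>t<n - 1. ec (od t) (below 0 K (od t)))"
  unfolding total_def alive_0 by (simp add: lessThan_atLeast0)

lemma sub_card_less:
  assumes "0 < card {q. q < N \<and> P q}" "card {q. q < N \<and> P q} < N"
  shows "\<exists>i<N. P i" "\<exists>i<N. \<not> P i"
proof -
  show "\<exists>i<N. P i" using assms(1) by (auto simp: card_gt_0_iff)
  show "\<exists>i<N. \<not> P i"
  proof (rule ccontr)
    assume "\<not> ?thesis"
    then have "{q. q < N \<and> P q} = {..<N}" by auto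
    then show False using assms(2) by simp
  qed
qed

text \<open>A tree edge with virtual nodes on both sides is crossed at least twice. Feasibility then
  yields capacity at least 2, and the model charges no more than the mapping pays.\<close>

lemma total_le_cost:
  assumes "feasible I m"
  shows "total 0 F0 cnt \<le> enat (mapping_cost I m)"
proof -
  have "ec (od t) (below 0 cnt (od t)) \<le> enat (crossings (od t) * edge_cost I {od t, pa (od t)})"
    if t: "t < n - 1" for t
  proof (cases "below 0 cnt (od t) = 0 \<or> N \<le> below 0 cnt (od t)")
    case False
    then have "0 < below 0 cnt (od t)" "below 0 cnt (od t) < N" by auto
    from sub_card_less[OF this[unfolded below_cnt]] obtain i j where
      "i < N" "img i \<in> D (od t)" "j < N" "img j \<notin> D (od t)" by blast
    then have 2: "2 \<le> crossings (od t)" by (intro changes_ge_2)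
    moreover have "crossings (od t) \<le> edge_cap I {od t, pa (od t)}"
      using assms t by (simp add: feasible_iff)
    ultimately have "ec (od t) (below 0 cnt (od t)) = enat (2 * edge_cost I {od t, pa (od t)})"
      using False by (auto simp: ec_def)
    also have "\<dots> \<le> enat (crossings (od t) * edge_cost I {od t, pa (od t)})"
      using 2 by (simp only: enat_ord_simps) (intro mult_right_mono, auto)
    finally show ?thesis .
  qed (auto simp: ec_def)
  then have "(\<Sum>t<n - 1. ec (od t) (below 0 cnt (od t))) \<le>
      (\<Sum>t<n - 1. enat (crossings (od t) * edge_cost I {od t, pa (od t)}))"
    by (intro sum_mono) auto
  moreover have "(\<Sum>u<n. F0 u (cnt u)) = (\<Sum>u<n. enat (cnt u * node_cost I u))"
    using assms by (intro sum.cong) (auto simp: F0_def feasible_iff)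
  ultimately show ?thesis unfolding total_0 mapping_cost_eq
    by (simp add: sum_enat flip: plus_enat_simps(1))
qed

text \<open>Finiteness of the total encodes the capacity constraints. The placement gives every
  subtree an interval of positions, hence at most two crossings per edge, and none if one side is
  empty.\<close>

lemma cost_le_total:
  assumes lc: "\<And>q. q < N \<Longrightarrow> img q = lc q" and p: "placed F 0 K st lc" and F: "F 0 = F0"
    and fin: "total 0 F0 K = enat c"
  shows "feasible I m \<and> mapping_cost I m \<le> c"
proof -
  have cnt: "cnt u = K u" if "u < n" for u
  proof -
    have "{q. q < N \<and> img q = u} = {q. q < N \<and> lc q = u}" using lc by auto
    then show ?thesis using placed_card[OF p, of u] that by (simp add: alive_0)
  qed
  have b: "below 0 K x = card {q. q < N \<and> img q \<in> D x}" for x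
    unfolding below_cnt[symmetric] below_def alive_0 using cnt by (intro sum.cong) auto
  have "F0 u (K u) \<noteq> \<infinity>" if "u < n" for u
  proof -
    have "F0 u (K u) \<le> (\<Sum>u<n. F0 u (K u))" using that by (intro member_le_sum) auto
    also have "\<dots> \<le> enat c" using fin unfolding total_0 by (metis le_iff_add)
    finally show ?thesis by (metis infinity_ileE)
  qed
  then have 1: "K u \<le> node_cap I u" if "u < n" for u
    using that unfolding F0_def by metis
  have "ec (od t) (below 0 K (od t)) \<noteq> \<infinity>" if "t < n - 1" for t
  proof -
    have "ec (od t) (below 0 K (od t)) \<le> (\<Sum>t<n - 1. ec (od t) (below 0 K (od t)))"
      using that by (intro member_le_sum) auto
    also have "\<dots> \<le> enat c" using fin unfolding total_0 by (metis le_iff_add add.commute)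
    finally show ?thesis by (metis infinity_ileE)
  qed
  note ecfin = this
  have 2: "crossings (od t) \<le> edge_cap I {od t, pa (od t)} \<and>
    enat (crossings (od t) * edge_cost I {od t, pa (od t)}) \<le> ec (od t) (below 0 K (od t))"
    if t: "t < n - 1" for t
  proof (cases "below 0 K (od t) = 0 \<or> N \<le> below 0 K (od t)")
    case True
    have "\<exists>b. \<forall>q<N. (img q \<in> D (od t)) = b"
    proof (rule ccontr)
      assume "\<not> ?thesis"
      from nonconstant[OF this] obtain i j where
        ij: "i < N" "img i \<in> D (od t)" "j < N" "img j \<notin> D (od t)" by (elim exE conjE)
      then have "{q. q < N \<and> img q \<in> D (od t)} \<subset> {..<N}" by auto
      then have "card {q. q < N \<and> img q \<in> D (od t)} < card {..<N}"
        by (intro psubset_card_mono) simp_all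
      then have "below 0 K (od t) < N" unfolding b by simp
      moreover have "0 < below 0 K (od t)" unfolding b using ij by (auto simp: card_gt_0_iff)
      ultimately show False using True by simp
    qed
    then obtain b where "\<forall>q<N. (img q \<in> D (od t)) = b" by (elim exE)
    then have "crossings (od t) = 0" by (intro changes_0[of N _ b]) simp
    then show ?thesis by (simp flip: zero_enat_def)
  next
    case False
    obtain s a where "\<forall>q<N. lc q \<in> D (od t) \<longleftrightarrow> s \<le> q \<and> q < s + a"
      using p t unfolding placed_def by blast
    then have c2: "crossings (od t) \<le> 2" using lc by (intro changes_interval[of _ _ s a]) auto
    have "2 \<le> edge_cap I {od t, pa (od t)}"
      using ecfin[OF t] False by (auto simp: ec_def split: if_splits)
    moreover have "crossings (od t) * edge_cost I {od t, pa (od t)} \<le> 2 * edge_cost I {od t, pa (od t)}"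
      using c2 by (rule mult_right_mono) simp
    ultimately show ?thesis using c2 False by (auto simp: ec_def)
  qed
  have "enat (mapping_cost I m) = (\<Sum>u<n. enat (cnt u * node_cost I u)) +
     (\<Sum>t<n - 1. enat (crossings (od t) * edge_cost I {od t, pa (od t)}))"
    unfolding mapping_cost_eq sum_enat by simp
  also have "\<dots> \<le> total 0 F0 K"
    unfolding total_0 using 1 2 cnt by (intro add_mono sum_mono) (auto simp: F0_def)
  finally show ?thesis using 1 2 cnt fin by (simp add: feasible_iff)
qed

end

lemma connected_path: "u < n \<Longrightarrow> v < n \<Longrightarrow> \<exists>p. is_path {..<n} E p \<and> hd p = u \<and> last p = v"
  using connected unfolding connected_graph_def by auto

text \<open>Since only the node images matter, the paths may be any that connectivity
  provides.\<close>

lemma mapping_exists: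
  assumes "\<And>q. q < N \<Longrightarrow> lc q < n"
  shows "\<exists>m. is_mapping I m \<and> (\<forall>q<N. fst m (X q) = lc q)"
proof -
  define g where "g x = lc (inv_into {..<N} X x)" for x
  have g: "g (X q) = lc q" if "q < N" for q
    using X(1) that by (simp add: g_def inv_into_f_f)
  have gn: "g x < n" if "x < N" for x
    using that X(2) g assms by (metis imageE lessThan_iff)
  define h where "h f = (SOME p. is_path {..<n} E p \<and> {hd p, last p} = g ` f)" for f :: "nat set"
  have h: "is_path {..<n} E (h f) \<and> {hd (h f), last (h f)} = g ` f" if "f \<in> ER I" for f
  proof -
    obtain i where "i < N" "f = {X i, X (Suc i mod N)}" using \<open>f \<in> ER I\<close> by (auto simp: ER)
    then show ?thesis
      unfolding h_def using connected_path[OF gn gn, of "X i" "X (Suc i mod N)"] X_less N3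
      by (intro someI_ex[of "\<lambda>p. is_path {..<n} E p \<and> {hd p, last p} = g ` f"]) auto
  qed
  show ?thesis using g gn h by (intro exI[of _ "(g, h)"]) (auto simp: is_mapping_def VR VS ES)
qed

text \<open>Only the row of the parent changes in a step, so the row of an eliminated node is frozen
  at the values with which it was merged.\<close>

primrec DP :: "nat \<Rightarrow> nat \<Rightarrow> nat \<Rightarrow> enat" where
  "DP 0 = F0"
| "DP (Suc i) = (DP i)(pa (od i) :=
     \<lambda>j. Min ((\<lambda>a. DP i (pa (od i)) (j - a) + (DP i (od i) a + ec (od i) a)) ` {..j}))"

declare DP.simps(2) [simp del]

definition choice :: "nat \<Rightarrow> nat \<Rightarrow> nat \<Rightarrow> bool" where
  "choice i j a \<longleftrightarrow> a \<le> j \<and>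
     DP (Suc i) (pa (od i)) j = DP i (pa (od i)) (j - a) + (DP i (od i) a + ec (od i) a)"

definition optimum :: enat where "optimum = DP (n - 1) root N"

lemma choice_exists: "\<exists>a. choice i j a"
proof -
  let ?S = "(\<lambda>a. DP i (pa (od i)) (j - a) + (DP i (od i) a + ec (od i) a)) ` {..j}"
  have "Min ?S \<in> ?S" by (intro Min_in) auto
  then obtain a where "a \<le> j" "Min ?S = DP i (pa (od i)) (j - a) + (DP i (od i) a + ec (od i) a)"
    by blast
  then show ?thesis by (auto simp: choice_def DP.simps)
qed

lemma DP_le: "a \<le> j \<Longrightarrow>
    DP (Suc i) (pa (od i)) j \<le> DP i (pa (od i)) (j - a) + (DP i (od i) a + ec (od i) a)"
  unfolding DP.simps fun_upd_same by (intro Min_le) auto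

lemma DP_other: "u \<noteq> pa (od i) \<Longrightarrow> DP (Suc i) u = DP i u"
  by (simp add: DP.simps)

lemma merged_DP: "(\<And>j. j \<le> N \<Longrightarrow> choice i j (c j)) \<Longrightarrow> merged i (DP i) (DP (Suc i)) c"
  unfolding merged_def Let_def
  by (intro conjI ballI allI impI DP_le) (auto simp: choice_def DP_other)

definition pick :: "nat \<Rightarrow> nat \<Rightarrow> nat" where "pick i j = (SOME a. choice i j a)"

lemma merged_pick: "merged i (DP i) (DP (Suc i)) (pick i)"
  by (rule merged_DP) (unfold pick_def, rule someI_ex, rule choice_exists)

lemma optimum_le:
  assumes "feasible I m"
  shows "optimum \<le> enat (mapping_cost I m)"
proof -
  have m: "is_mapping I m" using assms by (simp add: feasible_def)
  let ?c = "\<lambda>u. card {q. q < N \<and> fst m (X q) = u}"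
  have "sum ?c (alive 0) = (\<Sum>u\<in>{..<n}. \<Sum>q\<in>{q \<in> {..<N}. fst m (X q) = u}. 1)"
    unfolding alive_0 by (intro sum.cong) auto
  also have "\<dots> = (\<Sum>q<N. 1)"
    using img_less[OF m] by (intro sum.group) auto
  finally have "optimum \<le> total 0 (DP 0) ?c"
    unfolding optimum_def by (intro opt_le[OF merged_pick]) auto
  also have "\<dots> \<le> enat (mapping_cost I m)" using total_le_cost[OF m assms] by simp
  finally show ?thesis .
qed

lemma placed_exists: "i \<le> n - 1 \<Longrightarrow> \<exists>K st lc. placed DP i K st lc"
proof (induction i rule: inc_induct)
  case base
  have "placed DP (n - 1) (\<lambda>_. N) (\<lambda>_. 0) (\<lambda>_. root)" by (intro placed_init) auto
  then show ?case by blast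
next
  case (step i)
  then obtain K st lc where p: "placed DP (Suc i) K st lc" by blast
  let ?v = "od i" and ?p = "pa (od i)"
  let ?d = "pick i (K ?p)"
  let ?st = "st(?v := st ?p + (K ?p - ?d))"
  have i: "i < n - 1" "i < n" using step by auto
  have "placed DP i (K(?p := K ?p - ?d, ?v := ?d)) ?st
      (\<lambda>q. if ?st ?v \<le> q \<and> q < ?st ?v + ?d then ?v else lc q)"
    using pa_alive[OF i(1)] alive_Suc(2)[OF i(2)]
    by (intro placed_step[OF merged_pick p i(1)]) auto
  then show ?case by blast
qed

text \<open>Applies to any mapping with the prescribed node images; this is why the program may
  output the paths it finds by climbing.\<close>

lemma placed_optimal:
  assumes "placed DP 0 K st lc" "optimum \<noteq> \<infinity>" "is_mapping I m" "\<And>q. q < N \<Longrightarrow> fst m (X q) = lc q"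
  shows "min_cost_feasible I m \<and> enat (mapping_cost I m) = optimum"
proof -
  obtain c where c: "optimum = enat c" using assms(2) by auto
  have "total 0 F0 K = enat c" using assms(1) c by (simp add: placed_def optimum_def)
  from cost_le_total[OF assms(3) assms(4) assms(1) _ this]
  have f: "feasible I m" "mapping_cost I m \<le> c" by auto
  have "c \<le> mapping_cost I m'" if "feasible I m'" for m'
    using optimum_le[OF that] c by simp
  then show ?thesis using f c unfolding min_cost_feasible_def by (metis order_antisym order_trans)
qed

lemma placed_less: "placed DP i K st lc \<Longrightarrow> q < N \<Longrightarrow> lc q < n"
  by (auto simp: placed_def alive_iff)

lemma feasible_iff_optimum: "(\<exists>m. feasible I m \<and> enat (mapping_cost I m) \<le> g) \<longleftrightarrow> optimum \<le> g"
  if "g \<noteq> \<infinity>"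
proof
  assume "\<exists>m. feasible I m \<and> enat (mapping_cost I m) \<le> g"
  then show "optimum \<le> g" using optimum_le order_trans by blast
next
  assume g: "optimum \<le> g"
  obtain K st lc where p: "placed DP 0 K st lc" using placed_exists by blast
  obtain m where m: "is_mapping I m" "\<forall>q<N. fst m (X q) = lc q"
    using mapping_exists[of lc] placed_less[OF p] by blast
  have "optimum \<noteq> \<infinity>" using g that by (metis enat_ord_simps(5) order_antisym_conv enat_ord_code(3))
  then have "min_cost_feasible I m \<and> enat (mapping_cost I m) = optimum"
    using placed_optimal[OF p _ m(1)] m(2) by simp
  then show "\<exists>m. feasible I m \<and> enat (mapping_cost I m) \<le> g"
    using g unfolding min_cost_feasible_def by (intro exI[of _ m]) simp
qed

lemma infeasible: "optimum = \<infinity> \<Longrightarrow> \<not> feasible I m"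
  using optimum_le[of m] by auto

end

section \<open>The algorithm as a loop program\<close>

section \<open>The program\<close>

definition IfEq :: "aexp \<Rightarrow> aexp \<Rightarrow> com \<Rightarrow> com" where
  "IfEq a b c = IfLess a b Skip (IfLess b a Skip c)"

lemma IfEq_simps [simp]:
  "sem (IfEq a b c) s = (if ev a s = ev b s then sem c s else s)"
  "may (IfEq a b c) l = may c l"
  "bvs (IfEq a b c) = bvs c"
  "wfc (IfEq a b c) = (wfe a \<and> wfe b \<and> wfc c)"
  "tb (IfEq a b c) B = 2 * (esz a + esz b + 2) + tb c B"
  by (auto simp: IfEq_def)

abbreviation (input) "vnr \<equiv> 2::nat"
abbreviation (input) "vns \<equiv> 3::nat"
abbreviation (input) "vo1 \<equiv> 4::nat"
abbreviation (input) "vo2 \<equiv> 5::nat"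
abbreviation (input) "vnr1 \<equiv> 6::nat"
abbreviation (input) "vns1 \<equiv> 7::nat"
abbreviation (input) "vk \<equiv> 8::nat"
abbreviation (input) "vu \<equiv> 9::nat"
abbreviation (input) "vv \<equiv> 10::nat"
abbreviation (input) "vqt \<equiv> 11::nat"
abbreviation (input) "vh \<equiv> 12::nat"
abbreviation (input) "vp \<equiv> 13::nat"
abbreviation (input) "ve \<equiv> 14::nat"
abbreviation (input) "vroot \<equiv> 15::nat"
abbreviation (input) "vr \<equiv> 16::nat"
abbreviation (input) "vc \<equiv> 17::nat"
abbreviation (input) "vj \<equiv> 18::nat"
abbreviation (input) "va \<equiv> 19::nat"
abbreviation (input) "vt \<equiv> 20::nat"
abbreviation (input) "vrv \<equiv> 21::nat"
abbreviation (input) "vrp \<equiv> 22::nat"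
abbreviation (input) "vec \<equiv> 23::nat"
abbreviation (input) "vw \<equiv> 24::nat"
abbreviation (input) "vbest \<equiv> 25::nat"
abbreviation (input) "varg \<equiv> 26::nat"
abbreviation (input) "vz \<equiv> 27::nat"
abbreviation (input) "vop \<equiv> 28::nat"
abbreviation (input) "vlc \<equiv> 29::nat"
abbreviation (input) "vrc \<equiv> 30::nat"
abbreviation (input) "vb \<equiv> 31::nat"
abbreviation (input) "vok \<equiv> 32::nat"
abbreviation (input) "vfound \<equiv> 33::nat"
abbreviation (input) "vi \<equiv> 34::nat"

abbreviation (input) "aOut \<equiv> 1::nat"
abbreviation (input) "aSR \<equiv> 2::nat"
abbreviation (input) "aX \<equiv> 3::nat"
abbreviation (input) "aDG \<equiv> 4::nat"
abbreviation (input) "aSN \<equiv> 5::nat"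
abbreviation (input) "aSE \<equiv> 6::nat"
abbreviation (input) "aQ \<equiv> 7::nat"
abbreviation (input) "aPA \<equiv> 8::nat"
abbreviation (input) "aPE \<equiv> 9::nat"
abbreviation (input) "aRK \<equiv> 10::nat"
abbreviation (input) "aRO \<equiv> 11::nat"
abbreviation (input) "aF \<equiv> 12::nat"
abbreviation (input) "aCH \<equiv> 13::nat"
abbreviation (input) "aK \<equiv> 14::nat"
abbreviation (input) "aST \<equiv> 15::nat"
abbreviation (input) "aLC \<equiv> 16::nat"
abbreviation (input) "aM \<equiv> 17::nat"
abbreviation (input) "aLB \<equiv> 18::nat"
abbreviation (input) "aRB \<equiv> 19::nat"

text \<open>The indices follow the layout of \<open>encode\<close>: two sizes, \<open>N\<close>
  pairs, two sizes, \<open>n\<close> pairs, then blocks of four with the ends, the capacity and the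
  cost of an edge. Repeated addition replaces multiplication.\<close>

definition er_u :: "aexp \<Rightarrow> aexp" where "er_u k = At 0 (Plus (Num 2) (Plus k k))"
definition er_v :: "aexp \<Rightarrow> aexp" where "er_v k = At 0 (Plus (Num 3) (Plus k k))"
definition n_cap :: "aexp \<Rightarrow> aexp" where "n_cap u = At 0 (Plus (Rd vo1) (Plus u u))"
definition n_cost :: "aexp \<Rightarrow> aexp" where "n_cost u = At 0 (Plus (Plus (Rd vo1) (Plus u u)) (Num 1))"
definition es_at :: "nat \<Rightarrow> aexp \<Rightarrow> aexp" where
  "es_at d k = At 0 (Plus (Plus (Rd vo2) (Plus (Plus k k) (Plus k k))) (Num d))"

definition setup_com :: com where
  "setup_com =
     vnr ::= At 0 (Num 0) ;;
     vns ::= At 0 (Plus (Num 2) (Plus (Rd vnr) (Rd vnr))) ;;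
     vo1 ::= Plus (Num 4) (Plus (Rd vnr) (Rd vnr)) ;;
     vo2 ::= Plus (Rd vo1) (Plus (Rd vns) (Rd vns)) ;;
     vnr1 ::= Plus (Rd vnr) (Num 1) ;;
     vns1 ::= Minus (Rd vns) (Num 1)"

text \<open>
  \<open>aSR\<close> collects the sum of the two neighbours of each virtual node, from which \<open>aX\<close> lists the
  nodes around the cycle.
\<close>

definition nbr_sum_com :: com where
  "nbr_sum_com =
     For vk vnr (
       vu ::= er_u (Rd vk) ;;
       vv ::= er_v (Rd vk) ;;
       Put aSR (Rd vu) (Plus (At aSR (Rd vu)) (Rd vv)) ;;
       Put aSR (Rd vv) (Plus (At aSR (Rd vv)) (Rd vu)))"

text \<open>The walk runs past a full turn, so that entry \<open>N\<close> can be compared with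
  entry 0 when the input is checked.\<close>

definition walk_com :: com where
  "walk_com =
     Put aX (Num 0) (er_u (Num 0)) ;;
     Put aX (Num 1) (er_v (Num 0)) ;;
     For vk vnr (
       Put aX (Plus (Rd vk) (Num 2))
         (Minus (At aSR (At aX (Plus (Rd vk) (Num 1)))) (At aX (Rd vk))))"

text \<open>
  \<open>aDG\<close>, \<open>aSN\<close> and \<open>aSE\<close> hold the degree, the sum of the neighbours and the sum of the incident
  edge indices of each substrate node in the tree that remains: a leaf then has its neighbour and
  its edge stored there.  \<open>aQ\<close> is the queue of leaves and finally the elimination order.
\<close>

definition degree_com :: com where
  "degree_com =
     For vk vns1 (
       vu ::= es_at 0 (Rd vk) ;;
       vv ::= es_at 1 (Rd vk) ;;
       Put aDG (Rd vu) (Plus (At aDG (Rd vu)) (Num 1)) ;;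
       Put aDG (Rd vv) (Plus (At aDG (Rd vv)) (Num 1)) ;;
       Put aSN (Rd vu) (Plus (At aSN (Rd vu)) (Rd vv)) ;;
       Put aSN (Rd vv) (Plus (At aSN (Rd vv)) (Rd vu)) ;;
       Put aSE (Rd vu) (Plus (At aSE (Rd vu)) (Rd vk)) ;;
       Put aSE (Rd vv) (Plus (At aSE (Rd vv)) (Rd vk)))"

definition leaves_com :: com where
  "leaves_com =
     vqt ::= Num 0 ;;
     For vu vns (
       IfEq (At aDG (Rd vu)) (Num 1) (
         Put aQ (Rd vqt) (Rd vu) ;;
         vqt ::= Plus (Rd vqt) (Num 1)))"

text \<open>The last remaining node was queued while its degree was 1, so the root is entry
  \<open>n - 1\<close>. If \<open>n = 1\<close> nothing is ever queued, and the initial 0 in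
  \<open>aQ\<close> names the root.\<close>

definition strip_com :: com where
  "strip_com =
     For vh vns1 (
       vv ::= At aQ (Rd vh) ;;
       vp ::= At aSN (Rd vv) ;;
       ve ::= At aSE (Rd vv) ;;
       Put aPA (Rd vv) (Rd vp) ;;
       Put aPE (Rd vv) (Rd ve) ;;
       Put aRK (Rd vv) (Rd vh) ;;
       Put aDG (Rd vp) (Minus (At aDG (Rd vp)) (Num 1)) ;;
       Put aSN (Rd vp) (Minus (At aSN (Rd vp)) (Rd vv)) ;;
       Put aSE (Rd vp) (Minus (At aSE (Rd vp)) (Rd ve)) ;;
       IfEq (At aDG (Rd vp)) (Num 1) (
         Put aQ (Rd vqt) (Rd vp) ;;
         vqt ::= Plus (Rd vqt) (Num 1))) ;;
     vroot ::= At aQ (Rd vns1) ;;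
     Put aRK (Rd vroot) (Rd vns1)"

text \<open>
  Row \<open>u\<close> of the table \<open>aF\<close> starts at index \<open>aRO[u]\<close>; an entry 0 stands for infinity and
  an entry \<open>c + 1\<close> for the cost \<open>c\<close>.
\<close>

definition init_com :: com where
  "init_com =
     vr ::= Num 0 ;;
     For vu vns (
       Put aRO (Rd vu) (Rd vr) ;;
       vc ::= Num 1 ;;
       For vj vnr1 (
         IfLess (n_cap (Rd vu)) (Rd vj)
           (Put aF (Plus (Rd vr) (Rd vj)) (Num 0))
           (Put aF (Plus (Rd vr) (Rd vj)) (Rd vc)) ;;
         vc ::= Plus (Rd vc) (n_cost (Rd vu))) ;;
       vr ::= Plus (Rd vr) (Rd vnr1))"

text \<open>The edge cost is added to the row of the leaf in place. Entries 0, standing for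
  infinity, stay 0, and a capacity below 2 makes all interior entries infinite.\<close>

definition edge_com :: com where
  "edge_com =
     For va vnr1 (
       IfLess (Num 0) (Rd va)
         (IfLess (Rd va) (Rd vnr)
           (IfLess (Rd vec) (Num 2)
             (Put aF (Plus (Rd vrv) (Rd va)) (Num 0))
             (IfLess (Num 0) (At aF (Plus (Rd vrv) (Rd va)))
               (Put aF (Plus (Rd vrv) (Rd va))
                 (Plus (At aF (Plus (Rd vrv) (Rd va))) (Plus (Rd vw) (Rd vw))))
               Skip))
           Skip)
         Skip)"

text \<open>The subtraction of 1 corrects for two summands that are both shifted by one;
  \<open>vbest = 0\<close> means that no finite value has been seen.\<close>

definition min_com :: com where
  "min_com =
     vbest ::= Num 0 ;;
     varg ::= Num 0 ;;
     For va vnr1 (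
       IfLess (Rd vj) (Rd va) Skip (
         vu ::= At aF (Plus (Rd vrv) (Rd va)) ;;
         vc ::= At aF (Plus (Rd vrp) (Minus (Rd vj) (Rd va))) ;;
         IfLess (Num 0) (Rd vu)
           (IfLess (Num 0) (Rd vc)
             (vz ::= Minus (Plus (Rd vu) (Rd vc)) (Num 1) ;;
              IfLess (Num 0) (Rd vbest)
                (IfLess (Rd vz) (Rd vbest) (vbest ::= Rd vz ;; varg ::= Rd va) Skip)
                (vbest ::= Rd vz ;; varg ::= Rd va))
             Skip)
           Skip))"

text \<open>The index \<open>j\<close> runs downwards from \<open>N\<close>: entry \<open>j\<close>
  of the parent row is computed from entries at most \<open>j\<close>, so the row can be overwritten
  in place. The minimiser is kept in the row of the leaf.\<close>

definition merge_com :: com where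
  "merge_com =
     For vt vnr1 (
       vj ::= Minus (Rd vnr) (Rd vt) ;;
       min_com ;;
       Put aF (Plus (Rd vrp) (Rd vj)) (Rd vbest) ;;
       Put aCH (Plus (Rd vrv) (Rd vj)) (Rd varg))"

definition dp_com :: com where
  "dp_com =
     For vh vns1 (
       vv ::= At aQ (Rd vh) ;;
       vp ::= At aPA (Rd vv) ;;
       vrv ::= At aRO (Rd vv) ;;
       vrp ::= At aRO (Rd vp) ;;
       vec ::= es_at 2 (At aPE (Rd vv)) ;;
       vw ::= es_at 3 (At aPE (Rd vv)) ;;
       edge_com ;;
       merge_com)"

definition main_com :: com where
  "main_com = setup_com ;; nbr_sum_com ;; walk_com ;; degree_com ;; leaves_com ;; strip_com ;;
     init_com ;; dp_com"

text \<open>The positions around the cycle assigned to node \<open>u\<close> are the interval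
  of length \<open>aK[u]\<close> that starts at \<open>aST[u]\<close>.\<close>

definition place_com :: com where
  "place_com =
     Put aK (Rd vroot) (Rd vnr) ;;
     Put aST (Rd vroot) (Num 0) ;;
     For vt vnr (Put aLC (Rd vt) (Rd vroot)) ;;
     For vh vns1 (
       vv ::= At aQ (Minus (Minus (Rd vns1) (Num 1)) (Rd vh)) ;;
       vp ::= At aPA (Rd vv) ;;
       vc ::= At aCH (Plus (At aRO (Rd vv)) (At aK (Rd vp))) ;;
       Put aK (Rd vp) (Minus (At aK (Rd vp)) (Rd vc)) ;;
       Put aK (Rd vv) (Rd vc) ;;
       Put aST (Rd vv) (Plus (At aST (Rd vp)) (At aK (Rd vp))) ;;
       For vt vnr (
         IfLess (Rd vt) (Rd vc)
           (Put aLC (Plus (At aST (Rd vv)) (Rd vt)) (Rd vv))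
           Skip)) ;;
     For vt vnr (Put aM (At aX (Rd vt)) (At aLC (Rd vt)))"

definition emit :: "aexp \<Rightarrow> com" where
  "emit a = (Put aOut (Rd vop) a ;; vop ::= Plus (Rd vop) (Num 1))"

definition climb_com :: com where
  "climb_com =
     vlc ::= Num 0 ;;
     vrc ::= Num 0 ;;
     For vt vns (
       IfLess (At aRK (Rd va)) (At aRK (Rd vb))
         (Put aLB (Rd vlc) (Rd va) ;;
          vlc ::= Plus (Rd vlc) (Num 1) ;;
          va ::= At aPA (Rd va))
         (IfLess (At aRK (Rd vb)) (At aRK (Rd va))
           (Put aRB (Rd vrc) (Rd vb) ;;
            vrc ::= Plus (Rd vrc) (Num 1) ;;
            vb ::= At aPA (Rd vb))
           Skip))"

text \<open>The loops run \<open>n\<close> times with a guard rather than \<open>vlc\<close> or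
  \<open>vrc\<close> times, since the static time bound wants loop bounds that stay fixed.\<close>

definition write_path_com :: com where
  "write_path_com =
     emit (Plus (Plus (Rd vlc) (Rd vrc)) (Num 1)) ;;
     For vt vns (IfLess (Rd vt) (Rd vlc) (emit (At aLB (Rd vt))) Skip) ;;
     emit (Rd va) ;;
     For vt vns (
       IfLess (Num 0) (Rd vrc)
         (vrc ::= Minus (Rd vrc) (Num 1) ;;
          emit (At aRB (Rd vrc)))
         Skip)"

definition output_com :: com where
  "output_com =
     vop ::= Num 0 ;;
     emit (Num 1) ;;
     For vk vnr (emit (At aM (Rd vk))) ;;
     For vk vnr (
       va ::= At aM (er_u (Rd vk)) ;;
       vb ::= At aM (er_v (Rd vk)) ;;
       climb_com ;;
       write_path_com) ;;
     0 ::= Rd vop"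

definition opt_cell :: aexp where
  "opt_cell = At aF (Plus (At aRO (Rd vroot)) (Rd vnr))"

definition solve_com :: com where
  "solve_com =
     main_com ;;
     IfLess (Num 0) opt_cell
       (place_com ;; output_com)
       (Put aOut (Num 0) (Num 0) ;; 0 ::= Num 1)"

definition fail :: com where "fail = (vok ::= Num 0)"

text \<open>\<open>vok\<close> is 0 beforehand and becomes 1 only if the walk closes up; every later
  failure resets it.\<close>

definition check_cycle_com :: com where
  "check_cycle_com =
     IfEq (At aX (Rd vnr)) (At aX (Num 0)) (vok ::= Num 1) ;;
     For vi vnr (
       IfLess (At aX (Rd vi)) (Rd vnr) Skip fail ;;
       For vj vnr (
         IfLess (Rd vi) (Rd vj) (IfEq (At aX (Rd vi)) (At aX (Rd vj)) fail) Skip) ;;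
       vfound ::= Num 0 ;;
       For vk vnr (
         IfEq (er_u (Rd vk)) (At aX (Rd vi))
           (IfEq (er_v (Rd vk)) (At aX (Plus (Rd vi) (Num 1))) (vfound ::= Num 1)) ;;
         IfEq (er_v (Rd vk)) (At aX (Rd vi))
           (IfEq (er_u (Rd vk)) (At aX (Plus (Rd vi) (Num 1))) (vfound ::= Num 1))) ;;
       IfEq (Rd vfound) (Num 0) fail)"

text \<open>That each parent occurs later in the order is what makes the parent function a tree, so
  neither connectivity nor the absence of cycles has to be tested separately.\<close>

definition check_tree_com :: com where
  "check_tree_com =
     For vi vns (
       IfLess (At aQ (Rd vi)) (Rd vns) Skip fail ;;
       For vj vns (
         IfLess (Rd vi) (Rd vj) (IfEq (At aQ (Rd vi)) (At aQ (Rd vj)) fail) Skip)) ;;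
     For vi vns1 (
       vv ::= At aQ (Rd vi) ;;
       vp ::= At aPA (Rd vv) ;;
       vfound ::= Num 0 ;;
       For vj vns (
         IfLess (Rd vi) (Rd vj) (IfEq (At aQ (Rd vj)) (Rd vp) (vfound ::= Num 1)) Skip) ;;
       IfEq (Rd vfound) (Num 0) fail ;;
       vfound ::= Num 0 ;;
       For vk vns1 (
         IfEq (es_at 0 (Rd vk)) (Rd vv)
           (IfEq (es_at 1 (Rd vk)) (Rd vp) (vfound ::= Num 1)) ;;
         IfEq (es_at 1 (Rd vk)) (Rd vv)
           (IfEq (es_at 0 (Rd vk)) (Rd vp) (vfound ::= Num 1))) ;;
       IfEq (Rd vfound) (Num 0) fail)"

definition check_cap_com :: com where
  "check_cap_com =
     For vi vns (IfEq (n_cap (Rd vi)) (Num 0) fail) ;;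
     For vi vns1 (IfEq (es_at 2 (Rd vi)) (Num 0) fail)"

section \<open>Recovering the cyclic order from sums of neighbours\<close>

section \<open>Traversing the cycle\<close>

lemma cycle_edges_image:
  "cycle_edges vs = (\<lambda>i. {vs ! i, vs ! (Suc i mod length vs)}) ` {..<length vs}"
  by (auto simp: cycle_edges_def)

lemma cycle_edges_rotate1_subset: "cycle_edges (rotate1 vs) \<subseteq> cycle_edges vs"
proof
  fix e assume "e \<in> cycle_edges (rotate1 vs)"
  then obtain i where i: "i < length vs" "e = {rotate1 vs ! i, rotate1 vs ! (Suc i mod length vs)}"
    by (auto simp: cycle_edges_def)
  moreover have "Suc i mod length vs < length vs" using i(1) by (intro mod_less_divisor) auto
  ultimately show "e \<in> cycle_edges vs"
    unfolding cycle_edges_def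
    by (intro CollectI exI[of _ "Suc i mod length vs"]) (simp add: nth_rotate1)
qed

lemma cycle_edges_rotate_subset: "cycle_edges (rotate k vs) \<subseteq> cycle_edges vs"
proof (induction k)
  case (Suc k)
  then show ?case using cycle_edges_rotate1_subset[of "rotate k vs"] by auto
qed simp

lemma cycle_edges_rotate: "cycle_edges (rotate k vs) = cycle_edges vs"
proof -
  have "rotate (length vs - k mod length vs) (rotate k vs) = vs"
  proof (cases "vs = []")
    case False
    then have "(length vs - k mod length vs + k) mod length vs = 0"
      by (metis add.commute length_greater_0_conv less_imp_le_nat mod_add_left_eq mod_less_divisor
          mod_self le_add_diff_inverse2)
    then show ?thesis by (simp add: rotate_rotate rotate_id)
  qed simp
  then show ?thesis
    using cycle_edges_rotate_subset[of k vs]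
      cycle_edges_rotate_subset[of "length vs - k mod length vs" "rotate k vs"] by auto
qed

lemma cycle_edges_rev_subset: "cycle_edges (rev vs) \<subseteq> cycle_edges vs"
proof
  fix e assume "e \<in> cycle_edges (rev vs)"
  then obtain i where i: "i < length vs" "e = {rev vs ! i, rev vs ! (Suc i mod length vs)}"
    by (auto simp: cycle_edges_def)
  \<comment> \<open>In the original order the pair is traversed backwards, so it starts at the
    second of its ends.\<close>
  define j where "j = length vs - Suc (Suc i mod length vs)"
  have m: "Suc i mod length vs < length vs" using i(1) by (intro mod_less_divisor) auto
  have "j < length vs" "Suc j mod length vs = length vs - Suc i"
    using i(1) by (auto simp: j_def mod_Suc)
  then show "e \<in> cycle_edges vs"
    using i m unfolding cycle_edges_def
    by (intro CollectI exI[of _ j]) (auto simp: rev_nth j_def)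
qed

lemma cycle_edges_rev: "cycle_edges (rev vs) = cycle_edges vs"
  using cycle_edges_rev_subset[of vs] cycle_edges_rev_subset[of "rev vs"] by auto

text \<open>Rotation brings the edge to the front, and a reversal is added if the edge is listed in
  the opposite direction.\<close>

lemma cycle_start:
  assumes "distinct vs" "3 \<le> length vs" "{p, q} \<in> cycle_edges vs"
  obtains ws where "distinct ws" "set ws = set vs" "length ws = length vs"
    "cycle_edges ws = cycle_edges vs" "ws ! 0 = p" "ws ! 1 = q"
proof -
  let ?l = "length vs"
  obtain j where j: "j < ?l" "{p, q} = {vs ! j, vs ! (Suc j mod ?l)}"
    using assms(3) by (auto simp: cycle_edges_def)
  let ?us = "rotate j vs"
  have "vs \<noteq> []" using assms(2) by auto
  then have us: "?us ! 0 = vs ! j" "?us ! 1 = vs ! (Suc j mod ?l)"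
    using assms(2) j(1) nth_rotate[of 0 vs j] nth_rotate[of 1 vs j] by simp_all
  show ?thesis
  proof (cases "p = vs ! j")
    case True
    then have "q = vs ! (Suc j mod ?l)" using j(2) by (auto simp: doubleton_eq_iff)
    with True us show ?thesis using that[of ?us] assms(1) by (simp add: cycle_edges_rotate)
  next
    case False
    then have pq: "p = vs ! (Suc j mod ?l)" "q = vs ! j" using j(2) by (auto simp: doubleton_eq_iff)
    \<comment> \<open>In the reversed list the two ends occupy the last two positions, which a
      rotation by \<open>?l - 2\<close> brings to the front.\<close>
    let ?ws = "rotate (?l - 2) (rev ?us)"
    have "(?l - 2 + 1) mod ?l = ?l - 1" using assms(2) by simp
    then have "?ws ! 0 = ?us ! 1" "?ws ! 1 = ?us ! 0"
      using assms(2) \<open>vs \<noteq> []\<close> nth_rotate[of 0 "rev ?us" "?l - 2"] nth_rotate[of 1 "rev ?us" "?l - 2"]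
      by (simp_all add: rev_nth numeral_2_eq_2)
    then show ?thesis
      using that[of ?ws] assms(1) us pq by (simp add: cycle_edges_rotate cycle_edges_rev)
  qed
qed

definition nbr_sum :: "nat \<Rightarrow> (nat \<Rightarrow> nat) \<Rightarrow> (nat \<Rightarrow> nat) \<Rightarrow> nat \<Rightarrow> nat" where
  "nbr_sum m a b x = (\<Sum>k<m. (if a k = x then b k else 0) + (if b k = x then a k else 0))"

text \<open>The contribution of an edge to the node \<open>?x\<close> is the sum of its ends minus
  \<open>?x\<close>, which depends only on the edge as a set. So the sum over the list can be
  reindexed along the cycle, where just two edges contribute.\<close>

lemma nbr_sum_cycle:
  assumes ws: "distinct ws" "length ws = N" "3 \<le> N"
    and inj: "inj_on (\<lambda>k. {a k, b k}) {..<N}"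
    and edges: "(\<lambda>k. {a k, b k}) ` {..<N} = cycle_edges ws"
  shows "nbr_sum N a b (ws ! (Suc k mod N)) = ws ! (k mod N) + ws ! (Suc (Suc k) mod N)"
proof -
  let ?x = "ws ! (Suc k mod N)"
  let ?f = "\<lambda>e. if ?x \<in> e then \<Sum>e - ?x else 0"
  have lt: "Suc i mod N < N" for i using ws(3) by simp
  have ne: "ws ! i \<noteq> ws ! (Suc i mod N)" if "i < N" for i
    using ws that lt[of i] by (auto simp: nth_eq_iff_index_eq mod_Suc)
  have e2: "a k \<noteq> b k" if k: "k < N" for k
  proof -
    have "{a k, b k} \<in> cycle_edges ws" using edges k by blast
    then obtain i where "i < N" "{a k, b k} = {ws ! i, ws ! (Suc i mod N)}"
      using ws(2) by (auto simp: cycle_edges_def)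
    then show ?thesis using ne[of i] by (auto simp: doubleton_eq_iff)
  qed
  have f: "?f {p, q} = (if p = ?x then q else 0) + (if q = ?x then p else 0)" if "p \<noteq> q" for p q
    using that by auto
  have injw: "inj_on (\<lambda>i. {ws ! i, ws ! (Suc i mod N)}) {..<N}"
    using ws by (intro cycle_edge_inj) (auto simp: inj_on_def nth_eq_iff_index_eq)
  have "nbr_sum N a b ?x = (\<Sum>k<N. ?f {a k, b k})"
    unfolding nbr_sum_def using e2 f by (intro sum.cong) auto
  also have "\<dots> = sum ?f (cycle_edges ws)"
    unfolding edges[symmetric] by (subst sum.reindex[OF inj]) simp
  also have "\<dots> = (\<Sum>i<N. ?f {ws ! i, ws ! (Suc i mod N)})"
    unfolding cycle_edges_image ws(2) by (subst sum.reindex[OF injw]) simp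
  also have "\<dots> = (\<Sum>i<N. (if i = Suc k mod N then ws ! (Suc i mod N) else 0) +
      (if i = k mod N then ws ! i else 0))"
  proof (intro sum.cong refl)
    fix i assume i: "i \<in> {..<N}"
    have "ws ! i = ?x \<longleftrightarrow> i = Suc k mod N" using i ws lt by (auto simp: nth_eq_iff_index_eq)
    moreover have "ws ! (Suc i mod N) = ?x \<longleftrightarrow> Suc i mod N = Suc k mod N"
      using ws lt by (auto simp: nth_eq_iff_index_eq)
    moreover have "Suc i mod N = Suc k mod N \<longleftrightarrow> i = k mod N"
      using i ws(3) mod_less_divisor[of N k] by (auto simp: mod_Suc split: if_splits)
    ultimately show "?f {ws ! i, ws ! (Suc i mod N)} =
      (if i = Suc k mod N then ws ! (Suc i mod N) else 0) + (if i = k mod N then ws ! i else 0)"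
      using f[OF ne[of i]] i by simp
  qed
  also have "\<dots> = ws ! (Suc (Suc k) mod N) + ws ! (k mod N)"
    using ws(3) lt by (simp add: sum.distrib sum.delta mod_Suc_eq)
  finally show ?thesis by simp
qed

text \<open>The first listed edge fixes starting point and direction; after that the recurrence
  leaves no choice.\<close>

lemma walk_cycle:
  assumes vs: "distinct vs" "length vs = N" "3 \<le> N"
    and inj: "inj_on (\<lambda>k. {a k, b k}) {..<N}"
    and edges: "(\<lambda>k. {a k, b k}) ` {..<N} = cycle_edges vs"
    and X: "X 0 = a 0" "X 1 = b 0"
      "\<And>k. k < N \<Longrightarrow> X (k + 2) = nbr_sum N a b (X (k + 1)) - X k"
  obtains ws where "distinct ws" "set ws = set vs" "length ws = N"
    "cycle_edges ws = cycle_edges vs" "\<And>i. i < N + 2 \<Longrightarrow> X i = ws ! (i mod N)"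
proof -
  have "{a 0, b 0} \<in> cycle_edges vs" using edges vs(3) by (auto intro: image_eqI[of _ _ 0])
  then obtain ws where ws: "distinct ws" "set ws = set vs" "length ws = N"
    "cycle_edges ws = cycle_edges vs" "ws ! 0 = a 0" "ws ! 1 = b 0"
    using cycle_start[of vs "a 0" "b 0"] vs by metis
  have sums: "nbr_sum N a b (ws ! (Suc k mod N)) = ws ! (k mod N) + ws ! (Suc (Suc k) mod N)" for k
    using nbr_sum_cycle[OF ws(1,3) vs(3) inj] edges ws(4) by simp
  have "i < N + 2 \<Longrightarrow> X i = ws ! (i mod N)" for i
  proof (induction i rule: less_induct)
    case (less i)
    consider "i = 0" | "i = 1" | k where "i = k + 2" by (metis One_nat_def add_2_eq_Suc' nat.exhaust)
    then show ?case
    proof cases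
      case 3
      then have "X i = nbr_sum N a b (ws ! (Suc k mod N)) - ws ! (k mod N)"
        using less.IH[of k] less.IH[of "k + 1"] less.prems X(3)[of k] by simp
      then show ?thesis using sums[of k] 3 by simp
    qed (use X ws vs(3) in auto)
  qed
  then show ?thesis using that ws by blast
qed

section \<open>Correctness of the program\<close>

text \<open>The quantities are read off an arbitrary function, with no assumption of
  well-formedness, because the decision program is also executed on lists that encode no
  instance.\<close>

locale prog_input =
  fixes inp :: "nat \<Rightarrow> nat"
begin

definition N where "N = inp 0"
definition n where "n = inp (2 + (N + N))"
definition o1 where "o1 = 4 + (N + N)"
definition o2 where "o2 = o1 + (n + n)"
definition eu where "eu k = inp (2 + (k + k))"
definition ew where "ew k = inp (3 + (k + k))"
definition cap where "cap u = inp (o1 + (u + u))"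
definition cost where "cost u = inp (o1 + (u + u) + 1)"
definition es where "es d k = inp (o2 + ((k + k) + (k + k)) + d)"

definition loaded :: "state \<Rightarrow> bool" where
  "loaded s \<longleftrightarrow> (\<forall>i. s (Cell 0 i) = inp i) \<and> s (Var vnr) = N \<and> s (Var vns) = n \<and>
     s (Var vo1) = o1 \<and> s (Var vo2) = o2 \<and> s (Var vnr1) = N + 1 \<and> s (Var vns1) = n - 1"

lemma loaded_Var [simp]:
  "x \<notin> {vnr, vns, vo1, vo2, vnr1, vns1} \<Longrightarrow> loaded (s(Var x := v)) = loaded s"
  by (simp add: loaded_def)

lemma loaded_Cell [simp]: "k \<noteq> 0 \<Longrightarrow> loaded (s(Cell k i := v)) = loaded s"
  by (simp add: loaded_def)

lemma loaded_ev [simp]: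
  assumes "loaded s"
  shows "ev (er_u e) s = eu (ev e s)" "ev (er_v e) s = ew (ev e s)"
    "ev (n_cap e) s = cap (ev e s)" "ev (n_cost e) s = cost (ev e s)"
    "ev (es_at d e) s = es d (ev e s)"
    "s (Var vnr) = N" "s (Var vns) = n" "s (Var vnr1) = Suc N" "s (Var vns1) = n - Suc 0"
  using assms by (simp_all add: loaded_def er_u_def er_v_def n_cap_def n_cost_def es_at_def
      eu_def ew_def cap_def cost_def es_def)

definition keeps :: "com \<Rightarrow> bool" where
  "keeps c \<longleftrightarrow> (\<forall>x\<in>{vnr, vns, vo1, vo2, vnr1, vns1}. \<not> may c (Var x)) \<and> (\<forall>i. \<not> may c (Cell 0 i))"

lemma loaded_cong:
  assumes "loaded s0" "keeps c" and fr: "\<And>l. \<not> may c l \<Longrightarrow> s l = s0 l"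
  shows "loaded s"
proof -
  have "s (Var x) = s0 (Var x)" if "x \<in> {vnr, vns, vo1, vo2, vnr1, vns1}" for x
    by (rule fr) (use that assms(2) in \<open>auto simp: keeps_def\<close>)
  moreover have "s (Cell 0 i) = s0 (Cell 0 i)" for i
    by (rule fr) (use assms(2) in \<open>auto simp: keeps_def\<close>)
  ultimately show ?thesis using assms(1) unfolding loaded_def by simp
qed

lemma loaded_sem: "loaded s \<Longrightarrow> keeps c \<Longrightarrow> loaded (sem c s)"
  by (erule (1) loaded_cong) (rule sem_frame)

lemma For_loaded:
  assumes "loaded s0" "keeps (For x y c)" "I 0 s0"
    and step: "\<And>i s. i < s0 (Var y) \<Longrightarrow> I i s \<Longrightarrow> loaded s \<Longrightarrow>
      (\<And>l. \<not> may (For x y c) l \<Longrightarrow> s l = s0 l) \<Longrightarrow> I (Suc i) (sem c (s(Var x := i)))"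
  shows "I (s0 (Var y)) (sem (For x y c) s0)"
proof (rule For_inv)
  fix i s assume i: "i < s0 (Var y)" "I i s" and fr: "\<And>l. \<not> may (For x y c) l \<Longrightarrow> s l = s0 l"
  show "I (Suc i) (sem c (s(Var x := i)))"
    by (rule step[OF i loaded_cong[OF assms(1,2) fr] fr])
qed (rule assms(3))

lemma setup_correct:
  assumes "\<And>i. s (Cell 0 i) = inp i"
  shows "loaded (sem setup_com s)"
  using assms unfolding loaded_def by (simp add: setup_com_def N_def n_def o1_def o2_def)

lemma nbr_sum_correct:
  assumes "loaded s" "\<And>x. s (Cell aSR x) = 0"
  shows "sem nbr_sum_com s (Cell aSR x) = nbr_sum N eu ew x"
proof -
  have "\<forall>x. sem nbr_sum_com s (Cell aSR x) = nbr_sum (s (Var vnr)) eu ew x"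
    unfolding nbr_sum_com_def
  proof (rule For_loaded[where I = "\<lambda>i s. \<forall>x. s (Cell aSR x) = nbr_sum i eu ew x"])
    fix i s assume "\<forall>x. s (Cell aSR x) = nbr_sum i eu ew x" "loaded s"
    then show "\<forall>x. sem (vu ::= er_u (Rd vk) ;; vv ::= er_v (Rd vk) ;;
       Put aSR (Rd vu) (Plus (At aSR (Rd vu)) (Rd vv)) ;;
       Put aSR (Rd vv) (Plus (At aSR (Rd vv)) (Rd vu))) (s(Var vk := i)) (Cell aSR x) =
       nbr_sum (Suc i) eu ew x"
      by (simp add: nbr_sum_def)
  qed (use assms in \<open>auto simp: keeps_def nbr_sum_def\<close>)
  then show ?thesis using assms(1) by simp
qed

lemma walk_correct:
  assumes "loaded s" and SR: "\<And>x. s (Cell aSR x) = nbr_sum N eu ew x"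
  shows "sem walk_com s (Cell aX 0) = eu 0 \<and> sem walk_com s (Cell aX 1) = ew 0 \<and>
    (\<forall>k<N. sem walk_com s (Cell aX (k + 2)) =
      nbr_sum N eu ew (sem walk_com s (Cell aX (k + 1))) - sem walk_com s (Cell aX k))"
proof -
  let ?s0 = "s(Cell aX 0 := eu 0, Cell aX 1 := ew 0)"
  let ?I = "\<lambda>i s. s (Cell aX 0) = eu 0 \<and> s (Cell aX 1) = ew 0 \<and>
    (\<forall>k<i. s (Cell aX (k + 2)) = nbr_sum N eu ew (s (Cell aX (k + 1))) - s (Cell aX k))"
  let ?c = "Put aX (Plus (Rd vk) (Num 2))
         (Minus (At aSR (At aX (Plus (Rd vk) (Num 1)))) (At aX (Rd vk)))"
  have "?I (?s0 (Var vnr)) (sem (For vk vnr ?c) ?s0)"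
  proof (rule For_loaded[where I = ?I])
    fix i s' assume I: "?I i s'" and fr: "\<And>l. \<not> may (For vk vnr ?c) l \<Longrightarrow> s' l = ?s0 l"
    have "s' (Cell aSR x) = nbr_sum N eu ew x" for x using fr[of "Cell aSR x"] SR by simp
    then show "?I (Suc i) (sem ?c (s'(Var vk := i)))" using I by (auto simp: less_Suc_eq)
  qed (use assms in \<open>auto simp: keeps_def\<close>)
  then show ?thesis using assms(1) by (simp add: walk_com_def)
qed

end

section \<open>The leaf queue and its invariant\<close>

section \<open>Stripping leaves\<close>

locale edge_list =
  fixes n m :: nat and a b :: "nat \<Rightarrow> nat"
  assumes ab: "\<And>k. k < m \<Longrightarrow> a k < n \<and> b k < n \<and> a k \<noteq> b k"
    and inj_ab: "inj_on (\<lambda>k. {a k, b k}) {..<m}"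
begin

definition edges where "edges = (\<lambda>k. {a k, b k}) ` {..<m}"

text \<open>Using indices into the edge list instead of edges makes the degree, the neighbour sum
  and the edge-index sum all sums over the same set.\<close>

definition inc where "inc A x = {k. k < m \<and> {a k, b k} \<subseteq> A \<and> x \<in> {a k, b k}}"

lemma finite_inc [simp]: "finite (inc A x)"
  by (simp add: inc_def)

lemma card_edge: "\<forall>e\<in>edges. card e = 2"
  using ab by (auto simp: edges_def)

lemma inc_remove:
  assumes "inc A v = {k0}" "u \<noteq> v"
  shows "inc (A - {v}) u = inc A u - {k0}"
proof -
  have "k \<in> inc A v \<longleftrightarrow> k = k0" for k using assms(1) by auto
  then show ?thesis unfolding inc_def using assms(2) by blast
qed

lemma inc_unique:
  assumes "v \<in> A" "p \<in> A" "{v, p} \<in> edges" "\<And>u. u \<in> A \<Longrightarrow> {v, u} \<in> edges \<Longrightarrow> u = p"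
  shows "\<exists>k0. inc A v = {k0}"
proof -
  obtain k0 where k0: "k0 < m" "{v, p} = {a k0, b k0}" using assms(3) by (auto simp: edges_def)
  have "k = k0" if k: "k \<in> inc A v" for k
  proof -
    have km: "k < m" "{a k, b k} \<subseteq> A" "v \<in> {a k, b k}" using k by (auto simp: inc_def)
    then obtain u where u: "{a k, b k} = {v, u}" "u \<in> A" by (auto simp: doubleton_eq_iff)
    then have "{v, u} \<in> edges" using km unfolding edges_def by (intro image_eqI[of _ _ k]) auto
    then have "{a k, b k} = {a k0, b k0}" using assms(4)[OF u(2)] u k0 by simp
    then show ?thesis using inj_ab km(1) k0(1) by (auto simp: inj_on_def)
  qed
  moreover have "k0 \<in> inc A v" using k0 assms(1,2) by (auto simp: inc_def)
  ultimately show ?thesis by blast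
qed

lemma inc_leaf:
  assumes "inc A v = {k0}"
  defines "p \<equiv> a k0 + b k0 - v"
  shows "k0 < m" "{a k0, b k0} = {v, p}" "p \<in> A" "p \<noteq> v" "p < n" "v < n" "k0 \<in> inc A p"
    "u \<in> A \<Longrightarrow> {v, u} \<in> edges \<Longrightarrow> u = p"
    "u \<noteq> p \<Longrightarrow> u \<noteq> v \<Longrightarrow> k0 \<notin> inc A u"
proof -
  have k0: "k0 < m" "{a k0, b k0} \<subseteq> A" "v \<in> {a k0, b k0}" using assms(1) by (auto simp: inc_def)
  then show 1: "k0 < m" "{a k0, b k0} = {v, p}" "p \<in> A" "p \<noteq> v" "p < n" "v < n"
    using ab[of k0] by (auto simp: p_def)
  then show "k0 \<in> inc A p" using k0 by (auto simp: inc_def)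
  show "u \<noteq> p \<Longrightarrow> u \<noteq> v \<Longrightarrow> k0 \<notin> inc A u" using 1 by (auto simp: inc_def)
  show "u = p" if u: "u \<in> A" "{v, u} \<in> edges"
  proof -
    obtain k where k: "k < m" "{v, u} = {a k, b k}" using u by (auto simp: edges_def)
    have "v \<in> A" using k0 by auto
    then have "{a k, b k} \<subseteq> A \<and> v \<in> {a k, b k}" using u unfolding k(2)[symmetric] by simp
    then have "k \<in> inc A v" using k unfolding inc_def by blast
    then have "k = k0" using assms(1) by auto
    then show ?thesis using k 1 by (auto simp: doubleton_eq_iff)
  qed
qed

text \<open>Induction by removing a leaf. It is used to see that the edge list of an encoded tree
  has \<open>n - 1\<close> entries, which the definition of a tree does not say.\<close>

lemma card_edges_inside:
  assumes "acyclic_graph edges" "finite A" "A \<noteq> {}" "cut_connected edges A"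
  shows "card {e \<in> edges. e \<subseteq> A} = card A - 1"
  using assms(2-4)
proof (induction "card A" arbitrary: A rule: less_induct)
  case less
  have fin: "finite edges" by (simp add: edges_def)
  show ?case
  proof (cases "2 \<le> card A")
    case False
    then have "card A = 1" using less.prems by (metis One_nat_def Suc_leI card_gt_0_iff le_antisym not_less_eq_eq numeral_2_eq_2)
    then obtain x where "A = {x}" by (auto simp: card_1_singleton_iff)
    then have none: "{e \<in> edges. e \<subseteq> A} = {}" using card_edge by (auto simp: subset_singleton_iff)
    show ?thesis unfolding none using \<open>card A = 1\<close> by simp
  next
    case True
    obtain v p where vp: "v \<in> A" "p \<in> A" "{v, p} \<in> edges" "\<forall>u\<in>A. {v, u} \<in> edges \<longrightarrow> u = p"
      using leaf_exists[OF less.prems(3,1) True assms(1) card_edge] by blast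
    have "p \<noteq> v" using vp(3) card_edge by force
    have split: "{e \<in> edges. e \<subseteq> A} = insert {v, p} {e \<in> edges. e \<subseteq> A - {v}}"
    proof (intro set_eqI iffI)
      fix e assume e: "e \<in> {e \<in> edges. e \<subseteq> A}"
      then obtain x y where xy: "e = {x, y}" by (auto simp: edges_def)
      show "e \<in> insert {v, p} {e \<in> edges. e \<subseteq> A - {v}}"
        using e xy vp(4) by (cases "v \<in> e") (auto simp: insert_commute)
    qed (use vp(1-3) in auto)
    have "card (A - {v}) < card A" using card_Diff1_less[OF less.prems(1) vp(1)] .
    moreover have "cut_connected edges (A - {v})"
      using vp(4) by (intro cut_connected_remove[OF less.prems(3) vp(1,2) \<open>p \<noteq> v\<close>]) blast
    ultimately have IH: "card {e \<in> edges. e \<subseteq> A - {v}} = card (A - {v}) - 1"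
      using less.hyps[of "A - {v}"] less.prems(1) vp(1,2) \<open>p \<noteq> v\<close> by auto
    have "card {e \<in> edges. e \<subseteq> A} = Suc (card {e \<in> edges. e \<subseteq> A - {v}})"
      unfolding split using fin by (subst card_insert_disjoint) auto
    then show ?thesis using IH True vp(1) less.prems(1) by simp
  qed
qed

text \<open>The queue from \<open>h\<close> to \<open>qt\<close> holds exactly the remaining nodes
  of degree at most 1; degree 0 must be allowed because the last node stays queued after losing its
  final edge. The parent of an eliminated node is its only neighbour then still present, which
  finally identifies the two edge sets.\<close>

definition strip_inv where
  "strip_inv h Q qt PA PE RK DG SN SE \<longleftrightarrow> (let A = {..<n} - Q ` {..<h} in
     cut_connected edges A \<and> inj_on Q {..<qt} \<and> Q ` {..<qt} \<subseteq> {..<n} \<and> h \<le> (qt::nat) \<and>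
     (\<forall>u\<in>A. DG u = card (inc A u) \<and> SN u = (\<Sum>k\<in>inc A u. a k + b k - u) \<and> SE u = \<Sum>(inc A u)) \<and>
     (\<forall>u\<in>A. DG u \<le> 1 \<longleftrightarrow> u \<in> Q ` {h..<qt}) \<and>
     (\<forall>i<h. RK (Q i) = i \<and> PA (Q i) \<in> {..<n} - Q ` {..i} \<and> PE (Q i) < m \<and>
        {Q i, PA (Q i)} = {a (PE (Q i)), b (PE (Q i))} \<and>
        (\<forall>u\<in>{..<n} - Q ` {..i}. {Q i, u} \<in> edges \<longrightarrow> u = PA (Q i))))"

text \<open>A leaf exists while two nodes remain, so the queue is not exhausted. Connectivity
  excludes degree 0, so the head of the queue has exactly one incident edge, and its accumulated
  sums are the neighbour and the edge index themselves.\<close>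

lemma strip_step:
  assumes inv: "strip_inv h Q qt PA PE RK DG SN SE" and h: "h < n - 1" and ac: "acyclic_graph edges"
  defines "v \<equiv> Q h" and "p \<equiv> SN (Q h)" and "e \<equiv> SE (Q h)"
  defines "Q' \<equiv> (if DG p - 1 = 1 then Q(qt := p) else Q)"
    and "qt' \<equiv> (if DG p - 1 = 1 then qt + 1 else qt)"
  shows "strip_inv (Suc h) Q' qt' (PA(v := p)) (PE(v := e)) (RK(v := h)) (DG(p := DG p - 1))
    (SN(p := SN p - v)) (SE(p := SE p - e))" "p \<noteq> v"
proof -
  define A where "A = {..<n} - Q ` {..<h}"
  have inv': "cut_connected edges A" "inj_on Q {..<qt}" "Q ` {..<qt} \<subseteq> {..<n}" "h \<le> qt"
    "\<forall>u\<in>A. DG u = card (inc A u) \<and> SN u = (\<Sum>k\<in>inc A u. a k + b k - u) \<and> SE u = \<Sum>(inc A u)"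
    "\<forall>u\<in>A. DG u \<le> 1 \<longleftrightarrow> u \<in> Q ` {h..<qt}"
    "\<forall>i<h. RK (Q i) = i \<and> PA (Q i) \<in> {..<n} - Q ` {..i} \<and> PE (Q i) < m \<and>
        {Q i, PA (Q i)} = {a (PE (Q i)), b (PE (Q i))} \<and>
        (\<forall>u\<in>{..<n} - Q ` {..i}. {Q i, u} \<in> edges \<longrightarrow> u = PA (Q i))"
    using inv unfolding strip_inv_def Let_def A_def[symmetric] by - (elim conjE, assumption)+
  note cut = inv'(1) and injQ = inv'(2) and Qn = inv'(3) and hqt = inv'(4)
    and queue = inv'(6)[THEN bspec] and old = inv'(7)[THEN spec, THEN mp]
  note sums = inv'(5)[THEN bspec, THEN conjunct1] inv'(5)[THEN bspec, THEN conjunct2, THEN conjunct1]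
    inv'(5)[THEN bspec, THEN conjunct2, THEN conjunct2]
  have injh: "inj_on Q {..<h}" using injQ hqt by (auto intro: inj_on_subset)
  have "Q ` {..<h} \<subseteq> {..<n}" using Qn hqt by (meson image_mono lessThan_subset_iff order_trans)
  then have "card A = n - h"
    unfolding A_def using card_image[OF injh] by (simp add: card_Diff_subset)
  then have cardA: "2 \<le> card A" using h by simp
  have finA: "finite A" by (simp add: A_def)
  obtain v0 p0 where v0: "v0 \<in> A" "p0 \<in> A" "{v0, p0} \<in> edges" "\<forall>u\<in>A. {v0, u} \<in> edges \<longrightarrow> u = p0"
    using leaf_exists[OF cut finA cardA ac card_edge] by blast
  then obtain k1 where "inc A v0 = {k1}" using inc_unique[OF v0(1-3)] by blast
  then have "v0 \<in> A" "card (inc A v0) = 1" using v0(1) by simp_all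
  then have "v0 \<in> Q ` {h..<qt}" using queue[of v0] sums(1)[of v0] by simp
  then have hq: "h < qt" by auto
  have Qeq: "Q i = Q j \<longleftrightarrow> i = j" if "i < qt" "j < qt" for i j
    using injQ that by (auto simp: inj_on_eq_iff)
  have vA: "v \<in> A"
  proof -
    have "v \<notin> Q ` {..<h}"
    proof
      assume "v \<in> Q ` {..<h}"
      then obtain i where "i < h" "Q i = Q h" by (auto simp: v_def)
      then show False using Qeq[of i h] hq by simp
    qed
    then show ?thesis using Qn hq by (auto simp: A_def v_def)
  qed
  have "DG v \<le> 1" using queue[OF vA] hq by (auto simp: v_def)
  moreover have "inc A v \<noteq> {}"
  proof -
    obtain u where u: "u \<in> A" "{v, u} \<in> edges" using cut_connected_nbr[OF cut vA cardA] by blast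
    then obtain k where "k < m" "{v, u} = {a k, b k}" by (auto simp: edges_def)
    then have "k \<in> inc A v" using u(1) vA by (auto simp: inc_def)
    then show ?thesis by blast
  qed
  ultimately have "card (inc A v) = 1" using sums(1)[OF vA] by (simp add: card_gt_0_iff le_Suc_eq)
  then obtain k0 where k0: "inc A v = {k0}" by (auto simp: card_1_singleton_iff)
  have pe: "p = a k0 + b k0 - v" "e = k0"
    using sums(2,3)[OF vA] k0 by (simp_all add: p_def e_def v_def[symmetric])
  note leaf = inc_leaf[OF k0, folded pe(1)]
  then show pv: "p \<noteq> v" by blast
  let ?A = "A - {v}"
  have Qh: "Q' i = Q i" if "i < qt" for i using that by (auto simp: Q'_def)
  have imh: "Q' ` {..<Suc h} = insert v (Q ` {..<h})"
    using hq Qh by (auto simp: v_def lessThan_Suc)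
  have A': "{..<n} - Q' ` {..<Suc h} = ?A" unfolding imh by (auto simp: A_def)
  have imi: "Q' ` {..i} = Q ` {..i}" if "i \<le> h" for i
    using that hq Qh by (intro image_cong) auto
  have pA: "p \<in> A" using leaf(3) .
  have pk: "k0 \<in> inc A p" using leaf(7) .
  have Dp: "1 \<le> DG p" using sums(1)[OF pA] pk by (metis One_nat_def Suc_leI card_gt_0_iff empty_iff finite_inc)
  have inc': "inc ?A u = (if u = p then inc A p - {k0} else inc A u)" if "u \<in> ?A" for u
    using inc_remove[OF k0, of u] that leaf(9)[of u] by auto
  show "strip_inv (Suc h) Q' qt' (PA(v := p)) (PE(v := e)) (RK(v := h)) (DG(p := DG p - 1))
    (SN(p := SN p - v)) (SE(p := SE p - e))"
    unfolding strip_inv_def A' Let_def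
  proof (intro conjI ballI allI impI)
    show "cut_connected edges ?A"
      using cut_connected_remove[OF cut vA pA pv leaf(8)] .
    \<comment> \<open>A node whose degree just fell to 1 had degree 2 before, so it is not among the
      waiting entries; being alive, it is not among the processed ones either.\<close>
    have pnew: "p \<notin> Q ` {..<qt}" if "DG p - 1 = 1"
    proof
      assume "p \<in> Q ` {..<qt}"
      then obtain i where i: "i < qt" "p = Q i" by auto
      then have "\<not> i < h" using pA by (auto simp: A_def)
      then have "p \<in> Q ` {h..<qt}" using i by auto
      then show False using queue[OF pA] that by simp
    qed
    show "inj_on Q' {..<qt'}"
      using injQ pnew by (auto simp: Q'_def qt'_def lessThan_Suc inj_on_fun_updI)
    show "Q' ` {..<qt'} \<subseteq> {..<n}"
      using Qn leaf(5) by (auto simp: Q'_def qt'_def lessThan_Suc)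
    show "Suc h \<le> qt'" using hq by (simp add: qt'_def)
  next
    fix u assume u: "u \<in> ?A"
    then have uA: "u \<in> A" by auto
    show "(DG(p := DG p - 1)) u = card (inc ?A u)"
      using inc'[OF u] sums(1)[OF uA] pk by auto
    have "(\<Sum>k\<in>inc A p. a k + b k - p) = (a k0 + b k0 - p) + (\<Sum>k\<in>inc A p - {k0}. a k + b k - p)"
      using pk by (intro sum.remove) auto
    moreover have "a k0 + b k0 - p = v" using leaf(2) pv by (auto simp: doubleton_eq_iff)
    ultimately show "(SN(p := SN p - v)) u = (\<Sum>k\<in>inc ?A u. a k + b k - u)"
      using inc'[OF u] sums(2)[OF uA] by auto
    have "\<Sum>(inc A p) = k0 + \<Sum>(inc A p - {k0})"
      using pk by (intro sum.remove) auto
    then show "(SE(p := SE p - e)) u = \<Sum>(inc ?A u)"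
      using inc'[OF u] sums(3)[OF uA] pe(2) by auto
    have im: "u \<in> Q ` {h..<qt} \<longleftrightarrow> u \<in> Q ` {Suc h..<qt}"
    proof -
      have "{h..<qt} = insert h {Suc h..<qt}" using hq by auto
      then show ?thesis using u by (auto simp: v_def)
    qed
    have Q'im: "Q' ` {Suc h..<qt} = Q ` {Suc h..<qt}" using Qh by (intro image_cong) auto
    show "((DG(p := DG p - 1)) u \<le> 1) = (u \<in> Q' ` {Suc h..<qt'})"
    proof (cases "DG p - 1 = 1")
      case True
      then have "{Suc h..<qt'} = insert qt {Suc h..<qt}" "Q' qt = p"
        using hq by (auto simp: qt'_def Q'_def)
      then have "Q' ` {Suc h..<qt'} = insert p (Q ` {Suc h..<qt})" using Q'im by simp
      then show ?thesis using True queue[OF uA] im by auto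
    next
      case False
      then have "(DG(p := DG p - 1)) u \<le> 1 \<longleftrightarrow> DG u \<le> 1" using Dp by auto
      then show ?thesis using False queue[OF uA] im Q'im by (simp add: qt'_def)
    qed
  next
    fix i assume i: "i < Suc h"
    have Qi: "Q' i = Q i" using Qh i hq by simp
    have im: "Q' ` {..i} = Q ` {..i}" using imi i by simp
    have new: "Q ` {..h} = insert v (Q ` {..<h})" by (auto simp: v_def atMost_Suc lessThan_Suc_atMost[symmetric] lessThan_Suc)
    have ne: "Q i \<noteq> v" if "i \<noteq> h"
      using Qeq[of i h] that i hq by (auto simp: v_def)
    show "(RK(v := h)) (Q' i) = i"
      using old[of i] ne i unfolding Qi by (cases "i = h") (auto simp: v_def)
    show "(PA(v := p)) (Q' i) \<in> {..<n} - Q' ` {..i}"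
      using old[of i] ne i leaf(3) pv new unfolding Qi im
      by (cases "i = h") (auto simp: v_def[symmetric] A_def)
    show "(PE(v := e)) (Q' i) < m"
      using old[of i] ne i leaf(1) pe(2) unfolding Qi by (cases "i = h") (auto simp: v_def)
    show "{Q' i, (PA(v := p)) (Q' i)} = {a ((PE(v := e)) (Q' i)), b ((PE(v := e)) (Q' i))}"
      using old[of i] ne i leaf(2) pe(2) unfolding Qi by (cases "i = h") (auto simp: v_def[symmetric])
    show "u = (PA(v := p)) (Q' i)" if "u \<in> {..<n} - Q' ` {..i}" "{Q' i, u} \<in> edges" for u
    proof (cases "i = h")
      case True
      then have "u \<in> A" using that(1) new unfolding im by (auto simp: A_def)
      then show ?thesis using leaf(8) that(2) True Qi by (auto simp: v_def)
    next
      case False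
      then show ?thesis using old[of i] that ne i unfolding Qi im by auto
    qed
  qed
qed

text \<open>The one remaining node has no edges, hence degree 0, hence is queued: the queue is a
  permutation of all nodes. Every edge joins the end eliminated earlier to a neighbour still
  present, which can only be its parent.\<close>

lemma strip_final:
  assumes inv: "strip_inv (n - 1) Q qt PA PE RK DG SN SE" and n: "0 < n"
  defines "RK' \<equiv> RK(Q (n - 1) := n - 1)"
  shows "ptree n Q PA RK'" "ptree.E n Q PA = edges"
    "\<And>i. i < n - 1 \<Longrightarrow> PE (Q i) < m \<and> {Q i, PA (Q i)} = {a (PE (Q i)), b (PE (Q i))}"
proof -
  define A where "A = {..<n} - Q ` {..<n - 1}"
  have inv': "inj_on Q {..<qt}" "Q ` {..<qt} \<subseteq> {..<n}" "n - 1 \<le> qt"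
    "\<forall>u\<in>A. DG u = card (inc A u) \<and> SN u = (\<Sum>k\<in>inc A u. a k + b k - u) \<and> SE u = \<Sum>(inc A u)"
    "\<forall>u\<in>A. DG u \<le> 1 \<longleftrightarrow> u \<in> Q ` {n - 1..<qt}"
    "\<forall>i<n - 1. RK (Q i) = i \<and> PA (Q i) \<in> {..<n} - Q ` {..i} \<and> PE (Q i) < m \<and>
        {Q i, PA (Q i)} = {a (PE (Q i)), b (PE (Q i))} \<and>
        (\<forall>u\<in>{..<n} - Q ` {..i}. {Q i, u} \<in> edges \<longrightarrow> u = PA (Q i))"
    using inv unfolding strip_inv_def Let_def A_def[symmetric] by - (elim conjE, assumption)+
  note injQ = inv'(1) and Qn = inv'(2) and hqt = inv'(3)
    and sums = inv'(4)[THEN bspec, THEN conjunct1]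
    and queue = inv'(5)[THEN bspec] and old = inv'(6)[THEN spec, THEN mp]
  show "\<And>i. i < n - 1 \<Longrightarrow> PE (Q i) < m \<and> {Q i, PA (Q i)} = {a (PE (Q i)), b (PE (Q i))}"
    using old by blast
  have injn: "inj_on Q {..<n}" and imn: "Q ` {..<n} = {..<n}"
  proof -
    have inj1: "inj_on Q {..<n - 1}" using injQ hqt by (auto intro: inj_on_subset)
    have sub1: "Q ` {..<n - 1} \<subseteq> {..<n}" using Qn hqt by (meson image_mono lessThan_subset_iff order_trans)
    then have "card A = 1"
      unfolding A_def using card_image[OF inj1] n by (simp add: card_Diff_subset)
    then obtain r where r: "A = {r}" by (auto simp: card_1_singleton_iff)
    have "inc A r = {}" unfolding r inc_def by (auto dest: ab)
    then have "r \<in> Q ` {n - 1..<qt}" using queue[of r] sums[of r] r by simp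
    then have "n \<le> qt" using n by auto
    then show injn: "inj_on Q {..<n}" using injQ by (auto intro: inj_on_subset)
    have "Q ` {..<n} \<subseteq> {..<n}" using Qn \<open>n \<le> qt\<close> by (meson image_mono lessThan_subset_iff order_trans)
    then show "Q ` {..<n} = {..<n}"
      using card_image[OF injn] by (intro card_subset_eq) auto
  qed
  have Qeq: "Q i = Q j \<longleftrightarrow> i = j" if "i < n" "j < n" for i j
    using injn that by (auto simp: inj_on_eq_iff)
  have RK: "RK' (Q i) = i" if "i < n" for i
  proof (cases "i = n - 1")
    case False
    then show ?thesis using old[of i] Qeq[of i "n - 1"] that n by (auto simp: RK'_def)
  qed (simp add: RK'_def)
  have pa: "PA (Q i) < n \<and> i < RK' (PA (Q i))" if i: "i < n - 1" for i
  proof -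
    have P: "PA (Q i) \<in> {..<n}" "PA (Q i) \<notin> Q ` {..i}" using old[OF i] by auto
    then obtain j where j: "j < n" "PA (Q i) = Q j" using imn by (metis imageE lessThan_iff)
    then show ?thesis using P RK[OF j(1)] by (metis atMost_iff imageI lessThan_iff not_le)
  qed
  show pt: "ptree n Q PA RK'"
  proof
    show "0 < n" by (rule n)
    show "\<And>i. i < n \<Longrightarrow> Q i < n \<and> RK' (Q i) = i" using imn RK by blast
    fix v assume v: "v < n"
    then obtain i where i: "i < n" "v = Q i" using imn by (metis imageE lessThan_iff)
    then show "RK' v < n \<and> Q (RK' v) = v" using RK by simp
    assume "v \<noteq> Q (n - 1)"
    then have "i \<noteq> n - 1" using i by auto
    then show "PA v < n \<and> RK' v < RK' (PA v)" using pa[of i] i RK by auto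
  qed
  interpret ptree n Q PA RK' by (rule pt)
  show "E = edges"
  proof
    show "E \<subseteq> edges"
    proof
      fix e assume "e \<in> E"
      then obtain t where "t < n - 1" "e = {Q t, PA (Q t)}" by (auto simp: E_od)
      then show "e \<in> edges" using old[of t] by (auto simp: edges_def)
    qed
    show "edges \<subseteq> E"
    proof
      fix e assume e: "e \<in> edges"
      then obtain x y where xy: "e = {x, y}" "x < n" "y < n" "x \<noteq> y" using ab by (auto simp: edges_def)
      have *: "{x, y} \<in> E" if "{x, y} \<in> edges" "x < n" "y < n" "RK' x < RK' y" for x y
      proof -
        let ?i = "RK' x"
        have i: "?i < n - 1" using that rk[OF that(3)] by linarith
        have x: "Q ?i = x" using rk[OF that(2)] by blast
        have "y \<notin> Q ` {..?i}"
        proof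
          assume "y \<in> Q ` {..?i}"
          then obtain j where "j \<le> ?i" "y = Q j" by auto
          then show False using od[of j] that(4) i by simp
        qed
        then have "y = PA x" using old[OF i] that(1,3) x by auto
        then show ?thesis using i x unfolding E_od by (intro image_eqI[of _ _ ?i]) auto
      qed
      have "RK' x < RK' y \<or> RK' y < RK' x" using rk_eq[of x y] xy by (meson linorder_neqE_nat)
      then show "e \<in> E" using *[of x y] *[of y x] xy e by (auto simp: insert_commute)
    qed
  qed
qed

end

section \<open>Computing the elimination order\<close>

definition acc :: "nat \<Rightarrow> (nat \<Rightarrow> nat) \<Rightarrow> (nat \<Rightarrow> nat) \<Rightarrow> (nat \<Rightarrow> nat) \<Rightarrow> (nat \<Rightarrow> nat) \<Rightarrow> nat \<Rightarrow> nat" where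
  "acc m a b f g x = (\<Sum>k<m. (if a k = x then f k else 0) + (if b k = x then g k else 0))"

lemma (in edge_list) acc_inc:
  "acc m a b f g x = (\<Sum>k\<in>inc {..<n} x. if a k = x then f k else g k)"
proof -
  have "acc m a b f g x = (\<Sum>k\<in>{..<m}. if x \<in> {a k, b k} then (if a k = x then f k else g k) else 0)"
    unfolding acc_def by (intro sum.cong) (auto dest: ab)
  also have "\<dots> = (\<Sum>k\<in>{k \<in> {..<m}. x \<in> {a k, b k}}. if a k = x then f k else g k)"
    by (rule sum.inter_filter[symmetric]) simp
  also have "{k \<in> {..<m}. x \<in> {a k, b k}} = inc {..<n} x"
    using ab by (auto simp: inc_def)
  finally show ?thesis .
qed

context prog_input
begin

lemma degree_correct:
  assumes "loaded s" "\<And>x. s (Cell aDG x) = 0" "\<And>x. s (Cell aSN x) = 0" "\<And>x. s (Cell aSE x) = 0"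
  shows "\<forall>x. sem degree_com s (Cell aDG x) = acc (n - 1) (es 0) (es 1) (\<lambda>_. 1) (\<lambda>_. 1) x \<and>
    sem degree_com s (Cell aSN x) = acc (n - 1) (es 0) (es 1) (es 1) (es 0) x \<and>
    sem degree_com s (Cell aSE x) = acc (n - 1) (es 0) (es 1) (\<lambda>k. k) (\<lambda>k. k) x"
proof -
  let ?I = "\<lambda>i s. \<forall>x. s (Cell aDG x) = acc i (es 0) (es 1) (\<lambda>_. 1) (\<lambda>_. 1) x \<and>
    s (Cell aSN x) = acc i (es 0) (es 1) (es 1) (es 0) x \<and>
    s (Cell aSE x) = acc i (es 0) (es 1) (\<lambda>k. k) (\<lambda>k. k) x"
  have "?I (s (Var vns1)) (sem degree_com s)"
    unfolding degree_com_def
  proof (rule For_loaded[where I = ?I])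
    fix i s assume "?I i s" "loaded s"
    then show "?I (Suc i) (sem (vu ::= es_at 0 (Rd vk) ;;
       vv ::= es_at 1 (Rd vk) ;;
       Put aDG (Rd vu) (Plus (At aDG (Rd vu)) (Num 1)) ;;
       Put aDG (Rd vv) (Plus (At aDG (Rd vv)) (Num 1)) ;;
       Put aSN (Rd vu) (Plus (At aSN (Rd vu)) (Rd vv)) ;;
       Put aSN (Rd vv) (Plus (At aSN (Rd vv)) (Rd vu)) ;;
       Put aSE (Rd vu) (Plus (At aSE (Rd vu)) (Rd vk)) ;;
       Put aSE (Rd vv) (Plus (At aSE (Rd vv)) (Rd vk))) (s(Var vk := i)))"
      by (simp add: acc_def)
  qed (use assms in \<open>auto simp: keeps_def acc_def\<close>)
  then show ?thesis using assms(1) by simp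
qed

text \<open>The last claim, that nothing beyond the queue is written, matters for a one-node
  tree.\<close>

lemma leaves_correct:
  assumes "loaded s"
  defines "s' \<equiv> sem leaves_com s"
  shows "inj_on (\<lambda>i. s' (Cell aQ i)) {..<s' (Var vqt)}"
    "(\<lambda>i. s' (Cell aQ i)) ` {..<s' (Var vqt)} = {u. u < n \<and> s (Cell aDG u) = 1}"
    "s' (Var vqt) \<le> i \<Longrightarrow> s' (Cell aQ i) = s (Cell aQ i)"
proof -
  let ?s0 = "s(Var vqt := 0)"
  let ?I = "\<lambda>i t. inj_on (\<lambda>i. t (Cell aQ i)) {..<t (Var vqt)} \<and>
    (\<lambda>i. t (Cell aQ i)) ` {..<t (Var vqt)} = {u. u < i \<and> s (Cell aDG u) = 1} \<and>
    (\<forall>i\<ge>t (Var vqt). t (Cell aQ i) = s (Cell aQ i))"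
  let ?c = "IfEq (At aDG (Rd vu)) (Num 1) (
         Put aQ (Rd vqt) (Rd vu) ;;
         vqt ::= Plus (Rd vqt) (Num 1))"
  have "?I (?s0 (Var vns)) (sem (For vu vns ?c) ?s0)"
  proof (rule For_loaded[where I = ?I])
    fix i t assume I: "?I i t" and fr: "\<And>l. \<not> may (For vu vns ?c) l \<Longrightarrow> t l = ?s0 l"
    have dg: "t (Cell aDG x) = s (Cell aDG x)" for x using fr[of "Cell aDG x"] by simp
    show "?I (Suc i) (sem ?c (t(Var vu := i)))"
    proof (cases "s (Cell aDG i) = 1")
      case False
      then have "{u. u < Suc i \<and> s (Cell aDG u) = 1} = {u. u < i \<and> s (Cell aDG u) = 1}"
        by (auto simp: less_Suc_eq)
      then show ?thesis using I False dg by simp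
    next
      case True
      let ?q = "t (Var vqt)"
      let ?t = "sem ?c (t(Var vu := i))"
      have t: "?t (Var vqt) = Suc ?q" "?t (Cell aQ x) = (if x = ?q then i else t (Cell aQ x))" for x
        using True dg by simp_all
      have "i \<notin> (\<lambda>i. t (Cell aQ i)) ` {..<?q}" using I by simp
      then have "inj_on (\<lambda>x. if x = ?q then i else t (Cell aQ x)) (insert ?q {..<?q})"
        using I by (auto simp: inj_on_def)
      moreover have "(\<lambda>x. if x = ?q then i else t (Cell aQ x)) ` insert ?q {..<?q} =
          insert i ((\<lambda>i. t (Cell aQ i)) ` {..<?q})" by auto
      moreover have "insert i {u. u < i \<and> s (Cell aDG u) = 1} = {u. u < Suc i \<and> s (Cell aDG u) = 1}"
        using True by (auto simp: less_Suc_eq)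
      ultimately show ?thesis unfolding t lessThan_Suc using I by simp
    qed
  qed (use assms(1) in \<open>auto simp: keeps_def\<close>)
  then have "?I n s'" using assms(1) by (simp add: s'_def leaves_com_def)
  then show "inj_on (\<lambda>i. s' (Cell aQ i)) {..<s' (Var vqt)}"
    "(\<lambda>i. s' (Cell aQ i)) ` {..<s' (Var vqt)} = {u. u < n \<and> s (Cell aDG u) = 1}"
    "s' (Var vqt) \<le> i \<Longrightarrow> s' (Cell aQ i) = s (Cell aQ i)" by auto
qed

abbreviation "st_inv h t \<equiv> edge_list.strip_inv n (n - 1) (es 0) (es 1) h (\<lambda>i. t (Cell aQ i)) (t (Var vqt))
   (\<lambda>i. t (Cell aPA i)) (\<lambda>i. t (Cell aPE i)) (\<lambda>i. t (Cell aRK i)) (\<lambda>i. t (Cell aDG i))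
   (\<lambda>i. t (Cell aSN i)) (\<lambda>i. t (Cell aSE i))"

lemma strip_loop_correct:
  assumes el: "edge_list n (n - 1) (es 0) (es 1)" and s: "loaded s"
    and ac: "acyclic_graph (edge_list.edges (n - 1) (es 0) (es 1))" and i0: "st_inv 0 s"
    and c: "strip_com = (For vh vns1 c ;; d)"
  shows "st_inv (n - 1) (sem (For vh vns1 c) s)"
proof -
  have ceq: "c = (vv ::= At aQ (Rd vh) ;;
       vp ::= At aSN (Rd vv) ;;
       ve ::= At aSE (Rd vv) ;;
       Put aPA (Rd vv) (Rd vp) ;;
       Put aPE (Rd vv) (Rd ve) ;;
       Put aRK (Rd vv) (Rd vh) ;;
       Put aDG (Rd vp) (Minus (At aDG (Rd vp)) (Num 1)) ;;
       Put aSN (Rd vp) (Minus (At aSN (Rd vp)) (Rd vv)) ;;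
       Put aSE (Rd vp) (Minus (At aSE (Rd vp)) (Rd ve)) ;;
       IfEq (At aDG (Rd vp)) (Num 1) (
         Put aQ (Rd vqt) (Rd vp) ;;
         vqt ::= Plus (Rd vqt) (Num 1)))"
    using c by (simp add: strip_com_def)
  have "st_inv (s (Var vns1)) (sem (For vh vns1 c) s)"
  proof (rule For_loaded[where I = st_inv])
    fix h t assume h: "h < s (Var vns1)" and I: "st_inv h t"
    have h': "h < n - 1" using h s by simp
    let ?t = "sem c (t(Var vh := h))"
    let ?v = "t (Cell aQ h)"
    let ?p = "t (Cell aSN ?v)" and ?e = "t (Cell aSE ?v)"
    let ?q = "t (Cell aDG ?p) - 1 = 1"
    have 1: "(\<lambda>i. ?t (Cell aQ i)) = (if ?q then (\<lambda>i. t (Cell aQ i))(t (Var vqt) := ?p) else (\<lambda>i. t (Cell aQ i)))"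
      "?t (Var vqt) = (if ?q then t (Var vqt) + 1 else t (Var vqt))"
      "(\<lambda>i. ?t (Cell aPA i)) = (\<lambda>i. t (Cell aPA i))(?v := ?p)"
      "(\<lambda>i. ?t (Cell aPE i)) = (\<lambda>i. t (Cell aPE i))(?v := ?e)"
      "(\<lambda>i. ?t (Cell aRK i)) = (\<lambda>i. t (Cell aRK i))(?v := h)"
      "(\<lambda>i. ?t (Cell aDG i)) = (\<lambda>i. t (Cell aDG i))(?p := t (Cell aDG ?p) - 1)"
      "(\<lambda>i. ?t (Cell aSN i)) = (\<lambda>i. t (Cell aSN i))(?p := t (Cell aSN ?p) - ?v)"
      "(\<lambda>i. ?t (Cell aSE i)) = (\<lambda>i. t (Cell aSE i))(?p := t (Cell aSE ?p) - ?e)"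
      unfolding ceq by (auto simp: fun_eq_iff)
    show "st_inv (Suc h) ?t"
      unfolding 1 using edge_list.strip_step(1)[OF el I h' ac] by simp
  qed (use s i0 in \<open>auto simp: ceq keeps_def\<close>)
  then show ?thesis using s by simp
qed

lemma order_correct:
  assumes el: "edge_list n (n - 1) (es 0) (es 1)" and npos: "0 < n"
    and tree: "is_tree {..<n} (edge_list.edges (n - 1) (es 0) (es 1))" and s: "loaded s"
    and zero: "\<And>x. s (Cell aDG x) = 0" "\<And>x. s (Cell aSN x) = 0" "\<And>x. s (Cell aSE x) = 0"
      "\<And>x. s (Cell aQ x) = 0"
  defines "s' \<equiv> sem (degree_com ;; leaves_com ;; strip_com) s"
  defines "Q \<equiv> \<lambda>i. s' (Cell aQ i)" and "PA \<equiv> \<lambda>i. s' (Cell aPA i)" and "RK \<equiv> \<lambda>i. s' (Cell aRK i)"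
    and "PE \<equiv> \<lambda>i. s' (Cell aPE i)"
  shows "ptree n Q PA RK" "ptree.E n Q PA = edge_list.edges (n - 1) (es 0) (es 1)"
    "\<And>i. i < n - 1 \<Longrightarrow> PE (Q i) < n - 1 \<and> {Q i, PA (Q i)} = {es 0 (PE (Q i)), es 1 (PE (Q i))}"
    "s' (Var vroot) = Q (n - 1)" "loaded s'"
proof -
  interpret edge_list n "n - 1" "es 0" "es 1" by (rule el)
  obtain c where c: "strip_com = (For vh vns1 c ;;
      (vroot ::= At aQ (Rd vns1) ;; Put aRK (Rd vroot) (Rd vns1)))"
    unfolding strip_com_def by blast
  define s1 where "s1 = sem degree_com s"
  define s2 where "s2 = sem leaves_com s1"
  define s3 where "s3 = sem (For vh vns1 c) s2"
  have ac: "acyclic_graph edges" and cut: "cut_connected edges {..<n}"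
    using tree connected_cut by (auto simp: is_tree_def)
  have l1: "loaded s1" unfolding s1_def
    by (rule loaded_sem[OF s]) (simp add: keeps_def degree_com_def)
  have l2: "loaded s2" unfolding s2_def
    by (rule loaded_sem[OF l1]) (simp add: keeps_def leaves_com_def)
  have kc: "keeps (For vh vns1 c)" using c by (auto simp: strip_com_def keeps_def)
  have l3: "loaded s3" unfolding s3_def by (rule loaded_sem[OF l2 kc])
  have s': "s' = s3(Var vroot := s3 (Cell aQ (n - 1)), Cell aRK (s3 (Cell aQ (n - 1))) := n - 1)"
    using l3 by (simp add: s'_def c s1_def s2_def s3_def)
  show "loaded s'" using l3 by (simp add: s')
  show "s' (Var vroot) = Q (n - 1)" by (simp add: s' Q_def)
  have Q: "Q = (\<lambda>i. s3 (Cell aQ i))" and PA: "PA = (\<lambda>i. s3 (Cell aPA i))"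
    and PE: "PE = (\<lambda>i. s3 (Cell aPE i))"
    and RK: "RK = (\<lambda>i. s3 (Cell aRK i))(Q (n - 1) := n - 1)"
    by (auto simp: Q_def PA_def PE_def RK_def s')
  have other: "(\<Sum>k\<in>inc {..<n} x. if es 0 k = x then es 1 k else es 0 k) =
      (\<Sum>k\<in>inc {..<n} x. es 0 k + es 1 k - x)" for x
  proof (rule sum.cong[OF refl])
    fix k assume "k \<in> inc {..<n} x"
    then have "x = es 0 k \<or> x = es 1 k" unfolding inc_def by auto
    then show "(if es 0 k = x then es 1 k else es 0 k) = es 0 k + es 1 k - x" by auto
  qed
  have arr1: "s1 (Cell aDG x) = card (inc {..<n} x)"
    "s1 (Cell aSN x) = (\<Sum>k\<in>inc {..<n} x. es 0 k + es 1 k - x)" "s1 (Cell aSE x) = \<Sum>(inc {..<n} x)" for x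
    using degree_correct[OF s zero(1-3)] unfolding s1_def acc_inc other by simp_all
  have arr2: "s2 (Cell aDG x) = s1 (Cell aDG x)" "s2 (Cell aSN x) = s1 (Cell aSN x)"
    "s2 (Cell aSE x) = s1 (Cell aSE x)" for x
    unfolding s2_def by (rule sem_frame, simp add: leaves_com_def)+
  note lv = leaves_correct[OF l1, folded s2_def]
  have main: "ptree n Q PA RK \<and> ptree.E n Q PA = edges \<and>
    (\<forall>i<n - 1. PE (Q i) < n - 1 \<and> {Q i, PA (Q i)} = {es 0 (PE (Q i)), es 1 (PE (Q i))})"
  \<comment> \<open>A lone node has degree 0 and is never queued, so the queue invariant fails for
    it and the tree without edges is verified directly.\<close>
  proof (cases "n = 1")
    case True
    have none: "inc {..<n} 0 = {}" using True unfolding inc_def by simp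
    have "s1 (Cell aDG 0) = 0" unfolding arr1(1) none by simp
    then have "{u. u < n \<and> s1 (Cell aDG u) = 1} = {}" using True by auto
    then have "s2 (Var vqt) = 0" using lv(2) by auto
    then have "s2 (Cell aQ 0) = s1 (Cell aQ 0)" using lv(3)[of 0] by simp
    also have "\<dots> = 0" unfolding s1_def using zero(4) sem_frame[of degree_com "Cell aQ 0" s]
      by (simp add: degree_com_def)
    finally have Q0: "Q 0 = 0" using True l2 unfolding Q s3_def by simp
    have "ptree n Q PA RK" using True Q0 by unfold_locales (auto simp: RK)
    moreover from this have "ptree.E n Q PA = edges"
      unfolding ptree.E_od[OF \<open>ptree n Q PA RK\<close>] edges_def using True by simp
    ultimately show ?thesis using True by simp
  next
    case False
    \<comment> \<open>Connectivity with at least two nodes excludes degree 0, so degree 1 and degree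
      at most 1 agree initially.\<close>
    have dg1: "s1 (Cell aDG u) \<noteq> 0" if "u < n" for u
    proof -
      have "u \<in> {..<n}" "2 \<le> card {..<n}" using that False npos by auto
      from cut_connected_nbr[OF cut this] obtain w where "w < n" "{u, w} \<in> edges" by blast
      then obtain k where "k < n - 1" "{u, w} = {es 0 k, es 1 k}" unfolding edges_def by blast
      then have "k \<in> inc {..<n} u" using that \<open>w < n\<close> ab[of k] unfolding inc_def by auto
      then have "inc {..<n} u \<noteq> {}" by blast
      then show ?thesis unfolding arr1(1) card_0_eq[OF finite_inc] .
    qed
    have "s2 (Cell aDG u) \<le> 1 \<longleftrightarrow> u \<in> (\<lambda>i. s2 (Cell aQ i)) ` {0..<s2 (Var vqt)}" if "u < n" for u
    proof -
      have "u \<in> (\<lambda>i. s2 (Cell aQ i)) ` {0..<s2 (Var vqt)} \<longleftrightarrow> s1 (Cell aDG u) = 1"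
        unfolding lessThan_atLeast0[symmetric] lv(2) using that by simp
      then show ?thesis using dg1[OF that] arr2(1)[of u] by linarith
    qed
    then have "st_inv 0 s2"
      unfolding strip_inv_def Let_def using cut lv(1,2) arr1 arr2 by auto
    from strip_loop_correct[OF el l2 ac this c] have inv: "st_inv (n - 1) s3"
      unfolding s3_def .
    show ?thesis
      using strip_final[OF inv npos] unfolding Q PA PE RK by auto
  qed
  then show "ptree n Q PA RK" "ptree.E n Q PA = edges"
    "\<And>i. i < n - 1 \<Longrightarrow> PE (Q i) < n - 1 \<and> {Q i, PA (Q i)} = {es 0 (PE (Q i)), es 1 (PE (Q i))}"
    by auto
qed

end

section \<open>The cost tables refine the min-plus recursion\<close>

section \<open>The dynamic program\<close>

definition dec :: "nat \<Rightarrow> enat" where "dec x = (if x = 0 then \<infinity> else enat (x - 1))"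

lemma dec_simps [simp]: "dec 0 = \<infinity>" "dec (Suc c) = enat c"
  by (simp_all add: dec_def)

lemma dec_add: "0 < x \<Longrightarrow> 0 < y \<Longrightarrow> dec (x + y - 1) = dec x + dec y"
  by (cases x; cases y) auto

lemma dec_le: "0 < x \<Longrightarrow> 0 < y \<Longrightarrow> dec x \<le> dec y \<longleftrightarrow> x \<le> y"
  by (cases x; cases y) auto

lemma dec_infinite: "dec x = \<infinity> \<longleftrightarrow> x = 0"
  by (simp add: dec_def)

lemma row_eq:
  assumes "j \<le> N" "j' \<le> N"
  shows "u * Suc N + j = u' * Suc N + j' \<longleftrightarrow> u = u' \<and> j = j'"
proof
  assume "u * Suc N + j = u' * Suc N + j'"
  then have "(u * Suc N + j) div Suc N = (u' * Suc N + j') div Suc N"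
    "(u * Suc N + j) mod Suc N = (u' * Suc N + j') mod Suc N" by simp_all
  then show "u = u' \<and> j = j'" using assms by (simp only: div_mult_self3 mod_mult_self3) simp
qed simp

context prog_input
begin

lemma edge_correct:
  assumes "loaded s"
  shows "sem edge_com s (Cell aF x) = (if s (Var vrv) < x \<and> x < s (Var vrv) + N
     then (if s (Var vec) < 2 then 0 else if 0 < s (Cell aF x) then s (Cell aF x) + (s (Var vw) + s (Var vw))
       else 0) else s (Cell aF x))"
proof -
  let ?g = "\<lambda>x. if s (Var vec) < 2 then 0 else if 0 < s (Cell aF x)
    then s (Cell aF x) + (s (Var vw) + s (Var vw)) else 0"
  let ?I = "\<lambda>i t. \<forall>x. t (Cell aF x) = (if s (Var vrv) < x \<and> x < s (Var vrv) + N \<and> x < s (Var vrv) + i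
    then ?g x else s (Cell aF x))"
  have "?I (s (Var vnr1)) (sem edge_com s)"
    unfolding edge_com_def
  proof (rule For_loaded[where I = ?I])
    fix i t
    assume I: "?I i t" and l: "loaded t" and fr: "\<And>l. \<not> may (For va vnr1
      (IfLess (Num 0) (Rd va)
         (IfLess (Rd va) (Rd vnr)
           (IfLess (Rd vec) (Num 2)
             (Put aF (Plus (Rd vrv) (Rd va)) (Num 0))
             (IfLess (Num 0) (At aF (Plus (Rd vrv) (Rd va)))
               (Put aF (Plus (Rd vrv) (Rd va))
                 (Plus (At aF (Plus (Rd vrv) (Rd va))) (Plus (Rd vw) (Rd vw))))
               Skip))
           Skip)
         Skip)) l \<Longrightarrow> t l = s l"
    have v: "t (Var vrv) = s (Var vrv)" "t (Var vec) = s (Var vec)" "t (Var vw) = s (Var vw)"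
      by (rule fr, simp)+
    show "?I (Suc i) (sem (IfLess (Num 0) (Rd va)
         (IfLess (Rd va) (Rd vnr)
           (IfLess (Rd vec) (Num 2)
             (Put aF (Plus (Rd vrv) (Rd va)) (Num 0))
             (IfLess (Num 0) (At aF (Plus (Rd vrv) (Rd va)))
               (Put aF (Plus (Rd vrv) (Rd va))
                 (Plus (At aF (Plus (Rd vrv) (Rd va))) (Plus (Rd vw) (Rd vw))))
               Skip))
           Skip)
         Skip) (t(Var va := i)))"
      using I l v by (auto simp: less_Suc_eq)
  qed (use assms in \<open>auto simp: keeps_def\<close>)
  then show ?thesis using assms by auto
qed

definition val :: "state \<Rightarrow> nat \<Rightarrow> nat \<Rightarrow> nat \<Rightarrow> nat \<Rightarrow> enat" where
  "val s rv rp j a = dec (s (Cell aF (rp + (j - a)))) + dec (s (Cell aF (rv + a)))"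

text \<open>As long as no finite value is found, \<open>varg\<close> keeps its default 0; if that is
  still so at the end, all candidates are infinite and 0 is a valid minimiser.\<close>

lemma min_correct:
  assumes "loaded s" and j: "s (Var vj) \<le> N"
  defines "s' \<equiv> sem min_com s" and "w \<equiv> val s (s (Var vrv)) (s (Var vrp)) (s (Var vj))"
  shows "s' (Var varg) \<le> s (Var vj) \<and> dec (s' (Var vbest)) = w (s' (Var varg)) \<and>
    (\<forall>a\<le>s (Var vj). dec (s' (Var vbest)) \<le> w a)"
proof -
  let ?j = "s (Var vj)" and ?s0 = "s(Var vbest := 0, Var varg := 0)"
  let ?c = "IfLess (Rd vj) (Rd va) Skip (
         vu ::= At aF (Plus (Rd vrv) (Rd va)) ;;
         vc ::= At aF (Plus (Rd vrp) (Minus (Rd vj) (Rd va))) ;;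
         IfLess (Num 0) (Rd vu)
           (IfLess (Num 0) (Rd vc)
             (vz ::= Minus (Plus (Rd vu) (Rd vc)) (Num 1) ;;
              IfLess (Num 0) (Rd vbest)
                (IfLess (Rd vz) (Rd vbest) (vbest ::= Rd vz ;; varg ::= Rd va) Skip)
                (vbest ::= Rd vz ;; varg ::= Rd va))
             Skip)
           Skip)"
  let ?I = "\<lambda>i t. t (Var varg) \<le> ?j \<and> (t (Var vbest) = 0 \<or> dec (t (Var vbest)) = w (t (Var varg))) \<and>
    (\<forall>a\<le>?j. a < i \<longrightarrow> dec (t (Var vbest)) \<le> w a)"
  have "?I (?s0 (Var vnr1)) (sem (For va vnr1 ?c) ?s0)"
  proof (rule For_loaded[where I = ?I])
    fix i t
    assume I: "?I i t" and fr: "\<And>l. \<not> may (For va vnr1 ?c) l \<Longrightarrow> t l = ?s0 l"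
    have v: "t (Var vrv) = s (Var vrv)" "t (Var vrp) = s (Var vrp)" "t (Var vj) = ?j"
      "t (Cell aF x) = s (Cell aF x)" for x
      by (subst fr; simp)+
    let ?t = "sem ?c (t(Var va := i))"
    let ?x = "s (Cell aF (s (Var vrv) + i))" and ?y = "s (Cell aF (s (Var vrp) + (?j - i)))"
    have w: "w i = dec ?y + dec ?x" by (simp add: w_def val_def)
    consider "?j < i" | "i \<le> ?j" "?x = 0 \<or> ?y = 0" | "i \<le> ?j" "0 < ?x" "0 < ?y" by linarith
    then show "?I (Suc i) ?t"
    proof cases
      case 1
      then show ?thesis using I v by (auto simp: less_Suc_eq)
    next
      case 2
      then have "w i = \<infinity>" using w by auto
      moreover have "?t (Var varg) = t (Var varg)" "?t (Var vbest) = t (Var vbest)" using 2 v by auto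
      ultimately show ?thesis using I by (auto simp: less_Suc_eq)
    next
      case 3
      let ?z = "?x + ?y - 1"
      have z: "w i = dec ?z" "0 < ?z" using w 3 dec_add[of ?x ?y] by (auto simp: add.commute)
      show ?thesis
      proof (cases "t (Var vbest) = 0 \<or> ?z < t (Var vbest)")
        case True
        then have t: "?t (Var varg) = i" "?t (Var vbest) = ?z" using 3 v by auto
        have "dec ?z \<le> dec (t (Var vbest))"
          using True z(2) by (cases "t (Var vbest) = 0") (auto simp: dec_le)
        then show ?thesis using I z(1) 3 unfolding t by (auto simp: less_Suc_eq intro: order_trans)
      next
        case False
        then have t: "?t (Var varg) = t (Var varg)" "?t (Var vbest) = t (Var vbest)" using 3 v by auto
        have "dec (t (Var vbest)) \<le> dec ?z" using False z(2) by (subst dec_le) auto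
        then show ?thesis using I z(1) 3 unfolding t by (auto simp: less_Suc_eq)
      qed
    qed
  qed (use assms(1) in \<open>auto simp: keeps_def\<close>)
  moreover have "s' = sem (For va vnr1 ?c) ?s0" by (simp add: s'_def min_com_def)
  ultimately have I: "?I (Suc N) s'" using assms(1) by simp
  show ?thesis
  proof (cases "s' (Var vbest) = 0")
    case True
    then have "w a = \<infinity>" if "a \<le> ?j" for a using I that j by (metis dec_simps(1) enat_ord_simps(5) le_less_trans less_Suc_eq_le)
    then show ?thesis using I True by auto
  qed (use I j in auto)
qed

text \<open>Because \<open>j\<close> decreases, the parent entries read for the current
  \<open>j\<close> still have their old values. The rows of leaf and parent are disjoint, so the
  leaf row is constant throughout.\<close>

lemma merge_correct:
  assumes l: "loaded s" and disj: "\<And>a b. a \<le> N \<Longrightarrow> b \<le> N \<Longrightarrow> s (Var vrv) + a \<noteq> s (Var vrp) + b"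
  defines "rv \<equiv> s (Var vrv)" and "rp \<equiv> s (Var vrp)"
  defines "s' \<equiv> sem merge_com s"
  shows "\<And>x. (\<And>j. j \<le> N \<Longrightarrow> x \<noteq> rp + j) \<Longrightarrow> s' (Cell aF x) = s (Cell aF x)"
    "\<And>x. (\<And>j. j \<le> N \<Longrightarrow> x \<noteq> rv + j) \<Longrightarrow> s' (Cell aCH x) = s (Cell aCH x)"
    "\<And>j. j \<le> N \<Longrightarrow> s' (Cell aCH (rv + j)) \<le> j \<and>
       dec (s' (Cell aF (rp + j))) = val s rv rp j (s' (Cell aCH (rv + j))) \<and>
       (\<forall>a\<le>j. dec (s' (Cell aF (rp + j))) \<le> val s rv rp j a)"
proof -
  let ?c = "vj ::= Minus (Rd vnr) (Rd vt) ;;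
       min_com ;;
       Put aF (Plus (Rd vrp) (Rd vj)) (Rd vbest) ;;
       Put aCH (Plus (Rd vrv) (Rd vj)) (Rd varg)"
  let ?I = "\<lambda>i t. (\<forall>x. (\<forall>j\<le>N. x \<noteq> rp + j) \<longrightarrow> t (Cell aF x) = s (Cell aF x)) \<and>
    (\<forall>x. (\<forall>j\<le>N. x \<noteq> rv + j) \<longrightarrow> t (Cell aCH x) = s (Cell aCH x)) \<and>
    (\<forall>j\<le>N. j + i \<le> N \<longrightarrow> t (Cell aF (rp + j)) = s (Cell aF (rp + j))) \<and>
    (\<forall>j\<le>N. N < j + i \<longrightarrow> t (Cell aCH (rv + j)) \<le> j \<and>
       dec (t (Cell aF (rp + j))) = val s rv rp j (t (Cell aCH (rv + j))) \<and>
       (\<forall>a\<le>j. dec (t (Cell aF (rp + j))) \<le> val s rv rp j a))"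
  have "?I (s (Var vnr1)) s'"
    unfolding s'_def merge_com_def
  proof (rule For_loaded[where I = ?I])
    fix i t
    assume i: "i < s (Var vnr1)" and I: "?I i t" and lt: "loaded t"
      and fr: "\<And>l. \<not> may (For vt vnr1 ?c) l \<Longrightarrow> t l = s l"
    have iN: "i \<le> N" using i l by simp
    have v: "t (Var vrv) = rv" "t (Var vrp) = rp"
      unfolding rv_def rp_def by (rule fr, simp add: min_com_def)+
    let ?j = "N - i"
    define t1 where "t1 = t(Var vt := i, Var vj := ?j)"
    define t2 where "t2 = sem min_com t1"
    let ?t = "sem ?c (t(Var vt := i))"
    have l1: "loaded t1" using lt by (simp add: t1_def)
    have fr2: "\<And>l. \<not> may min_com l \<Longrightarrow> t2 l = t1 l" unfolding t2_def by (rule sem_frame)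
    have v2: "t2 (Var vrv) = rv" "t2 (Var vrp) = rp" "t2 (Var vj) = ?j"
      "t2 (Cell aF x) = t (Cell aF x)" "t2 (Cell aCH x) = t (Cell aCH x)" for x
      using v by (subst fr2; simp add: min_com_def t1_def)+
    have "t1 (Var vj) \<le> N" by (simp add: t1_def)
    note m = min_correct[OF l1 this, folded t2_def]
    have "t (Cell aF (rp + (?j - a))) = s (Cell aF (rp + (?j - a)))" if "a \<le> ?j" for a
    proof -
      have "?j - a \<le> N" "?j - a + i \<le> N" using that iN by auto
      then show ?thesis using I by blast
    qed
    moreover have "t (Cell aF (rv + a)) = s (Cell aF (rv + a))" if "a \<le> ?j" for a
      using I disj[of a] that by (auto simp: rv_def rp_def)
    ultimately have val: "val t1 rv rp ?j a = val s rv rp ?j a" if "a \<le> ?j" for a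
      using that by (simp add: val_def t1_def)
    have tv: "?t (Cell aF x) = (if x = rp + ?j then t2 (Var vbest) else t (Cell aF x))"
      "?t (Cell aCH x) = (if x = rv + ?j then t2 (Var varg) else t (Cell aCH x))" for x
      using lt v2 by (simp_all add: t1_def[symmetric] t2_def[symmetric])
    have t1v: "t1 (Var vrv) = rv" "t1 (Var vrp) = rp" "t1 (Var vj) = ?j" using v by (simp_all add: t1_def)
    have new: "t2 (Var varg) \<le> ?j" "dec (t2 (Var vbest)) = val s rv rp ?j (t2 (Var varg))"
      "\<And>a. a \<le> ?j \<Longrightarrow> dec (t2 (Var vbest)) \<le> val s rv rp ?j a"
      using m val unfolding t1v by auto
    show "?I (Suc i) ?t"
      unfolding tv
    proof (intro conjI allI impI)
      fix x assume x: "\<forall>j\<le>N. x \<noteq> rp + j"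
      then have "x \<noteq> rp + ?j" using diff_le_self by blast
      then show "(if x = rp + ?j then t2 (Var vbest) else t (Cell aF x)) = s (Cell aF x)"
        using I x by (simp only: if_False)
    next
      fix x assume x: "\<forall>j\<le>N. x \<noteq> rv + j"
      then have "x \<noteq> rv + ?j" using diff_le_self by blast
      then show "(if x = rv + ?j then t2 (Var varg) else t (Cell aCH x)) = s (Cell aCH x)"
        using I x by (simp only: if_False)
    next
      fix j assume j: "j \<le> N" "N < j + Suc i"
      have "j = ?j \<or> N < j + i" using j iN by linarith
      then show "(if rv + j = rv + ?j then t2 (Var varg) else t (Cell aCH (rv + j))) \<le> j"
        "dec (if rp + j = rp + ?j then t2 (Var vbest) else t (Cell aF (rp + j))) =
          val s rv rp j (if rv + j = rv + ?j then t2 (Var varg) else t (Cell aCH (rv + j)))"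
        "\<And>a. a \<le> j \<Longrightarrow> dec (if rp + j = rp + ?j then t2 (Var vbest) else t (Cell aF (rp + j))) \<le>
          val s rv rp j a"
        using new I j by auto
    qed (use I iN in auto)
  qed (use l in \<open>auto simp: keeps_def min_com_def\<close>)
  moreover have "s (Var vnr1) = Suc N" using l by simp
  ultimately have I: "?I (Suc N) s'" by (simp only:)
  show "\<And>x. (\<And>j. j \<le> N \<Longrightarrow> x \<noteq> rp + j) \<Longrightarrow> s' (Cell aF x) = s (Cell aF x)"
    using I by blast
  show "\<And>x. (\<And>j. j \<le> N \<Longrightarrow> x \<noteq> rv + j) \<Longrightarrow> s' (Cell aCH x) = s (Cell aCH x)"
    using I by blast
  fix j assume "j \<le> N"
  moreover from this have "N < j + Suc N" by simp
  ultimately show "s' (Cell aCH (rv + j)) \<le> j \<and>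
       dec (s' (Cell aF (rp + j))) = val s rv rp j (s' (Cell aCH (rv + j))) \<and>
       (\<forall>a\<le>j. dec (s' (Cell aF (rp + j))) \<le> val s rv rp j a)"
    using I by blast
qed

lemma init_correct:
  assumes l: "loaded s"
  defines "s' \<equiv> sem init_com s"
  shows "u < n \<Longrightarrow> s' (Cell aRO u) = u * Suc N"
    "u < n \<Longrightarrow> j \<le> N \<Longrightarrow> dec (s' (Cell aF (u * Suc N + j))) =
       (if j \<le> cap u then enat (j * cost u) else \<infinity>)"
proof -
  let ?b = "IfLess (n_cap (Rd vu)) (Rd vj)
           (Put aF (Plus (Rd vr) (Rd vj)) (Num 0))
           (Put aF (Plus (Rd vr) (Rd vj)) (Rd vc)) ;;
         vc ::= Plus (Rd vc) (n_cost (Rd vu))"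
  let ?c = "Put aRO (Rd vu) (Rd vr) ;;
       vc ::= Num 1 ;;
       For vj vnr1 ?b ;;
       vr ::= Plus (Rd vr) (Rd vnr1)"
  let ?val = "\<lambda>u j. (if j \<le> cap u then enat (j * cost u) else \<infinity>)"
  let ?I = "\<lambda>i t. t (Var vr) = i * Suc N \<and> (\<forall>u<i. t (Cell aRO u) = u * Suc N \<and>
    (\<forall>j\<le>N. dec (t (Cell aF (u * Suc N + j))) = ?val u j))"
  let ?s0 = "s(Var vr := 0)"
  have "?I (?s0 (Var vns)) (sem (For vu vns ?c) ?s0)"
  proof (rule For_loaded[where I = ?I])
    fix u t assume I: "?I u t" and lt: "loaded t"
    let ?t0 = "t(Var vu := u, Cell aRO u := t (Var vr), Var vc := 1)"
    let ?r = "u * Suc N"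
    define t1 where "t1 = sem (For vj vnr1 ?b) ?t0"
    let ?J = "\<lambda>i t'. t' (Var vc) = 1 + i * cost u \<and>
      (\<forall>j<i. dec (t' (Cell aF (?r + j))) = ?val u j) \<and>
      (\<forall>x<?r. t' (Cell aF x) = t (Cell aF x))"
    have "?J (?t0 (Var vnr1)) t1"
      unfolding t1_def
    proof (rule For_loaded[where I = ?J])
      fix i t' assume J: "?J i t'" and lt': "loaded t'" and fr: "\<And>l. \<not> may (For vj vnr1 ?b) l \<Longrightarrow> t' l = ?t0 l"
      have v: "t' (Var vu) = u" "t' (Var vr) = ?r" using I by (subst fr; simp)+
      show "?J (Suc i) (sem ?b (t'(Var vj := i)))"
      proof -
        let ?t' = "sem ?b (t'(Var vj := i))"
        have "?t' (Cell aF x) = (if x = ?r + i then if cap u < i then 0 else Suc (i * cost u)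
            else t' (Cell aF x))" "?t' (Var vc) = 1 + Suc i * cost u" for x
          using J lt' v by simp_all
        then show ?thesis using J by (simp add: less_Suc_eq)
      qed
    qed (use lt in \<open>auto simp: keeps_def\<close>)
    then have J: "?J (Suc N) t1" using lt by simp
    have fr: "\<And>l. \<not> may (For vj vnr1 ?b) l \<Longrightarrow> t1 l = ?t0 l" unfolding t1_def by (rule sem_frame)
    have l1: "loaded t1" unfolding t1_def by (rule loaded_sem) (use lt in \<open>auto simp: keeps_def\<close>)
    have v: "t1 (Var vr) = ?r" "t1 (Cell aRO x) = (if x = u then ?r else t (Cell aRO x))" for x
      using I by (subst fr; simp)+
    have t: "sem ?c (t(Var vu := u)) = t1(Var vr := ?r + Suc N)"
      using v l1 by (simp add: t1_def)
    have "dec (t1 (Cell aF (u' * Suc N + j))) = ?val u' j" if "u' < Suc u" "j \<le> N" for u' j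
    proof (cases "u' = u")
      case False
      have "u' * Suc N + j < Suc u' * Suc N" using that(2) by simp
      also have "\<dots> \<le> ?r" using that(1) False by (intro mult_right_mono) auto
      finally show ?thesis using J I that False by (auto simp: less_Suc_eq)
    qed (use J that in auto)
    then show "?I (Suc u) (sem ?c (t(Var vu := u)))"
      unfolding t using v I by (auto simp: less_Suc_eq)
  qed (use l in \<open>auto simp: keeps_def\<close>)
  then have "?I n s'" using l by (simp add: s'_def init_com_def)
  then show "u < n \<Longrightarrow> s' (Cell aRO u) = u * Suc N"
    "u < n \<Longrightarrow> j \<le> N \<Longrightarrow> dec (s' (Cell aF (u * Suc N + j))) = ?val u j" by auto
qed

end

locale valid_input = prog_input inp for inp +
  fixes I :: "(nat, nat) univne"
  assumes cyc: "is_cycle (VR I) (ER I)" and VR_eq: "VR I = {..<N}"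
    and ER_eq: "ER I = (\<lambda>k. {eu k, ew k}) ` {..<N}" and inj_ER: "inj_on (\<lambda>k. {eu k, ew k}) {..<N}"
    and npos: "0 < n" and VS_eq: "VS I = {..<n}" and el: "edge_list n (n - 1) (es 0) (es 1)"
    and ES_eq: "ES I = edge_list.edges (n - 1) (es 0) (es 1)" and tree: "is_tree (VS I) (ES I)"
    and node_eq: "\<And>u. u < n \<Longrightarrow> node_cap I u = cap u \<and> node_cost I u = cost u"
    and edge_eq: "\<And>k. k < n - 1 \<Longrightarrow>
      edge_cap I {es 0 k, es 1 k} = es 2 k \<and> edge_cost I {es 0 k, es 1 k} = es 3 k"

locale ordered_input = valid_input inp I + cycle_into_tree "prog_input.n inp" od pa rk I "prog_input.N inp" X
  for inp I od pa rk X +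
  fixes pe :: "nat \<Rightarrow> nat"
  assumes pe: "\<And>i. i < n - 1 \<Longrightarrow> pe (od i) < n - 1 \<and> {od i, pa (od i)} = {es 0 (pe (od i)), es 1 (pe (od i))}"
begin

text \<open>The equalities hold for all indices, not only valid ones, because \<open>od\<close>,
  \<open>pa\<close> and the others are taken to be the array contents themselves.\<close>

definition tables :: "state \<Rightarrow> bool" where
  "tables s \<longleftrightarrow> loaded s \<and> (\<forall>i. s (Cell aQ i) = od i \<and> s (Cell aPA i) = pa i \<and>
     s (Cell aRK i) = rk i \<and> s (Cell aPE i) = pe i \<and> s (Cell aX i) = X i) \<and> s (Var vroot) = root"

lemma tables_Var [simp]:
  "x \<notin> {vnr, vns, vo1, vo2, vnr1, vns1, vroot} \<Longrightarrow> tables (s(Var x := v)) = tables s"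
  by (simp add: tables_def)

lemma tables_Cell [simp]: "k \<notin> {0, aQ, aPA, aRK, aPE, aX} \<Longrightarrow> tables (s(Cell k i := v)) = tables s"
  by (simp add: tables_def)

lemma tables_ev [simp]:
  assumes "tables s"
  shows "loaded s" "s (Cell aQ i) = od i" "s (Cell aPA i) = pa i" "s (Cell aRK i) = rk i"
    "s (Cell aPE i) = pe i" "s (Cell aX i) = X i" "s (Var vroot) = root"
  using assms by (simp_all add: tables_def)

definition keeps_tables :: "com \<Rightarrow> bool" where
  "keeps_tables c \<longleftrightarrow> keeps c \<and> \<not> may c (Var vroot) \<and>
     (\<forall>k\<in>{aQ, aPA, aRK, aPE, aX}. \<forall>i. \<not> may c (Cell k i))"

lemma tables_cong:
  assumes "tables s0" "keeps_tables c" and fr: "\<And>l. \<not> may c l \<Longrightarrow> s l = s0 l"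
  shows "tables s"
proof -
  have "loaded s" using assms by (intro loaded_cong[of s0 c s]) (auto simp: keeps_tables_def)
  moreover have "s (Var vroot) = s0 (Var vroot)"
    by (rule fr) (use assms(2) in \<open>auto simp: keeps_tables_def\<close>)
  moreover have "s (Cell k i) = s0 (Cell k i)" if "k \<in> {aQ, aPA, aRK, aPE, aX}" for k i
    by (rule fr) (use assms(2) that in \<open>auto simp: keeps_tables_def\<close>)
  ultimately show ?thesis using assms(1) unfolding tables_def by simp
qed

lemma tables_sem: "tables s \<Longrightarrow> keeps_tables c \<Longrightarrow> tables (sem c s)"
  by (erule (1) tables_cong) (rule sem_frame)

lemma For_tables:
  assumes "tables s0" "keeps_tables (For x y c)" "J 0 s0"
    and step: "\<And>i s. i < s0 (Var y) \<Longrightarrow> J i s \<Longrightarrow> tables s \<Longrightarrow>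
      (\<And>l. \<not> may (For x y c) l \<Longrightarrow> s l = s0 l) \<Longrightarrow> J (Suc i) (sem c (s(Var x := i)))"
  shows "J (s0 (Var y)) (sem (For x y c) s0)"
proof (rule For_inv)
  fix i s assume i: "i < s0 (Var y)" "J i s" and fr: "\<And>l. \<not> may (For x y c) l \<Longrightarrow> s l = s0 l"
  show "J (Suc i) (sem c (s(Var x := i)))"
    by (rule step[OF i tables_cong[OF assms(1,2) fr] fr])
qed (rule assms(3))

definition rows :: "state \<Rightarrow> bool" where "rows s \<longleftrightarrow> (\<forall>u<n. s (Cell aRO u) = u * Suc N)"

lemma min_choice:
  assumes "c \<le> j" "x = DP h (pa (od h)) (j - c) + (DP h (od h) c + ec (od h) c)"
    "\<And>a. a \<le> j \<Longrightarrow> x \<le> DP h (pa (od h)) (j - a) + (DP h (od h) a + ec (od h) a)"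
  shows "x = DP (Suc h) (pa (od h)) j" "choice h j c"
proof -
  obtain a where "choice h j a" using choice_exists by blast
  then have "x \<le> DP (Suc h) (pa (od h)) j" using assms(3)[of a] by (simp add: choice_def)
  moreover have "DP (Suc h) (pa (od h)) j \<le> x" using DP_le[OF assms(1)] assms(2) by simp
  ultimately show "x = DP (Suc h) (pa (od h)) j" by simp
  then show "choice h j c" using assms(1,2) by (simp add: choice_def)
qed

text \<open>The invariant speaks only about the rows of nodes alive: the row of the leaf is spoiled
  by adding the edge cost, but that node leaves the set in the same step. The choices recorded for
  earlier leaves lie in rows of their own and are not touched again.\<close>

lemma dp_correct:
  assumes s: "tables s" "rows s"
    and init: "\<And>u j. u < n \<Longrightarrow> j \<le> N \<Longrightarrow> dec (s (Cell aF (u * Suc N + j))) = F0 u j"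
  defines "s' \<equiv> sem dp_com s"
  shows "dec (s' (Cell aF (root * Suc N + N))) = optimum"
    "\<And>i j. i < n - 1 \<Longrightarrow> j \<le> N \<Longrightarrow> choice i j (s' (Cell aCH (od i * Suc N + j)))"
proof -
  let ?c = "vv ::= At aQ (Rd vh) ;;
       vp ::= At aPA (Rd vv) ;;
       vrv ::= At aRO (Rd vv) ;;
       vrp ::= At aRO (Rd vp) ;;
       vec ::= es_at 2 (At aPE (Rd vv)) ;;
       vw ::= es_at 3 (At aPE (Rd vv)) ;;
       edge_com ;;
       merge_com"
  let ?J = "\<lambda>h t. (\<forall>u\<in>alive h. \<forall>j\<le>N. dec (t (Cell aF (u * Suc N + j))) = DP h u j) \<and>
    (\<forall>i<h. \<forall>j\<le>N. choice i j (t (Cell aCH (od i * Suc N + j))))"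
  have "?J (s (Var vns1)) s'"
    unfolding s'_def dp_com_def
  proof (rule For_tables[where J = ?J])
    fix h t assume h: "h < s (Var vns1)" and J: "?J h t" and t: "tables t"
      and fr: "\<And>l. \<not> may (For vh vns1 ?c) l \<Longrightarrow> t l = s l"
    have h: "h < n - 1" "h < n" using h s(1) by simp_all
    let ?v = "od h" and ?p = "pa (od h)"
    let ?rv = "?v * Suc N" and ?rp = "?p * Suc N" and ?k = "pe ?v"
    have vp: "?v < n" "?p < n" "?v \<noteq> ?p" "?v \<in> alive h" "?p \<in> alive h"
      using od_notroot[OF h(1)] pa_alive[OF h(1)] alive_Suc[OF h(2)] by (auto simp: alive_iff)
    have "t (Cell aRO u) = s (Cell aRO u)" for u
      by (rule fr) (simp add: edge_com_def merge_com_def min_com_def)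
    then have ro: "t (Cell aRO u) = u * Suc N" if "u < n" for u using s(2) that by (simp add: rows_def)
    define t1 where "t1 = t(Var vh := h, Var vv := ?v, Var vp := ?p, Var vrv := ?rv, Var vrp := ?rp,
      Var vec := es 2 ?k, Var vw := es 3 ?k)"
    define t2 where "t2 = sem edge_com t1"
    define t3 where "t3 = sem merge_com t2"
    have t3: "sem ?c (t(Var vh := h)) = t3"
      using t ro[OF vp(1)] ro[OF vp(2)] by (simp add: t3_def t2_def t1_def)
    have l1: "loaded t1" using t by (simp add: t1_def)
    have l2: "loaded t2" unfolding t2_def by (rule loaded_sem[OF l1]) (simp add: keeps_def edge_com_def)
    have v1: "t1 (Var vrv) = ?rv" "t1 (Var vec) = es 2 ?k" "t1 (Var vw) = es 3 ?k"
      "t1 (Cell aF x) = t (Cell aF x)" for x by (simp_all add: t1_def)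
    note e = edge_correct[OF l1, folded t2_def, unfolded v1]
    have v2: "t2 (Var vrv) = ?rv" "t2 (Var vrp) = ?rp" "t2 (Cell aCH x) = t (Cell aCH x)" for x
      unfolding t2_def by (subst sem_frame; simp add: edge_com_def t1_def)+
    have row_v: "dec (t2 (Cell aF (?rv + a))) = DP h ?v a + ec ?v a" if a: "a \<le> N" for a
    proof -
      have cap: "edge_cap I {?v, ?p} = es 2 ?k" "edge_cost I {?v, ?p} = es 3 ?k"
        using pe[OF h(1)] edge_eq[of ?k] by auto
      have D: "dec (t (Cell aF (?rv + a))) = DP h ?v a" using J vp(4) a by blast
      let ?x = "t (Cell aF (?rv + a))"
      have T: "t2 (Cell aF (?rv + a)) = (if 0 < a \<and> a < N then (if es 2 ?k < 2 then 0
        else if 0 < ?x then ?x + (es 3 ?k + es 3 ?k) else 0) else ?x)"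
        unfolding e by auto
      show ?thesis
      proof (cases "a = 0 \<or> N \<le> a")
        case True
        then show ?thesis unfolding T using D by (auto simp: ec_def)
      next
        case False
        show ?thesis
        proof (cases "?x")
          case 0
          then show ?thesis unfolding T D[symmetric] using False by simp
        next
          case (Suc c)
          then show ?thesis unfolding T D[symmetric] using False by (simp add: ec_def cap mult_2)
        qed
      qed
    qed
    have row_u: "t2 (Cell aF (u * Suc N + a)) = t (Cell aF (u * Suc N + a))" if "u \<noteq> ?v" "a \<le> N" for u a
    proof -
      have "\<not> (?rv < u * Suc N + a \<and> u * Suc N + a < ?rv + N)"
      proof
        assume "?rv < u * Suc N + a \<and> u * Suc N + a < ?rv + N"
        then obtain b where "b \<le> N" "u * Suc N + a = ?rv + b"
          by (intro that[of "u * Suc N + a - ?rv"]) auto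
        then show False using row_eq[of a N b u ?v] that by simp
      qed
      then show ?thesis unfolding e by (simp only: if_False)
    qed
    have disj: "t2 (Var vrv) + a \<noteq> t2 (Var vrp) + b" if "a \<le> N" "b \<le> N" for a b
      unfolding v2 using row_eq[OF that, of ?v ?p] vp(3) by simp
    note m = merge_correct[OF l2 disj, folded t3_def, unfolded v2]
    have val: "val t2 ?rv ?rp j a = DP h ?p (j - a) + (DP h ?v a + ec ?v a)" if "a \<le> j" "j \<le> N" for a j
    proof -
      have "dec (t2 (Cell aF (?rp + (j - a)))) = DP h ?p (j - a)"
      proof -
        have "j - a \<le> N" using that by simp
        then show ?thesis using row_u[of ?p "j - a"] vp(3,5) J by metis
      qed
      then show ?thesis unfolding val_def using row_v[of a] that by simp
    qed
    have new: "dec (t3 (Cell aF (?rp + j))) = DP (Suc h) ?p j" "choice h j (t3 (Cell aCH (?rv + j)))"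
      if j: "j \<le> N" for j
    proof -
      let ?a = "t3 (Cell aCH (?rv + j))" and ?x = "dec (t3 (Cell aF (?rp + j)))"
      have m3: "?a \<le> j \<and> ?x = val t2 ?rv ?rp j ?a \<and> (\<forall>a\<le>j. ?x \<le> val t2 ?rv ?rp j a)"
        by (rule m(3)) (use j in simp_all)
      then have x: "?a \<le> j" "?x = DP h ?p (j - ?a) + (DP h ?v ?a + ec ?v ?a)"
        using val[OF _ j] by auto
      have le: "?x \<le> DP h ?p (j - a) + (DP h ?v a + ec ?v a)" if "a \<le> j" for a
        using m3 val[OF that j] that by metis
      show "?x = DP (Suc h) ?p j" "choice h j ?a" by (rule min_choice[OF x le]; assumption)+
    qed
    have oldF: "t3 (Cell aF (u * Suc N + j)) = t2 (Cell aF (u * Suc N + j))" if "u \<noteq> ?p" "j \<le> N" for u j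
      by (rule m(1)) (use row_eq[OF that(2)] that(1) in auto)
    have oldC: "t3 (Cell aCH (u * Suc N + j)) = t (Cell aCH (u * Suc N + j))" if "u \<noteq> ?v" "j \<le> N" for u j
      by (rule m(2)) (use row_eq[OF that(2)] that(1) in auto)
    show "?J (Suc h) (sem ?c (t(Var vh := h)))"
      unfolding t3
    proof (intro conjI ballI allI impI)
      fix u j assume u: "u \<in> alive (Suc h)" and j: "j \<le> N"
      have uv: "u \<noteq> ?v" "u \<in> alive h" using u alive_Suc[OF h(2)] by auto
      show "dec (t3 (Cell aF (u * Suc N + j))) = DP (Suc h) u j"
      proof (cases "u = ?p")
        case True
        then show ?thesis using new(1)[OF j] by simp
      next
        case False
        then show ?thesis using oldF[OF False j] row_u[OF uv(1) j] J uv(2) j DP_other[OF False] by simp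
      qed
    next
      fix i j assume i: "i < Suc h" and j: "j \<le> N"
      show "choice i j (t3 (Cell aCH (od i * Suc N + j)))"
      proof (cases "i = h")
        case True
        then show ?thesis using new(2)[OF j] by simp
      next
        case False
        then have "od i \<noteq> ?v" using od_eq[of i h] i h by simp
        from oldC[OF this j] show ?thesis using J i j False by (simp add: less_Suc_eq)
      qed
    qed
  next
    show "?J 0 s" using init by (simp add: alive_0)
  qed (use s in \<open>auto simp: keeps_tables_def keeps_def edge_com_def merge_com_def min_com_def\<close>)
  moreover have "s (Var vns1) = n - 1" using s(1) by simp
  ultimately have J: "?J (n - 1) s'" by (simp only:)
  show "\<And>i j. i < n - 1 \<Longrightarrow> j \<le> N \<Longrightarrow> choice i j (s' (Cell aCH (od i * Suc N + j)))"
    using J by blast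
  have "root \<in> alive (n - 1)" using root by (simp add: alive_iff)
  then show "dec (s' (Cell aF (root * Suc N + N))) = optimum"
    unfolding optimum_def using J by blast
qed

definition solved :: "state \<Rightarrow> bool" where
  "solved s \<longleftrightarrow> tables s \<and> rows s \<and> dec (s (Cell aF (root * Suc N + N))) = optimum \<and>
     (\<forall>i<n - 1. \<forall>j\<le>N. choice i j (s (Cell aCH (od i * Suc N + j))))"

lemma solved_opt_cell: "solved s \<Longrightarrow> dec (ev opt_cell s) = optimum"
  using root(1) by (simp add: solved_def opt_cell_def rows_def)

lemma solve_tables:
  assumes "tables s"
  shows "solved (sem dp_com (sem init_com s))"
proof -
  let ?s = "sem init_com s"
  have l: "loaded s" using assms by simp
  have t: "tables ?s"
    by (rule tables_sem[OF assms]) (simp add: keeps_tables_def keeps_def init_com_def)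
  have r: "rows ?s" using init_correct(1)[OF l] by (simp add: rows_def)
  have F: "dec (?s (Cell aF (u * Suc N + j))) = F0 u j" if "u < n" "j \<le> N" for u j
    using init_correct(2)[OF l that] node_eq[OF that(1)] by (simp add: F0_def)
  have "tables (sem dp_com ?s)"
    by (rule tables_sem[OF t])
      (simp add: keeps_tables_def keeps_def dp_com_def edge_com_def merge_com_def min_com_def)
  moreover have "rows (sem dp_com ?s)"
    using r unfolding rows_def
    by (subst sem_frame) (simp_all add: dp_com_def edge_com_def merge_com_def min_com_def)
  ultimately show ?thesis using dp_correct[OF t r F] by (auto simp: solved_def)
qed

end

context valid_input
begin

text \<open>The witnesses are the arrays computed by the program. That the walk closes up is
  recorded for the certificate.\<close>

lemma main_correct:
  assumes s: "\<And>i. s (Cell 0 i) = inp i" "\<And>k i. k \<noteq> 0 \<Longrightarrow> s (Cell k i) = 0"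
  shows "\<exists>od pa rk X pe. ordered_input inp I od pa rk X pe \<and> X N = X 0 \<and>
    ordered_input.solved inp I od pa rk X pe (sem main_com s)"
proof -
  define s0 where "s0 = sem setup_com s"
  define s1 where "s1 = sem nbr_sum_com s0"
  define s2 where "s2 = sem walk_com s1"
  define s3 where "s3 = sem (degree_com ;; leaves_com ;; strip_com) s2"
  have main: "sem main_com s = sem dp_com (sem init_com s3)"
    by (simp add: main_com_def s3_def s2_def s1_def s0_def)
  have l0: "loaded s0" unfolding s0_def by (rule setup_correct[OF s(1)])
  have l1: "loaded s1" unfolding s1_def by (rule loaded_sem[OF l0]) (simp add: keeps_def nbr_sum_com_def)
  have l2: "loaded s2" unfolding s2_def by (rule loaded_sem[OF l1]) (simp add: keeps_def walk_com_def)
  have z0: "s0 (Cell k i) = 0" if "k \<noteq> 0" for k i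
    unfolding s0_def using s(2)[OF that] by (subst sem_frame) (simp_all add: setup_com_def)
  have z1: "s1 (Cell k i) = 0" if "k \<noteq> 0" "k \<noteq> aSR" for k i
    unfolding s1_def using z0[OF that(1)] that by (subst sem_frame) (simp_all add: nbr_sum_com_def)
  have z2: "s2 (Cell k i) = 0" if "k \<noteq> 0" "k \<noteq> aSR" "k \<noteq> aX" for k i
    unfolding s2_def using z1[OF that(1,2)] that by (subst sem_frame) (simp_all add: walk_com_def)
  have sr: "s1 (Cell aSR x) = nbr_sum N eu ew x" for x
    unfolding s1_def using nbr_sum_correct[OF l0 z0] by simp
  note w = walk_correct[OF l1 sr, folded s2_def]
  obtain vs where vs: "distinct vs" "3 \<le> length vs" "{..<N} = set vs" "ER I = cycle_edges vs"
    using cyc unfolding is_cycle_def VR_eq by blast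
  have lenN: "length vs = N" using distinct_card[OF vs(1)] vs(3) by (metis card_lessThan)
  have edges: "(\<lambda>k. {eu k, ew k}) ` {..<N} = cycle_edges vs" using ER_eq vs(4) by simp
  let ?X = "\<lambda>i. s2 (Cell aX i)"
  have X01: "?X 0 = eu 0" "?X 1 = ew 0" and
    X2: "\<And>k. k < N \<Longrightarrow> ?X (k + 2) = nbr_sum N eu ew (?X (k + 1)) - ?X k"
    using w by blast+
  obtain ws where ws: "distinct ws" "set ws = set vs" "length ws = N" "cycle_edges ws = cycle_edges vs"
    "\<And>i. i < N + 2 \<Longrightarrow> ?X i = ws ! (i mod N)"
    using walk_cycle[OF vs(1) lenN _ inj_ER edges X01 X2] vs(2) lenN by metis
  have N3: "3 \<le> N" using vs(2) lenN by simp
  have tr: "is_tree {..<n} (edge_list.edges (n - 1) (es 0) (es 1))" using tree VS_eq ES_eq by simp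
  note o = order_correct[OF el npos tr l2 z2 z2 z2 z2, folded s3_def]
  let ?Q = "\<lambda>i. s3 (Cell aQ i)" and ?PA = "\<lambda>i. s3 (Cell aPA i)" and ?RK = "\<lambda>i. s3 (Cell aRK i)"
    and ?PE = "\<lambda>i. s3 (Cell aPE i)"
  have pt: "ptree n ?Q ?PA ?RK" by (rule o) simp_all
  have ptE: "ptree.E n ?Q ?PA = edge_list.edges (n - 1) (es 0) (es 1)" by (rule o) simp_all
  have ptP: "?PE (?Q i) < n - 1 \<and> {?Q i, ?PA (?Q i)} = {es 0 (?PE (?Q i)), es 1 (?PE (?Q i))}"
    if "i < n - 1" for i
    by (rule o) (use that in simp_all)
  have root: "s3 (Var vroot) = ?Q (n - 1)" by (rule o) simp_all
  have l3: "loaded s3" by (rule o) simp_all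
  have X3: "s3 (Cell aX i) = ?X i" for i
    unfolding s3_def
    by (subst sem_frame) (simp_all add: degree_com_def leaves_com_def strip_com_def)
  have Xlt: "?X i = ws ! i" if "i < N" for i using ws(5)[of i] that by simp
  have cit: "cycle_into_tree n ?Q ?PA ?RK I N ?X"
  proof (intro cycle_into_tree.intro cycle_into_tree_axioms.intro pt N3 VR_eq VS_eq)
    show "inj_on ?X {..<N}"
      using ws(1,3) Xlt by (auto simp: inj_on_def nth_eq_iff_index_eq)
    have "?X ` {..<N} = (!) ws ` {..<N}" using Xlt by (intro image_cong) auto
    also have "\<dots> = set ws" using ws(3) by (auto simp: in_set_conv_nth image_def)
    finally show "?X ` {..<N} = {..<N}" using ws(2) vs(3) by simp
    have "cycle_edges ws = (\<lambda>i. {?X i, ?X (Suc i mod N)}) ` {..<N}"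
      unfolding cycle_edges_image ws(3) using Xlt N3 by (intro image_cong) auto
    then show "ER I = (\<lambda>i. {?X i, ?X (Suc i mod N)}) ` {..<N}" using vs(4) ws(4) by simp
    show "ES I = ptree.E n ?Q ?PA" using ptE ES_eq by simp
  qed
  have oi: "ordered_input inp I ?Q ?PA ?RK ?X ?PE"
    by (intro ordered_input.intro ordered_input_axioms.intro cit ptP) unfold_locales
  have "ordered_input.tables inp ?Q ?PA ?RK ?X ?PE s3"
    unfolding ordered_input.tables_def[OF oi] using l3 X3 root ptree.root_def[OF pt] by simp
  then have "ordered_input.solved inp I ?Q ?PA ?RK ?X ?PE (sem main_com s)"
    unfolding main by (rule ordered_input.solve_tables[OF oi])
  moreover have "?X N = ?X 0" using ws(5)[of N] ws(5)[of 0] N3 by simp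
  ultimately show ?thesis using oi
    by - (rule exI[of _ ?Q], rule exI[of _ ?PA], rule exI[of _ ?RK], rule exI[of _ ?X],
      rule exI[of _ ?PE], intro conjI)
qed

end

section \<open>From the tables to an optimal mapping and its encoding\<close>

section \<open>Backtracking and output\<close>

definition out :: "state \<Rightarrow> nat list" where
  "out t = map (\<lambda>i. t (Cell aOut i)) [0..<t (Var vop)]"

lemma sem_emit: "sem (emit a) t = t(Cell aOut (t (Var vop)) := ev a t, Var vop := Suc (t (Var vop)))"
  by (simp add: emit_def)

lemma out_emit [simp]: "out (sem (emit a) t) = out t @ [ev a t]"
  by (simp add: out_def sem_emit)

lemma out_upd [simp]:
  "x \<noteq> vop \<Longrightarrow> out (t(Var x := v)) = out t" "k \<noteq> aOut \<Longrightarrow> out (t(Cell k i := v)) = out t"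
  by (simp_all add: out_def)

lemma out_cong: "t (Var vop) = t' (Var vop) \<Longrightarrow> (\<And>i. t (Cell aOut i) = t' (Cell aOut i)) \<Longrightarrow> out t = out t'"
  by (simp add: out_def)

definition LB :: "state \<Rightarrow> nat list" where
  "LB t = map (\<lambda>i. t (Cell aLB i)) [0..<t (Var vlc)]"

definition RB :: "state \<Rightarrow> nat list" where
  "RB t = map (\<lambda>i. t (Cell aRB i)) [0..<t (Var vrc)]"

context prog_input
begin

lemma write_path_correct:
  assumes l: "loaded t" and len: "length (LB t) \<le> n" "length (RB t) \<le> n"
  defines "p \<equiv> LB t @ t (Var va) # rev (RB t)"
  shows "out (sem write_path_com t) = out t @ length p # p"
proof -
  let ?L = "LB t" and ?R = "RB t"
  have lL: "length ?L = t (Var vlc)" and lR: "length ?R = t (Var vrc)" by (simp_all add: LB_def RB_def)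
  have nL: "?L ! i = t (Cell aLB i)" if "i < t (Var vlc)" for i using that by (simp add: LB_def)
  have nR: "?R ! i = t (Cell aRB i)" if "i < t (Var vrc)" for i using that by (simp add: RB_def)
  let ?c1 = "IfLess (Rd vt) (Rd vlc) (emit (At aLB (Rd vt))) Skip"
  let ?c2 = "IfLess (Num 0) (Rd vrc)
         (vrc ::= Minus (Rd vrc) (Num 1) ;;
          emit (At aRB (Rd vrc)))
         Skip"
  define t1 where "t1 = sem (emit (Plus (Plus (Rd vlc) (Rd vrc)) (Num 1))) t"
  have o1: "out t1 = out t @ [length p]" by (simp add: t1_def p_def lL lR)
  define t2 where "t2 = sem (For vt vns ?c1) t1"
  have fr1: "x \<noteq> vop \<Longrightarrow> t1 (Var x) = t (Var x)" "k \<noteq> aOut \<Longrightarrow> t1 (Cell k i) = t (Cell k i)" for x k i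
    by (simp_all add: t1_def sem_emit)
  have l1: "loaded t1" using l by (simp add: t1_def sem_emit)
  have "out t2 = out t1 @ take (t1 (Var vns)) ?L"
    unfolding t2_def
  proof (rule For_loaded[where I = "\<lambda>i t'. out t' = out t1 @ take i ?L"])
    fix i t' assume I: "out t' = out t1 @ take i ?L" and fr: "\<And>l. \<not> may (For vt vns ?c1) l \<Longrightarrow> t' l = t1 l"
    have v: "t' (Var vlc) = t (Var vlc)" "t' (Cell aLB x) = t (Cell aLB x)" for x
      using fr1 by (subst fr; simp add: emit_def)+
    show "out (sem ?c1 (t'(Var vt := i))) = out t1 @ take (Suc i) ?L"
      using I v lL nL[of i] by (simp add: take_Suc_conv_app_nth)
  qed (use l1 in \<open>auto simp: keeps_def emit_def\<close>)
  then have o2: "out t2 = out t1 @ ?L" using l1 len by simp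
  have fr2: "\<And>l. \<not> may (For vt vns ?c1) l \<Longrightarrow> t2 l = t1 l" unfolding t2_def by (rule sem_frame)
  define t3 where "t3 = sem (emit (Rd va)) t2"
  have l2: "loaded t2" unfolding t2_def by (rule loaded_sem[OF l1]) (simp add: keeps_def emit_def)
  have l3: "loaded t3" using l2 by (simp add: t3_def sem_emit)
  have "t2 (Var va) = t (Var va)" using fr1 by (subst fr2; simp add: emit_def)
  then have o3: "out t3 = out t2 @ [t (Var va)]" by (simp add: t3_def)
  have v3: "t3 (Var vrc) = t (Var vrc)" "t3 (Cell aRB x) = t (Cell aRB x)" for x
    using fr1 by (simp add: t3_def sem_emit, subst fr2; simp add: emit_def)+
  let ?J = "\<lambda>i t'. t' (Var vrc) = length ?R - i \<and> out t' = out t3 @ rev (drop (length ?R - i) ?R)"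
  have "?J (t3 (Var vns)) (sem (For vt vns ?c2) t3)"
  proof (rule For_loaded[where I = ?J])
    fix i t' assume J: "?J i t'" and fr: "\<And>l. \<not> may (For vt vns ?c2) l \<Longrightarrow> t' l = t3 l"
    have v: "t' (Cell aRB x) = t (Cell aRB x)" for x
      using v3(2) by (subst fr; simp add: emit_def)
    show "?J (Suc i) (sem ?c2 (t'(Var vt := i)))"
    proof (cases "i < length ?R")
      case True
      let ?k = "length ?R - Suc i"
      have k: "?k < length ?R" "length ?R - i = Suc ?k" using True by auto
      have d: "drop ?k ?R = ?R ! ?k # drop (Suc ?k) ?R" using k(1) by (simp add: Cons_nth_drop_Suc)
      have Rk: "?R ! ?k = t (Cell aRB ?k)" using nR[of ?k] k(1) lR by simp
      have c2: "sem ?c2 (t'(Var vt := i)) = sem (emit (At aRB (Rd vrc))) (t'(Var vt := i, Var vrc := ?k))"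
        using J k by simp
      have "out (sem ?c2 (t'(Var vt := i))) = out t' @ [?R ! ?k]"
        unfolding c2 out_emit using v Rk by simp
      moreover have "sem ?c2 (t'(Var vt := i)) (Var vrc) = ?k" unfolding c2 by (simp add: sem_emit)
      ultimately show ?thesis using J k d by simp
    qed (use J in simp)
  qed (use l3 v3 lR in \<open>auto simp: keeps_def emit_def\<close>)
  then have "out (sem (For vt vns ?c2) t3) = out t3 @ rev ?R" using l3 len by simp
  moreover have "sem write_path_com t = sem (For vt vns ?c2) t3"
    by (simp add: write_path_com_def t3_def t2_def t1_def)
  ultimately show ?thesis using o1 o2 o3 by (simp add: p_def)
qed

end

context ordered_input
begin

text \<open>Each pass moves one end or finds both equal; after \<open>n\<close> passes the length
  bound on \<open>climb\<close> leaves only the second possibility.\<close>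

lemma climb_correct:
  assumes t: "tables t" and ab: "t (Var va) < n" "t (Var vb) < n"
  defines "t' \<equiv> sem climb_com t"
  shows "climb (t (Var va)) (t (Var vb)) (t' (Var va)) (t' (Var va)) (LB t') (RB t')"
proof -
  let ?c = "IfLess (At aRK (Rd va)) (At aRK (Rd vb))
         (Put aLB (Rd vlc) (Rd va) ;;
          vlc ::= Plus (Rd vlc) (Num 1) ;;
          va ::= At aPA (Rd va))
         (IfLess (At aRK (Rd vb)) (At aRK (Rd va))
           (Put aRB (Rd vrc) (Rd vb) ;;
            vrc ::= Plus (Rd vrc) (Num 1) ;;
            vb ::= At aPA (Rd vb))
           Skip)"
  let ?t0 = "t(Var vlc := 0, Var vrc := 0)"
  let ?J = "\<lambda>i t'. climb (t (Var va)) (t (Var vb)) (t' (Var va)) (t' (Var vb)) (LB t') (RB t') \<and>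
    (t' (Var va) = t' (Var vb) \<or> length (LB t') + length (RB t') = i)"
  have "?J (?t0 (Var vns)) (sem (For vt vns ?c) ?t0)"
  proof (rule For_tables[where J = ?J])
    fix i t1 assume J: "?J i t1" and t1: "tables t1"
    let ?a = "t1 (Var va)" and ?b = "t1 (Var vb)" and ?t = "sem ?c (t1(Var vt := i))"
    have abn: "?a < n" "?b < n" using J by (auto simp: climb_def)
    consider "?a = ?b" | "rk ?a < rk ?b" | "rk ?b < rk ?a"
      using rk_eq[OF abn] by linarith
    then show "?J (Suc i) ?t"
    proof cases
      case 1
      then have "?t = t1(Var vt := i)" using t1 by simp
      then show ?thesis using J 1 by (simp add: LB_def RB_def)
    next
      case 2
      then have "LB ?t = LB t1 @ [?a]" "RB ?t = RB t1" "?t (Var va) = pa ?a" "?t (Var vb) = ?b"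
        using t1 by (simp_all add: LB_def RB_def)
      then show ?thesis using climb_left[OF conjunct1[OF J] 2] J 2 by auto
    next
      case 3
      then have "LB ?t = LB t1" "RB ?t = RB t1 @ [?b]" "?t (Var va) = ?a" "?t (Var vb) = pa ?b"
        using t1 by (simp_all add: LB_def RB_def)
      then show ?thesis using climb_right[OF conjunct1[OF J] 3] J 3 by auto
    qed
  next
    show "?J 0 ?t0" using climb_init[OF ab] by (simp add: LB_def RB_def)
  qed (use t in \<open>auto simp: keeps_tables_def keeps_def\<close>)
  then have J: "?J n t'" using t by (simp add: t'_def climb_com_def)
  then have "t' (Var va) = t' (Var vb)" using climb_length by fastforce
  then show ?thesis using J by simp
qed

text \<open>The eliminations are undone in reverse order: pass \<open>h\<close> handles
  \<open>i = n - 1 - Suc h\<close>, and the invariant is \<open>placed\<close> at the stage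
  reached.\<close>

lemma place_correct:
  assumes s: "solved s"
  defines "s' \<equiv> sem place_com s"
  shows "\<exists>K st lc. placed DP 0 K st lc \<and> (\<forall>q<N. s' (Cell aM (X q)) = lc q)"
proof -
  let ?ch = "\<lambda>i j. s (Cell aCH (od i * Suc N + j))"
  have ts: "tables s" and rs: "rows s" using s by (auto simp: solved_def)
  have merged: "merged i (DP i) (DP (Suc i)) (?ch i)" if "i < n - 1" for i
    using s that by (intro merged_DP) (auto simp: solved_def)
  let ?ci = "Put aLC (Rd vt) (Rd vroot)"
  let ?c1 = "IfLess (Rd vt) (Rd vc)
           (Put aLC (Plus (At aST (Rd vv)) (Rd vt)) (Rd vv))
           Skip"
  let ?c = "vv ::= At aQ (Minus (Minus (Rd vns1) (Num 1)) (Rd vh)) ;;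
       vp ::= At aPA (Rd vv) ;;
       vc ::= At aCH (Plus (At aRO (Rd vv)) (At aK (Rd vp))) ;;
       Put aK (Rd vp) (Minus (At aK (Rd vp)) (Rd vc)) ;;
       Put aK (Rd vv) (Rd vc) ;;
       Put aST (Rd vv) (Plus (At aST (Rd vp)) (At aK (Rd vp))) ;;
       For vt vnr ?c1"
  let ?c2 = "Put aM (At aX (Rd vt)) (At aLC (Rd vt))"
  define s0 where "s0 = s(Cell aK root := N, Cell aST root := 0)"
  define s1 where "s1 = sem (For vt vnr ?ci) s0"
  define s2 where "s2 = sem (For vh vns1 ?c) s1"
  have s': "s' = sem (For vt vnr ?c2) s2"
    using ts by (simp add: s'_def place_com_def s2_def s1_def s0_def del: sem.simps(6))
  have t0: "tables s0" using ts by (simp add: s0_def)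
  have t1: "tables s1" unfolding s1_def by (rule tables_sem[OF t0]) (simp add: keeps_tables_def keeps_def)
  have t2: "tables s2" unfolding s2_def by (rule tables_sem[OF t1]) (simp add: keeps_tables_def keeps_def)
  have "\<forall>q<s0 (Var vnr). s1 (Cell aLC q) = root"
    unfolding s1_def
  proof (rule For_tables[where J = "\<lambda>i t. \<forall>q<i. t (Cell aLC q) = root"])
    fix i t assume "\<forall>q<i. t (Cell aLC q) = root" "tables t"
    then show "\<forall>q<Suc i. sem ?ci (t(Var vt := i)) (Cell aLC q) = root" by (simp add: less_Suc_eq)
  qed (use t0 in \<open>auto simp: keeps_tables_def keeps_def\<close>)
  then have lc1: "\<And>q. q < N \<Longrightarrow> s1 (Cell aLC q) = root" using t0 by simp
  have v1: "s1 (Cell aK root) = N" "s1 (Cell aST root) = 0" "s1 (Cell aCH x) = s (Cell aCH x)"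
    "s1 (Cell aRO x) = s (Cell aRO x)" for x
    unfolding s1_def by (subst sem_frame; simp add: s0_def)+
  let ?J = "\<lambda>h t. placed DP (n - 1 - h) (\<lambda>u. t (Cell aK u)) (\<lambda>u. t (Cell aST u)) (\<lambda>q. t (Cell aLC q))"
  have "?J (s1 (Var vns1)) s2"
    unfolding s2_def
  proof (rule For_tables[where J = ?J])
    fix h t assume h: "h < s1 (Var vns1)" and J: "?J h t" and tt: "tables t"
      and fr: "\<And>l. \<not> may (For vh vns1 ?c) l \<Longrightarrow> t l = s1 l"
    define i where "i = n - 1 - Suc h"
    have i: "i < n - 1" "n - 1 - h = Suc i" "n - Suc 0 - Suc 0 - h = i" using h t1 by (simp_all add: i_def)
    let ?v = "od i" and ?p = "pa (od i)"
    let ?K = "t (Cell aK ?p)"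
    let ?d = "?ch i ?K" and ?st = "t (Cell aST ?p) + (t (Cell aK ?p) - ?ch i (t (Cell aK ?p)))"
    have vn: "?v < n" "?p \<noteq> ?v" using od_notroot[OF i(1)] pa_alive(2)[OF i(1)] by auto
    have P: "placed DP (Suc i) (\<lambda>u. t (Cell aK u)) (\<lambda>u. t (Cell aST u)) (\<lambda>q. t (Cell aLC q))"
      using J unfolding i(2) .
    have KN: "?K \<le> N" using placed_le[OF P pa_alive(1)[OF i(1)]] .
    have "t (Cell aCH x) = s (Cell aCH x)" "t (Cell aRO x) = s (Cell aRO x)" for x
      using v1 by (subst fr; simp)+
    then have ch: "t (Cell aCH (t (Cell aRO ?v) + ?K)) = ?d"
      using rs vn(1) by (simp add: rows_def)
    have "choice i ?K ?d" using s i(1) KN by (simp add: solved_def)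
    then have dK: "?d \<le> ?K" by (simp add: choice_def)
    define ta where "ta = t(Var vh := h, Var vv := ?v, Var vp := ?p, Var vc := ?d,
      Cell aK ?p := ?K - ?d, Cell aK ?v := ?d, Cell aST ?v := ?st)"
    have ta: "tables ta" using tt by (simp add: ta_def)
    define tb where "tb = sem (For vt vnr ?c1) ta"
    have tb: "sem ?c (t(Var vh := h)) = tb"
      using tt ch vn i(3) by (simp add: tb_def ta_def)
    have "\<forall>q. tb (Cell aLC q) = (if ?st \<le> q \<and> q < ?st + ?d \<and> q < ?st + ta (Var vnr) then ?v else t (Cell aLC q))"
      unfolding tb_def
    proof (rule For_tables[where J = "\<lambda>j t'. \<forall>q. t' (Cell aLC q) =
        (if ?st \<le> q \<and> q < ?st + ?d \<and> q < ?st + j then ?v else t (Cell aLC q))"])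
      fix j t' assume J': "\<forall>q. t' (Cell aLC q) =
        (if ?st \<le> q \<and> q < ?st + ?d \<and> q < ?st + j then ?v else t (Cell aLC q))"
        and fr': "\<And>l. \<not> may (For vt vnr ?c1) l \<Longrightarrow> t' l = ta l"
      have "t' (Var vv) = ?v" "t' (Var vc) = ?d" "t' (Cell aST ?v) = ?st"
        by (subst fr'; simp add: ta_def)+
      then show "\<forall>q. sem ?c1 (t'(Var vt := j)) (Cell aLC q) =
        (if ?st \<le> q \<and> q < ?st + ?d \<and> q < ?st + Suc j then ?v else t (Cell aLC q))"
        using J' by (auto simp: less_Suc_eq)
    next
      show "\<forall>q. ta (Cell aLC q) = (if ?st \<le> q \<and> q < ?st + ?d \<and> q < ?st + 0 then ?v else t (Cell aLC q))"
        by (simp add: ta_def)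
    qed (use ta in \<open>auto simp: keeps_tables_def keeps_def\<close>)
    moreover have "ta (Var vnr) = N" using ta by simp
    \<comment> \<open>The inner loop runs \<open>N\<close> times, which covers all \<open>?d\<close>
      positions as \<open>?d\<close> \<le> \<open>?K\<close> \<le> \<open>N\<close>.\<close>
    ultimately have lc: "tb (Cell aLC q) = (if ?st \<le> q \<and> q < ?st + ?d then ?v else t (Cell aLC q))" for q
      using dK KN by auto
    have vb: "tb (Cell aK u) = (if u = ?v then ?d else if u = ?p then ?K - ?d else t (Cell aK u))"
      "tb (Cell aST u) = (if u = ?v then ?st else t (Cell aST u))" for u
      unfolding tb_def by (subst sem_frame; simp add: ta_def)+
    have vA: "u \<noteq> ?v" if "u \<in> alive (Suc i)" for u using alive_Suc(2)[OF less_le_trans[OF i(1) diff_le_self]] that by auto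
    have "placed DP i (\<lambda>u. tb (Cell aK u)) (\<lambda>u. tb (Cell aST u)) (\<lambda>q. tb (Cell aLC q))"
      by (rule placed_step[OF merged P i(1)]) (use vb lc vA vn in auto)
    then show "?J (Suc h) (sem ?c (t(Var vh := h)))" unfolding tb i_def[symmetric] .
  next
    show "?J 0 s1" using placed_init[of "\<lambda>q. s1 (Cell aLC q)" "\<lambda>u. s1 (Cell aST u)" "\<lambda>u. s1 (Cell aK u)" DP] lc1 v1 by simp
  qed (use t1 in \<open>auto simp: keeps_tables_def keeps_def\<close>)
  then have P: "placed DP 0 (\<lambda>u. s2 (Cell aK u)) (\<lambda>u. s2 (Cell aST u)) (\<lambda>q. s2 (Cell aLC q))"
    using t1 by simp
  have "\<forall>q<s2 (Var vnr). s' (Cell aM (X q)) = s2 (Cell aLC q)"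
    unfolding s'
  \<comment> \<open>The guard is there because \<open>X\<close> is known to be injective only below
    \<open>N\<close>.\<close>
  proof (rule For_tables[where J = "\<lambda>i t. i \<le> N \<longrightarrow> (\<forall>q<i. t (Cell aM (X q)) = s2 (Cell aLC q))", THEN mp])
    fix i t assume J: "i \<le> N \<longrightarrow> (\<forall>q<i. t (Cell aM (X q)) = s2 (Cell aLC q))" and tt: "tables t"
      and fr: "\<And>l. \<not> may (For vt vnr ?c2) l \<Longrightarrow> t l = s2 l"
    have "t (Cell aLC q) = s2 (Cell aLC q)" for q by (subst fr; simp)
    moreover have "X q \<noteq> X i" if "q < i" "i < N" for q
      using X(1) that by (auto simp: inj_on_eq_iff)
    ultimately show "Suc i \<le> N \<longrightarrow> (\<forall>q<Suc i. sem ?c2 (t(Var vt := i)) (Cell aM (X q)) = s2 (Cell aLC q))"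
      using J tt by (auto simp: less_Suc_eq)
  qed (use t2 in \<open>auto simp: keeps_tables_def keeps_def\<close>)
  then have "\<forall>q<N. s' (Cell aM (X q)) = s2 (Cell aLC q)" using t2 by simp
  with P show ?thesis by blast
qed

text \<open>The paths are collected as a list in the order of the edge list, the form in which
  \<open>encode_mapping\<close> writes them; they become a function on edges only
  afterwards.\<close>

lemma output_correct:
  assumes t: "tables t" and M: "\<And>x. x < N \<Longrightarrow> t (Cell aM x) < n"
  defines "t' \<equiv> sem output_com t" and "M \<equiv> \<lambda>x. t (Cell aM x)"
  shows "\<exists>ps. length ps = N \<and>
    (\<forall>k<N. is_path {..<n} E (ps ! k) \<and> hd (ps ! k) = M (eu k) \<and> last (ps ! k) = M (ew k)) \<and>
    map (\<lambda>i. t' (Cell aOut i)) [0..<t' (Var 0)] =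
      1 # map M [0..<N] @ concat (map (\<lambda>p. length p # p) ps)"
proof -
  let ?ce = "emit (At aM (Rd vk))"
  let ?cp = "va ::= At aM (er_u (Rd vk)) ;; vb ::= At aM (er_v (Rd vk)) ;; climb_com ;; write_path_com"
  have kt: "keeps_tables (For vk vnr ?ce)" "keeps_tables (For vk vnr ?cp)" "keeps_tables climb_com"
    by (simp_all add: keeps_tables_def keeps_def emit_def climb_com_def write_path_com_def)
  define t0 where "t0 = sem (emit (Num 1)) (t(Var vop := 0))"
  define t1 where "t1 = sem (For vk vnr ?ce) t0"
  define t2 where "t2 = sem (For vk vnr ?cp) t1"
  have t': "t' = t2(Var 0 := t2 (Var vop))"
    unfolding t'_def output_com_def t2_def t1_def t0_def by (simp del: sem.simps(6))
  have tab0: "tables t0" using t by (simp add: t0_def sem_emit)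
  have tab1: "tables t1" unfolding t1_def by (rule tables_sem[OF tab0 kt(1)])
  have M0: "t0 (Cell aM x) = M x" for x by (simp add: t0_def sem_emit M_def)
  have M1: "t1 (Cell aM x) = M x" for x unfolding t1_def M0[symmetric] by (rule sem_frame) (simp add: emit_def)
  have "out t1 = 1 # map M [0..<t0 (Var vnr)]"
    unfolding t1_def
  proof (rule For_tables[OF tab0 kt(1), where J = "\<lambda>i s. out s = 1 # map M [0..<i]"])
    show "out t0 = 1 # map M [0..<0]" by (simp add: t0_def) (simp add: out_def)
    fix i s assume J: "out s = 1 # map M [0..<i]" and fr: "\<And>l. \<not> may (For vk vnr ?ce) l \<Longrightarrow> s l = t0 l"
    have "s (Cell aM x) = M x" for x unfolding M0[symmetric] by (rule fr) (simp add: emit_def)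
    then show "out (sem ?ce (s(Var vk := i))) = 1 # map M [0..<Suc i]" using J by simp
  qed
  then have o1: "out t1 = 1 # map M [0..<N]" using tab0 by simp
  let ?J = "\<lambda>i s. i \<le> N \<longrightarrow> (\<exists>ps. length ps = i \<and>
    (\<forall>k<i. is_path {..<n} E (ps ! k) \<and> hd (ps ! k) = M (eu k) \<and> last (ps ! k) = M (ew k)) \<and>
    out s = 1 # map M [0..<N] @ concat (map (\<lambda>p. length p # p) ps))"
  have "?J (t1 (Var vnr)) t2"
    unfolding t2_def
  proof (rule For_tables[OF tab1 kt(2), where J = ?J])
    show "?J 0 t1" using o1 by simp
    fix i s assume J: "?J i s" and s: "tables s" and fr: "\<And>l. \<not> may (For vk vnr ?cp) l \<Longrightarrow> s l = t1 l"
    have Ms: "s (Cell aM x) = M x" for x unfolding M1[symmetric]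
      by (rule fr) (simp add: emit_def climb_com_def write_path_com_def)
    show "?J (Suc i) (sem ?cp (s(Var vk := i)))"
    proof
      assume i: "Suc i \<le> N"
      then obtain ps where ps: "length ps = i"
        "\<forall>k<i. is_path {..<n} E (ps ! k) \<and> hd (ps ! k) = M (eu k) \<and> last (ps ! k) = M (ew k)"
        "out s = 1 # map M [0..<N] @ concat (map (\<lambda>p. length p # p) ps)"
        using J by auto
      have "{eu i, ew i} \<in> ER I" unfolding ER_eq using i by (intro image_eqI[of _ _ i]) auto
      then obtain q where "q < N" "{eu i, ew i} = {X q, X (Suc q mod N)}" unfolding ER by blast
      then have uw: "eu i < N" "ew i < N" using X_less[of q] X_less[of "Suc q mod N"] N3
        by (auto simp: doubleton_eq_iff)
      define sa where "sa = s(Var vk := i, Var va := M (eu i), Var vb := M (ew i))"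
      define sb where "sb = sem climb_com sa"
      have sa: "tables sa" using s by (simp add: sa_def)
      have sb: "tables sb" unfolding sb_def by (rule tables_sem[OF sa kt(3)])
      have "M (eu i) < n" "M (ew i) < n" using M uw by (simp_all add: M_def)
      then have cl: "climb (M (eu i)) (M (ew i)) (sb (Var va)) (sb (Var va)) (LB sb) (RB sb)"
        using climb_correct[OF sa] by (simp add: sb_def sa_def)
      let ?p = "LB sb @ sb (Var va) # rev (RB sb)"
      have "out (sem write_path_com sb) = out sb @ length ?p # ?p"
        using climb_length[OF cl] sb by (intro write_path_correct) auto
      moreover have "out sb = out sa"
        unfolding sb_def by (rule out_cong; rule sem_frame; simp add: climb_com_def)
      moreover have "out sa = out s" by (simp add: sa_def)
      moreover have "sem ?cp (s(Var vk := i)) = sem write_path_com sb"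
        using s Ms by (simp add: sb_def sa_def)
      ultimately have "out (sem ?cp (s(Var vk := i))) = out s @ length ?p # ?p" by simp
      then have "out (sem ?cp (s(Var vk := i))) =
          1 # map M [0..<N] @ concat (map (\<lambda>p. length p # p) (ps @ [?p]))"
        using ps(3) by simp
      moreover have "\<forall>k<Suc i. is_path {..<n} E ((ps @ [?p]) ! k) \<and> hd ((ps @ [?p]) ! k) = M (eu k) \<and>
          last ((ps @ [?p]) ! k) = M (ew k)"
        using ps(1,2) climb_path[OF cl] by (auto simp: nth_append less_Suc_eq)
      moreover have "length (ps @ [?p]) = Suc i" using ps(1) by simp
      ultimately show "\<exists>ps. length ps = Suc i \<and>
        (\<forall>k<Suc i. is_path {..<n} E (ps ! k) \<and> hd (ps ! k) = M (eu k) \<and> last (ps ! k) = M (ew k)) \<and>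
        out (sem ?cp (s(Var vk := i))) = 1 # map M [0..<N] @ concat (map (\<lambda>p. length p # p) ps)"
        by blast
    qed
  qed
  moreover have "t1 (Var vnr) = N" using tab1 by simp
  moreover have "map (\<lambda>i. t' (Cell aOut i)) [0..<t' (Var 0)] = out t2" by (simp add: t' out_def)
  ultimately show ?thesis by auto
qed

text \<open>Copying the output is part of the running time, so its length has to be bounded; a tree
  path has at most \<open>n\<close> nodes.\<close>

lemma encode_length:
  assumes "length ps = N" "\<forall>k<N. is_path {..<n} E (ps ! k)"
  shows "length (1 # map M [0..<N] @ concat (map (\<lambda>p. length p # p) ps)) \<le> 1 + N + N * (n + 1)"
proof -
  have "length p \<le> n" if p: "p \<in> set ps" for p
  proof -
    obtain k where "k < N" "p = ps ! k" using p assms(1) by (auto simp: in_set_conv_nth)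
    then have "distinct p" "set p \<subseteq> {..<n}" using assms(2) by (auto simp: is_path_def)
    then show ?thesis by (metis card_lessThan card_mono distinct_card finite_lessThan)
  qed
  then have "sum_list (map (\<lambda>p. length p + 1) ps) \<le> sum_list (map (\<lambda>_. n + 1) ps)"
    by (intro sum_list_mono) auto
  then show ?thesis using assms(1) by (simp add: length_concat comp_def sum_list_triv)
qed

text \<open>A mapping assigns paths to edges as sets, so the path of an edge is looked up through
  its unique index in the list.\<close>

lemma min_cost_output:
  assumes opt: "optimum \<noteq> \<infinity>" and pl: "placed DP 0 K st lc" and M: "\<And>q. q < N \<Longrightarrow> M (X q) = lc q"
    and er: "length er = N" "\<And>k. k < N \<Longrightarrow> er ! k = (eu k, ew k)" and ps: "length ps = N"
      "\<forall>k<N. is_path {..<n} E (ps ! k) \<and> hd (ps ! k) = M (eu k) \<and> last (ps ! k) = M (ew k)"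
  shows "\<exists>m. min_cost_feasible I m \<and>
    encode_mapping I er m = map M [0..<N] @ concat (map (\<lambda>p. length p # p) ps)"
proof -
  define P where "P f = ps ! (THE k. k < N \<and> {eu k, ew k} = f)" for f
  have P: "P {eu k, ew k} = ps ! k" if "k < N" for k
  proof -
    have "(THE k'. k' < N \<and> {eu k', ew k'} = {eu k, ew k}) = k"
      using that inj_ER by (intro the_equality) (auto simp: inj_on_def)
    then show ?thesis by (simp add: P_def)
  qed
  let ?m = "(M, P)"
  have Mn: "M x < n" if "x < N" for x
    using that X(2) M placed_less[OF pl] by (metis imageE lessThan_iff)
  have "is_mapping I ?m"
    using Mn ps(2) P unfolding is_mapping_def VR_eq ER_eq VS_eq ES by auto
  then have "min_cost_feasible I ?m"
    using placed_optimal[OF pl opt] M by simp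
  moreover have "map (\<lambda>(u, v). length (P {u, v}) # P {u, v}) er = map (\<lambda>p. length p # p) ps"
    using er ps(1) P by (intro nth_equalityI) auto
  then have "encode_mapping I er ?m = map M [0..<N] @ concat (map (\<lambda>p. length p # p) ps)"
    by (simp add: encode_mapping_def VR_eq)
  ultimately show ?thesis by blast
qed

end

context valid_input
begin

lemma solve_correct:
  assumes s: "\<And>i. s (Cell 0 i) = inp i" "\<And>k i. k \<noteq> 0 \<Longrightarrow> s (Cell k i) = 0"
    and er: "length er = N" "\<And>k. k < N \<Longrightarrow> er ! k = (eu k, ew k)"
  defines "s' \<equiv> sem solve_com s"
  shows "optimal_output I er (map (\<lambda>i. s' (Cell aOut i)) [0..<s' (Var 0)])"
    "s' (Var 0) \<le> 1 + N + N * (n + 1)"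
proof -
  let ?ys = "map (\<lambda>i. s' (Cell aOut i)) [0..<s' (Var 0)]"
  let ?t = "sem main_com s"
  obtain od pa rk X pe where oi: "ordered_input inp I od pa rk X pe"
    and solved: "ordered_input.solved inp I od pa rk X pe ?t"
    using main_correct[OF s] by blast
  interpret ordered_input inp I od pa rk X pe by (rule oi)
  have dec: "dec (ev opt_cell ?t) = optimum" by (rule solved_opt_cell[OF solved])
  have "optimal_output I er ?ys \<and> length ?ys \<le> 1 + N + N * (n + 1)"
  proof (cases "ev opt_cell ?t = 0")
    case True
    then have "\<not> feasible I m" for m using infeasible dec by simp
    moreover have "s' = ?t(Cell aOut 0 := 0, Var 0 := 1)"
      using True unfolding s'_def solve_com_def by simp
    ultimately show ?thesis by (simp add: optimal_output_def)
  next
    case False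
    define t1 where "t1 = sem place_com ?t"
    have s'eq: "s' = sem output_com t1"
      using False unfolding s'_def solve_com_def t1_def by simp
    have opt: "optimum \<noteq> \<infinity>" using dec False dec_infinite by metis
    obtain K st lc where pl: "placed DP 0 K st lc" and M: "\<forall>q<N. t1 (Cell aM (X q)) = lc q"
      using place_correct[OF solved] unfolding t1_def by blast
    have "tables ?t" using solved by (simp add: solved_def)
    then have t1: "tables t1"
      unfolding t1_def by (rule tables_sem) (simp add: keeps_tables_def keeps_def place_com_def)
    have Mn: "t1 (Cell aM x) < n" if "x < N" for x
      using that X(2) M placed_less[OF pl] by (metis imageE lessThan_iff)
    have "\<exists>ps. length ps = N \<and>
      (\<forall>k<N. is_path {..<n} E (ps ! k) \<and> hd (ps ! k) = t1 (Cell aM (eu k)) \<and> last (ps ! k) = t1 (Cell aM (ew k))) \<and>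
      ?ys = 1 # map (\<lambda>x. t1 (Cell aM x)) [0..<N] @ concat (map (\<lambda>p. length p # p) ps)"
      unfolding s'eq by (rule output_correct[OF t1]) (rule Mn)
    then obtain ps where ps: "length ps = N"
      "\<forall>k<N. is_path {..<n} E (ps ! k) \<and> hd (ps ! k) = t1 (Cell aM (eu k)) \<and> last (ps ! k) = t1 (Cell aM (ew k))"
      "?ys = 1 # map (\<lambda>x. t1 (Cell aM x)) [0..<N] @ concat (map (\<lambda>p. length p # p) ps)"
      by (elim exE conjE)
    obtain m where m: "min_cost_feasible I m"
      "encode_mapping I er m = map (\<lambda>x. t1 (Cell aM x)) [0..<N] @ concat (map (\<lambda>p. length p # p) ps)"
      using min_cost_output[OF opt pl _ er ps(1), of "\<lambda>x. t1 (Cell aM x)"] M ps(2) by blast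
    then have "feasible I m" by (simp add: min_cost_feasible_def)
    then have "(\<exists>m. feasible I m) = True" by blast
    moreover have "\<exists>m'. min_cost_feasible I m' \<and> ?ys = 1 # encode_mapping I er m'"
      by (rule exI[of _ m]) (use m ps(3) in \<open>simp only: simp_thms\<close>)
    ultimately have "optimal_output I er ?ys"
      unfolding optimal_output_def by (simp only: if_True)
    moreover have "length ?ys \<le> 1 + N + N * (n + 1)"
      unfolding ps(3) using ps(1,2) by (intro encode_length) auto
    ultimately show ?thesis by blast
  qed
  then show "optimal_output I er ?ys" "s' (Var 0) \<le> 1 + N + N * (n + 1)" by simp_all
qed

end

section \<open>The input list as the encoding of an instance\<close>

section \<open>Encoded instances\<close>

lemma length_concat_blocks:
  "(\<And>x. x \<in> set xs \<Longrightarrow> length (f x) = m) \<Longrightarrow> length (concat (map f xs)) = length xs * m"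
  by (induction xs) auto

lemma nth_concat_blocks:
  "(\<And>x. x \<in> set xs \<Longrightarrow> length (f x) = m) \<Longrightarrow> k < length xs \<Longrightarrow> d < m \<Longrightarrow>
    concat (map f xs) ! (k * m + d) = f (xs ! k) ! d"
proof (induction xs arbitrary: k)
  case (Cons x xs)
  show ?case
  proof (cases k)
    case 0
    then show ?thesis using Cons.prems by (simp add: nth_append)
  next
    case (Suc k')
    have "concat (map f (x # xs)) ! (k * m + d) = (f x @ concat (map f xs)) ! (length (f x) + (k' * m + d))"
      using Cons.prems(1)[of x] by (simp add: Suc add.assoc)
    also have "\<dots> = concat (map f xs) ! (k' * m + d)" by (rule nth_append_length_plus)
    also have "\<dots> = f (xs ! k') ! d" using Cons by (intro Cons.IH) (auto simp: Suc)
    finally show ?thesis by (simp add: Suc)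
  qed
qed simp

lemma is_cycle_card:
  assumes "is_cycle V E"
  shows "3 \<le> card V" "card E = card V"
proof -
  obtain vs where vs: "distinct vs" "3 \<le> length vs" "V = set vs" "E = cycle_edges vs"
    using assms by (auto simp: is_cycle_def)
  then show "3 \<le> card V" by (simp add: distinct_card)
  have "inj_on (\<lambda>i. {vs ! i, vs ! (Suc i mod length vs)}) {..<length vs}"
    using vs by (intro cycle_edge_inj) (auto simp: inj_on_def nth_eq_iff_index_eq)
  then have "card E = length vs" unfolding vs(4) cycle_edges_image by (simp add: card_image)
  then show "card E = card V" using vs by (simp add: distinct_card)
qed

lemma edge_listing_card: "edge_listing E es \<Longrightarrow> length es = card E"
  unfolding edge_listing_def using distinct_card by fastforce

lemma edge_listing_nth:
  assumes "edge_listing E es" and ab: "\<And>k. k < length es \<Longrightarrow> es ! k = (a k, b k)"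
  shows "inj_on (\<lambda>k. {a k, b k}) {..<length es}" "(\<lambda>k. {a k, b k}) ` {..<length es} = E"
proof -
  let ?l = "map (\<lambda>(u, v). {u, v}) es"
  have l: "distinct ?l" "set ?l = E" using assms(1) by (auto simp: edge_listing_def)
  have nth: "?l ! k = {a k, b k}" if "k < length es" for k using ab[OF that] that by simp
  show "inj_on (\<lambda>k. {a k, b k}) {..<length es}"
  proof (rule inj_onI)
    fix i j assume "i \<in> {..<length es}" "j \<in> {..<length es}" "{a i, b i} = {a j, b j}"
    then show "i = j" using nth nth_eq_iff_index_eq[OF l(1), of i j] by simp
  qed
  have "(\<lambda>k. {a k, b k}) ` {..<length es} = (!) ?l ` {..<length ?l}"
    using nth by (intro image_cong) auto
  also have "\<dots> = set ?l" unfolding set_conv_nth by blast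
  finally show "(\<lambda>k. {a k, b k}) ` {..<length es} = E" using l(2) by (simp only:)
qed

definition input_of :: "nat list \<Rightarrow> nat \<Rightarrow> nat" where
  "input_of xs i = (if i < length xs then xs ! i else 0)"

text \<open>The tail \<open>ys\<close> is empty for the optimisation problem and holds the budget
  for the decision problem.\<close>

locale encoded =
  fixes I :: "(nat, nat) univne" and er est :: "(nat \<times> nat) list" and xs ys :: "nat list"
  assumes pres: "presented_instance I er est" and cyc: "is_cycle (VR I) (ER I)"
    and tree: "is_tree (VS I) (ES I)" and xs: "xs = encode I er est @ ys"
begin

sublocale prog_input "input_of xs" .

lemma sizes: "3 \<le> card (VR I)" "length er = card (VR I)" "0 < card (VS I)" "length est = card (VS I) - 1"
  "VR I = {..<card (VR I)}" "VS I = {..<card (VS I)}"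
proof -
  have el: "edge_listing (ER I) er" "edge_listing (ES I) est"
    and V: "VR I = {..<card (VR I)}" "VS I = {..<card (VS I)}"
    using pres by (auto simp: presented_instance_def)
  show "VR I = {..<card (VR I)}" "VS I = {..<card (VS I)}" by (rule V)+
  show "3 \<le> card (VR I)" "length er = card (VR I)"
    using is_cycle_card[OF cyc] edge_listing_card[OF el(1)] by auto
  have sg: "simple_graph (VS I) (ES I)" using tree by (simp add: is_tree_def connected_graph_def)
  then show n: "0 < card (VS I)" by (auto simp: simple_graph_def card_gt_0_iff)
  let ?a = "\<lambda>k. fst (est ! k)" and ?b = "\<lambda>k. snd (est ! k)"
  have en: "inj_on (\<lambda>k. {?a k, ?b k}) {..<length est}" "(\<lambda>k. {?a k, ?b k}) ` {..<length est} = ES I"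
    using edge_listing_nth[OF el(2), of ?a ?b] by auto
  interpret edge_list "card (VS I)" "length est" ?a ?b
  proof
    fix k assume "k < length est"
    then have "{?a k, ?b k} \<in> ES I" using en(2) by blast
    then have "{?a k, ?b k} \<subseteq> VS I" "card {?a k, ?b k} = 2" using sg by (auto simp: simple_graph_def)
    then show "?a k < card (VS I) \<and> ?b k < card (VS I) \<and> ?a k \<noteq> ?b k"
      using V(2) by (auto simp: card_insert_if split: if_splits)
  qed (rule en(1))
  have ES: "edges = ES I" using en(2) by (simp add: edges_def)
  have "finite (VS I)" "VS I \<noteq> {}" "cut_connected edges (VS I)" "acyclic_graph edges"
    using tree n connected_cut[of "VS I" "ES I"] by (auto simp: ES is_tree_def card_gt_0_iff)
  then have "card {e \<in> edges. e \<subseteq> VS I} = card (VS I) - 1"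
    by (intro card_edges_inside) auto
  moreover have "{e \<in> edges. e \<subseteq> VS I} = ES I"
    using sg by (auto simp: ES simple_graph_def)
  ultimately show "length est = card (VS I) - 1" using edge_listing_card[OF el(2)] by simp
qed

lemma length_xs: "length xs = 2 * card (VR I) + 6 * card (VS I) + length ys"
proof -
  have B: "length (concat (map (\<lambda>(u, v). [u, v]) er)) = length er * 2"
    by (rule length_concat_blocks) auto
  have D: "length (concat (map (\<lambda>u. [node_cap I u, node_cost I u]) [0..<card (VS I)])) = card (VS I) * 2"
    using length_concat_blocks[of "[0..<card (VS I)]" "\<lambda>u. [node_cap I u, node_cost I u]" 2] by simp
  have F: "length (concat (map (\<lambda>(u, v). [u, v, edge_cap I {u, v}, edge_cost I {u, v}]) est)) = length est * 4"
    by (rule length_concat_blocks) auto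
  show ?thesis using sizes(2,3,4) unfolding xs encode_def length_append B D F by simp
qed

lemma input_nth:
  shows "input_of xs 0 = card (VR I)" "input_of xs 1 = card (VR I)"
    "k < card (VR I) \<Longrightarrow> input_of xs (2 + (k + k)) = fst (er ! k) \<and> input_of xs (3 + (k + k)) = snd (er ! k)"
    "input_of xs (2 + (card (VR I) + card (VR I))) = card (VS I)"
    "input_of xs (3 + (card (VR I) + card (VR I))) = card (VS I) - 1"
    "u < card (VS I) \<Longrightarrow> input_of xs (4 + (card (VR I) + card (VR I)) + (u + u)) = node_cap I u \<and>
       input_of xs (4 + (card (VR I) + card (VR I)) + (u + u) + 1) = node_cost I u"
    "k < card (VS I) - 1 \<Longrightarrow> d < 4 \<Longrightarrow>
       input_of xs (4 + (card (VR I) + card (VR I)) + (card (VS I) + card (VS I)) + ((k + k) + (k + k)) + d) =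
       [fst (est ! k), snd (est ! k), edge_cap I {fst (est ! k), snd (est ! k)},
        edge_cost I {fst (est ! k), snd (est ! k)}] ! d"
proof -
  let ?N = "card (VR I)" and ?n = "card (VS I)"
  define A where "A = [?N, length er]"
  define B where "B = concat (map (\<lambda>(u, v). [u, v]) er)"
  define C where "C = [?n, length est]"
  define D where "D = concat (map (\<lambda>u. [node_cap I u, node_cost I u]) [0..<?n])"
  define F where "F = concat (map (\<lambda>(u, v). [u, v, edge_cap I {u, v}, edge_cost I {u, v}]) est)"
  have xs': "xs = A @ B @ C @ D @ F @ ys"
    unfolding xs encode_def A_def B_def C_def D_def F_def by simp
  have lB: "length B = ?N * 2" unfolding B_def sizes(2)[symmetric] by (rule length_concat_blocks) auto
  have lD: "length D = ?n * 2"
    using length_concat_blocks[of "[0..<?n]" "\<lambda>u. [node_cap I u, node_cost I u]" 2] by (simp add: D_def)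
  have lF: "length F = (?n - 1) * 4" unfolding F_def sizes(4)[symmetric] by (rule length_concat_blocks) auto
  have lA: "length A = 2" and lC: "length C = 2" by (simp_all add: A_def C_def)
  have nB: "B ! (k * 2 + d) = [fst (er ! k), snd (er ! k)] ! d" if "k < ?N" "d < 2" for k d
    unfolding B_def using that sizes(2) by (subst nth_concat_blocks) (auto split: prod.splits)
  have nD: "D ! (k * 2 + d) = [node_cap I k, node_cost I k] ! d" if "k < ?n" "d < 2" for k d
    unfolding D_def using that by (subst nth_concat_blocks) auto
  have nF: "F ! (k * 4 + d) = [fst (est ! k), snd (est ! k), edge_cap I {fst (est ! k), snd (est ! k)},
        edge_cost I {fst (est ! k), snd (est ! k)}] ! d" if "k < ?n - 1" "d < 4" for k d
    unfolding F_def using that sizes(4) by (subst nth_concat_blocks) (auto split: prod.splits)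
  have inA: "input_of xs i = A ! i" if "i < 2" for i
    using that lA by (simp add: input_of_def xs' nth_append)
  have inB: "input_of xs (2 + i) = B ! i" if "i < ?N * 2" for i
    using that nth_append_length_plus[of A "B @ C @ D @ F @ ys" i] lA lB
    by (simp add: input_of_def xs' nth_append)
  have inC: "input_of xs (2 + ?N * 2 + i) = C ! i" if "i < 2" for i
    using that nth_append_length_plus[of "A @ B" "C @ D @ F @ ys" i] lA lB lC
    by (simp add: input_of_def xs' nth_append)
  have inD: "input_of xs (4 + ?N * 2 + i) = D ! i" if "i < ?n * 2" for i
    using that nth_append_length_plus[of "A @ B @ C" "D @ F @ ys" i] lA lB lC lD
    by (simp add: input_of_def xs' nth_append)
  have inF: "input_of xs (4 + ?N * 2 + ?n * 2 + i) = F ! i" if "i < (?n - 1) * 4" for i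
    using that nth_append_length_plus[of "A @ B @ C @ D" "F @ ys" i] lA lB lC lD lF
    by (simp add: input_of_def xs' nth_append)
  show "input_of xs 0 = ?N" "input_of xs 1 = ?N" using inA[of 0] inA[of 1] sizes(2) by (simp_all add: A_def)
  show "input_of xs (2 + (?N + ?N)) = ?n" "input_of xs (3 + (?N + ?N)) = ?n - 1"
    using inC[of 0] inC[of 1] sizes(4) by (simp_all add: C_def mult_2_right eval_nat_numeral)
  show "input_of xs (2 + (k + k)) = fst (er ! k) \<and> input_of xs (3 + (k + k)) = snd (er ! k)" if "k < ?N"
    using inB[of "k * 2 + 0"] inB[of "k * 2 + 1"] nB[OF that, of 0] nB[OF that, of 1] that
    by (simp add: mult_2_right eval_nat_numeral)
  show "input_of xs (4 + (?N + ?N) + (u + u)) = node_cap I u \<and>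
       input_of xs (4 + (?N + ?N) + (u + u) + 1) = node_cost I u" if "u < ?n"
    using inD[of "u * 2 + 0"] inD[of "u * 2 + 1"] nD[OF that, of 0] nD[OF that, of 1] that
    by (simp add: mult_2_right add.assoc)
  show "input_of xs (4 + (?N + ?N) + (?n + ?n) + ((k + k) + (k + k)) + d) =
       [fst (est ! k), snd (est ! k), edge_cap I {fst (est ! k), snd (est ! k)},
        edge_cost I {fst (est ! k), snd (est ! k)}] ! d" if k: "k < ?n - 1" "d < 4"
  proof -
    have i: "k * 4 + d < (?n - 1) * 4" using k by simp
    have e: "4 + (?N + ?N) + (?n + ?n) + ((k + k) + (k + k)) + d = 4 + ?N * 2 + ?n * 2 + (k * 4 + d)"
      by simp
    show ?thesis unfolding e inF[OF i] nF[OF k] ..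
  qed
qed

lemma params: "N = card (VR I)" "n = card (VS I)"
  unfolding n_def unfolding N_def using input_nth(1,4) by simp_all

lemma er_nth: "k < N \<Longrightarrow> er ! k = (eu k, ew k)"
  using input_nth(3)[of k] by (simp add: eu_def ew_def params)

lemma es_nth: "k < n - 1 \<Longrightarrow> est ! k = (es 0 k, es 1 k) \<and>
    edge_cap I {es 0 k, es 1 k} = es 2 k \<and> edge_cost I {es 0 k, es 1 k} = es 3 k"
proof -
  assume k: "k < n - 1"
  have "es d k = [fst (est ! k), snd (est ! k), edge_cap I {fst (est ! k), snd (est ! k)},
        edge_cost I {fst (est ! k), snd (est ! k)}] ! d" if "d < 4" for d
    using input_nth(7)[OF _ that, of k] k unfolding es_def o2_def o1_def params by simp
  from this[of 0] this[of 1] this[of 2] this[of 3] show ?thesis by (simp add: prod_eq_iff)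
qed

lemma valid: "valid_input (input_of xs) I"
proof (rule valid_input.intro)
  have el: "edge_listing (ER I) er" "edge_listing (ES I) est" and ui: "univne_instance I"
    using pres by (auto simp: presented_instance_def)
  have sg: "simple_graph (VS I) (ES I)" using tree by (simp add: is_tree_def connected_graph_def)
  show "is_cycle (VR I) (ER I)" "is_tree (VS I) (ES I)" by (rule cyc, rule tree)
  show "VR I = {..<N}" "VS I = {..<n}" using sizes(5,6) by (simp_all add: params)
  show "0 < n" using sizes(3) by (simp add: params)
  have lr: "length er = N" and ls: "length est = n - 1" using sizes by (simp_all add: params)
  show "ER I = (\<lambda>k. {eu k, ew k}) ` {..<N}" "inj_on (\<lambda>k. {eu k, ew k}) {..<N}"
    using edge_listing_nth[OF el(1), of eu ew] er_nth unfolding lr by auto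
  have en: "inj_on (\<lambda>k. {es 0 k, es 1 k}) {..<n - 1}" "(\<lambda>k. {es 0 k, es 1 k}) ` {..<n - 1} = ES I"
    using edge_listing_nth[OF el(2), of "es 0" "es 1"] es_nth unfolding ls by blast+
  show el': "edge_list n (n - 1) (es 0) (es 1)"
  proof
    fix k assume "k < n - 1"
    then have "{es 0 k, es 1 k} \<in> ES I" using en(2) by blast
    then have "{es 0 k, es 1 k} \<subseteq> VS I" "card {es 0 k, es 1 k} = 2" using sg unfolding simple_graph_def by blast+
    then show "es 0 k < n \<and> es 1 k < n \<and> es 0 k \<noteq> es 1 k"
      using \<open>VS I = {..<n}\<close> by (auto simp: card_insert_if split: if_splits)
  qed (rule en(1))
  show "ES I = edge_list.edges (n - 1) (es 0) (es 1)"
    using en(2) edge_list.edges_def[OF el'] by simp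
  show "node_cap I u = cap u \<and> node_cost I u = cost u" if "u < n" for u
    using input_nth(6)[of u] that unfolding cap_def cost_def o1_def params by simp
  show "edge_cap I {es 0 k, es 1 k} = es 2 k \<and> edge_cost I {es 0 k, es 1 k} = es 3 k" if "k < n - 1" for k
    using es_nth[OF that] by blast
qed

end

section \<open>Running time\<close>

text \<open>The set-up is split off because it assigns the loop-bound variables, which the static
  time bound forbids in the command it is applied to.\<close>

definition work_com :: com where
  "work_com = nbr_sum_com ;; walk_com ;; degree_com ;; leaves_com ;; strip_com ;; init_com ;; dp_com"

lemma main_work: "main_com = setup_com ;; work_com"
  by (simp add: main_com_def work_com_def)

lemmas com_defs = setup_com_def nbr_sum_com_def walk_com_def degree_com_def leaves_com_def strip_com_def
  init_com_def dp_com_def edge_com_def min_com_def merge_com_def place_com_def emit_def climb_com_def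
  write_path_com_def output_com_def fail_def check_cycle_com_def check_tree_com_def check_cap_com_def
  er_u_def er_v_def n_cap_def n_cost_def es_at_def opt_cell_def

lemma wfc_solve: "wfc solve_com"
  by (simp add: solve_com_def main_com_def com_defs)

lemma input_init: "init_state xs (Cell 0 i) = input_of xs i"
  by (simp add: input_of_def)

context prog_input
begin

definition limit :: "nat \<Rightarrow> nat" where
  "limit y = (if y = vnr then N else if y = vns then n else if y = vnr1 then N + 1 else n)"

lemma loaded_limit: "loaded s \<Longrightarrow> y \<in> {vnr, vns, vnr1, vns1} \<Longrightarrow> s (Var y) \<le> limit y"
  by (auto simp: limit_def)

lemma tm_limit:
  assumes "loaded s" "bvs c \<subseteq> {vnr, vns, vnr1, vns1}" "\<forall>y\<in>{vnr, vns, vnr1, vns1}. \<not> may c (Var y)"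
  shows "tm c s \<le> tb c limit"
  using assms loaded_limit by (intro tm_le_tb) blast

lemma tm_main:
  assumes "\<And>i. s (Cell 0 i) = inp i"
  shows "tm main_com s \<le> 100 + tb work_com limit"
proof -
  have "tm work_com (sem setup_com s) \<le> tb work_com limit"
    by (rule tm_limit[OF setup_correct[OF assms]]) (auto simp: work_com_def com_defs)
  moreover have "tm setup_com s \<le> 100" by (simp add: setup_com_def)
  ultimately show ?thesis by (simp add: main_work)
qed

lemma loaded_main: "(\<And>i. s (Cell 0 i) = inp i) \<Longrightarrow> loaded (sem main_com s)"
  unfolding main_work sem.simps
  by (rule loaded_sem[OF setup_correct]) (simp_all add: keeps_def work_com_def com_defs)

end

context prog_input
begin

text \<open>With \<open>N\<close> at least 3 and \<open>n\<close> positive, every lower-order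
  monomial is at most \<open>N * N * n\<close>, the term contributed by the convolutions. The factor
  2000 is generous.\<close>

lemma tb_work:
  assumes "3 \<le> N" "0 < n"
  shows "tb work_com limit \<le> 2000 * (N * N * n)" "N \<le> N * N * n" "n \<le> N * N * n" "N * n \<le> N * N * n" "1 \<le> N * N * n"
    "N * N \<le> N * N * n"
    "tb (IfLess (Num 0) opt_cell (place_com ;; output_com) (Put aOut (Num 0) (Num 0) ;; 0 ::= Num 1)) limit
      \<le> 2000 * (N * N * n)"
proof -
  have 1: "1 \<le> N" "1 \<le> n" using assms by auto
  have NN: "N \<le> N * N" using 1 by simp
  show h: "N * N \<le> N * N * n" "N * n \<le> N * N * n" using 1 by simp_all
  then show h2: "N \<le> N * N * n" using NN by linarith
  have "n \<le> N * n" using 1 by simp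
  then show h3: "n \<le> N * N * n" using h by linarith
  then show h4: "1 \<le> N * N * n" using 1 by linarith
  note hs = h[unfolded mult.assoc] h2[unfolded mult.assoc] h3[unfolded mult.assoc] h4[unfolded mult.assoc]
  show "tb work_com limit \<le> 2000 * (N * N * n)"
    by (simp add: work_com_def com_defs limit_def algebra_simps) (use hs in linarith)
  show "tb (IfLess (Num 0) opt_cell (place_com ;; output_com) (Put aOut (Num 0) (Num 0) ;; 0 ::= Num 1)) limit
      \<le> 2000 * (N * N * n)"
    by (simp add: com_defs limit_def algebra_simps) (use hs in linarith)
qed

lemma tm_solve:
  assumes s: "\<And>i. s (Cell 0 i) = inp i" and N: "3 \<le> N" "0 < n"
  shows "tm solve_com s \<le> 4100 * (N * N * n)"
proof -
  let ?c = "IfLess (Num 0) opt_cell (place_com ;; output_com) (Put aOut (Num 0) (Num 0) ;; 0 ::= Num 1)"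
  have "tm ?c (sem main_com s) \<le> tb ?c limit"
    by (rule tm_limit[OF loaded_main[OF s]]) (auto simp: com_defs)
  moreover have "tm main_com s \<le> 100 + tb work_com limit" by (rule tm_main[OF s])
  moreover have "tm solve_com s = tm main_com s + tm ?c (sem main_com s)"
    unfolding solve_com_def tm.simps(4) ..
  ultimately show ?thesis using tb_work[OF N] by linarith
qed

end

text \<open>The slack between 4100 and 4300 pays for copying the input and the output.\<close>

lemma (in encoded) solve_computes:
  assumes "ys = []"
  shows "\<exists>t out. t \<le> 4300 * (card (VR I))\<^sup>2 * card (VS I) \<and>
    computes_within (prog solve_com) xs out t \<and> optimal_output I er out"
proof -
  interpret valid_input "input_of xs" I by (rule valid)
  let ?s = "init_state xs"
  let ?s' = "sem solve_com ?s"
  have N: "3 \<le> N" "0 < n" using sizes by (simp_all add: params)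
  have z: "\<And>k i. k \<noteq> 0 \<Longrightarrow> ?s (Cell k i) = 0" by simp
  have len: "length er = N" using sizes by (simp add: params)
  note c = solve_correct[OF input_init z len er_nth]
  have t: "tm solve_com ?s \<le> 4100 * (N * N * n)" by (rule tm_solve[OF input_init N])
  have lx: "length xs = 2 * N + 6 * n" using length_xs assms by (simp add: params)
  have "tm solve_com ?s + 13 * length xs + 14 * ?s' (Var 0) + 7 \<le> 4300 * (N * N * n)"
  proof -
    have "N * (n + 1) = N * n + N" by simp
    then show ?thesis using t c(2) lx tb_work(2-6)[OF N] by linarith
  qed
  then have "tm solve_com ?s + 13 * length xs + 14 * ?s' (Var 0) + 7 \<le> 4300 * (card (VR I))\<^sup>2 * card (VS I)"
    by (simp add: params power2_eq_square mult.assoc)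
  then show ?thesis using prog_computes[OF wfc_solve, of xs] c(1) by blast
qed

section \<open>Checks of the computed orders and what they prove\<close>

section \<open>Certifying the input\<close>

context prog_input
begin

text \<open>A loop of tests, each of which leaves a flag alone or sets it to \<open>b\<close>. With
  \<open>b = 0\<close> the flag records that all tests pass, with \<open>b = 1\<close> that a search
  has found something.\<close>

lemma For_flag:
  assumes s0: "loaded s0" and k: "keeps (For x y c)" and v: "v \<noteq> x"
    and step: "\<And>i t. i < s0 (Var y) \<Longrightarrow> loaded t \<Longrightarrow> (\<And>l. \<not> may (For x y c) l \<Longrightarrow> t l = s0 l) \<Longrightarrow>
      sem c (t(Var x := i)) (Var v) = (if P i then t (Var v) else b)"
  shows "sem (For x y c) s0 (Var v) = (if \<forall>i<s0 (Var y). P i then s0 (Var v) else b)"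
proof (rule For_loaded[OF s0 k, where I = "\<lambda>i t. t (Var v) = (if \<forall>j<i. P j then s0 (Var v) else b)"])
  fix i t
  assume i: "i < s0 (Var y)" and I: "t (Var v) = (if \<forall>j<i. P j then s0 (Var v) else b)" and l: "loaded t"
    and fr: "\<And>l. \<not> may (For x y c) l \<Longrightarrow> t l = s0 l"
  have e: "sem c (t(Var x := i)) (Var v) = (if P i then t (Var v) else b)" by (rule step[OF i l fr])
  show "sem c (t(Var x := i)) (Var v) = (if \<forall>j<Suc i. P j then s0 (Var v) else b)"
    unfolding e I by (auto simp: less_Suc_eq)
qed simp

lemma if_nested: "(if A then (if B then x else y) else y) = (if B \<and> A then x else y)"
  by simp

definition cycle_cert :: "(nat \<Rightarrow> nat) \<Rightarrow> bool" where
  "cycle_cert X \<longleftrightarrow> X N = X 0 \<and> (\<forall>i<N. X i < N \<and> (\<forall>j<N. \<not> (i < j \<and> X i = X j)) \<and>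
     \<not> (\<forall>k<N. \<not> (eu k = X i \<and> ew k = X (Suc i) \<or> ew k = X i \<and> eu k = X (Suc i))))"

definition tree_cert :: "(nat \<Rightarrow> nat) \<Rightarrow> (nat \<Rightarrow> nat) \<Rightarrow> bool" where
  "tree_cert Q PA \<longleftrightarrow> (\<forall>i<n. Q i < n \<and> (\<forall>j<n. \<not> (i < j \<and> Q i = Q j))) \<and>
     (\<forall>i<n - 1. \<not> (\<forall>j<n. \<not> (i < j \<and> Q j = PA (Q i))) \<and>
       \<not> (\<forall>k<n - 1. \<not> (es 0 k = Q i \<and> es 1 k = PA (Q i) \<or> es 1 k = Q i \<and> es 0 k = PA (Q i))))"

definition cap_cert :: bool where
  "cap_cert \<longleftrightarrow> (\<forall>u<n. cap u \<noteq> 0) \<and> (\<forall>k<n - 1. es 2 k \<noteq> 0)"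

lemma check_cycle_correct:
  assumes s: "loaded s" "s (Var vok) = 0"
  shows "sem check_cycle_com s (Var vok) = (if cycle_cert (\<lambda>i. s (Cell aX i)) then 1 else 0)"
proof -
  let ?X = "\<lambda>i. s (Cell aX i)"
  let ?cj = "IfLess (Rd vi) (Rd vj) (IfEq (At aX (Rd vi)) (At aX (Rd vj)) fail) Skip"
  let ?ck = "IfEq (er_u (Rd vk)) (At aX (Rd vi))
           (IfEq (er_v (Rd vk)) (At aX (Plus (Rd vi) (Num 1))) (vfound ::= Num 1)) ;;
         IfEq (er_v (Rd vk)) (At aX (Rd vi))
           (IfEq (er_u (Rd vk)) (At aX (Plus (Rd vi) (Num 1))) (vfound ::= Num 1))"
  let ?ci = "IfLess (At aX (Rd vi)) (Rd vnr) Skip fail ;;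
       For vj vnr ?cj ;;
       vfound ::= Num 0 ;;
       For vk vnr ?ck ;;
       IfEq (Rd vfound) (Num 0) fail"
  let ?F = "\<lambda>i. \<forall>k<N. \<not> (eu k = ?X i \<and> ew k = ?X (Suc i) \<or> ew k = ?X i \<and> eu k = ?X (Suc i))"
  let ?D = "\<lambda>i. \<forall>j<N. \<not> (i < j \<and> ?X i = ?X j)"
  let ?s0 = "s(Var vok := (if ?X N = ?X 0 then 1 else 0))"
  have 1: "sem check_cycle_com s = sem (For vi vnr ?ci) ?s0"
    using s by (simp add: check_cycle_com_def fun_upd_idem del: sem.simps(6))
  have 2: "sem (For vi vnr ?ci) ?s0 (Var vok) = (if \<forall>i<?s0 (Var vnr). ?X i < N \<and> ?D i \<and> \<not> ?F i then ?s0 (Var vok) else 0)"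
  proof (rule For_flag)
    fix i t assume t: "loaded t" and fr: "\<And>l. \<not> may (For vi vnr ?ci) l \<Longrightarrow> t l = ?s0 l"
    have X: "t (Cell aX x) = ?X x" for x by (subst fr; simp add: fail_def)
    let ?t = "t(Var vi := i)"
    define t1 where "t1 = sem (IfLess (At aX (Rd vi)) (Rd vnr) Skip fail) ?t"
    define t2 where "t2 = sem (For vj vnr ?cj) t1"
    define t3 where "t3 = t2(Var vfound := 0)"
    define t4 where "t4 = sem (For vk vnr ?ck) t3"
    have k: "keeps (For vj vnr ?cj)" "keeps (For vk vnr ?ck)" by (auto simp: keeps_def fail_def)
    have l1: "loaded t1" using t by (simp add: t1_def fail_def)
    have l2: "loaded t2" unfolding t2_def by (rule loaded_sem[OF l1 k(1)])
    have l3: "loaded t3" using l2 by (simp add: t3_def)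
    have v1: "t1 (Var vi) = i" "t1 (Cell aX x) = ?X x" "t1 (Var vok) = (if ?X i < N then t (Var vok) else 0)" for x
      using X t by (simp_all add: t1_def fail_def)
    have "t2 (Var vok) = (if \<forall>j<t1 (Var vnr). \<not> (i < j \<and> ?X i = ?X j) then t1 (Var vok) else 0)"
      unfolding t2_def
    proof (rule For_flag[OF l1 k(1)])
      fix j t' assume fr': "\<And>l. \<not> may (For vj vnr ?cj) l \<Longrightarrow> t' l = t1 l"
      have "t' (Var vi) = i" "t' (Cell aX x) = ?X x" for x using v1 by (subst fr'; simp add: fail_def)+
      then show "sem ?cj (t'(Var vj := j)) (Var vok) = (if \<not> (i < j \<and> ?X i = ?X j) then t' (Var vok) else 0)"
        by (simp add: fail_def)
    qed simp
    then have v2: "t2 (Var vok) = (if ?D i then t1 (Var vok) else 0)" using l1 by simp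
    have v3: "t3 (Var vi) = i" "t3 (Cell aX x) = ?X x" for x
      unfolding t3_def t2_def using v1 by (simp_all add: sem_frame fail_def del: sem.simps(6))
    have "t4 (Var vfound) = (if \<forall>k<t3 (Var vnr). \<not> (eu k = ?X i \<and> ew k = ?X (Suc i) \<or> ew k = ?X i \<and> eu k = ?X (Suc i))
      then t3 (Var vfound) else 1)"
      unfolding t4_def
    proof (rule For_flag[OF l3 k(2)])
      fix k t' assume t': "loaded t'" and fr': "\<And>l. \<not> may (For vk vnr ?ck) l \<Longrightarrow> t' l = t3 l"
      have "t' (Var vi) = i" "t' (Cell aX x) = ?X x" for x using v3 by (subst fr'; simp)+
      then show "sem ?ck (t'(Var vk := k)) (Var vfound) = (if \<not> (eu k = ?X i \<and> ew k = ?X (Suc i) \<or> ew k = ?X i \<and> eu k = ?X (Suc i))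
        then t' (Var vfound) else 1)"
        using t' by auto
    qed simp
    then have v4: "t4 (Var vfound) = (if ?F i then 0 else 1)" using l3 by (simp add: t3_def)
    have v5: "t4 (Var vok) = t2 (Var vok)"
      unfolding t4_def by (subst sem_frame) (simp_all add: t3_def)
    have E: "sem ?ci ?t = sem (IfEq (Rd vfound) (Num 0) fail) t4"
      unfolding t4_def t3_def t2_def t1_def by (simp only: sem.simps(4) sem.simps(2) ev.simps)
    show "sem ?ci ?t (Var vok) = (if ?X i < N \<and> ?D i \<and> \<not> ?F i then t (Var vok) else 0)"
      unfolding E using v1 v2 v4 v5 by (auto simp: fail_def)
  qed (use s in \<open>auto simp: keeps_def fail_def\<close>)
  have 3: "?s0 (Var vnr) = N" using s by simp
  have 4: "?s0 (Var vok) = (if ?X N = ?X 0 then 1 else 0)" by simp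
  show ?thesis unfolding 1 2 3 4 cycle_cert_def if_nested ..
qed

lemma check_tree_correct:
  assumes s: "loaded s"
  shows "sem check_tree_com s (Var vok) =
    (if tree_cert (\<lambda>i. s (Cell aQ i)) (\<lambda>i. s (Cell aPA i)) then s (Var vok) else 0)"
proof -
  let ?Q = "\<lambda>i. s (Cell aQ i)" and ?PA = "\<lambda>i. s (Cell aPA i)"
  let ?cj = "IfLess (Rd vi) (Rd vj) (IfEq (At aQ (Rd vi)) (At aQ (Rd vj)) fail) Skip"
  let ?ci = "IfLess (At aQ (Rd vi)) (Rd vns) Skip fail ;; For vj vns ?cj"
  let ?dj = "IfLess (Rd vi) (Rd vj) (IfEq (At aQ (Rd vj)) (Rd vp) (vfound ::= Num 1)) Skip"
  let ?dk = "IfEq (es_at 0 (Rd vk)) (Rd vv)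
           (IfEq (es_at 1 (Rd vk)) (Rd vp) (vfound ::= Num 1)) ;;
         IfEq (es_at 1 (Rd vk)) (Rd vv)
           (IfEq (es_at 0 (Rd vk)) (Rd vp) (vfound ::= Num 1))"
  let ?di = "vv ::= At aQ (Rd vi) ;;
       vp ::= At aPA (Rd vv) ;;
       vfound ::= Num 0 ;;
       For vj vns ?dj ;;
       IfEq (Rd vfound) (Num 0) fail ;;
       vfound ::= Num 0 ;;
       For vk vns1 ?dk ;;
       IfEq (Rd vfound) (Num 0) fail"
  let ?D = "\<lambda>i. \<forall>j<n. \<not> (i < j \<and> ?Q i = ?Q j)"
  let ?P = "\<lambda>i. \<forall>j<n. \<not> (i < j \<and> ?Q j = ?PA (?Q i))"
  let ?E = "\<lambda>i. \<forall>k<n - 1. \<not> (es 0 k = ?Q i \<and> es 1 k = ?PA (?Q i) \<or> es 1 k = ?Q i \<and> es 0 k = ?PA (?Q i))"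
  define s1 where "s1 = sem (For vi vns ?ci) s"
  have ki: "keeps (For vi vns ?ci)" "keeps (For vi vns1 ?di)" by (auto simp: keeps_def fail_def)
  have "s1 (Var vok) = (if \<forall>i<s (Var vns). ?Q i < n \<and> ?D i then s (Var vok) else 0)"
    unfolding s1_def
  proof (rule For_flag[OF s ki(1)])
    fix i t assume t: "loaded t" and fr: "\<And>l. \<not> may (For vi vns ?ci) l \<Longrightarrow> t l = s l"
    have Q: "t (Cell aQ x) = ?Q x" for x by (subst fr; simp add: fail_def)
    let ?t = "t(Var vi := i)"
    define t1 where "t1 = sem (IfLess (At aQ (Rd vi)) (Rd vns) Skip fail) ?t"
    have k: "keeps (For vj vns ?cj)" by (auto simp: keeps_def fail_def)
    have l1: "loaded t1" using t by (simp add: t1_def fail_def)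
    have v1: "t1 (Var vi) = i" "t1 (Cell aQ x) = ?Q x" "t1 (Var vok) = (if ?Q i < n then t (Var vok) else 0)" for x
      using Q t by (simp_all add: t1_def fail_def)
    have "sem (For vj vns ?cj) t1 (Var vok) = (if \<forall>j<t1 (Var vns). \<not> (i < j \<and> ?Q i = ?Q j) then t1 (Var vok) else 0)"
    proof (rule For_flag[OF l1 k])
      fix j t' assume fr': "\<And>l. \<not> may (For vj vns ?cj) l \<Longrightarrow> t' l = t1 l"
      have "t' (Var vi) = i" "t' (Cell aQ x) = ?Q x" for x using v1 by (subst fr'; simp add: fail_def)+
      then show "sem ?cj (t'(Var vj := j)) (Var vok) = (if \<not> (i < j \<and> ?Q i = ?Q j) then t' (Var vok) else 0)"
        by (simp add: fail_def)
    qed simp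
    then show "sem ?ci ?t (Var vok) = (if ?Q i < n \<and> ?D i then t (Var vok) else 0)"
      using l1 v1 unfolding t1_def by (auto simp del: sem.simps(5,6))
  qed simp
  then have v1: "s1 (Var vok) = (if \<forall>i<n. ?Q i < n \<and> ?D i then s (Var vok) else 0)" using s by simp
  have c1: "s1 (Cell k x) = s (Cell k x)" for k x unfolding s1_def by (rule sem_frame) (simp add: fail_def)
  have l1: "loaded s1" unfolding s1_def by (rule loaded_sem[OF s ki(1)])
  have "sem (For vi vns1 ?di) s1 (Var vok) = (if \<forall>i<s1 (Var vns1). \<not> ?P i \<and> \<not> ?E i then s1 (Var vok) else 0)"
  proof (rule For_flag[OF l1 ki(2)])
    fix i t assume t: "loaded t" and fr: "\<And>l. \<not> may (For vi vns1 ?di) l \<Longrightarrow> t l = s1 l"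
    have Q: "t (Cell aQ x) = ?Q x" "t (Cell aPA x) = ?PA x" for x using c1 by (subst fr; simp add: fail_def)+
    let ?t = "t(Var vi := i)"
    define t1 where "t1 = ?t(Var vv := ?Q i, Var vp := ?PA (?Q i), Var vfound := 0)"
    define t2 where "t2 = sem (For vj vns ?dj) t1"
    define t3 where "t3 = (sem (IfEq (Rd vfound) (Num 0) fail) t2)(Var vfound := 0)"
    define t4 where "t4 = sem (For vk vns1 ?dk) t3"
    have k: "keeps (For vj vns ?dj)" "keeps (For vk vns1 ?dk)" by (auto simp: keeps_def fail_def)
    have m1: "loaded t1" using t by (simp add: t1_def)
    have m2: "loaded t2" unfolding t2_def by (rule loaded_sem[OF m1 k(1)])
    have m3: "loaded t3" using m2 by (simp add: t3_def fail_def)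
    have w1: "t1 (Var vi) = i" "t1 (Cell aQ x) = ?Q x" "t1 (Var vp) = ?PA (?Q i)" for x
      using Q by (simp_all add: t1_def)
    have "t2 (Var vfound) = (if \<forall>j<t1 (Var vns). \<not> (i < j \<and> ?Q j = ?PA (?Q i)) then t1 (Var vfound) else 1)"
      unfolding t2_def
    proof (rule For_flag[OF m1 k(1)])
      fix j t' assume fr': "\<And>l. \<not> may (For vj vns ?dj) l \<Longrightarrow> t' l = t1 l"
      have "t' (Var vi) = i" "t' (Cell aQ x) = ?Q x" "t' (Var vp) = ?PA (?Q i)" for x using w1 by (subst fr'; simp)+
      then show "sem ?dj (t'(Var vj := j)) (Var vfound) = (if \<not> (i < j \<and> ?Q j = ?PA (?Q i)) then t' (Var vfound) else 1)"
        by simp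
    qed simp
    then have w2: "t2 (Var vfound) = (if ?P i then 0 else 1)" using m1 by (simp add: t1_def)
    have f2: "t2 (Var vok) = t (Var vok)" "t2 (Var vv) = ?Q i" "t2 (Var vp) = ?PA (?Q i)"
      unfolding t2_def by (simp_all add: sem_frame t1_def del: sem.simps(6))
    have f3: "t3 (Var vok) = (if ?P i then 0 else t (Var vok))" "t3 (Var vv) = ?Q i" "t3 (Var vp) = ?PA (?Q i)"
      using f2 w2 by (auto simp: t3_def fail_def)
    have "t4 (Var vfound) = (if \<forall>k<t3 (Var vns1). \<not> (es 0 k = ?Q i \<and> es 1 k = ?PA (?Q i) \<or> es 1 k = ?Q i \<and> es 0 k = ?PA (?Q i))
      then t3 (Var vfound) else 1)"
      unfolding t4_def
    proof (rule For_flag[OF m3 k(2)])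
      fix k t' assume t': "loaded t'" and fr': "\<And>l. \<not> may (For vk vns1 ?dk) l \<Longrightarrow> t' l = t3 l"
      have "t' (Var vv) = ?Q i" "t' (Var vp) = ?PA (?Q i)" using f3 by (subst fr'; simp)+
      then show "sem ?dk (t'(Var vk := k)) (Var vfound) =
        (if \<not> (es 0 k = ?Q i \<and> es 1 k = ?PA (?Q i) \<or> es 1 k = ?Q i \<and> es 0 k = ?PA (?Q i)) then t' (Var vfound) else 1)"
        using t' by auto
    qed simp
    moreover have "t3 (Var vns1) = n - 1" using m3 by simp
    ultimately have w4: "t4 (Var vfound) = (if ?E i then 0 else 1)" by (simp only:) (simp add: t3_def)
    have f4: "t4 (Var vok) = t3 (Var vok)" unfolding t4_def by (rule sem_frame) simp
    have e1: "sem (vfound ::= Num 0) (sem (vp ::= At aPA (Rd vv)) (sem (vv ::= At aQ (Rd vi)) ?t)) = t1"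
      using Q by (simp add: t1_def)
    have E: "sem ?di ?t = sem (IfEq (Rd vfound) (Num 0) fail) t4"
      unfolding t4_def t3_def t2_def e1[symmetric] by (simp only: sem.simps(4)) (simp only: sem.simps(2) ev.simps)
    show "sem ?di ?t (Var vok) = (if \<not> ?P i \<and> \<not> ?E i then t (Var vok) else 0)"
      unfolding E using w4 f4 f3 by (auto simp: fail_def)
  qed simp
  moreover have "s1 (Var vns1) = n - 1" using l1 by simp
  ultimately have v2: "sem check_tree_com s (Var vok) = (if \<forall>i<n - 1. \<not> ?P i \<and> \<not> ?E i then s1 (Var vok) else 0)"
    unfolding check_tree_com_def s1_def sem.simps(4) by (simp only:)
  show ?thesis unfolding v2 v1 tree_cert_def if_nested ..
qed

lemma check_cap_correct:
  assumes s: "loaded s"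
  shows "sem check_cap_com s (Var vok) = (if cap_cert then s (Var vok) else 0)"
proof -
  let ?c = "IfEq (n_cap (Rd vi)) (Num 0) fail" and ?d = "IfEq (es_at 2 (Rd vi)) (Num 0) fail"
  have k: "keeps (For vi vns ?c)" "keeps (For vi vns1 ?d)" by (auto simp: keeps_def fail_def)
  define s1 where "s1 = sem (For vi vns ?c) s"
  have l1: "loaded s1" unfolding s1_def by (rule loaded_sem[OF s k(1)])
  have "s1 (Var vok) = (if \<forall>i<s (Var vns). cap i \<noteq> 0 then s (Var vok) else 0)"
    unfolding s1_def by (rule For_flag[OF s k(1)]) (auto simp: fail_def)
  moreover have "sem (For vi vns1 ?d) s1 (Var vok) = (if \<forall>i<s1 (Var vns1). es 2 i \<noteq> 0 then s1 (Var vok) else 0)"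
    by (rule For_flag[OF l1 k(2)]) (auto simp: fail_def)
  moreover have "sem check_cap_com s = sem (For vi vns1 ?d) s1" by (simp add: check_cap_com_def s1_def del: sem.simps(6))
  ultimately show ?thesis using s l1 by (auto simp: cap_cert_def simp del: sem.simps(6))
qed

end

text \<open>An instance must be connected, and a certified cycle has to supply this. The path runs
  along the list between the two positions, reversed if necessary.\<close>

lemma cycle_connected:
  assumes "is_cycle V E"
  shows "connected_graph V E"
proof -
  obtain vs where vs: "distinct vs" "3 \<le> length vs" "V = set vs" "E = cycle_edges vs"
    using assms by (auto simp: is_cycle_def)
  let ?l = "length vs"
  have mod: "Suc i mod ?l < ?l" for i using vs(2) by (intro mod_less_divisor) linarith
  have "simple_graph V E"
    unfolding simple_graph_def vs(3,4) cycle_edges_def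
  proof (intro conjI ballI)
    show "set vs \<noteq> {}" using vs(2) by auto
    fix e assume "e \<in> {{vs ! i, vs ! (Suc i mod ?l)} |i. i < ?l}"
    then obtain i where i: "i < ?l" "e = {vs ! i, vs ! (Suc i mod ?l)}" by blast
    then show "e \<subseteq> set vs" using mod[of i] by simp
    have "vs ! i \<noteq> vs ! (Suc i mod ?l)"
      using i(1) mod[of i] vs(1,2) by (auto simp: nth_eq_iff_index_eq mod_Suc)
    then show "card e = 2" using i(2) by simp
  qed simp
  moreover have path: "\<exists>p. is_path V E p \<and> hd p = vs ! i \<and> last p = vs ! j" if "i \<le> j" "j < ?l" for i j
  proof -
    let ?p = "take (Suc j - i) (drop i vs)"
    have len: "length ?p = Suc j - i" using that by simp
    have nth: "?p ! a = vs ! (i + a)" if "a < Suc j - i" for a using that \<open>i \<le> j\<close> \<open>j < ?l\<close> by simp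
    have "path_edges ?p \<subseteq> E"
    proof
      fix e assume "e \<in> path_edges ?p"
      then obtain a where a: "Suc a < Suc j - i" "e = {?p ! a, ?p ! Suc a}"
        unfolding path_edges_def len by blast
      then have "e = {vs ! (i + a), vs ! (Suc (i + a) mod ?l)}" using nth that by simp
      moreover have "i + a < ?l" using a(1) that by simp
      ultimately show "e \<in> E" unfolding vs(4) cycle_edges_def by blast
    qed
    moreover have "set ?p \<subseteq> V" unfolding vs(3) by (meson order_trans set_drop_subset set_take_subset)
    moreover have "?p \<noteq> []" using that by simp
    moreover from this have "hd ?p = vs ! i" "last ?p = vs ! j"
      using nth[of 0] nth[of "j - i"] that len by (simp_all add: hd_conv_nth last_conv_nth)
    moreover have "distinct ?p" using vs(1) by simp
    ultimately show ?thesis unfolding is_path_def by blast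
  qed
  have "\<exists>p. is_path V E p \<and> hd p = u \<and> last p = v" if uv: "u \<in> V" "v \<in> V" for u v
  proof -
    obtain i j where ij: "i < ?l" "u = vs ! i" "j < ?l" "v = vs ! j"
      using uv unfolding vs(3) in_set_conv_nth by blast
    show ?thesis
    proof (cases "i \<le> j")
      case True
      then show ?thesis using path ij by blast
    next
      case False
      then obtain p where p: "is_path V E p" "hd p = v" "last p = u" using path[of j i] ij by auto
      then have "is_path V E (rev p)" "hd (rev p) = u" "last (rev p) = v"
        by (auto simp: is_path_rev hd_rev last_rev)
      then show ?thesis by blast
    qed
  qed
  ultimately show ?thesis unfolding connected_graph_def by blast
qed

text \<open>Pigeonhole: \<open>m\<close> listed edges that cover a set of \<open>m\<close> required
  edges are distinct and contain nothing else. This lets the checks look only for the presence of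
  the required edges.\<close>

lemma covering_inj:
  assumes "S \<subseteq> f ` {..<m}" "card S = m" "finite S"
  shows "inj_on f {..<m}" "f ` {..<m} = S"
proof -
  have "card S \<le> card (f ` {..<m})" using assms by (intro card_mono) auto
  moreover have "card (f ` {..<m}) \<le> m" using card_image_le[of "{..<m}" f] by simp
  ultimately have c: "card (f ` {..<m}) = m" using assms(2) by simp
  then show "inj_on f {..<m}" by (intro eq_card_imp_inj_on) auto
  show "f ` {..<m} = S" using card_subset_eq[OF _ assms(1)] c assms(2) by simp
qed

lemma upt_join: "i \<le> j \<Longrightarrow> j \<le> k \<Longrightarrow> [i..<j] @ [j..<k] = [i..<k]"
  using upt_add_eq_append[of i j "k - j"] by simp

lemma upt_join5:
  assumes "a \<le> b" "b \<le> c" "c \<le> d" "d \<le> e" "e \<le> f"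
  shows "[a..<f] = [a..<b] @ [b..<c] @ [c..<d] @ [d..<e] @ [e..<f]"
proof -
  have "[d..<f] = [d..<e] @ [e..<f]" using assms by (intro upt_join[symmetric])
  moreover have "[c..<f] = [c..<d] @ [d..<f]" using assms by (intro upt_join[symmetric]) auto
  moreover have "[b..<f] = [b..<c] @ [c..<f]" using assms by (intro upt_join[symmetric]) auto
  moreover have "[a..<f] = [a..<b] @ [b..<f]" using assms by (intro upt_join[symmetric]) auto
  ultimately show ?thesis by simp
qed

lemma map_upt_blocks2:
  "map f [a..<a + 2 * m] = concat (map (\<lambda>k. [f (a + (k + k)), f (a + (k + k) + 1)]) [0..<m])"
proof (induction m)
  case (Suc m)
  have "[a..<a + 2 * Suc m] = [a..<a + 2 * m] @ [a + (m + m), a + (m + m) + 1]"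
    by (simp add: mult_2)
  then show ?case using Suc by (simp add: mult_2)
qed simp

lemma map_upt_blocks4:
  "map f [a..<a + 4 * m] = concat (map (\<lambda>k. [f (a + ((k + k) + (k + k)) + 0), f (a + ((k + k) + (k + k)) + 1),
     f (a + ((k + k) + (k + k)) + 2), f (a + ((k + k) + (k + k)) + 3)]) [0..<m])"
proof (induction m)
  case (Suc m)
  have e: "4 * m = (m + m) + (m + m)" by simp
  define b where "b = a + ((m + m) + (m + m))"
  have 1: "a + 4 * m = b" "a + 4 * Suc m = b + 4" by (simp_all add: b_def)
  have "[b..<b+4] = [b, b + 1, b + 2, b + 3]" by (simp add: upt_rec[of _ "b+4"] numeral_2_eq_2 numeral_3_eq_3)
  moreover have "[a..<b+4] = [a..<b] @ [b..<b+4]" by (rule upt_add_eq_append) (simp add: b_def)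
  ultimately have "map f [a..<a + 4 * Suc m] = map f [a..<a + 4 * m] @ [f (b + 0), f (b + 1), f (b + 2), f (b + 3)]"
    unfolding 1 by simp
  also have "\<dots> = concat (map (\<lambda>k. [f (a + ((k + k) + (k + k)) + 0), f (a + ((k + k) + (k + k)) + 1),
     f (a + ((k + k) + (k + k)) + 2), f (a + ((k + k) + (k + k)) + 3)]) [0..<Suc m])"
    unfolding Suc.IH b_def by simp
  finally show ?case .
qed simp

section \<open>Soundness and completeness of the certificates, and membership in P\<close>

section \<open>The decision problem\<close>

text \<open>These are exactly the tests the program makes; together they force the list to be an
  encoding followed by a budget.\<close>

locale certified = prog_input "input_of xs" for xs +
  fixes X Q PA :: "nat \<Rightarrow> nat"
  assumes N: "2 < N" "input_of xs 1 = N" and n: "0 < n" "input_of xs (3 + (N + N)) + 1 = n"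
    and len: "length xs = 1 + (N + N) + ((n + n) + ((n + n) + (n + n)))"
    and certs: "cycle_cert X" "tree_cert Q PA" cap_cert
begin

lemma cycle_facts:
  "is_cycle {..<N} ((\<lambda>k. {eu k, ew k}) ` {..<N})" "inj_on (\<lambda>k. {eu k, ew k}) {..<N}"
proof -
  have c: "X N = X 0" "\<And>i. i < N \<Longrightarrow> X i < N" "\<And>i j. i < N \<Longrightarrow> j < N \<Longrightarrow> i < j \<Longrightarrow> X i \<noteq> X j"
    "\<And>i. i < N \<Longrightarrow> \<exists>k<N. eu k = X i \<and> ew k = X (Suc i) \<or> ew k = X i \<and> eu k = X (Suc i)"
    using certs(1) unfolding cycle_cert_def by blast+
  have inj: "inj_on X {..<N}"
    unfolding inj_on_def using c(3) by (metis lessThan_iff linorder_neqE_nat)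
  let ?S = "(\<lambda>i. {X i, X (Suc i mod N)}) ` {..<N}"
  have "?S \<subseteq> (\<lambda>k. {eu k, ew k}) ` {..<N}"
  proof
    fix e assume "e \<in> ?S"
    then obtain i where i: "i < N" "e = {X i, X (Suc i mod N)}" by blast
    have "X (Suc i mod N) = X (Suc i)" using i(1) c(1) by (cases "Suc i = N") auto
    moreover obtain k where "k < N" "eu k = X i \<and> ew k = X (Suc i) \<or> ew k = X i \<and> eu k = X (Suc i)"
      using c(4)[OF i(1)] by blast
    ultimately show "e \<in> (\<lambda>k. {eu k, ew k}) ` {..<N}" using i(2) by (intro image_eqI[of _ _ k]) auto
  qed
  note sub = this
  have "card ?S = N" using cycle_edge_inj[OF inj] N(1) by (simp add: card_image)
  note S = covering_inj[OF sub this finite_imageI[OF finite_lessThan]]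
  show "inj_on (\<lambda>k. {eu k, ew k}) {..<N}" by (rule S(1))
  let ?vs = "map X [0..<N]"
  have "X ` {..<N} = {..<N}" using c(2) card_image[OF inj] by (intro card_subset_eq) auto
  then have "distinct ?vs" "3 \<le> length ?vs" "{..<N} = set ?vs"
    using inj N(1) by (auto simp: distinct_map lessThan_atLeast0)
  moreover have "cycle_edges ?vs = ?S"
    unfolding cycle_edges_image using N(1) by (intro image_cong) auto
  ultimately show "is_cycle {..<N} ((\<lambda>k. {eu k, ew k}) ` {..<N})"
    unfolding S(2) is_cycle_def by (intro exI[of _ ?vs] conjI) (simp_all only:)
qed

text \<open>The order is injective on \<open>n\<close> positions, hence a permutation, and parents
  come later, so it presents a tree. Its \<open>n - 1\<close> edges occur among the
  \<open>n - 1\<close> listed ones, hence are all of them.\<close>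

lemma tree_facts:
  "is_tree {..<n} ((\<lambda>k. {es 0 k, es 1 k}) ` {..<n - 1})" "inj_on (\<lambda>k. {es 0 k, es 1 k}) {..<n - 1}"
proof -
  have c: "\<And>i. i < n \<Longrightarrow> Q i < n" "\<And>i j. i < n \<Longrightarrow> j < n \<Longrightarrow> i < j \<Longrightarrow> Q i \<noteq> Q j"
    "\<And>i. i < n - 1 \<Longrightarrow> \<exists>j<n. i < j \<and> Q j = PA (Q i)"
    "\<And>i. i < n - 1 \<Longrightarrow> \<exists>k<n - 1. es 0 k = Q i \<and> es 1 k = PA (Q i) \<or> es 1 k = Q i \<and> es 0 k = PA (Q i)"
    using certs(2) unfolding tree_cert_def by blast+
  have inj: "inj_on Q {..<n}"
    unfolding inj_on_def using c(2) by (metis lessThan_iff linorder_neqE_nat)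
  have im: "Q ` {..<n} = {..<n}" using c(1) card_image[OF inj] by (intro card_subset_eq) auto
  define R where "R = inv_into {..<n} Q"
  have R: "R (Q i) = i" if "i < n" for i using inv_into_f_f[OF inj] that by (simp add: R_def)
  have QR: "R v < n \<and> Q (R v) = v" if "v < n" for v
    using inv_into_into[of v Q "{..<n}"] f_inv_into_f[of v Q "{..<n}"] that im by (simp add: R_def)
  have pt: "ptree n Q PA R"
  proof
    fix v assume v: "v < n" "v \<noteq> Q (n - 1)"
    then have "R v \<noteq> n - 1" using QR by metis
    then have "R v < n - 1" using QR[OF v(1)] by linarith
    then obtain j where "j < n" "R v < j" "Q j = PA (Q (R v))" using c(3) by blast
    then show "PA v < n \<and> R v < R (PA v)" using QR[OF v(1)] R[of j] c(1)[of j] by simp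
  qed (use n R QR c(1) in auto)
  interpret ptree n Q PA R by (rule pt)
  have "E \<subseteq> (\<lambda>k. {es 0 k, es 1 k}) ` {..<n - 1}"
  proof
    fix e assume "e \<in> E"
    then obtain t where t: "t < n - 1" "e = {Q t, PA (Q t)}" unfolding E_od by blast
    then obtain k where "k < n - 1" "es 0 k = Q t \<and> es 1 k = PA (Q t) \<or> es 1 k = Q t \<and> es 0 k = PA (Q t)"
      using c(4) by blast
    then show "e \<in> (\<lambda>k. {es 0 k, es 1 k}) ` {..<n - 1}" using t(2) by (intro image_eqI[of _ _ k]) auto
  qed
  note sub = this
  have "finite E" by (simp add: E_od)
  note S = covering_inj[OF sub card_E this]
  show "inj_on (\<lambda>k. {es 0 k, es 1 k}) {..<n - 1}" by (rule S(1))
  show "is_tree {..<n} ((\<lambda>k. {es 0 k, es 1 k}) ` {..<n - 1})" unfolding S(2) by (rule is_tree)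
qed

definition er where "er = map (\<lambda>k. (eu k, ew k)) [0..<N]"
definition est where "est = map (\<lambda>k. (es 0 k, es 1 k)) [0..<n - 1]"
text \<open>The list gives capacities and costs by position, whereas an instance wants them as
  functions of the edge.\<close>

definition ix where "ix e = (THE k. k < n - 1 \<and> {es 0 k, es 1 k} = e)"
definition inst :: "(nat, nat) univne" where
  "inst = \<lparr>VR = {..<N}, ER = (\<lambda>k. {eu k, ew k}) ` {..<N}, VS = {..<n},
     ES = (\<lambda>k. {es 0 k, es 1 k}) ` {..<n - 1}, node_cap = cap, edge_cap = (\<lambda>e. es 2 (ix e)),
     node_cost = cost, edge_cost = (\<lambda>e. es 3 (ix e))\<rparr>"

lemma ix: "k < n - 1 \<Longrightarrow> ix {es 0 k, es 1 k} = k"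
  unfolding ix_def using tree_facts(2) by (intro the_equality) (auto simp: inj_on_def)

lemma xs_encode: "xs = encode inst er est @ [input_of xs (length xs - 1)]"
proof -
  let ?f = "input_of xs" and ?L = "length xs"
  have L: "?L = Suc (o2 + 4 * (n - 1))" using len n(1) by (simp add: o2_def o1_def)
  have o: "o1 = 2 + 2 * N + 2" "o2 = o1 + 2 * n" by (simp_all add: o1_def o2_def)
  have "xs = map ?f [0..<?L]" by (rule nth_equalityI) (auto simp: input_of_def)
  also have "[0..<?L] = [0..<2] @ [2..<2 + 2 * N] @ [2 + 2 * N..<o1] @ [o1..<o1 + 2 * n] @ [o2..<o2 + 4 * (n - 1)] @ [?L - 1]"
  proof -
    have "[0..<?L] = [0..<o2 + 4 * (n - 1)] @ [?L - 1]" unfolding L by simp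
    moreover have "[0..<o2 + 4 * (n - 1)] = [0..<2] @ [2..<2 + 2 * N] @ [2 + 2 * N..<o1] @ [o1..<o2] @ [o2..<o2 + 4 * (n - 1)]"
      by (rule upt_join5) (simp_all add: o)
    ultimately show ?thesis using o(2) by simp
  qed
  finally have x: "xs = map ?f [0..<2] @ map ?f [2..<2 + 2 * N] @ map ?f [2 + 2 * N..<o1] @
      map ?f [o1..<o1 + 2 * n] @ map ?f [o2..<o2 + 4 * (n - 1)] @ [?f (?L - 1)]"
    by simp
  have A: "map ?f [0..<2] = [N, N]" using N(2) by (simp add: numeral_2_eq_2 N_def)
  have B: "map ?f [2..<2 + 2 * N] = concat (map (\<lambda>(u, v). [u, v]) er)"
    unfolding map_upt_blocks2 er_def by (simp add: comp_def eu_def ew_def eval_nat_numeral)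
  have C: "map ?f [2 + 2 * N..<o1] = [n, n - 1]"
  proof -
    have "?f (2 + 2 * N) = n" "?f (Suc (2 + 2 * N)) = n - 1" using n(2) by (simp_all add: n_def mult_2 numeral_3_eq_3)
    moreover have "[2 + 2 * N..<o1] = [2 + 2 * N, Suc (2 + 2 * N)]" by (simp add: o1_def upt_rec)
    ultimately show ?thesis by simp
  qed
  have D: "map ?f [o1..<o1 + 2 * n] = concat (map (\<lambda>u. [node_cap inst u, node_cost inst u]) [0..<n])"
    unfolding map_upt_blocks2 by (simp add: inst_def cap_def cost_def)
  have F: "map ?f [o2..<o2 + 4 * (n - 1)] =
      concat (map (\<lambda>(u, v). [u, v, edge_cap inst {u, v}, edge_cost inst {u, v}]) est)"
  proof -
    have "(case (es 0 k, es 1 k) of (u, v) \<Rightarrow> [u, v, edge_cap inst {u, v}, edge_cost inst {u, v}]) =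
        [es 0 k, es 1 k, es 2 k, es 3 k]" if "k < n - 1" for k
      unfolding inst_def using ix[OF that] by simp
    then have "map (\<lambda>(u, v). [u, v, edge_cap inst {u, v}, edge_cost inst {u, v}]) est =
        map (\<lambda>k. [es 0 k, es 1 k, es 2 k, es 3 k]) [0..<n - 1]"
      unfolding est_def map_map by (intro map_cong refl) (simp add: comp_def)
    then show ?thesis unfolding map_upt_blocks4 es_def by simp
  qed
  have V: "card (VR inst) = N" "card (VS inst) = n" "length er = N" "length est = n - 1"
    by (simp_all add: inst_def er_def est_def)
  show ?thesis
    unfolding encode_def V by (rule trans[OF x[unfolded A B C D F]]) simp
qed

lemma encoded: "encoded inst er est xs [input_of xs (length xs - 1)]"
proof
  show cyc: "is_cycle (VR inst) (ER inst)" and tree: "is_tree (VS inst) (ES inst)"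
    using cycle_facts(1) tree_facts(1) by (simp_all add: inst_def)
  show "xs = encode inst er est @ [input_of xs (length xs - 1)]" by (rule xs_encode)
  have "edge_listing (ER inst) er"
    unfolding edge_listing_def er_def inst_def using cycle_facts(2)
    by (simp add: comp_def distinct_map lessThan_atLeast0)
  moreover have "edge_listing (ES inst) est"
    unfolding edge_listing_def est_def inst_def using tree_facts(2)
    by (simp add: comp_def distinct_map lessThan_atLeast0)
  moreover have "univne_instance inst"
    unfolding univne_instance_def
  proof (intro conjI ballI)
    show "connected_graph (VR inst) (ER inst)" by (rule cycle_connected[OF cyc])
    show "connected_graph (VS inst) (ES inst)" using tree by (simp add: is_tree_def)
    show "0 < node_cap inst u" if "u \<in> VS inst" for u
      using that certs(3) by (simp add: inst_def cap_cert_def)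
    show "0 < edge_cap inst e" if "e \<in> ES inst" for e
    proof -
      obtain k where k: "k < n - 1" "e = {es 0 k, es 1 k}" using \<open>e \<in> ES inst\<close> unfolding inst_def by auto
      then have "edge_cap inst e = es 2 k" using ix by (simp add: inst_def)
      then show ?thesis using certs(3) k(1) by (simp add: cap_cert_def)
    qed
  qed
  ultimately show "presented_instance inst er est"
    by (simp add: presented_instance_def inst_def)
qed

end

text \<open>Completeness of the checks: on a genuine instance the orders found by the program pass,
  and the decoded optimum is compared with the budget.\<close>

lemma (in encoded) certificates:
  assumes ys: "ys = [\<Gamma>]" and s: "\<And>i. s (Cell 0 i) = input_of xs i" "\<And>k i. k \<noteq> 0 \<Longrightarrow> s (Cell k i) = 0"
  defines "t \<equiv> sem main_com s"
  shows "certified xs (\<lambda>i. t (Cell aX i)) (\<lambda>i. t (Cell aQ i)) (\<lambda>i. t (Cell aPA i))"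
    "input_of xs (length xs - 1) = \<Gamma>"
    "(\<exists>m. feasible I m \<and> mapping_cost I m \<le> \<Gamma>) \<longleftrightarrow> 0 < ev opt_cell t \<and> ev opt_cell t - 1 \<le> \<Gamma>"
proof -
  interpret valid_input "input_of xs" I by (rule valid)
  obtain od pa rk X pe where oi: "ordered_input (input_of xs) I od pa rk X pe" and XN: "X N = X 0"
    and solved: "ordered_input.solved (input_of xs) I od pa rk X pe t"
    using main_correct[OF s] unfolding t_def by blast
  interpret ordered_input "input_of xs" I od pa rk X pe by (rule oi)
  have t: "t (Cell aX i) = X i" "t (Cell aQ i) = od i" "t (Cell aPA i) = pa i" for i
    using solved by (simp_all add: solved_def)
  have lx: "length xs = 2 * N + 6 * n + 1" using length_xs ys by (simp add: params)
  show "input_of xs (length xs - 1) = \<Gamma>"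
    using xs ys by (simp add: input_of_def)
  have "cycle_cert X"
    unfolding cycle_cert_def
  proof (intro conjI allI impI)
    fix i assume i: "i < N"
    show "X i < N" by (rule X_less[OF i])
    show "\<not> (i < j \<and> X i = X j)" if "j < N" for j using X(1) i that by (auto simp: inj_on_eq_iff)
    have "{X i, X (Suc i mod N)} \<in> (\<lambda>k. {eu k, ew k}) ` {..<N}" using ER ER_eq i by auto
    moreover have "X (Suc i mod N) = X (Suc i)" using i XN by (cases "Suc i = N") auto
    ultimately obtain k where "k < N" "{X i, X (Suc i)} = {eu k, ew k}" by auto
    then show "\<not> (\<forall>k<N. \<not> (eu k = X i \<and> ew k = X (Suc i) \<or> ew k = X i \<and> eu k = X (Suc i)))"
      by (auto simp: doubleton_eq_iff)
  qed (rule XN)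
  moreover have "tree_cert od pa"
    unfolding tree_cert_def
  proof (intro conjI allI impI)
    fix i assume i: "i < n"
    show "od i < n" using od[OF i] by simp
    show "\<not> (i < j \<and> od i = od j)" if "j < n" for j using od_eq[OF i that] by auto
  next
    fix i assume i: "i < n - 1"
    then have "pa (od i) < n" "rk (od i) < rk (pa (od i))" using pa' od_notroot by blast+
    then have "rk (pa (od i)) < n" "i < rk (pa (od i))" "od (rk (pa (od i))) = pa (od i)"
      using rk[of "pa (od i)"] od[of i] i by auto
    then show "\<not> (\<forall>j<n. \<not> (i < j \<and> od j = pa (od i)))" by blast
    have "pe (od i) < n - 1" "{od i, pa (od i)} = {es 0 (pe (od i)), es 1 (pe (od i))}"
      using pe[OF i] by auto
    then show "\<not> (\<forall>k<n - 1. \<not> (es 0 k = od i \<and> es 1 k = pa (od i) \<or> es 1 k = od i \<and> es 0 k = pa (od i)))"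
      by (auto simp: doubleton_eq_iff)
  qed
  moreover have cap_cert
    unfolding cap_cert_def
  proof (intro conjI allI impI)
    have ui: "univne_instance I" using pres by (simp add: presented_instance_def)
    show "cap u \<noteq> 0" if "u < n" for u
    proof -
      have "0 < node_cap I u" using ui that by (subst (asm) univne_instance_def) (subst (asm) VS_eq, blast)
      then show ?thesis using node_eq[OF that] by simp
    qed
    show "es 2 k \<noteq> 0" if "k < n - 1" for k
    proof -
      have "{es 0 k, es 1 k} \<in> ES I" unfolding ES_eq edge_list.edges_def[OF el] using that by blast
      then have "0 < edge_cap I {es 0 k, es 1 k}" using ui by (auto simp: univne_instance_def)
      then show ?thesis using edge_eq[OF that] by simp
    qed
  qed
  ultimately show "certified xs (\<lambda>i. t (Cell aX i)) (\<lambda>i. t (Cell aQ i)) (\<lambda>i. t (Cell aPA i))"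
    unfolding t certified_def
    using N3 npos lx input_nth(2,5) by (simp add: params)
  have dec: "dec (ev opt_cell t) = optimum" by (rule solved_opt_cell[OF solved])
  have "(\<exists>m. feasible I m \<and> mapping_cost I m \<le> \<Gamma>) \<longleftrightarrow> optimum \<le> enat \<Gamma>"
    using feasible_iff_optimum[of "enat \<Gamma>"] by simp
  then show "(\<exists>m. feasible I m \<and> mapping_cost I m \<le> \<Gamma>) \<longleftrightarrow> 0 < ev opt_cell t \<and> ev opt_cell t - 1 \<le> \<Gamma>"
    unfolding dec[symmetric] by (auto simp: dec_def)
qed

text \<open>\<open>vz\<close> holds the input length. Comparing it with
  \<open>1 + 2 * N + 6 * n\<close>, the length of an encoding with its budget, bounds
  \<open>N\<close> and \<open>n\<close> before they serve as loop bounds.\<close>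

definition if_sized :: "com \<Rightarrow> com" where
  "if_sized c =
     IfLess (Num 2) (Rd vnr)
     (IfEq (At 0 (Num 1)) (Rd vnr)
     (IfLess (Num 0) (Rd vns)
     (IfEq (Plus (At 0 (Plus (Num 3) (Plus (Rd vnr) (Rd vnr)))) (Num 1)) (Rd vns)
     (IfEq (Rd vz) (Plus (Plus (Num 1) (Plus (Rd vnr) (Rd vnr)))
       (Plus (Plus (Rd vns) (Rd vns)) (Plus (Plus (Rd vns) (Rd vns)) (Plus (Rd vns) (Rd vns))))) c)) Skip)) Skip"

text \<open>The output cell is 0 from the start, so only acceptance writes. The budget sits in
  \<open>vb\<close>, and table entries are costs plus 1.\<close>

definition answer_com :: com where
  "answer_com =
     IfLess (Num 0) (Rd vok)
       (IfLess (Num 0) opt_cell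
         (IfLess (Rd vb) (Minus opt_cell (Num 1)) Skip (Put aOut (Num 0) (Num 1)))
         Skip)
       Skip"

definition verify_com :: com where
  "verify_com = vok ::= Num 0 ;; check_cycle_com ;; check_tree_com ;; check_cap_com ;; answer_com"

text \<open>
  The sizes are checked before the main program runs, so that its running time is polynomial on
  every input; the structure of the graphs is certified afterwards by the orders it has computed.
  The budget is the last entry of the input.
\<close>

definition decide_com :: com where
  "decide_com =
     vz ::= Rd 0 ;;
     0 ::= Num 1 ;;
     vnr ::= At 0 (Num 0) ;;
     vns ::= At 0 (Plus (Num 2) (Plus (Rd vnr) (Rd vnr))) ;;
     if_sized (vb ::= At 0 (Minus (Rd vz) (Num 1)) ;; main_com ;; verify_com)"

lemma wfc_decide: "wfc decide_com"
  by (simp add: decide_com_def if_sized_def verify_com_def answer_com_def main_com_def com_defs)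

context prog_input
begin

definition sized :: "nat \<Rightarrow> bool" where
  "sized l \<longleftrightarrow> (2 < N \<and> inp 1 = N) \<and> (0 < n \<and> inp (3 + (N + N)) + 1 = n) \<and>
     l = 1 + (N + N) + ((n + n) + ((n + n) + (n + n)))"

lemma if_sized:
  assumes "\<And>i. s (Cell 0 i) = inp i" "s (Var vnr) = N" "s (Var vns) = n"
  shows "sem (if_sized c) s = (if sized (s (Var vz)) then sem c s else s)"
    "tm (if_sized c) s \<le> 200 + (if sized (s (Var vz)) then tm c s else 0)"
proof -
  show "sem (if_sized c) s = (if sized (s (Var vz)) then sem c s else s)"
    using assms by (simp add: if_sized_def sized_def)
  show "tm (if_sized c) s \<le> 200 + (if sized (s (Var vz)) then tm c s else 0)"
    using assms by (simp add: if_sized_def sized_def IfEq_def)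
qed

lemma verify_correct:
  assumes t: "loaded t" "t (Cell aOut 0) = 0"
  shows "sem verify_com t (Cell aOut 0) =
    (if cycle_cert (\<lambda>i. t (Cell aX i)) \<and> tree_cert (\<lambda>i. t (Cell aQ i)) (\<lambda>i. t (Cell aPA i)) \<and> cap_cert \<and>
       0 < ev opt_cell t \<and> ev opt_cell t - 1 \<le> t (Var vb) then 1 else 0)"
proof -
  define t0 where "t0 = t(Var vok := 0)"
  define t1 where "t1 = sem check_cycle_com t0"
  define t2 where "t2 = sem check_tree_com t1"
  define t3 where "t3 = sem check_cap_com t2"
  have k: "keeps check_cycle_com" "keeps check_tree_com" by (auto simp: keeps_def com_defs)
  have l0: "loaded t0" using t by (simp add: t0_def)
  have l1: "loaded t1" unfolding t1_def by (rule loaded_sem[OF l0 k(1)])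
  have l2: "loaded t2" unfolding t2_def by (rule loaded_sem[OF l1 k(2)])
  have c0: "t0 (Cell i j) = t (Cell i j)" for i j by (simp add: t0_def)
  have c1: "t1 (Cell i j) = t (Cell i j)" for i j
    unfolding t1_def by (subst sem_frame) (simp_all add: com_defs c0)
  have fr: "t3 l = t l" if "l \<in> {Cell i j, Var vroot, Var vnr, Var vb}" for l i j
    unfolding t3_def t2_def t1_def t0_def using that by (auto simp: sem_frame com_defs simp del: sem.simps(6))
  have e: "ev opt_cell t3 = ev opt_cell t" by (simp add: opt_cell_def fr)
  have "t1 (Var vok) = (if cycle_cert (\<lambda>i. t (Cell aX i)) then 1 else 0)"
    using check_cycle_correct[OF l0] unfolding t1_def[symmetric] c0 by (simp add: t0_def)
  moreover have "t2 (Var vok) = (if tree_cert (\<lambda>i. t (Cell aQ i)) (\<lambda>i. t (Cell aPA i)) then t1 (Var vok) else 0)"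
    using check_tree_correct[OF l1] unfolding t2_def[symmetric] c1 .
  moreover have "t3 (Var vok) = (if cap_cert then t2 (Var vok) else 0)"
    using check_cap_correct[OF l2] unfolding t3_def[symmetric] .
  ultimately have "t3 (Var vok) = (if cycle_cert (\<lambda>i. t (Cell aX i)) \<and>
      tree_cert (\<lambda>i. t (Cell aQ i)) (\<lambda>i. t (Cell aPA i)) \<and> cap_cert then 1 else 0)"
    by simp
  moreover have "sem verify_com t = sem answer_com t3"
    unfolding verify_com_def t3_def t2_def t1_def t0_def by (simp only: sem.simps(4) sem.simps(2) ev.simps)
  moreover have "t3 (Cell aOut 0) = 0" "t3 (Var vb) = t (Var vb)" using fr t(2) by simp_all
  ultimately show ?thesis by (auto simp: answer_com_def e)
qed

lemma tm_verify:
  assumes t: "loaded t" and M: "N \<le> M" "n \<le> M" "1 \<le> M"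
  shows "tm verify_com t \<le> 3000 * (M * M * M)"
proof -
  have "tm verify_com t \<le> tb verify_com limit"
    by (rule tm_limit[OF t]) (auto simp: verify_com_def answer_com_def com_defs)
  also have "tb verify_com limit \<le> 3000 * (M * M * M)"
  proof -
    have "N * N \<le> M * M" "n * n \<le> M * M" using M by (auto intro: mult_mono)
    moreover have "M * M \<le> M * M * M" "M \<le> M * M" using M by simp_all
    ultimately have "N * N \<le> M * M * M" "n * n \<le> M * M * M" "N \<le> M * M * M" "n \<le> M * M * M" "1 \<le> M * M * M"
      using M by linarith+
    note hs = this[unfolded mult.assoc]
    show ?thesis
      by (simp add: verify_com_def answer_com_def com_defs limit_def algebra_simps) (use hs in linarith)
  qed
  finally show ?thesis .
qed

end

text \<open>Lists of the wrong size leave the output at 0. On the others, acceptance amounts to the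
  certificates and the budget test; to prove membership the instance is rebuilt from the list, while
  conversely a given instance is shown to pass.\<close>

lemma decide_correct:
  fixes xs :: "nat list"
  defines "s \<equiv> sem decide_com (init_state xs)"
  shows "s (Var 0) = 1"
    "s (Cell aOut 0) = (if xs \<in> C_uniVNE is_cycle is_tree then 1 else 0)"
    "tm decide_com (init_state xs) \<le> 6000 * (length xs + 1) ^ 3"
proof -
  interpret prog_input "input_of xs" .
  let ?l = "length xs"
  define s0 where "s0 = (init_state xs)(Var vz := ?l, Var 0 := 1, Var vnr := N, Var vns := n)"
  define s1 where "s1 = s0(Var vb := input_of xs (?l - 1))"
  define t where "t = sem main_com s1"
  let ?B = "vb ::= At 0 (Minus (Rd vz) (Num 1)) ;; main_com ;; verify_com"
  have c0: "s0 (Cell 0 i) = input_of xs i" for i by (simp add: s0_def input_of_def)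
  have v0: "s0 (Var vnr) = N" "s0 (Var vns) = n" "s0 (Var vz) = ?l" by (simp_all add: s0_def)
  have c1: "s1 (Cell 0 i) = input_of xs i" "k \<noteq> 0 \<Longrightarrow> s1 (Cell k i) = 0" for k i
    using c0 by (simp_all add: s1_def) (simp add: s0_def)
  have "s = sem (if_sized ?B) s0"
    unfolding s_def decide_com_def s0_def
    by (simp add: N_def n_def input_of_def)
  moreover have "sem ?B s0 = sem verify_com t"
    unfolding t_def s1_def using c0 v0(3) by simp
  ultimately have s: "s = (if sized ?l then sem verify_com t else s0)"
    using if_sized(1)[OF c0 v0(1,2)] v0(3) by simp
  have lt: "loaded t" unfolding t_def by (rule loaded_main[OF c1(1)])
  have tf: "t l = s1 l" if "l \<in> {Var 0, Var vb, Cell aOut 0}" for l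
    unfolding t_def by (rule sem_frame) (use that in \<open>auto simp: main_com_def com_defs\<close>)
  have "sem verify_com t (Var 0) = t (Var 0)"
    by (rule sem_frame) (simp add: verify_com_def answer_com_def com_defs)
  then show "s (Var 0) = 1" unfolding s using tf by (simp add: s1_def s0_def)
  have t0: "t (Cell aOut 0) = 0" "t (Var vb) = input_of xs (?l - 1)" using tf c1(2) by (simp_all add: s1_def)
  let ?acc = "certified xs (\<lambda>i. t (Cell aX i)) (\<lambda>i. t (Cell aQ i)) (\<lambda>i. t (Cell aPA i)) \<and>
    0 < ev opt_cell t \<and> ev opt_cell t - 1 \<le> input_of xs (?l - 1)"
  have "s (Cell aOut 0) = (if ?acc then 1 else 0)"
  proof (cases "sized ?l")
    case True
    then show ?thesis unfolding s certified_def using verify_correct[OF lt t0(1)] t0(2)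
      by (simp add: sized_def)
  next
    case False
    then have "\<not> certified xs X Q PA" for X Q PA unfolding certified_def sized_def by blast
    then show ?thesis unfolding s using False by (simp add: s0_def)
  qed
  moreover have "?acc \<longleftrightarrow> xs \<in> C_uniVNE is_cycle is_tree"
  proof
    assume acc: ?acc
    then interpret c: certified xs "\<lambda>i. t (Cell aX i)" "\<lambda>i. t (Cell aQ i)" "\<lambda>i. t (Cell aPA i)" by blast
    let ?\<Gamma> = "input_of xs (?l - 1)"
    interpret e: encoded c.inst c.er c.est xs "[?\<Gamma>]" by (rule c.encoded)
    have "\<exists>m. feasible c.inst m \<and> mapping_cost c.inst m \<le> ?\<Gamma>"
      using e.certificates(3)[OF refl c1] acc unfolding t_def by blast
    then show "xs \<in> C_uniVNE is_cycle is_tree"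
      unfolding C_uniVNE_def using e.pres e.cyc e.tree e.xs by blast
  next
    assume "xs \<in> C_uniVNE is_cycle is_tree"
    then obtain I er es \<Gamma> where x: "xs = encode I er es @ [\<Gamma>]" "presented_instance I er es"
      "is_cycle (VR I) (ER I)" "is_tree (VS I) (ES I)" and m: "\<exists>m. feasible I m \<and> mapping_cost I m \<le> \<Gamma>"
      unfolding C_uniVNE_def by blast
    then interpret e: encoded I er es xs "[\<Gamma>]" by unfold_locales
    show ?acc
      using e.certificates[OF refl c1] m unfolding t_def by simp
  qed
  ultimately show "s (Cell aOut 0) = (if xs \<in> C_uniVNE is_cycle is_tree then 1 else 0)" by simp
  let ?M = "?l + 1"
  have M: "1 \<le> ?M * ?M * ?M" by simp
  have "tm decide_com (init_state xs) \<le> 100 + tm (if_sized ?B) s0"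
    unfolding decide_com_def s0_def by (simp add: N_def n_def input_of_def)
  moreover have "tm (if_sized ?B) s0 \<le> 200 + (if sized ?l then tm ?B s0 else 0)"
    using if_sized(2)[OF c0 v0(1,2), of ?B] v0(3) by simp
  moreover have "tm ?B s0 \<le> 5200 * (?M * ?M * ?M)" if z: "sized ?l"
  proof -
    have N: "3 \<le> N" "0 < n" "N \<le> ?M" "n \<le> ?M" using z by (simp_all add: sized_def)
    have "N * N * n \<le> ?M * ?M * ?M" using N by (intro mult_mono) auto
    then have "tm main_com s1 \<le> 2100 * (?M * ?M * ?M)"
      using tm_main[OF c1(1)] tb_work(1)[OF N(1,2)] M by linarith
    moreover have "tm verify_com t \<le> 3000 * (?M * ?M * ?M)" by (rule tm_verify[OF lt N(3,4)]) simp
    moreover have "tm ?B s0 = 13 + tm main_com s1 + tm verify_com t"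
      unfolding t_def s1_def using c0 v0(3) by simp
    ultimately show ?thesis using M by linarith
  qed
  ultimately have "tm decide_com (init_state xs) \<le> 6000 * (?M * ?M * ?M)" using M by (auto split: if_splits)
  then show "tm decide_com (init_state xs) \<le> 6000 * (length xs + 1) ^ 3" by (simp only: power3_eq_cube)
qed

theorem theorem6:
  "C_uniVNE is_cycle is_tree \<in> class_P \<and>
   (\<exists>(P :: instr list) (C :: nat). \<forall>I er es.
      presented_instance I er es \<and> is_cycle (VR I) (ER I) \<and> is_tree (VS I) (ES I) \<longrightarrow>
      (\<exists>t ys. t \<le> C * (card (VR I))\<^sup>2 * card (VS I) \<and>
              computes_within P (encode I er es) ys t \<and> optimal_output I er ys))"
proof
  show "C_uniVNE is_cycle is_tree \<in> class_P"
  proof (rule class_PI)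
    fix xs :: "nat list"
    let ?s = "sem decide_com (init_state xs)" and ?M = "(length xs + 1) ^ 3"
    have "length xs + 1 \<le> ?M" by (rule self_le_power) auto
    then have "tm decide_com (init_state xs) + 13 * length xs + 14 * ?s (Var 0) + 7 \<le> 6100 * ?M"
      using decide_correct(1,3)[of xs] by linarith
    moreover have "map (\<lambda>i. ?s (Cell 1 i)) [0..<?s (Var 0)] = [if xs \<in> C_uniVNE is_cycle is_tree then 1 else 0]"
      using decide_correct(1,2)[of xs] by simp
    ultimately show "\<exists>t. t \<le> 6100 * (length xs + 1) ^ 3 \<and>
        computes_within (prog decide_com) xs [if xs \<in> C_uniVNE is_cycle is_tree then 1 else 0] t"
      using prog_computes[OF wfc_decide, of xs] by metis
  qed
  have "\<exists>t ys. t \<le> 4300 * (card (VR I))\<^sup>2 * card (VS I) \<and>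
      computes_within (prog solve_com) (encode I er es) ys t \<and> optimal_output I er ys"
    if "presented_instance I er es" "is_cycle (VR I) (ER I)" "is_tree (VS I) (ES I)" for I er es
  proof -
    interpret encoded I er es "encode I er es" "[]" using that by unfold_locales auto
    show ?thesis by (rule solve_computes) simp
  qed
  then show "\<exists>(P :: instr list) (C :: nat). \<forall>I er es.
      presented_instance I er es \<and> is_cycle (VR I) (ER I) \<and> is_tree (VS I) (ES I) \<longrightarrow>
      (\<exists>t ys. t \<le> C * (card (VR I))\<^sup>2 * card (VS I) \<and>
              computes_within P (encode I er es) ys t \<and> optimal_output I er ys)"
    by blast
qed

end
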